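(* Let $m\ge3$ be an integer. (1) For every isotropic plane $P\subset(\mathbb{Z}/m\mathbb{Z})^4$ and every generator $\omega$ of $\bigwedge^2P$ up to sign, the subcomplex $S(P,[\omega])$ of $\Delta_2[m]$ is isomorphic, as a simplicial complex, to the link of $\mathrm{PD}_2^{\mathrm{rt}}/\mathrm{GL}_2(\mathbb{Z})[m]$, and hence to a triangulation of a closed oriented surface of genus $h_m$. (2) Every $1$- and $2$-dimensional simplex of $\Delta_2[m]$ lies in a unique $S(P,[\omega])$. In particular, $\Delta_2[m]$, and hence also $LA_2[m]^{\mathrm{trop}}$, is obtained from $\pi_m:=\frac{m^4}{2}\prod_{p\mid m}(1-p^{-4})$ surfaces of genus $h_m$, each with $c_{1,m}$ distinct marked points, by gluing these $\pi_m\cdot c_{1,m}$ points into $\pi_m$ equivalence classes.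
   Context: Numbers (products over primes $p\mid m$): $c_{1,m}=\frac{m^2}{2}\prod(1-p^{-2})$, $c_{2,m}=\frac{m^3}{4}\prod(1-p^{-2})$, $c_{3,m}=\frac{m^3}{6}\prod(1-p^{-2})$, $h_m=1-\frac12(c_{1,m}-c_{2,m}+c_{3,m})$. For $R=\mathbb{Z}$ or $\mathbb{Z}/m\mathbb{Z}$, $R^4$ has basis $e_1,e_2,f_1,f_2$ and standard symplectic form $J$ with $J(e_i,e_j)=J(f_i,f_j)=0$, $J(e_i,f_j)=\delta_{ij}$. An isotropic subspace of $R^4$ is a free submodule that is totally isotropic for $J$ and is a direct summand with free complement; an isotropic plane is one of rank $2$. An element of $(\mathbb{Z}/m\mathbb{Z})^4$ is primitive if its coordinates generate the unit ideal. $[-]$ denotes equivalence class up to sign. $\Delta_2[m]$ is the simplicial complex with vertices the classes $[v]$ of primitive $v\in(\mathbb{Z}/m\mathbb{Z})^4$; $[v],[w]$ form an edge iff $\{v,w\}$ is a basis of an isotropic plane; $[u],[v],[w]$ form a $2$-simplex iff each pair forms an edge and $\pm u\pm v\pm w=0$ for some choice of signs. For an isotropic plane $P\subset(\mathbb{Z}/m\mathbb{Z})^4$ and $[\omega]$ a generator, up to sign, of the free rank $1$ module $\bigwedge^2P$, $S(P,[\omega])$ is the subcomplex of $\Delta_2[m]$ on the vertices $[v]$ with $v\in P$ primitive, in which $[v],[w]$ span an edge if $v\wedge w=\pm\omega$, and three vertices span a triangle if each pair spans an edge. Fans: for $P$ an isotropic subspace of $\mathbb{Z}^4$ or $P=\mathbb{Z}^2$,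 $\Sigma(P)$ is the fan in $\mathrm{Sym}^2(P\otimes\mathbb{R})$ (with $vv^t=v\otimes v$) with cones $\{0\}$, the rays $\mathbb{R}_{\ge0}\langle vv^t\rangle$ for $v\in P$ primitive, and, if $P$ has rank $2$, $\mathbb{R}_{\ge0}\langle vv^t,ww^t\rangle$ and $\mathbb{R}_{\ge0}\langle vv^t,ww^t,(v+w)(v+w)^t\rangle$ for all $\mathbb{Z}$-bases $v,w$ of $P$. Its support $|\Sigma(P)|$ is topologized as the colimit of its closed cones. $\mathrm{PD}_2^{\mathrm{rt}}=|\Sigma(\mathbb{Z}^2)|$ is the cone of positive semi-definite symmetric $2\times2$ real matrices with kernel defined over $\mathbb{Q}$, and $\mathrm{GL}_2(\mathbb{Z})[m]=\ker(\mathrm{GL}_2(\mathbb{Z})\to\mathrm{GL}_2(\mathbb{Z}/m\mathbb{Z}))$ acts on it by $Q\mapsto AQA^t$. The link of a space $X$ glued from cones is $(X\setminus\{0\})/\mathbb{R}_{>0}$; the link of $\mathrm{PD}_2^{\mathrm{rt}}/\mathrm{GL}_2(\mathbb{Z})[m]$ is a simplicial complex whose simplices are the orbits of nonzero cones of $\Sigma(\mathbb{Z}^2)$. $A_2[m]^{\mathrm{trop}}$ is the quotient (colimit in topological spaces) of $\bigsqcup_P|\Sigma(P)|$, $P$ ranging over all isotropic subspaces of $\mathbb{Z}^4$, by the maps $|\Sigma(P')|\to|\Sigma(P)|$ induced by all $\gamma\in\Gamma[m]=\ker(\mathrm{Sp}_4(\mathbb{Z})\to\mathrm{Sp}_4(\mathbb{Z}/m\mathbb{Z}))$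 with $\gamma P'\subseteq P$, and $LA_2[m]^{\mathrm{trop}}$ is its link. *)

theory Defs
  imports
    "HOL-Analysis.Analysis"
    "HOL-Number_Theory.Cong"
    "Berlekamp_Zassenhaus.Finite_Field"
begin

section \<open>Numerical invariants\<close>

definition c1 :: "nat \<Rightarrow> real" where
  "c1 m = real m ^ 2 / 2 * (\<Prod>p\<in>prime_factors m. 1 - 1 / real p ^ 2)"

definition c2 :: "nat \<Rightarrow> real" where
  "c2 m = real m ^ 3 / 4 * (\<Prod>p\<in>prime_factors m. 1 - 1 / real p ^ 2)"

definition c3 :: "nat \<Rightarrow> real" where
  "c3 m = real m ^ 3 / 6 * (\<Prod>p\<in>prime_factors m. 1 - 1 / real p ^ 2)"

definition genus_num :: "nat \<Rightarrow> real" where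
  "genus_num m = 1 - (c1 m - c2 m + c3 m) / 2"

definition pi_num :: "nat \<Rightarrow> real" where
  "pi_num m = real m ^ 4 / 2 * (\<Prod>p\<in>prime_factors m. 1 - 1 / real p ^ 4)"


section \<open>Symplectic modules\<close>

text \<open>Everything here is stated over a commutative ring \<open>'r\<close>, to be used for the integers
  and for \<open>'m mod_ring\<close>, the ring of residues modulo \<open>CARD('m)\<close>.\<close>

interpretation rvec: Modules.module "(*s) :: 'r::comm_ring_1 \<Rightarrow> 'r ^ 'n \<Rightarrow> 'r ^ 'n"
  by unfold_locales (simp_all add: vec_eq_iff algebra_simps)

definition is_basis :: "('r::comm_ring_1 ^ 'n) set \<Rightarrow> ('r ^ 'n) set \<Rightarrow> bool" where
  "is_basis B P \<longleftrightarrow> \<not> rvec.dependent B \<and> rvec.span B = P"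

definition is_basis_pair :: "'r::comm_ring_1 ^ 'n \<Rightarrow> 'r ^ 'n \<Rightarrow> ('r ^ 'n) set \<Rightarrow> bool" where
  "is_basis_pair v w P \<longleftrightarrow> v \<noteq> w \<and> is_basis {v, w} P"

definition free_submodule :: "('r::comm_ring_1 ^ 'n) set \<Rightarrow> bool" where
  "free_submodule P \<longleftrightarrow> rvec.subspace P \<and> (\<exists>B. is_basis B P)"

text \<open>The coordinates 1, 2, 3, 4 belong to the basis vectors \<open>e\<^sub>1, e\<^sub>2, f\<^sub>1, f\<^sub>2\<close>.\<close>

definition symp :: "'r::comm_ring_1 ^ 4 \<Rightarrow> 'r ^ 4 \<Rightarrow> 'r" where
  "symp x y = x$1 * y$3 + x$2 * y$4 - x$3 * y$1 - x$4 * y$2"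

definition isotropic_subspace :: "('r::comm_ring_1 ^ 4) set \<Rightarrow> bool" where
  "isotropic_subspace P \<longleftrightarrow>
     free_submodule P \<and> (\<forall>x\<in>P. \<forall>y\<in>P. symp x y = 0) \<and>
     (\<exists>Q. free_submodule Q \<and> P \<inter> Q = {0} \<and> {x + y | x y. x \<in> P \<and> y \<in> Q} = UNIV)"

definition isotropic_plane :: "('r::comm_ring_1 ^ 4) set \<Rightarrow> bool" where
  "isotropic_plane P \<longleftrightarrow> isotropic_subspace P \<and> (\<exists>B. is_basis B P \<and> card B = 2)"

definition primitive :: "'r::comm_ring_1 ^ 'n \<Rightarrow> bool" where
  "primitive v \<longleftrightarrow> (\<exists>c. (\<Sum>i\<in>UNIV. c i * v $ i) = 1)"

definition pm :: "'a::uminus \<Rightarrow> 'a set" where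
  "pm x = {x, - x}"

text \<open>The exterior square of the free module with basis indexed by \<open>'n\<close> is modelled by the
  alternating matrices, with \<open>v \<and> w = v w\<^sup>t - w v\<^sup>t\<close>. For a direct summand \<open>P\<close> the natural map
  from the exterior square of \<open>P\<close> is injective, so that the former is the span of
  the \<open>v \<and> w\<close> with \<open>v, w \<in> P\<close>.\<close>

definition mscale :: "'r::comm_ring_1 \<Rightarrow> 'r ^ 'n ^ 'n \<Rightarrow> 'r ^ 'n ^ 'n" where
  "mscale c M = (\<chi> i j. c * M $ i $ j)"

interpretation rmat: Modules.module "mscale :: 'r::comm_ring_1 \<Rightarrow> 'r ^ 'n ^ 'n \<Rightarrow> 'r ^ 'n ^ 'n"
  by unfold_locales (simp_all add: mscale_def vec_eq_iff algebra_simps)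

definition wedge :: "'r::comm_ring_1 ^ 'n \<Rightarrow> 'r ^ 'n \<Rightarrow> 'r ^ 'n ^ 'n" where
  "wedge v w = (\<chi> i j. v $ i * w $ j - w $ i * v $ j)"

definition ext_square :: "('r::comm_ring_1 ^ 'n) set \<Rightarrow> ('r ^ 'n ^ 'n) set" where
  "ext_square P = rmat.span {wedge v w | v w. v \<in> P \<and> w \<in> P}"

text \<open>The generators of the exterior square, up to sign.\<close>

definition generator_classes :: "('r::comm_ring_1 ^ 'n) set \<Rightarrow> ('r ^ 'n ^ 'n) set set" where
  "generator_classes P = {pm \<omega> | \<omega>. rmat.span {\<omega>} = ext_square P}"


section \<open>Simplicial complexes\<close>

text \<open>Abstract simplicial complexes are sets of nonempty simplices.\<close>

definition abstract_complex :: "'v set set \<Rightarrow> bool" where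
  "abstract_complex K \<longleftrightarrow>
     (\<forall>\<sigma>\<in>K. finite \<sigma> \<and> \<sigma> \<noteq> {}) \<and> (\<forall>\<sigma>\<in>K. \<forall>\<tau>. \<tau> \<subseteq> \<sigma> \<and> \<tau> \<noteq> {} \<longrightarrow> \<tau> \<in> K)"

definition Delta2_edge :: "('m::nontriv mod_ring ^ 4) set \<Rightarrow> ('m mod_ring ^ 4) set \<Rightarrow> bool" where
  "Delta2_edge a b \<longleftrightarrow>
     (\<exists>v w P. a = pm v \<and> b = pm w \<and> isotropic_plane P \<and> is_basis_pair v w P)"

definition Delta2 :: "('m::nontriv mod_ring ^ 4) set set set" where
  "Delta2 =
     {{pm v} | v. primitive v} \<union>
     {{a, b} | a b. Delta2_edge a b} \<union>
     {{a, b, c} | a b c. Delta2_edge a b \<and> Delta2_edge a c \<and> Delta2_edge b c \<and>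
        (\<exists>u\<in>a. \<exists>v\<in>b. \<exists>w\<in>c. u + v + w = 0)}"

definition S_edge :: "('m::nontriv mod_ring ^ 4) set \<Rightarrow> ('m mod_ring ^ 4 ^ 4) set \<Rightarrow>
    ('m mod_ring ^ 4) set \<Rightarrow> ('m mod_ring ^ 4) set \<Rightarrow> bool" where
  "S_edge P \<Omega> a b \<longleftrightarrow>
     (\<exists>v w. v \<in> P \<and> primitive v \<and> w \<in> P \<and> primitive w \<and> a = pm v \<and> b = pm w \<and> wedge v w \<in> \<Omega>)"

text \<open>Below, \<open>\<Omega>\<close> is the class \<open>pm \<omega>\<close> of a generator.\<close>

definition S_complex :: "('m::nontriv mod_ring ^ 4) set \<Rightarrow> ('m mod_ring ^ 4 ^ 4) set \<Rightarrow>
    ('m mod_ring ^ 4) set set set" where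
  "S_complex P \<Omega> =
     {{pm v} | v. v \<in> P \<and> primitive v} \<union>
     {{a, b} | a b. S_edge P \<Omega> a b} \<union>
     {{a, b, c} | a b c. S_edge P \<Omega> a b \<and> S_edge P \<Omega> a c \<and> S_edge P \<Omega> b c}"


section \<open>Colimit and quotient topologies, geometric realization\<close>

text \<open>The union of a family of subsets of a topological space, with the colimit topology for
  the inclusions of the members of the family.\<close>

definition coherent_topology :: "'a::topological_space set set \<Rightarrow> 'a topology" where
  "coherent_topology \<C> =
     topology (\<lambda>U. U \<subseteq> \<Union>\<C> \<and> (\<forall>C\<in>\<C>. openin (top_of_set C) (U \<inter> C)))"

lemma openin_coherent_topology:
  "openin (coherent_topology \<C>) U \<longleftrightarrow>
     U \<subseteq> \<Union>\<C> \<and> (\<forall>C\<in>\<C>. openin (top_of_set C) (U \<inter> C))"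
proof -
  have "istopology (\<lambda>U. U \<subseteq> \<Union>\<C> \<and> (\<forall>C\<in>\<C>. openin (top_of_set C) (U \<inter> C)))"
    unfolding istopology_def
  proof (intro conjI allI impI ballI)
    fix S T C
    assume S: "S \<subseteq> \<Union>\<C> \<and> (\<forall>C\<in>\<C>. openin (top_of_set C) (S \<inter> C))"
      and T: "T \<subseteq> \<Union>\<C> \<and> (\<forall>C\<in>\<C>. openin (top_of_set C) (T \<inter> C))"
    show "S \<inter> T \<subseteq> \<Union>\<C>"
      using S by blast
    assume "C \<in> \<C>"
    then have "openin (top_of_set C) ((S \<inter> C) \<inter> (T \<inter> C))"
      using S T openin_Int by metis
    moreover have "(S \<inter> C) \<inter> (T \<inter> C) = S \<inter> T \<inter> C"
      by blast
    ultimately show "openin (top_of_set C) (S \<inter> T \<inter> C)"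
      by (simp only:)
  next
    fix \<K>
    assume K: "\<forall>K\<in>\<K>. K \<subseteq> \<Union>\<C> \<and> (\<forall>C\<in>\<C>. openin (top_of_set C) (K \<inter> C))"
    then show "\<Union>\<K> \<subseteq> \<Union>\<C>"
      by blast
    fix C assume "C \<in> \<C>"
    then have "openin (top_of_set C) (\<Union>((\<lambda>K. K \<inter> C) ` \<K>))"
      using K by (intro openin_Union) auto
    moreover have "\<Union>((\<lambda>K. K \<inter> C) ` \<K>) = \<Union>\<K> \<inter> C"
      by blast
    ultimately show "openin (top_of_set C) (\<Union>\<K> \<inter> C)"
      by (simp only:)
  qed
  then show ?thesis
    unfolding coherent_topology_def by (simp only: topology_inverse')
qed

definition quotient_space :: "'a topology \<Rightarrow> ('a \<times> 'a) set \<Rightarrow> 'a set topology" where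
  "quotient_space X r =
     topology (\<lambda>U. U \<subseteq> topspace X // r \<and> openin X {x \<in> topspace X. r `` {x} \<in> U})"

lemma openin_quotient_space:
  "openin (quotient_space X r) U \<longleftrightarrow>
     U \<subseteq> topspace X // r \<and> openin X {x \<in> topspace X. r `` {x} \<in> U}"
proof -
  have "istopology (\<lambda>U. U \<subseteq> topspace X // r \<and> openin X {x \<in> topspace X. r `` {x} \<in> U})"
    unfolding istopology_def
  proof (intro conjI allI impI)
    fix S T
    assume S: "S \<subseteq> topspace X // r \<and> openin X {x \<in> topspace X. r `` {x} \<in> S}"
      and T: "T \<subseteq> topspace X // r \<and> openin X {x \<in> topspace X. r `` {x} \<in> T}"
    show "S \<inter> T \<subseteq> topspace X // r"
      using S by blast
    have "{x \<in> topspace X. r `` {x} \<in> S \<inter> T} =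
        {x \<in> topspace X. r `` {x} \<in> S} \<inter> {x \<in> topspace X. r `` {x} \<in> T}"
      by blast
    then show "openin X {x \<in> topspace X. r `` {x} \<in> S \<inter> T}"
      using S T by (simp only: openin_Int)
  next
    fix \<K>
    assume K: "\<forall>K\<in>\<K>. K \<subseteq> topspace X // r \<and> openin X {x \<in> topspace X. r `` {x} \<in> K}"
    then show "\<Union>\<K> \<subseteq> topspace X // r"
      by blast
    have "{x \<in> topspace X. r `` {x} \<in> \<Union>\<K>} = (\<Union>K\<in>\<K>. {x \<in> topspace X. r `` {x} \<in> K})"
      by blast
    then show "openin X {x \<in> topspace X. r `` {x} \<in> \<Union>\<K>}"
      using K by (simp only:) (intro openin_Union, auto)
  qed
  then show ?thesis
    unfolding quotient_space_def by (simp only: topology_inverse')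
qed

text \<open>Points of the realization are barycentric coordinates.\<close>

definition closed_simplex :: "'v set \<Rightarrow> ('v \<Rightarrow> real) set" where
  "closed_simplex \<sigma> = {f. (\<forall>v. 0 \<le> f v) \<and> (\<forall>v. v \<notin> \<sigma> \<longrightarrow> f v = 0) \<and> sum f \<sigma> = 1}"

definition realization :: "'v set set \<Rightarrow> ('v \<Rightarrow> real) topology" where
  "realization K = coherent_topology (closed_simplex ` K)"


section \<open>Closed oriented surfaces\<close>

definition closed_surface :: "'a topology \<Rightarrow> bool" where
  "closed_surface X \<longleftrightarrow>
     topspace X \<noteq> {} \<and> compact_space X \<and> connected_space X \<and> Hausdorff_space X \<and>
     (\<forall>x\<in>topspace X. \<exists>U V. openin X U \<and> x \<in> U \<and> open (V :: (real ^ 2) set) \<and>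
        subtopology X U homeomorphic_space top_of_set V)"

text \<open>An orientation of a triangle \<open>T\<close> is a cyclic permutation \<open>\<rho> T\<close> of its vertices; it is
  coherent if the two triangles at an edge induce opposite orientations of this edge.\<close>

definition coherently_orientable :: "'v set set \<Rightarrow> bool" where
  "coherently_orientable K \<longleftrightarrow>
     (\<exists>\<rho>. (\<forall>T\<in>K. card T = 3 \<longrightarrow>
            (\<forall>a\<in>T. \<rho> T a \<in> T \<and> \<rho> T a \<noteq> a \<and> \<rho> T (\<rho> T (\<rho> T a)) = a)) \<and>
          (\<forall>T\<in>K. \<forall>T'\<in>K. card T = 3 \<and> card T' = 3 \<and> T \<noteq> T' \<longrightarrow>
            (\<forall>a \<in> T \<inter> T'. \<rho> T a \<in> T' \<longrightarrow> \<rho> T' (\<rho> T a) = a)))"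

definition euler_char :: "'v set set \<Rightarrow> int" where
  "euler_char K = (\<Sum>\<sigma>\<in>K. (-1) ^ (card \<sigma> - 1))"

text \<open>Orientability and Euler characteristic do not depend on the triangulation; the genus \<open>g\<close>
  of a closed oriented surface is defined by \<open>\<chi> = 2 - 2 g\<close>. Every compact surface
  is triangulable, with finitely many vertices, which may be taken to be natural numbers.\<close>

definition closed_oriented_surface :: "'a topology \<Rightarrow> nat \<Rightarrow> bool" where
  "closed_oriented_surface X g \<longleftrightarrow>
     closed_surface X \<and>
     (\<exists>K :: nat set set. finite K \<and> abstract_complex K \<and> realization K homeomorphic_space X \<and>
        coherently_orientable K \<and> euler_char K = 2 - 2 * int g)"

text \<open>The disjoint union of the spaces \<open>Y i\<close>, \<open>i \<in> I\<close>, with points identified according to an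
  equivalence relation \<open>E\<close> on a set of marked points (a subset of the disjoint union).\<close>

definition glue_points :: "'i set \<Rightarrow> ('i \<Rightarrow> 'a topology) \<Rightarrow> (('i \<times> 'a) \<times> ('i \<times> 'a)) set \<Rightarrow>
    ('i \<times> 'a) set topology" where
  "glue_points I Y E = quotient_space (sum_topology Y I) (Id \<union> E)"


section \<open>Fans of positive semi-definite forms\<close>

text \<open>For a direct summand \<open>P\<close> of \<open>\<int>\<^sup>n\<close>, the symmetric square of \<open>P \<otimes> \<real>\<close> is a subspace of
  the symmetric \<open>n \<times> n\<close> matrices, \<open>v \<otimes> v\<close> being the matrix \<open>v v\<^sup>t\<close>.\<close>

definition outer_sq :: "int ^ 'n \<Rightarrow> real ^ 'n ^ 'n" where
  "outer_sq v = (\<chi> i j. real_of_int (v $ i) * real_of_int (v $ j))"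

definition fan :: "(int ^ 'n) set \<Rightarrow> (real ^ 'n ^ 'n) set set" where
  "fan P =
     {{0}} \<union>
     {convex_cone hull {outer_sq v} | v. v \<in> P \<and> primitive v} \<union>
     {convex_cone hull {outer_sq v, outer_sq w} | v w. is_basis_pair v w P} \<union>
     {convex_cone hull {outer_sq v, outer_sq w, outer_sq (v + w)} | v w. is_basis_pair v w P}"

definition fan_support :: "(int ^ 'n) set \<Rightarrow> (real ^ 'n ^ 'n) topology" where
  "fan_support P = coherent_topology (fan P)"

definition conj_act :: "int ^ 'n ^ 'n \<Rightarrow> real ^ 'n ^ 'n \<Rightarrow> real ^ 'n ^ 'n" where
  "conj_act A Q =
     (let B = (\<chi> i j. real_of_int (A $ i $ j)) in B ** Q ** transpose B)"

definition congruent_to_one :: "nat \<Rightarrow> int ^ 'n ^ 'n \<Rightarrow> bool" where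
  "congruent_to_one m A \<longleftrightarrow> (\<forall>i j. [A $ i $ j = mat 1 $ i $ j] (mod int m))"

text \<open>The link \<open>(X - {z}) / \<real>\<^bsub>>0\<^esub>\<close> of a space \<open>X\<close> with apex \<open>z\<close> and scaling action \<open>scl\<close>.\<close>

definition scaling_rel :: "(real \<Rightarrow> 'a \<Rightarrow> 'a) \<Rightarrow> 'a topology \<Rightarrow> 'a \<Rightarrow> ('a \<times> 'a) set" where
  "scaling_rel scl X z =
     {(x, y). x \<in> topspace X - {z} \<and> y \<in> topspace X - {z} \<and> (\<exists>t>0. y = scl t x)}"

definition cone_link :: "(real \<Rightarrow> 'a \<Rightarrow> 'a) \<Rightarrow> 'a topology \<Rightarrow> 'a \<Rightarrow> 'a set topology" where
  "cone_link scl X z = quotient_space (subtopology X (topspace X - {z})) (scaling_rel scl X z)"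


section \<open>The link of \<open>PD\<^sub>2\<^sup>r\<^sup>t / GL\<^sub>2(\<int>)[m]\<close>\<close>

definition GL2_level :: "nat \<Rightarrow> (int ^ 2 ^ 2) set" where
  "GL2_level m = {A. invertible A \<and> congruent_to_one m A}"

definition PD2_rt :: "(real ^ 2 ^ 2) topology" where
  "PD2_rt = fan_support (UNIV :: (int ^ 2) set)"

definition GL2_rel :: "nat \<Rightarrow> ((real ^ 2 ^ 2) \<times> (real ^ 2 ^ 2)) set" where
  "GL2_rel m = {(Q, conj_act A Q) | Q A. A \<in> GL2_level m}"

definition PD2_quot :: "nat \<Rightarrow> (real ^ 2 ^ 2) set topology" where
  "PD2_quot m = quotient_space PD2_rt (GL2_rel m)"

definition PD2_scale :: "real \<Rightarrow> (real ^ 2 ^ 2) set \<Rightarrow> (real ^ 2 ^ 2) set" where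
  "PD2_scale t c = (\<lambda>Q. t *\<^sub>R Q) ` c"

definition PD2_link :: "nat \<Rightarrow> (real ^ 2 ^ 2) set set topology" where
  "PD2_link m = cone_link PD2_scale (PD2_quot m) (GL2_rel m `` {0})"

definition cone_orbits :: "nat \<Rightarrow> (real ^ 2 ^ 2) set set set" where
  "cone_orbits m =
     {{conj_act A ` C | A. A \<in> GL2_level m} | C. C \<in> fan (UNIV :: (int ^ 2) set) \<and> C \<noteq> {0}}"

definition link_cell :: "nat \<Rightarrow> (real ^ 2 ^ 2) set set \<Rightarrow> (real ^ 2 ^ 2) set set set" where
  "link_cell m \<O> =
     (\<lambda>Q. scaling_rel PD2_scale (PD2_quot m) (GL2_rel m `` {0}) `` {GL2_rel m `` {Q}}) `
       (\<Union>\<O> - {0})"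

text \<open>An isomorphism of the simplicial complex \<open>K\<close> with the link, whose simplices are the
  orbits of nonzero cones: a homeomorphism, together with a bijection between the simplices of
  \<open>K\<close> and those orbits, such that closed simplices are mapped onto the corresponding closed cells.
  As the inclusions of closed simplices are the face relations, these are preserved.\<close>

definition isomorphic_to_PD2_link :: "'v set set \<Rightarrow> nat \<Rightarrow> bool" where
  "isomorphic_to_PD2_link K m \<longleftrightarrow>
     (\<exists>h F. homeomorphic_map (realization K) (PD2_link m) h \<and>
        bij_betw F K (cone_orbits m) \<and>
        (\<forall>\<sigma>\<in>K. h ` closed_simplex \<sigma> = link_cell m (F \<sigma>)))"


section \<open>\<open>A\<^sub>2[m]\<^sup>t\<^sup>r\<^sup>o\<^sup>p\<close> and its link\<close>

definition Sp4_level :: "nat \<Rightarrow> (int ^ 4 ^ 4) set" where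
  "Sp4_level m = {A. (\<forall>x y. symp (A *v x) (A *v y) = symp x y) \<and> congruent_to_one m A}"

definition A2_glue ::
  "nat \<Rightarrow> (int ^ 4) set \<times> (real ^ 4 ^ 4) \<Rightarrow> (int ^ 4) set \<times> (real ^ 4 ^ 4) \<Rightarrow> bool" where
  "A2_glue m a b \<longleftrightarrow>
     (\<exists>P' P x A. isotropic_subspace P' \<and> isotropic_subspace P \<and> x \<in> topspace (fan_support P') \<and>
        A \<in> Sp4_level m \<and> (\<lambda>v. A *v v) ` P' \<subseteq> P \<and> a = (P', x) \<and> b = (P, conj_act A x))"

definition A2_rel ::
  "nat \<Rightarrow> (((int ^ 4) set \<times> (real ^ 4 ^ 4)) \<times> ((int ^ 4) set \<times> (real ^ 4 ^ 4))) set" where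
  "A2_rel m = {(a, b). equivclp (A2_glue m) a b}"

definition A2_trop :: "nat \<Rightarrow> ((int ^ 4) set \<times> (real ^ 4 ^ 4)) set topology" where
  "A2_trop m = quotient_space (sum_topology fan_support {P. isotropic_subspace P}) (A2_rel m)"

definition A2_scale ::
  "real \<Rightarrow> ((int ^ 4) set \<times> (real ^ 4 ^ 4)) set \<Rightarrow> ((int ^ 4) set \<times> (real ^ 4 ^ 4)) set" where
  "A2_scale t c = (\<lambda>(P, x). (P, t *\<^sub>R x)) ` c"

definition LA2_trop :: "nat \<Rightarrow> ((int ^ 4) set \<times> (real ^ 4 ^ 4)) set set topology" where
  "LA2_trop m = cone_link A2_scale (A2_trop m) (A2_rel m `` {({0}, 0)})"

end

(* Two vertices of S(P, omega) and the bases of P with determinant 1 or -1 are reductions of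
   unimodular integral pairs, so that S(P, omega) is the quotient of the complex of unimodular
   pairs in Z^2 by the congruence subgroup; likewise Delta_2[m] is the quotient of the complex of
   pairs spanning isotropic planes of Z^4. In both cases barycentric coordinates with respect to
   the generators of a cone, which are unique by evaluating perfect forms, give a map from the
   union of the cones to the realization of the quotient complex. It has continuous sections over
   the closed simplices, hence is a quotient map, and its fibres are the orbits of the scaling and
   the congruence subgroup because unimodular (symplectic) pairs with equal reductions are
   congruent. Two quotient maps with equal fibres have homeomorphic targets.

   In S(P, omega) the link of a vertex v is an m-cycle u, u + v, ..., u + (m - 1) v, which gives
   charts, the Euler characteristic (6 - m) V / 6 and, together with the sign of the determinant,
   an orientation; the Euclidean algorithm gives connectedness. The numbers of vertices and of
   planes with a generator come from counting primitive vectors and good pairs. As an edge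
   {v, w} determines P = <v, w> and omega = v wedge w, the surfaces meet only in vertices. *)

theory Submission
  imports Defs
begin

section \<open>Unimodular pairs and symplectic bases\<close>

text \<open>Residue rings have zero divisors, so independence, bases and summands are all expressed
  by dual covectors: v, w form a basis of a free direct summand iff there are c, d with c(v) = d(w)
  = 1 and c(w) = d(v) = 0. Such equations survive reduction. Lifting back is done in coordinates,
  and its one real difficulty is to lift a unimodular row to a unimodular row.

  Everything lives on vectors up to sign, and the signs are the obstacle: two vertices v, w are
  completed to a triangle both by v + w and by v - w, and these must stay distinct after reduction.
  They coincide only if 2v or 2w vanishes, which m \<ge> 3 excludes. The same fact makes the
  orientation by the sign of the determinant well defined.

  In the colimit for the symplectic group the gluing maps run only between isotropic subspaces
  mapped into each other, so congruent points of two planes must be joined through the smallest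
  subspace that carries them.

  The count of simplices yields the genus as a rational number only; that it is a natural number
  rests on a divisibility by 24 for Jordan's totient of m and on the spherical cases m = 3, 4,
  5.\<close>

definition dotp :: "'r::comm_ring_1 ^ 'n \<Rightarrow> 'r ^ 'n \<Rightarrow> 'r" where
  "dotp c v = (\<Sum>i\<in>UNIV. c $ i * v $ i)"

lemma dotp_simps [simp]:
  "dotp c (v + w) = dotp c v + dotp c w" "dotp c (v - w) = dotp c v - dotp c w"
  "dotp c (- v) = - dotp c v" "dotp c (a *s v) = a * dotp c v" "dotp c 0 = 0"
  "dotp (c + d) v = dotp c v + dotp d v" "dotp (c - d) v = dotp c v - dotp d v"
  "dotp (- c) v = - dotp c v" "dotp (a *s c) v = a * dotp c v" "dotp 0 v = 0"
  by (simp_all add: dotp_def sum.distrib sum_subtractf sum_negf sum_distrib_left algebra_simps)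

lemma primitive_iff_dotp: "primitive v \<longleftrightarrow> (\<exists>c. dotp c v = 1)"
proof
  assume "primitive v"
  then obtain c where "(\<Sum>i\<in>UNIV. c i * v $ i) = 1" by (auto simp: primitive_def)
  then have "dotp (\<chi> i. c i) v = 1" by (simp add: dotp_def)
  then show "\<exists>c. dotp c v = 1" by blast
qed (auto simp: primitive_def dotp_def)

text \<open>The map x |-> c(x) v + d(x) w is then a projection onto the span of v, w, so these are
  the bases of free summands of rank two. The equational form passes through every ring
  homomorphism.\<close>

definition upair :: "'r::comm_ring_1 ^ 'n \<Rightarrow> 'r ^ 'n \<Rightarrow> bool" where
  "upair v w \<longleftrightarrow> (\<exists>c d. dotp c v = 1 \<and> dotp c w = 0 \<and> dotp d v = 0 \<and> dotp d w = 1)"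

lemma upairI: "dotp c v = 1 \<Longrightarrow> dotp c w = 0 \<Longrightarrow> dotp d v = 0 \<Longrightarrow> dotp d w = 1 \<Longrightarrow> upair v w"
  by (auto simp: upair_def)

lemma upair_primitive: "upair v w \<Longrightarrow> primitive v" "upair v w \<Longrightarrow> primitive w"
  by (auto simp: upair_def primitive_iff_dotp)

lemma upair_sym: "upair v w \<Longrightarrow> upair w v"
  by (auto simp: upair_def)

lemma upair_minus: "upair v w \<Longrightarrow> upair v (- w)"
proof -
  assume "upair v w"
  then obtain c d where cd: "dotp c v = 1" "dotp c w = 0" "dotp d v = 0" "dotp d w = 1"
    by (auto simp: upair_def)
  show ?thesis by (rule upairI[of c _ _ "- d"]) (auto simp: cd)
qed

lemma upair_add: "upair v w \<Longrightarrow> upair v (a *s v + w)"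
proof -
  assume "upair v w"
  then obtain c d where cd: "dotp c v = 1" "dotp c w = 0" "dotp d v = 0" "dotp d w = 1"
    by (auto simp: upair_def)
  show ?thesis by (rule upairI[of "c - a *s d" _ _ d]) (auto simp: cd)
qed

lemma upair_indep: "upair v w \<Longrightarrow> a *s v + b *s w = 0 \<Longrightarrow> a = 0 \<and> b = 0"
proof -
  assume "upair v w" and 0: "a *s v + b *s w = 0"
  then obtain c d where cd: "dotp c v = 1" "dotp c w = 0" "dotp d v = 0" "dotp d w = 1"
    by (auto simp: upair_def)
  have "dotp c (a *s v + b *s w) = a" "dotp d (a *s v + b *s w) = b"
    by (simp_all add: cd)
  then show ?thesis unfolding 0 by simp
qed

definition span2 :: "'r::comm_ring_1 ^ 'n \<Rightarrow> 'r ^ 'n \<Rightarrow> ('r ^ 'n) set" where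
  "span2 v w = {a *s v + b *s w | a b. True}"

lemma span_pair: "rvec.span {v, w} = span2 v w"
proof -
  have "x - k *s v = l *s w \<longleftrightarrow> x = k *s v + l *s w" for x k l
    by (auto simp: algebra_simps)
  then show ?thesis
    unfolding span2_def by (auto simp: rvec.span_insert[of v] rvec.span_singleton image_iff)
qed

lemma span2I: "x = a *s v + b *s w \<Longrightarrow> x \<in> span2 v w"
  by (auto simp: span2_def)

lemma span2_mem [simp]: "v \<in> span2 v w" "w \<in> span2 v w"
  by (rule span2I[of _ 1 _ 0], simp) (rule span2I[of _ 0 _ 1], simp)

text \<open>The side condition \<open>v \<noteq> w\<close> is absorbed on the right: equal vectors
  satisfy the nontrivial relation with coefficients 1 and -1.\<close>

lemma is_basis_pair_iff:
  "is_basis_pair v w P \<longleftrightarrow> (\<forall>a b. a *s v + b *s w = 0 \<longrightarrow> a = 0 \<and> b = 0) \<and> P = span2 v w"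
proof (cases "v = w")
  case True
  have "1 *s v + (-1) *s v = 0" by simp
  then have "\<not> (\<forall>a b. a *s v + b *s w = 0 \<longrightarrow> a = 0 \<and> b = 0)"
    using True by (metis zero_neq_one)
  then show ?thesis using True by (simp add: is_basis_pair_def)
next
  case False
  have "\<not> rvec.dependent {v, w} \<longleftrightarrow> (\<forall>a b. a *s v + b *s w = 0 \<longrightarrow> a = 0 \<and> b = 0)"
  proof
    assume ind: "\<not> rvec.dependent {v, w}"
    show "\<forall>a b. a *s v + b *s w = 0 \<longrightarrow> a = 0 \<and> b = 0"
    proof (intro allI impI)
      fix a b assume ab: "a *s v + b *s w = 0"
      have "\<not> (\<exists>u. (\<exists>x\<in>{v, w}. u x \<noteq> 0) \<and> (\<Sum>x\<in>{v, w}. u x *s x) = 0)"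
        using ind by (simp add: rvec.dependent_finite)
      from this[simplified, rule_format, of "\<lambda>x. if x = v then a else b"]
      show "a = 0 \<and> b = 0" using ab False by auto
    qed
  next
    assume "\<forall>a b. a *s v + b *s w = 0 \<longrightarrow> a = 0 \<and> b = 0"
    then show "\<not> rvec.dependent {v, w}"
      using False by (auto simp: rvec.dependent_finite)
  qed
  then show ?thesis
    using False unfolding is_basis_pair_def is_basis_def span_pair by auto
qed

lemma is_basis_pair_upair: "upair v w \<Longrightarrow> is_basis_pair v w P \<longleftrightarrow> P = span2 v w"
  using upair_indep by (auto simp: is_basis_pair_iff)

lemma is_basis_pair_mem: "is_basis_pair v w P \<Longrightarrow> v \<in> P \<and> w \<in> P"
  by (auto simp: is_basis_pair_iff)

lemma subspace_span2: "rvec.subspace (span2 v w)"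
  by (metis rvec.subspace_span span_pair)

lemma free_submodule_span2: "upair v w \<Longrightarrow> free_submodule (span2 v w)"
  using is_basis_pair_upair[of v w "span2 v w"] subspace_span2
  unfolding free_submodule_def is_basis_pair_def by blast

lemma vec_axis_sum: "(v :: 'r::comm_ring_1 ^ 'n) = (\<Sum>i\<in>UNIV. v $ i *s axis i 1)"
  by (simp add: vec_eq_iff axis_def if_distrib cong: if_cong)

text \<open>The dual covectors are the two coordinates of the projection onto \<open>P\<close> along
  \<open>Q\<close>.\<close>

lemma upair_of_summand:
  fixes v w :: "'r::comm_ring_1 ^ 'n"
  assumes b: "is_basis_pair v w P" and Q: "rvec.subspace Q"
    and PQ: "P \<inter> Q = {0}" "{x + y | x y. x \<in> P \<and> y \<in> Q} = UNIV"
  shows "upair v w"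
proof -
  have P: "P = span2 v w" and ind: "\<And>a b. a *s v + b *s w = 0 \<Longrightarrow> a = 0 \<and> b = 0"
    using b by (auto simp: is_basis_pair_iff)
  have "\<exists>a b q. q \<in> Q \<and> x = a *s v + b *s w + q" for x
    using PQ(2) P by (fastforce simp: span2_def)
  then obtain A B q where AB: "\<And>x. q x \<in> Q" "\<And>x. x = A x *s v + B x *s w + q x"
    by metis
  \<comment> \<open>\<open>A\<close>, \<open>B\<close>, \<open>q\<close> are arbitrary choices and
    not known to be linear. Only their values at the unit vectors enter, and are extended linearly;
    the error stays in the submodule \<open>Q\<close>.\<close>
  define c d where "c = (\<chi> i. A (axis i 1))" and "d = (\<chi> i. B (axis i 1))"
  have main: "dotp c x *s v + dotp d x *s w - x \<in> Q" for x
  proof -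
    have "x = (\<Sum>i\<in>UNIV. x $ i *s (A (axis i 1) *s v + B (axis i 1) *s w + q (axis i 1)))"
      using vec_axis_sum[of x] AB(2) by simp
    also have "\<dots> = dotp c x *s v + dotp d x *s w + (\<Sum>i\<in>UNIV. x $ i *s q (axis i 1))"
      by (simp add: dotp_def c_def d_def vec_eq_iff sum.distrib sum_distrib_left sum_distrib_right algebra_simps)
    finally have "dotp c x *s v + dotp d x *s w - x = - (\<Sum>i\<in>UNIV. x $ i *s q (axis i 1))"
      by (simp add: algebra_simps)
    moreover have "- (\<Sum>i\<in>UNIV. x $ i *s q (axis i 1)) \<in> Q"
      by (intro rvec.subspace_neg[OF Q] rvec.subspace_sum[OF Q] rvec.subspace_scale[OF Q] AB)
    ultimately show ?thesis by simp
  qed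
  have *: "x = 0" if "x \<in> Q" "x = a *s v + b *s w" for x a b
    using that PQ(1) P by (auto simp: span2_def)
  have "(dotp c v - 1) *s v + dotp d v *s w = 0"
    by (rule *[of _ "dotp c v - 1" "dotp d v"]) (use main[of v] in \<open>simp_all add: algebra_simps\<close>)
  moreover have "dotp c w *s v + (dotp d w - 1) *s w = 0"
    by (rule *[of _ "dotp c w" "dotp d w - 1"]) (use main[of w] in \<open>simp_all add: algebra_simps\<close>)
  ultimately show ?thesis
    using ind[of "dotp c v - 1" "dotp d v"] ind[of "dotp c w" "dotp d w - 1"]
    by (intro upairI[of c _ _ d]) auto
qed

section \<open>The symplectic form and symplectic bases\<close>

lemma symp_simps [simp]:
  "symp (x + y) z = symp x z + symp y z" "symp z (x + y) = symp z x + symp z y"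
  "symp (x - y) z = symp x z - symp y z" "symp z (x - y) = symp z x - symp z y"
  "symp (a *s x) z = a * symp x z" "symp z (a *s x) = a * symp z x"
  "symp (- x) z = - symp x z" "symp z (- x) = - symp z x"
  "symp 0 z = 0" "symp z 0 = 0" "symp x x = 0"
  by (simp_all add: symp_def algebra_simps)

lemma symp_swap: "symp x y = - symp y x"
  by (simp add: symp_def algebra_simps)

definition vec4 :: "'r \<Rightarrow> 'r \<Rightarrow> 'r \<Rightarrow> 'r \<Rightarrow> 'r ^ 4" where
  "vec4 a b c d = (\<chi> i. if i = 1 then a else if i = 2 then b else if i = 3 then c else d)"

lemma vec4_simps [simp]:
  "vec4 a b c d $ 1 = a" "vec4 a b c d $ 2 = b" "vec4 a b c d $ 3 = c" "vec4 a b c d $ 4 = d"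
  by (simp_all add: vec4_def)

lemma vec4_eq_iff: "(v :: 'r ^ 4) = w \<longleftrightarrow> v $ 1 = w $ 1 \<and> v $ 2 = w $ 2 \<and> v $ 3 = w $ 3 \<and> v $ 4 = w $ 4"
  by (auto simp: vec_eq_iff forall_4)

definition sympl :: "'r::comm_ring_1 ^ 4 \<Rightarrow> 'r ^ 4" where
  "sympl y = vec4 (y$3) (y$4) (- (y$1)) (- (y$2))"

lemma dotp_sympl: "dotp (sympl y) x = symp x y"
  by (simp add: dotp_def sum_4 sympl_def symp_def algebra_simps)

text \<open>Perfectness of the form: every covector is the pairing with an explicit vector.\<close>

lemma symp_of_covector: "symp x (vec4 (- (c$3)) (- (c$4)) (c$1) (c$2)) = dotp c x"
  by (simp add: dotp_def sum_4 symp_def algebra_simps)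

text \<open>The order is that of e1, e2, f1, f2: \<open>v\<close>, \<open>w\<close> span a
  Lagrangian and \<open>x\<close>, \<open>y\<close> are dual to them. That four vectors with these
  relations form a basis is \<open>sympbasis_expand\<close>.\<close>

definition sympbasis :: "'r::comm_ring_1 ^ 4 \<Rightarrow> 'r ^ 4 \<Rightarrow> 'r ^ 4 \<Rightarrow> 'r ^ 4 \<Rightarrow> bool" where
  "sympbasis v w x y \<longleftrightarrow> symp v w = 0 \<and> symp v x = 1 \<and> symp v y = 0 \<and> symp w x = 0 \<and>
     symp w y = 1 \<and> symp x y = 0"

lemma sympbasis_rels:
  assumes "sympbasis v w x y"
  shows "symp v w = 0" "symp v x = 1" "symp v y = 0" "symp w x = 0" "symp w y = 1" "symp x y = 0"
    "symp w v = 0" "symp x v = -1" "symp y v = 0" "symp x w = 0" "symp y w = -1" "symp y x = 0"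
  using assms by (auto simp: sympbasis_def symp_swap[of w v] symp_swap[of x v] symp_swap[of y v]
      symp_swap[of x w] symp_swap[of y w] symp_swap[of y x])

text \<open>The working form of a basis of an isotropic plane, see
  \<open>isotropic_basis_pair_iff\<close>.\<close>

definition good :: "'r::comm_ring_1 ^ 4 \<Rightarrow> 'r ^ 4 \<Rightarrow> bool" where
  "good v w \<longleftrightarrow> upair v w \<and> symp v w = 0"

lemma sympbasis_upair: "sympbasis v w x y \<Longrightarrow> upair v w" "sympbasis v w x y \<Longrightarrow> upair x y"
proof -
  assume s: "sympbasis v w x y"
  show "upair v w"
    by (rule upairI[of "sympl x" _ _ "sympl y"]) (simp_all add: dotp_sympl sympbasis_rels[OF s])
  show "upair x y"
    by (rule upairI[of "- sympl v" _ _ "- sympl w"]) (simp_all add: dotp_sympl sympbasis_rels[OF s])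
qed

lemma sympbasis_good: "sympbasis v w x y \<Longrightarrow> good v w"
  using sympbasis_upair by (auto simp: good_def sympbasis_def)

text \<open>Represent the dual covectors as pairings with \<open>x\<close> and \<open>y\<close>. The
  only relation that may fail is the one between \<open>x\<close> and \<open>y\<close>, and
  subtracting \<open>symp x y\<close> times \<open>w\<close> from \<open>x\<close> repairs it
  because \<open>v\<close>, \<open>w\<close> are orthogonal.\<close>

lemma good_sympbasis:
  assumes "good v w" shows "\<exists>x y. sympbasis v w x y"
proof -
  obtain c d where cd: "dotp c v = 1" "dotp c w = 0" "dotp d v = 0" "dotp d w = 1"
    using assms by (auto simp: upair_def good_def)
  obtain x where x: "\<And>z. symp z x = dotp c z" using symp_of_covector[where c = c] by metis
  obtain y where y: "\<And>z. symp z y = dotp d z" using symp_of_covector[where c = d] by metis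
  have "symp v w = 0" "symp w v = 0" using assms symp_swap[of w v] by (auto simp: good_def)
  then have "sympbasis v w (x - symp x y *s w) y"
    using x y cd by (simp add: sympbasis_def)
  then show ?thesis by blast
qed

text \<open>The relations say that the matrix \<open>H\<close> of symplectic coordinates is a left
  inverse of the matrix \<open>G\<close> of basis vectors; the expansion says that it is a right
  inverse, which \<open>lr\<close> provides.\<close>

lemma sympbasis_expand:
  fixes v w x y z :: "'r::comm_ring_1 ^ 4"
  assumes lr: "\<And>A B :: 'r ^ 4 ^ 4. A ** B = mat 1 \<Longrightarrow> B ** A = mat 1"
    and s: "sympbasis v w x y"
  shows "z = symp z x *s v + symp z y *s w + symp v z *s x + symp w z *s y"
proof -
  define H where "H = vec4 (sympl x) (sympl y) (- sympl v) (- sympl w)"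
  define G where "G = (\<chi> i. vec4 (v$i) (w$i) (x$i) (y$i))"
  have "H ** G = mat 1"
    using sympbasis_rels[OF s]
    by (simp add: vec_eq_iff forall_4 matrix_matrix_mult_def sum_4 H_def G_def sympl_def mat_def symp_def algebra_simps)
  then have "z = (G ** H) *v z"
    using lr by simp
  also have "\<dots> = G *v (H *v z)"
    by (simp add: matrix_vector_mul_assoc)
  also have "\<dots> = symp z x *s v + symp z y *s w + symp v z *s x + symp w z *s y"
    by (simp add: vec_eq_iff forall_4 matrix_vector_mult_def sum_4 H_def G_def sympl_def symp_def algebra_simps)
  finally show ?thesis .
qed

text \<open>A property of the ring, so that the symplectic lemmas can be stated once and applied to
  the integers and to residue rings.\<close>

definition inverse_comm :: "'r::comm_ring_1 itself \<Rightarrow> bool" where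
  "inverse_comm _ \<longleftrightarrow> (\<forall>A B :: 'r ^ 4 ^ 4. A ** B = mat 1 \<longrightarrow> B ** A = mat 1)"

text \<open>A left invertible matrix acts injectively, hence bijectively on a finite module.\<close>

lemma inverse_comm_finite: "inverse_comm TYPE('r::{comm_ring_1, finite})"
  unfolding inverse_comm_def
proof (intro allI impI)
  fix A B :: "'r ^ 4 ^ 4" assume AB: "A ** B = mat 1"
  then have "A *v (B *v x) = x" for x
    by (simp add: matrix_vector_mul_assoc)
  then have "inj ((*v) B)" by (metis injI)
  then have "surj ((*v) B)" by (simp add: finite_UNIV_inj_surj)
  then have "B *v (A *v y) = y" for y
    by (metis \<open>\<And>x. A *v (B *v x) = x\<close> surjD)
  then show "B ** A = mat 1"
    by (simp add: matrix_eq matrix_vector_mul_assoc)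
qed

text \<open>Integer matrices embed into real ones, where one-sided inverses are two-sided.\<close>

lemma inverse_comm_int: "inverse_comm TYPE(int)"
  unfolding inverse_comm_def
proof (intro allI impI)
  fix A B :: "int ^ 4 ^ 4" assume AB: "A ** B = mat 1"
  define R :: "int ^ 4 ^ 4 \<Rightarrow> real ^ 4 ^ 4" where "R A = (\<chi> i j. real_of_int (A $ i $ j))" for A
  have R: "R (A ** B) = R A ** R B" for A B
    by (simp add: R_def vec_eq_iff matrix_matrix_mult_def)
  have R1: "R (mat 1) = mat 1"
    by (simp add: R_def vec_eq_iff mat_def)
  have inj: "R A = R B \<Longrightarrow> A = B" for A B
    by (simp add: R_def vec_eq_iff)
  have "R A ** R B = mat 1" using AB R R1 by metis
  then have "R B ** R A = mat 1" using matrix_left_right_inverse by blast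
  then show "B ** A = mat 1" using R R1 inj by metis
qed

lemma isotropic_subspaceI:
  assumes "free_submodule P" "\<And>x y. x \<in> P \<Longrightarrow> y \<in> P \<Longrightarrow> symp x y = 0" "free_submodule Q"
    "P \<inter> Q = {0}" "\<And>z. \<exists>p\<in>P. \<exists>q\<in>Q. z = p + q"
  shows "isotropic_subspace P"
proof -
  have "{p + q | p q. p \<in> P \<and> q \<in> Q} = UNIV"
    using assms(5) by blast
  then show ?thesis
    using assms(1-4) unfolding isotropic_subspace_def by (intro conjI exI[of _ Q]) auto
qed

text \<open>The other half \<open>x\<close>, \<open>y\<close> of a symplectic basis spans a free
  complement; pairing with \<open>x\<close> and \<open>y\<close> shows that the intersection is
  zero.\<close>

lemma isotropic_span2:
  fixes v w :: "'r::comm_ring_1 ^ 4"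
  assumes lr: "inverse_comm TYPE('r)" and g: "good v w"
  shows "isotropic_subspace (span2 v w)"
proof -
  obtain x y where s: "sympbasis v w x y" using good_sympbasis[OF g] by blast
  note rels = sympbasis_rels[OF s]
  have "free_submodule (span2 x y)" "free_submodule (span2 v w)"
    using sympbasis_upair[OF s] free_submodule_span2 by auto
  moreover have "symp p q = 0" if "p \<in> span2 v w" "q \<in> span2 v w" for p q
    using that rels by (auto simp: span2_def)
  moreover have "span2 v w \<inter> span2 x y = {0}"
  proof -
    have "p = 0" if p: "p \<in> span2 v w" "p \<in> span2 x y" for p
    proof -
      obtain a b c d where *: "p = a *s v + b *s w" "p = c *s x + d *s y"
        using p unfolding span2_def by blast
      have "symp p x = a" "symp p y = b" using *(1) rels by simp_all
      moreover have "symp p x = 0" "symp p y = 0" using *(2) rels by simp_all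
      ultimately show ?thesis using * by simp
    qed
    moreover have "0 \<in> span2 v w" "0 \<in> span2 x y"
      using subspace_span2 rvec.subspace_0 by auto
    ultimately show ?thesis by blast
  qed
  moreover have "\<exists>p\<in>span2 v w. \<exists>q\<in>span2 x y. z = p + q" for z
  proof -
    have "z = (symp z x *s v + symp z y *s w) + (symp v z *s x + symp w z *s y)"
      using sympbasis_expand[OF _ s, of z] lr by (simp add: inverse_comm_def add.assoc)
    then show ?thesis by (blast intro: span2I)
  qed
  ultimately show ?thesis
    using isotropic_subspaceI by metis
qed

lemma isotropic_basis_pair_iff:
  fixes v w :: "'r::comm_ring_1 ^ 4"
  assumes "inverse_comm TYPE('r)"
  shows "isotropic_subspace P \<and> is_basis_pair v w P \<longleftrightarrow> good v w \<and> P = span2 v w"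
proof
  assume *: "isotropic_subspace P \<and> is_basis_pair v w P"
  then obtain Q where "rvec.subspace Q" "P \<inter> Q = {0}" "{x + y | x y. x \<in> P \<and> y \<in> Q} = UNIV"
    and sy: "\<forall>x\<in>P. \<forall>y\<in>P. symp x y = 0"
    unfolding isotropic_subspace_def free_submodule_def by blast
  then have "upair v w"
    using upair_of_summand[of v w P Q] * by blast
  moreover have "symp v w = 0"
    using * is_basis_pair_mem[of v w P] sy by blast
  ultimately show "good v w \<and> P = span2 v w"
    using * is_basis_pair_upair by (auto simp: good_def)
next
  assume "good v w \<and> P = span2 v w"
  then show "isotropic_subspace P \<and> is_basis_pair v w P"
    using isotropic_span2[OF assms] by (auto simp: good_def is_basis_pair_upair)
qed

lemma isotropic_plane_iff:
  fixes P :: "('r::comm_ring_1 ^ 4) set"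
  assumes "inverse_comm TYPE('r)"
  shows "isotropic_plane P \<longleftrightarrow> (\<exists>v w. good v w \<and> P = span2 v w)"
proof -
  have "(\<exists>B. is_basis B P \<and> card B = 2) \<longleftrightarrow> (\<exists>v w. is_basis_pair v w P)"
    unfolding is_basis_pair_def card_2_iff by blast
  then show ?thesis
    unfolding isotropic_plane_def using isotropic_basis_pair_iff[OF assms] by metis
qed

lemma isotropic_zero: "isotropic_subspace ({0} :: ('r::comm_ring_1 ^ 4) set)"
proof -
  let ?B = "range (\<lambda>i::4. axis i (1::'r))"
  have inj: "inj (\<lambda>i::4. axis i (1::'r))" by (simp add: inj_on_def axis_eq_axis)
  have "\<not> rvec.dependent ?B"
  proof
    assume "rvec.dependent ?B"
    then obtain u where u: "(\<Sum>v\<in>?B. u v *s v) = 0" "\<exists>v\<in>?B. u v \<noteq> 0"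
      by (auto simp: rvec.dependent_finite)
    have "(\<Sum>v\<in>?B. u v *s v) = (\<Sum>i\<in>UNIV. u (axis i 1) *s axis i 1)"
      using inj by (simp add: sum.reindex)
    also have "\<dots> = (\<chi> i. u (axis i 1))"
      using vec_axis_sum[of "\<chi> i. u (axis i 1)"] by simp
    finally show False using u by (auto simp: vec_eq_iff)
  qed
  moreover have "rvec.span ?B = UNIV"
  proof -
    have "x \<in> rvec.span ?B" for x :: "'r ^ 4"
      by (subst vec_axis_sum) (intro rvec.span_sum rvec.span_scale rvec.span_base, simp)
    then show ?thesis by blast
  qed
  ultimately have "free_submodule (UNIV :: ('r ^ 4) set)"
    unfolding free_submodule_def is_basis_def by auto
  moreover have "free_submodule ({0} :: ('r ^ 4) set)"
    unfolding free_submodule_def is_basis_def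
    using rvec.independent_empty rvec.span_empty by auto
  ultimately show ?thesis
    unfolding isotropic_subspace_def by (auto intro!: exI[of _ UNIV])
qed

text \<open>Lines are needed for the points on rays of the fans. Pairing with \<open>x\<close> reads
  off the coefficient of \<open>v\<close>, hence vanishes on the complement spanned by
  \<open>w\<close>, \<open>x\<close>, \<open>y\<close>.\<close>

lemma isotropic_line:
  fixes v w :: "'r::comm_ring_1 ^ 4"
  assumes lr: "inverse_comm TYPE('r)" and g: "good v w"
  shows "isotropic_subspace (range (\<lambda>a. a *s v))"
proof -
  obtain x y where s: "sympbasis v w x y" using good_sympbasis[OF g] by blast
  note rels = sympbasis_rels[OF s]
  let ?P = "range (\<lambda>a. a *s v)" and ?Q = "rvec.span {w, x, y}"
  have Q: "z \<in> ?Q \<longleftrightarrow> (\<exists>a b c. z = a *s w + (b *s x + c *s y))" for z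
  proof -
    have "z \<in> ?Q \<longleftrightarrow> (\<exists>a. z - a *s w \<in> span2 x y)"
      unfolding rvec.span_insert[of w] span_pair by simp
    also have "\<dots> \<longleftrightarrow> (\<exists>a b c. z = a *s w + (b *s x + c *s y))"
      unfolding span2_def by (auto simp: algebra_simps)
    finally show ?thesis .
  qed
  have Qsymp: "symp z x = 0" if "z \<in> ?Q" for z
    using that rels by (auto simp: Q)
  have coef: "a = 0" if "a *s v = 0" for a
  proof -
    have "symp (a *s v) x = a" using rels by simp
    then show ?thesis using that by simp
  qed
  have "\<not> rvec.dependent {v}"
    using coef by (auto simp: rvec.dependent_finite)
  then have "free_submodule ?P"
    unfolding free_submodule_def is_basis_def
    by (metis rvec.span_singleton rvec.subspace_span)
  moreover have "free_submodule ?Q"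
  proof -
    have ne: "w \<noteq> x" "w \<noteq> y" "x \<noteq> y"
      using rels(1-6) symp_simps(11)[of w] zero_neq_one by metis+
    have "\<not> rvec.dependent {w, x, y}"
    proof
      assume "rvec.dependent {w, x, y}"
      then obtain u where u: "u w \<noteq> 0 \<or> u x \<noteq> 0 \<or> u y \<noteq> 0" "u w *s w + (u x *s x + u y *s y) = 0"
        using ne by (auto simp: rvec.dependent_finite)
      have "symp (u w *s w + (u x *s x + u y *s y)) y = u w"
        "symp v (u w *s w + (u x *s x + u y *s y)) = u x"
        "symp w (u w *s w + (u x *s x + u y *s y)) = u y"
        using rels by simp_all
      then have "u w = 0" "u x = 0" "u y = 0" unfolding u(2) by simp_all
      then show False using u(1) by simp
    qed
    then show ?thesis
      unfolding free_submodule_def is_basis_def by (intro conjI exI[of _ "{w, x, y}"]) simp_all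
  qed
  moreover have "symp p q = 0" if "p \<in> ?P" "q \<in> ?P" for p q
    using that by auto
  moreover have "?P \<inter> ?Q = {0}"
  proof -
    have "p = 0" if p: "p \<in> ?P" "p \<in> ?Q" for p
    proof -
      obtain a where a: "p = a *s v" using p(1) by auto
      have "symp p x = a" using a rels by simp
      then show ?thesis using Qsymp[OF p(2)] a by simp
    qed
    moreover have "0 \<in> ?P" by (rule range_eqI[of _ _ 0]) simp
    ultimately show ?thesis using rvec.span_zero by blast
  qed
  moreover have "\<exists>p\<in>?P. \<exists>q\<in>?Q. z = p + q" for z
  proof -
    have "z = symp z x *s v + (symp z y *s w + (symp v z *s x + symp w z *s y))"
      using sympbasis_expand[OF _ s, of z] lr by (simp add: inverse_comm_def add.assoc)
    moreover have "symp z y *s w + (symp v z *s x + symp w z *s y) \<in> ?Q"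
      unfolding Q by blast
    ultimately show ?thesis by blast
  qed
  ultimately show ?thesis
    using isotropic_subspaceI by metis
qed

text \<open>Orthogonality to \<open>v\<close> kills the \<open>x\<close>-coordinate, and
  \<open>w0\<close>, \<open>y\<close> is a symplectic basis of the quotient of the orthogonal of
  \<open>v\<close> by \<open>v\<close>: what remains is that the image of \<open>w\<close> there is
  primitive. This reduces lifting and counting of neighbours to unimodular rows of length
  two.\<close>

lemma good_iff_coords:
  fixes v w0 x y :: "'r::comm_ring_1 ^ 4"
  assumes lr: "inverse_comm TYPE('r)" and s: "sympbasis v w0 x y"
  shows "good v w \<longleftrightarrow> (\<exists>a b d. (\<exists>s t. s * b + t * d = 1) \<and> w = a *s v + b *s w0 + d *s y)"
proof
  assume g: "good v w"
  then obtain c d where cd: "dotp c v = 1" "dotp c w = 0" "dotp d v = 0" "dotp d w = 1"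
    by (auto simp: upair_def good_def)
  have w: "w = symp w x *s v + symp w y *s w0 + symp w0 w *s y"
    using sympbasis_expand[OF _ s, of w] lr g by (simp add: inverse_comm_def good_def)
  have "dotp d w = dotp d w0 * symp w y + dotp d y * symp w0 w"
    by (subst w) (simp add: cd algebra_simps)
  then show "\<exists>a b d. (\<exists>s t. s * b + t * d = 1) \<and> w = a *s v + b *s w0 + d *s y"
    using w cd by metis
next
  assume "\<exists>a b d. (\<exists>s t. s * b + t * d = 1) \<and> w = a *s v + b *s w0 + d *s y"
  then obtain a b d s' t where *: "s' * b + t * d = 1" "w = a *s v + b *s w0 + d *s y" by blast
  note rels = sympbasis_rels[OF s]
  \<comment> \<open>The pairings with \<open>y\<close> and with \<open>- w0\<close> read off
    \<open>b\<close> and \<open>d\<close>, so \<open>e\<close> turns the Bezout relation into a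
    covector with value 1 at \<open>w\<close> and 0 at \<open>v\<close>.\<close>
  define e where "e = s' *s sympl y - t *s sympl w0"
  have "dotp e v = 0" "dotp e w = 1"
    using *(1) rels by (simp_all add: e_def dotp_sympl *(2) mult.commute)
  moreover have "symp w x = a" using *(2) rels by simp
  then have "dotp (sympl x - a *s e) v = 1" "dotp (sympl x - a *s e) w = 0"
    using rels \<open>dotp e v = 0\<close> \<open>dotp e w = 1\<close> by (simp_all add: dotp_sympl)
  moreover have "symp v w = 0" using * rels by simp
  ultimately show "good v w" using upairI unfolding good_def by metis
qed

section \<open>Reduction modulo \<open>m\<close>\<close>

lemma bezout_finite:
  fixes v :: "'a \<Rightarrow> int"
  assumes "finite A"
  shows "\<exists>c. (\<Sum>i\<in>A. c i * v i) = Gcd (v ` A)"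
  using assms
proof induction
  case (insert a A)
  then obtain c where c: "(\<Sum>i\<in>A. c i * v i) = Gcd (v ` A)" by blast
  obtain x y where xy: "x * v a + y * Gcd (v ` A) = gcd (v a) (Gcd (v ` A))"
    using bezout_int by blast
  have "(\<Sum>i\<in>A. (if i = a then x else y * c i) * v i) = y * (\<Sum>i\<in>A. c i * v i)"
    using insert.hyps by (auto simp: sum_distrib_left mult.assoc intro!: sum.cong)
  then have "(\<Sum>i\<in>insert a A. (if i = a then x else y * c i) * v i) = Gcd (v ` insert a A)"
    using insert.hyps xy c by simp
  then show ?case by (intro exI[of _ "\<lambda>i. if i = a then x else y * c i"])
qed simp

text \<open>Take for k the product of the primes of \<open>g\<close> that do not divide
  \<open>a\<close>. A prime of \<open>g\<close> then divides exactly one of \<open>a\<close> and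
  \<open>k * m\<close>, by \<open>c\<close> if it divides \<open>a\<close>, hence never their
  sum.\<close>

lemma coprime_shift:
  fixes a g m :: int
  assumes g: "g \<noteq> 0" and c: "\<And>p. prime p \<Longrightarrow> p dvd a \<Longrightarrow> p dvd g \<Longrightarrow> \<not> p dvd m"
  shows "\<exists>k. coprime (a + k * m) g"
proof -
  define k where "k = \<Prod>{p \<in> prime_factors g. \<not> p dvd a}"
  have k: "p dvd k \<longleftrightarrow> \<not> p dvd a" if p: "prime p" "p dvd g" for p
  proof
    assume "p dvd k"
    then obtain q where q: "q \<in> prime_factors g" "\<not> q dvd a" "p dvd q"
      using prime_dvd_prod_iff[of "{p \<in> prime_factors g. \<not> p dvd a}" p "\<lambda>x. x"] p unfolding k_def by auto
    then have "p = q" using p by (metis in_prime_factors_iff primes_dvd_imp_eq)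
    then show "\<not> p dvd a" using q by simp
  next
    assume "\<not> p dvd a"
    then show "p dvd k"
      unfolding k_def using p g by (intro dvd_prodI) (auto simp: in_prime_factors_iff)
  qed
  have "coprime (a + k * m) g"
  proof (rule ccontr)
    assume nc: "\<not> coprime (a + k * m) g"
    have "gcd (a + k * m) g \<noteq> 0" using g by simp
    moreover have "\<not> is_unit (gcd (a + k * m) g)" using nc by (simp only: is_unit_gcd not_False_eq_True)
    ultimately obtain p where "p dvd gcd (a + k * m) g" "prime p"
      using prime_divisor_exists by blast
    then have p: "prime p" "p dvd a + k * m" "p dvd g" by (simp_all only: gcd_greatest_iff)
    show False
    proof (cases "p dvd a")
      case True
      then have "p dvd k * m" using p(2) by (simp add: dvd_add_right_iff)
      then show False using True k c p prime_dvd_mult_iff by blast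
    next
      case False
      then have "p dvd k * m" using k p by auto
      then show False using False p(2) by (simp add: dvd_add_left_iff)
    qed
  qed
  then show ?thesis by blast
qed

lemma primitive_int_iff:
  fixes v :: "int ^ 'n"
  shows "primitive v \<longleftrightarrow> (\<forall>p. prime p \<longrightarrow> \<not> (\<forall>i. p dvd v $ i))"
proof
  assume "primitive v"
  then obtain c where c: "(\<Sum>i\<in>UNIV. c i * v $ i) = 1" by (auto simp: primitive_def)
  show "\<forall>p. prime p \<longrightarrow> \<not> (\<forall>i. p dvd v $ i)"
  proof (intro allI impI notI)
    fix p :: int assume p: "prime p" "\<forall>i. p dvd v $ i"
    then have "p dvd (\<Sum>i\<in>UNIV. c i * v $ i)" by (intro dvd_sum) simp
    then show False using c p by (metis not_prime_unit)
  qed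
next
  assume *: "\<forall>p. prime p \<longrightarrow> \<not> (\<forall>i. p dvd v $ i)"
  obtain c where c: "(\<Sum>i\<in>UNIV. c i * v $ i) = Gcd (range (($) v))"
    using bezout_finite[of UNIV "($) v"] by auto
  have "Gcd (range (($) v)) = 1"
  proof (rule ccontr)
    assume "Gcd (range (($) v)) \<noteq> 1"
    moreover have "Gcd (range (($) v)) \<ge> 0" by simp
    ultimately obtain p where p: "prime p" "p dvd Gcd (range (($) v))"
      using prime_factor_int[of "Gcd (range (($) v))"] by force
    then have "\<forall>i. p dvd v $ i" by (meson Gcd_dvd dvd_trans rangeI)
    then show False using * p by blast
  qed
  then show "primitive v" using c by (auto simp: primitive_def)
qed

definition red :: "int ^ 'n \<Rightarrow> 'm::nontriv mod_ring ^ 'n" where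
  "red v = (\<chi> i. of_int (v $ i))"

lemma of_int_mod_ring_eq_iff:
  "(of_int a :: 'm::nontriv mod_ring) = of_int b \<longleftrightarrow> [a = b] (mod int CARD('m))"
  unfolding of_int_of_int_mod_ring cong_def by transfer simp

lemma of_int_mod_ring_eq_0_iff:
  "(of_int a :: 'm::nontriv mod_ring) = 0 \<longleftrightarrow> int CARD('m) dvd a"
  using of_int_mod_ring_eq_iff[of a 0] by (simp add: cong_0_iff)

lemma of_int_surj: "\<exists>k. (x :: 'm::nontriv mod_ring) = of_int k"
  by (metis of_int_mod_ring_to_int_mod_ring of_int_of_int_mod_ring)

lemma red_simps [simp]:
  "red (v + w) = red v + red w" "red (v - w) = red v - red w" "red (- v) = - red v"
  "red (k *s v) = of_int k *s red v" "red 0 = 0"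
  by (simp_all add: red_def vec_eq_iff)

lemma red_nth [simp]: "red v $ i = of_int (v $ i)"
  by (simp add: red_def)

lemma dotp_red: "dotp (red c) (red v) = of_int (dotp c v)"
  by (simp add: dotp_def)

lemma symp_red: "symp (red v) (red w) = of_int (symp v w)"
  by (simp add: symp_def)

lemma red_surj: "\<exists>v. red v = (u :: 'm::nontriv mod_ring ^ 'n)"
proof -
  have "\<forall>i. \<exists>k. u $ i = of_int k" using of_int_surj by blast
  then obtain f where "\<forall>i. u $ i = of_int (f i)" by metis
  then have "red (\<chi> i. f i) = u" by (simp add: vec_eq_iff)
  then show ?thesis by blast
qed

lemma red_eq_iff: "(red v :: 'm::nontriv mod_ring ^ 'n) = red w \<longleftrightarrow> (\<forall>i. [v $ i = w $ i] (mod int CARD('m)))"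
  by (simp add: vec_eq_iff of_int_mod_ring_eq_iff)

lemma upair_red: "upair v w \<Longrightarrow> upair (red v) (red w)"
  unfolding upair_def by (metis dotp_red of_int_0 of_int_1)

lemma good_red: "good v w \<Longrightarrow> good (red v) (red w)"
  by (auto simp: good_def upair_red symp_red)

lemma sympbasis_red: "sympbasis v w x y \<Longrightarrow> sympbasis (red v) (red w) (red x) (red y)"
  by (simp add: sympbasis_def symp_red)

lemma primitive_red: "primitive v \<Longrightarrow> primitive (red v)"
  unfolding primitive_iff_dotp by (metis dotp_red of_int_1)

text \<open>Bezout coefficients modulo m exist as soon as the gcd of the entries is prime to m, so
  only the primes dividing m matter.\<close>

lemma primitive_red_iff:
  fixes v :: "int ^ 'n"
  shows "primitive (red v :: 'm::nontriv mod_ring ^ 'n) \<longleftrightarrow>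
    (\<forall>p. prime p \<longrightarrow> p dvd int CARD('m) \<longrightarrow> \<not> (\<forall>i. p dvd v $ i))"
proof
  assume "primitive (red v :: 'm mod_ring ^ 'n)"
  then obtain u where u: "dotp u (red v :: 'm mod_ring ^ 'n) = 1" by (auto simp: primitive_iff_dotp)
  obtain c where "red c = u" using red_surj by blast
  then have "(of_int (dotp c v) :: 'm mod_ring) = of_int 1" using u dotp_red by (metis of_int_1)
  then have c: "int CARD('m) dvd dotp c v - 1" by (simp only: of_int_mod_ring_eq_iff cong_iff_dvd_diff)
  show "\<forall>p. prime p \<longrightarrow> p dvd int CARD('m) \<longrightarrow> \<not> (\<forall>i. p dvd v $ i)"
  proof (intro allI impI notI)
    fix p :: int assume p: "prime p" "p dvd int CARD('m)" "\<forall>i. p dvd v $ i"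
    then have "p dvd dotp c v" unfolding dotp_def by (intro dvd_sum) simp
    moreover have "p dvd dotp c v - 1" using c p dvd_trans by blast
    ultimately have "p dvd 1" by (metis dvd_diff_right_iff)
    then show False using p by (metis not_prime_unit)
  qed
next
  assume *: "\<forall>p. prime p \<longrightarrow> p dvd int CARD('m) \<longrightarrow> \<not> (\<forall>i. p dvd v $ i)"
  let ?g = "Gcd (range (($) v))"
  obtain c where c: "(\<Sum>i\<in>UNIV. c i * v $ i) = ?g"
    using bezout_finite[of UNIV "($) v"] by auto
  have "gcd ?g (int CARD('m)) = 1"
  proof (rule ccontr)
    assume ne: "gcd ?g (int CARD('m)) \<noteq> 1"
    moreover have "gcd ?g (int CARD('m)) \<ge> 0" by simp
    ultimately obtain p where p: "prime p" "p dvd gcd ?g (int CARD('m))"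
      using prime_factor_int[of "gcd ?g (int CARD('m))"] by force
    then have "\<forall>i. p dvd v $ i" by (meson Gcd_dvd dvd_trans rangeI gcd_dvd1)
    then show False using * p by auto
  qed
  then obtain x y where "x * ?g + y * int CARD('m) = 1"
    using bezout_int by metis
  then have "int CARD('m) dvd x * ?g - 1"
    by (metis add_diff_cancel_left' dvd_minus_iff dvd_triv_right minus_diff_eq)
  then have "(of_int (x * ?g) :: 'm mod_ring) = of_int 1"
    by (simp only: of_int_mod_ring_eq_iff cong_iff_dvd_diff)
  moreover have "dotp (\<chi> i. x * c i) v = x * ?g"
    by (simp add: dotp_def c[symmetric] sum_distrib_left mult.assoc)
  ultimately have "dotp (red (\<chi> i. x * c i)) (red v :: 'm mod_ring ^ 'n) = 1"
    by (simp only: dotp_red) simp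
  then show "primitive (red v :: 'm mod_ring ^ 'n)"
    unfolding primitive_iff_dotp by blast
qed

text \<open>One coordinate is moved by a multiple of m until it is prime to the gcd of the others.
  Two coordinates are essential: for rows of length one the only primitive integers are 1 and
  -1.\<close>

lemma primitive_lift:
  fixes u :: "'m::nontriv mod_ring ^ 'n"
  assumes u: "primitive u" and n: "CARD('n) \<ge> 2"
  shows "\<exists>v. primitive v \<and> red v = u"
proof -
  obtain v0 where v0: "red v0 = u" using red_surj by blast
  obtain i j :: 'n where ij: "i \<noteq> j"
    using n by (metis One_nat_def Suc_1 card_le_Suc0_iff_eq finite not_less_eq_eq iso_tuple_UNIV_I)
  let ?m = "int CARD('m)"
  \<comment> \<open>A zero at \<open>j\<close> is replaced by m, which has the same reduction, so
    that the gcd of the coordinates other than \<open>i\<close> is nonzero.\<close>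
  define v1 where "v1 = (\<chi> k. if k = j \<and> v0 $ j = 0 then ?m else v0 $ k)"
  have v1: "red v1 = u" "v1 $ j \<noteq> 0"
    using v0 by (auto simp: v1_def vec_eq_iff) (metis of_int_0)
  let ?g = "Gcd (($) v1 ` (- {i}))"
  have gd: "?g dvd v1 $ k" if "k \<noteq> i" for k
    using that by (intro Gcd_dvd) auto
  have "?g \<noteq> 0" using gd[of j] ij v1(2) by auto
  moreover have "\<not> p dvd ?m" if "prime p" "p dvd v1 $ i" "p dvd ?g" for p
  proof
    assume "p dvd ?m"
    moreover have "\<forall>k. p dvd v1 $ k" using that gd by (metis dvd_trans)
    ultimately show False using u that(1) v1(1) primitive_red_iff by metis
  qed
  ultimately obtain k where k: "coprime (v1 $ i + k * ?m) ?g"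
    using coprime_shift[of ?g "v1 $ i" ?m] by blast
  define v where "v = (\<chi> l. if l = i then v1 $ i + k * ?m else v1 $ l)"
  have "red v = u" using v1(1) by (auto simp: v_def vec_eq_iff)
  moreover have "primitive v"
    unfolding primitive_int_iff
  proof (intro allI impI notI)
    fix p :: int assume p: "prime p" "\<forall>l. p dvd v $ l"
    have "p dvd v1 $ l" if "l \<noteq> i" for l using p(2)[rule_format, of l] that by (simp add: v_def)
    then have "p dvd ?g" by (auto intro: Gcd_greatest)
    moreover have "p dvd v1 $ i + k * ?m" using p(2)[rule_format, of i] by (simp add: v_def)
    ultimately show False using k p(1) by (meson coprime_common_divisor not_prime_unit)
  qed
  ultimately show ?thesis by blast
qed

lemma primitive_2_iff: "primitive (v :: 'r::comm_ring_1 ^ 2) \<longleftrightarrow> (\<exists>s t. s * v $ 1 + t * v $ 2 = 1)"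
proof
  assume "\<exists>s t. s * v $ 1 + t * v $ 2 = 1"
  then obtain s t where "s * v $ 1 + t * v $ 2 = 1" by blast
  then show "primitive v"
    unfolding primitive_def by (intro exI[of _ "\<lambda>i. if i = 1 then s else t"]) (simp add: sum_2)
qed (auto simp: primitive_def sum_2)

lemma coprime_lift:
  fixes b d :: "'m::nontriv mod_ring"
  assumes "s * b + t * d = 1"
  shows "\<exists>b' d' s' t' :: int. of_int b' = b \<and> of_int d' = d \<and> s' * b' + t' * d' = 1"
proof -
  have "primitive (vector [b, d] :: 'm mod_ring ^ 2)"
    using assms by (auto simp: primitive_2_iff)
  then obtain v :: "int ^ 2" where v: "primitive v" "red v = (vector [b, d] :: 'm mod_ring ^ 2)"
    using primitive_lift[of "vector [b, d] :: 'm mod_ring ^ 2"] by auto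
  then show ?thesis
    unfolding primitive_2_iff by (metis red_nth vector_2)
qed

section \<open>Coherent and quotient topologies\<close>

lemma quotient_maps_same_fibres:
  assumes f: "quotient_map X Y f" and g: "quotient_map X Z g"
    and eq: "\<And>x y. x \<in> topspace X \<Longrightarrow> y \<in> topspace X \<Longrightarrow> f x = f y \<longleftrightarrow> g x = g y"
  obtains h where "homeomorphic_map Y Z h" "\<And>x. x \<in> topspace X \<Longrightarrow> h (f x) = g x"
proof -
  obtain h where h: "continuous_map Y Z h" "\<And>x. x \<in> topspace X \<Longrightarrow> h (f x) = g x"
    using quotient_map_lift_exists[OF f quotient_imp_continuous_map[OF g]] eq by metis
  obtain k where k: "continuous_map Z Y k" "\<And>x. x \<in> topspace X \<Longrightarrow> k (g x) = f x"
    using quotient_map_lift_exists[OF g quotient_imp_continuous_map[OF f]] eq by metis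
  have "homeomorphic_maps Y Z h k"
    unfolding homeomorphic_maps_def
    using h k quotient_imp_surjective_map[OF f] quotient_imp_surjective_map[OF g]
    by (metis (no_types, lifting) imageE)
  then show ?thesis
    using that h homeomorphic_maps_map by blast
qed

lemma topspace_coherent_topology [simp]: "topspace (coherent_topology \<C>) = \<Union>\<C>"
proof -
  have "openin (coherent_topology \<C>) (\<Union>\<C>)"
    unfolding openin_coherent_topology by (auto simp: Int_absorb1 Union_upper)
  then show ?thesis
    by (metis openin_coherent_topology openin_subset openin_topspace subset_antisym)
qed

lemma topspace_quotient_space [simp]: "topspace (quotient_space X r) = topspace X // r"
proof -
  have "{x \<in> topspace X. r `` {x} \<in> topspace X // r} = topspace X"
    by (auto intro: quotientI)
  then have "openin (quotient_space X r) (topspace X // r)"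
    unfolding openin_quotient_space by simp
  then show ?thesis
    by (metis openin_quotient_space openin_subset openin_topspace subset_antisym)
qed

lemma quotient_map_quotient_space: "quotient_map X (quotient_space X r) (\<lambda>x. r `` {x})"
  unfolding quotient_map_def by (auto simp: openin_quotient_space quotient_def)

text \<open>If the preimage of U is open, then on each piece C the section g pulls it back to U
  \<inter> C, which is therefore open in C; that is openness in the coherent topology.\<close>

lemma quotient_map_coherent_sections:
  assumes f: "continuous_map X (coherent_topology \<C>) f"
    and g: "\<And>C. C \<in> \<C> \<Longrightarrow> \<exists>g. continuous_map (top_of_set C) X g \<and> (\<forall>p\<in>C. f (g p) = p)"
  shows "quotient_map X (coherent_topology \<C>) f"
  unfolding quotient_map_def
proof (intro conjI allI impI)
  have "p \<in> f ` topspace X" if C: "C \<in> \<C>" and p: "p \<in> C" for p C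
  proof -
    obtain g where "continuous_map (top_of_set C) X g" "\<forall>p\<in>C. f (g p) = p"
      using g[OF C] by blast
    then show ?thesis
      using p continuous_map_image_subset_topspace by (metis image_eqI image_subset_iff topspace_euclidean_subtopology)
  qed
  then show "f ` topspace X = topspace (coherent_topology \<C>)"
    using continuous_map_image_subset_topspace[OF f] by auto
next
  fix U assume U: "U \<subseteq> topspace (coherent_topology \<C>)"
  show "openin X {x \<in> topspace X. f x \<in> U} = openin (coherent_topology \<C>) U"
  proof
    assume op: "openin X {x \<in> topspace X. f x \<in> U}"
    have "openin (top_of_set C) (U \<inter> C)" if C: "C \<in> \<C>" for C
    proof -
      obtain g where g: "continuous_map (top_of_set C) X g" "\<forall>p\<in>C. f (g p) = p"
        using g[OF C] by blast
      have "openin (top_of_set C) {p \<in> topspace (top_of_set C). g p \<in> {x \<in> topspace X. f x \<in> U}}"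
        using openin_continuous_map_preimage[OF g(1) op] .
      moreover have "{p \<in> topspace (top_of_set C). g p \<in> {x \<in> topspace X. f x \<in> U}} = U \<inter> C"
        using g continuous_map_image_subset_topspace[OF g(1)] by auto
      ultimately show ?thesis by simp
    qed
    then show "openin (coherent_topology \<C>) U"
      using U by (auto simp: openin_coherent_topology)
  qed (use openin_continuous_map_preimage[OF f] in blast)
qed

lemma openin_coherent_finite:
  assumes "finite \<C>" "\<And>C. C \<in> \<C> \<Longrightarrow> closed C"
  shows "coherent_topology \<C> = top_of_set (\<Union>\<C>)"
  unfolding topology_eq
proof (intro allI iffI)
  fix U assume "openin (coherent_topology \<C>) U"
  then have U: "U \<subseteq> \<Union>\<C>" "\<And>C. C \<in> \<C> \<Longrightarrow> openin (top_of_set C) (U \<inter> C)"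
    by (auto simp: openin_coherent_topology)
  have "closed (C - U)" if "C \<in> \<C>" for C
  proof -
    have "closedin (top_of_set C) (C - U \<inter> C)"
      using U(2)[OF that] by (metis closedin_diff closedin_topspace topspace_euclidean_subtopology)
    moreover have "C - U \<inter> C = C - U" by blast
    ultimately show ?thesis
      using assms(2) that closedin_closed_trans by fastforce
  qed
  then have "closed (\<Union>C\<in>\<C>. C - U)"
    using assms(1) by blast
  moreover have "(\<Union>C\<in>\<C>. C - U) = \<Union>\<C> - U" by blast
  ultimately have "closedin (top_of_set (\<Union>\<C>)) (\<Union>\<C> - U)"
    by (metis Diff_subset closed_subset)
  then show "openin (top_of_set (\<Union>\<C>)) U"
    using U(1) by (simp add: openin_closedin_eq)
next
  fix U assume U: "openin (top_of_set (\<Union>\<C>)) U"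
  then obtain T where T: "open T" "U = \<Union>\<C> \<inter> T"
    by (auto simp: openin_open)
  then have "openin (top_of_set C) (U \<inter> C)" if "C \<in> \<C>" for C
  proof -
    have "U \<inter> C = C \<inter> T" using T that by blast
    then show ?thesis using T(1) by (simp add: openin_open_Int)
  qed
  then show "openin (coherent_topology \<C>) U"
    using T by (auto simp: openin_coherent_topology)
qed

section \<open>Realizations of finite complexes and links of quotients\<close>

lemma continuous_on_coordinate: "continuous_on A (\<lambda>f :: 'v \<Rightarrow> real. f v)"
  by (rule continuous_on_subset[OF continuous_on_product_coordinates]) simp

lemma closed_closed_simplex:
  assumes "finite \<sigma>"
  shows "closed (closed_simplex \<sigma>)"
proof -
  have "closed_simplex \<sigma> = (\<Inter>v. {f. 0 \<le> f v}) \<inter> (\<Inter>v\<in>-\<sigma>. {f. f v = 0}) \<inter> {f. (\<Sum>v\<in>\<sigma>. f v) = 1}"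
    unfolding closed_simplex_def by auto
  moreover have "closed {f :: 'a \<Rightarrow> real. 0 \<le> f v}" "closed {f :: 'a \<Rightarrow> real. f v = 0}" for v
    by (intro closed_Collect_le closed_Collect_eq continuous_on_coordinate continuous_intros)+
  moreover have "closed {f :: 'a \<Rightarrow> real. (\<Sum>v\<in>\<sigma>. f v) = 1}"
    by (intro closed_Collect_eq continuous_on_sum continuous_on_coordinate continuous_intros)
  ultimately show ?thesis
    by (auto intro!: closed_INT closed_Int)
qed

text \<open>A closed subset of a cube, which is compact by Tychonoff even when there are infinitely
  many possible vertices.\<close>

lemma compact_closed_simplex:
  assumes "finite \<sigma>"
  shows "compact (closed_simplex \<sigma>)"
proof -
  have "compactin (product_topology (\<lambda>_::'a. euclideanreal) UNIV) (PiE UNIV (\<lambda>_. {0..1}))"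
    by (subst compactin_PiE) auto
  then have "compact (PiE (UNIV::'a set) (\<lambda>_. {0..1::real}))"
    by (simp add: euclidean_product_topology)
  moreover have "f v \<le> 1" if "f \<in> closed_simplex \<sigma>" for f v
  proof (cases "v \<in> \<sigma>")
    case True
    then have "f v \<le> sum f \<sigma>"
      using that assms by (intro member_le_sum) (auto simp: closed_simplex_def)
    then show ?thesis using that by (simp add: closed_simplex_def)
  qed (use that in \<open>auto simp: closed_simplex_def\<close>)
  then have "closed_simplex \<sigma> \<subseteq> PiE UNIV (\<lambda>_. {0..1})"
    by (auto simp: closed_simplex_def)
  ultimately show ?thesis
    using closed_closed_simplex[OF assms] compact_Int_closed by (metis Int_absorb1)
qed

abbreviation polyhedron_of :: "'v set set \<Rightarrow> ('v \<Rightarrow> real) set" where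
  "polyhedron_of K \<equiv> \<Union>(closed_simplex ` K)"

lemma topspace_realization [simp]: "topspace (realization K) = polyhedron_of K"
  by (simp add: realization_def)

lemma realization_finite:
  assumes "finite K" "\<And>\<sigma>. \<sigma> \<in> K \<Longrightarrow> finite \<sigma>"
  shows "realization K = top_of_set (polyhedron_of K)"
  unfolding realization_def
  by (rule openin_coherent_finite) (use assms closed_closed_simplex in auto)

lemma compact_polyhedron_of:
  assumes "finite K" "\<And>\<sigma>. \<sigma> \<in> K \<Longrightarrow> finite \<sigma>"
  shows "compact (polyhedron_of K)"
  using assms compact_closed_simplex by (intro compact_UN) auto

lemma continuous_map_into_functions:
  fixes f :: "'a \<Rightarrow> 'v \<Rightarrow> real"
  assumes "\<And>x. x \<in> topspace X \<Longrightarrow> f x \<in> S" "\<And>v. continuous_map X euclideanreal (\<lambda>x. f x v)"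
  shows "continuous_map X (top_of_set S) f"
proof -
  have "continuous_map X (product_topology (\<lambda>_. euclideanreal) UNIV) f"
    using assms(2) by (simp add: continuous_map_componentwise_UNIV)
  then show ?thesis
    using assms(1) by (auto simp: euclidean_product_topology continuous_map_in_subtopology)
qed

text \<open>The link is a quotient of a quotient: by \<open>r\<close>, then by scaling. This
  composes both to one quotient map from the space before gluing. There \<open>sc\<close> is the
  scaling, \<open>scl\<close> the induced one on classes, and \<open>Z\<close> the set of all points
  glued to the apex \<open>z\<close>.\<close>

lemma quotient_map_cone_link:
  fixes sc :: "real \<Rightarrow> 'a \<Rightarrow> 'a" and scl :: "real \<Rightarrow> 'a set \<Rightarrow> 'a set"
  assumes r: "\<And>x y. x \<in> topspace X \<Longrightarrow> y \<in> topspace X \<Longrightarrow> r `` {x} = r `` {y} \<longleftrightarrow> (x, y) \<in> r"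
    and sc: "\<And>t x. 0 < t \<Longrightarrow> x \<in> topspace X \<Longrightarrow> sc t x \<in> topspace X"
    and scl: "\<And>t x. 0 < t \<Longrightarrow> x \<in> topspace X \<Longrightarrow> scl t (r `` {x}) = r `` {sc t x}"
    and sc1: "\<And>x. x \<in> topspace X \<Longrightarrow> sc 1 x = x"
    and scm: "\<And>s t x. 0 < t \<Longrightarrow> 0 < s \<Longrightarrow> x \<in> topspace X \<Longrightarrow> sc s (sc t x) = sc (s * t) x"
    and z: "z \<in> topspace X" and Z: "\<And>x. x \<in> topspace X \<Longrightarrow> (z, x) \<in> r \<longleftrightarrow> x \<in> Z"
    and scZ: "\<And>t x. 0 < t \<Longrightarrow> x \<in> topspace X - Z \<Longrightarrow> sc t x \<notin> Z"
    and op: "openin X (topspace X - Z)"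
  defines "L \<equiv> cone_link scl (quotient_space X r) (r `` {z})"
    and "h \<equiv> \<lambda>x. scaling_rel scl (quotient_space X r) (r `` {z}) `` {r `` {x}}"
  shows "quotient_map (subtopology X (topspace X - Z)) L h"
    and "\<And>x y. x \<in> topspace X - Z \<Longrightarrow> y \<in> topspace X - Z \<Longrightarrow>
      h x = h y \<longleftrightarrow> (\<exists>t>0. (sc t x, y) \<in> r)"
proof -
  let ?Q = "quotient_space X r" let ?z = "r `` {z}"
  let ?V = "topspace ?Q - {?z}" let ?s = "scaling_rel scl ?Q ?z"
  have eqz: "r `` {x} = ?z \<longleftrightarrow> x \<in> Z" if "x \<in> topspace X" for x
    using r[OF z that] Z[OF that] by auto
  have U: "{x \<in> topspace X. r `` {x} \<in> ?V} = topspace X - Z"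
    using eqz by (auto intro: quotientI)
  \<comment> \<open>The complement of \<open>Z\<close> is open and saturated; only therefore does
    the quotient map by \<open>r\<close> restrict to a quotient map away from the apex.\<close>
  have opV: "openin ?Q ?V"
    unfolding openin_quotient_space using op U by auto
  have q1: "quotient_map (subtopology X (topspace X - Z)) (subtopology ?Q ?V) (\<lambda>x. r `` {x})"
    using quotient_map_restriction[OF quotient_map_quotient_space U] opV by blast
  have q2: "quotient_map (subtopology ?Q ?V) L (\<lambda>c. ?s `` {c})"
    unfolding L_def cone_link_def by (rule quotient_map_quotient_space)
  show "quotient_map (subtopology X (topspace X - Z)) L h"
    using quotient_map_compose[OF q1 q2] by (simp add: h_def o_def)
  have mem: "c \<in> ?s `` {r `` {x}} \<longleftrightarrow> (\<exists>t>0. c = r `` {sc t x})" if x: "x \<in> topspace X - Z" for c x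
  proof
    assume "c \<in> ?s `` {r `` {x}}"
    then show "\<exists>t>0. c = r `` {sc t x}"
      using x scl by (auto simp: scaling_rel_def)
  next
    assume "\<exists>t>0. c = r `` {sc t x}"
    then obtain t where t: "t > 0" "c = r `` {sc t x}" by blast
    have "sc t x \<in> topspace X - Z" using sc scZ x t by auto
    then have "c \<in> ?V" using t eqz by (auto intro: quotientI)
    moreover have "r `` {x} \<in> ?V" using x eqz by (auto intro: quotientI)
    ultimately show "c \<in> ?s `` {r `` {x}}"
      using t scl x by (auto simp: scaling_rel_def)
  qed
  fix x y assume x: "x \<in> topspace X - Z" and y: "y \<in> topspace X - Z"
  show "h x = h y \<longleftrightarrow> (\<exists>t>0. (sc t x, y) \<in> r)"
  proof
    assume "h x = h y"
    then have "r `` {y} \<in> ?s `` {r `` {x}}"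
      using mem[OF y] sc1 y by (metis DiffD1 h_def zero_less_one)
    then show "\<exists>t>0. (sc t x, y) \<in> r"
      using mem[OF x] r sc x y by (metis DiffD1)
  next
    assume "\<exists>t>0. (sc t x, y) \<in> r"
    then obtain t where t: "t > 0" "(sc t x, y) \<in> r" by blast
    have tx: "sc t x \<in> topspace X" using sc x t by auto
    have y': "r `` {sc t x} = r `` {y}" using r tx y t by auto
    have eq: "r `` {sc s y} = r `` {sc (s * t) x}" if "s > 0" for s
      using scl[OF that tx] scl[OF that, of y] y y' scm[OF t(1) that] x by auto
    have "c \<in> h x \<longleftrightarrow> c \<in> h y" for c
    proof
      assume "c \<in> h x"
      then obtain u where u: "u > 0" "c = r `` {sc u x}" using mem[OF x] h_def by auto
      then have "c = r `` {sc (u / t) y}" using eq[of "u / t"] t by simp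
      then show "c \<in> h y" using mem[OF y] u t h_def by (metis divide_pos_pos)
    next
      assume "c \<in> h y"
      then obtain u where u: "u > 0" "c = r `` {sc u y}" using mem[OF y] h_def by auto
      then show "c \<in> h x" using eq mem[OF x] t h_def by (metis mult_pos_pos)
    qed
    then show "h x = h y" by blast
  qed
qed

section \<open>Lifting to congruence subgroups\<close>

definition det2 :: "'r::comm_ring_1 ^ 2 \<Rightarrow> 'r ^ 2 \<Rightarrow> 'r" where
  "det2 v w = v $ 1 * w $ 2 - v $ 2 * w $ 1"

lemma det2_simps [simp]:
  "det2 (x + y) z = det2 x z + det2 y z" "det2 z (x + y) = det2 z x + det2 z y"
  "det2 (x - y) z = det2 x z - det2 y z" "det2 z (x - y) = det2 z x - det2 z y"
  "det2 (a *s x) z = a * det2 x z" "det2 z (a *s x) = a * det2 z x"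
  "det2 (- x) z = - det2 x z" "det2 z (- x) = - det2 z x"
  "det2 0 z = 0" "det2 z 0 = 0" "det2 x x = 0"
  by (simp_all add: det2_def algebra_simps)

lemma det2_swap: "det2 x y = - det2 y x"
  by (simp add: det2_def algebra_simps)

lemma det2_red: "det2 (red v) (red w) = of_int (det2 v w)"
  by (simp add: det2_def)

lemma vec2_eq_iff: "(v :: 'r ^ 2) = w \<longleftrightarrow> v $ 1 = w $ 1 \<and> v $ 2 = w $ 2"
  by (auto simp: vec_eq_iff forall_2)

text \<open>Cramer's rule with the denominator cleared, hence valid over every commutative
  ring.\<close>

lemma det2_expand: "det2 v w *s x = det2 x w *s v + det2 v x *s w"
  by (simp add: vec2_eq_iff det2_def algebra_simps)

text \<open>In one direction the determinant of the dual covectors is inverse to that of the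
  vectors; in the other the rows of the inverse matrix are the dual covectors.\<close>

lemma upair_2_iff: "upair (v :: 'r::comm_ring_1 ^ 2) w \<longleftrightarrow> det2 v w dvd 1"
proof
  assume "upair v w"
  then obtain c d where "dotp c v = 1" "dotp c w = 0" "dotp d v = 0" "dotp d w = 1"
    by (auto simp: upair_def)
  moreover have "det2 c d * det2 v w = dotp c v * dotp d w - dotp c w * dotp d v"
    by (simp add: det2_def dotp_def sum_2 algebra_simps)
  ultimately show "det2 v w dvd 1" by (metis diff_zero dvd_triv_right mult_1 mult_zero_left)
next
  assume "det2 v w dvd 1"
  then obtain e where e: "1 = det2 v w * e" by (auto elim: dvdE)
  show "upair v w"
    by (rule upairI[of "e *s vector [w$2, - w$1]" _ _ "e *s vector [- v$2, v$1]"])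
      (use e in \<open>simp_all add: dotp_def sum_2 det2_def algebra_simps\<close>)
qed

lemma basis_UNIV_2_iff: "is_basis_pair v w (UNIV :: ('r::comm_ring_1 ^ 2) set) \<longleftrightarrow> upair v w"
proof
  assume "is_basis_pair v w (UNIV :: ('r ^ 2) set)"
  then have U: "UNIV = span2 v w" by (simp add: is_basis_pair_iff)
  obtain a b where ab: "axis 1 1 = a *s v + b *s w" using U unfolding span2_def by blast
  obtain c d where cd: "axis 2 1 = c *s v + d *s w" using U unfolding span2_def by blast
  have "det2 (axis 1 1) (axis 2 (1::'r)) = 1" by (simp add: det2_def axis_def)
  then have "det2 v w * (a * d - b * c) = 1"
    using det2_swap[of w v] by (simp add: ab cd algebra_simps)
  then show "upair v w" unfolding upair_2_iff by (metis dvd_triv_left)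
next
  assume u: "upair v w"
  then obtain e where e: "1 = det2 v w * e" unfolding upair_2_iff by (auto elim: dvdE)
  have "x \<in> span2 v w" for x
  proof -
    have "e * det2 v w = 1" by (simp only: mult.commute[of e] e)
    then have "x = (e * det2 v w) *s x" by (simp only: vector_smult_lid)
    also have "\<dots> = e *s (det2 v w *s x)" by (simp only: vector_smult_assoc)
    also have "\<dots> = (e * det2 x w) *s v + (e * det2 v x) *s w"
      using arg_cong[OF det2_expand[of v w x], of "(*s) e"] by (simp add: vector_add_ldistrib)
    finally show ?thesis by (rule span2I)
  qed
  then have "UNIV = span2 v w" by blast
  then show "is_basis_pair v w (UNIV :: ('r ^ 2) set)" using u is_basis_pair_upair by blast
qed

lemma primitive_2_det: "primitive (v :: 'r::comm_ring_1 ^ 2) \<Longrightarrow> \<exists>w. det2 v w = 1"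
proof -
  assume "primitive v"
  then obtain s t where "s * v $ 1 + t * v $ 2 = 1" by (auto simp: primitive_2_iff)
  then have "det2 v (vector [- t, s]) = 1" by (simp add: det2_def algebra_simps)
  then show ?thesis by blast
qed

lemma det2_zero_multiple:
  assumes "primitive (v :: 'r::comm_ring_1 ^ 2)" "det2 v u = 0"
  shows "\<exists>k. u = k *s v"
proof -
  obtain w where w: "det2 v w = 1" using primitive_2_det assms(1) by blast
  have "u = det2 u w *s v" using det2_expand[of v w u] assms(2) w by simp
  then show ?thesis by blast
qed

text \<open>If \<open>w0\<close> has determinant 1 with \<open>v\<close>, then
  \<open>e *s w0\<close> has the desired determinant, and its reduction differs from
  \<open>w\<close> by a multiple of \<open>red v\<close>; that multiple can be lifted without
  changing the determinant.\<close>

lemma det2_lift: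
  fixes w :: "'m::nontriv mod_ring ^ 2"
  assumes v: "primitive v" and d: "det2 (red v) w = of_int e"
  shows "\<exists>w'. red w' = w \<and> det2 v w' = e"
proof -
  obtain w0 where w0: "det2 v w0 = 1" using primitive_2_det v by blast
  have "det2 (red v) (w - red (e *s w0)) = 0"
    using d w0 by (simp add: det2_red del: red_simps) 
  then obtain k where k: "w - red (e *s w0) = k *s red v"
    using det2_zero_multiple primitive_red[OF v] by blast
  obtain l where "k = of_int l" using of_int_surj by blast
  then have "red (e *s w0 + l *s v) = w" using k by (simp add: algebra_simps)
  moreover have "det2 v (e *s w0 + l *s v) = e" using w0 by simp
  ultimately show ?thesis by blast
qed

lemma matrix_of_linear:
  fixes F :: "'r::comm_ring_1 ^ 'n \<Rightarrow> 'r ^ 'k"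
  assumes add: "\<And>x y. F (x + y) = F x + F y" and sc: "\<And>a x. F (a *s x) = a *s F x"
  shows "matrix F *v x = F x"
proof -
  have F0: "F 0 = 0" using sc[of 0 0] by simp
  have "F (sum g A) = (\<Sum>i\<in>A. F (g i))" for g and A :: "'n set"
    by (induction A rule: infinite_finite_induct) (simp_all add: F0 add)
  then have "F x = (\<Sum>i\<in>UNIV. x $ i *s F (axis i 1))"
    by (subst vec_axis_sum) (simp add: sc)
  then show ?thesis
    by (simp add: vec_eq_iff matrix_def matrix_vector_mult_def mult.commute)
qed

text \<open>The form in which congruence is used: the subgroup fixes all reductions.\<close>

lemma congruent_to_one_iff:
  fixes A :: "int ^ 'n ^ 'n"
  shows "congruent_to_one CARD('m) A \<longleftrightarrow> (\<forall>v. red (A *v v) = (red v :: 'm::nontriv mod_ring ^ 'n))"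
proof
  assume c: "congruent_to_one CARD('m) A"
  then have A: "(of_int (A $ i $ j) :: 'm mod_ring) = of_int (mat 1 $ i $ j)" for i j
    by (simp only: congruent_to_one_def of_int_mod_ring_eq_iff)
  show "\<forall>v. red (A *v v) = (red v :: 'm mod_ring ^ 'n)"
  proof
    fix v
    have "(\<Sum>j\<in>UNIV. (of_int (A $ i $ j) :: 'm mod_ring) * of_int (v $ j)) = of_int (v $ i)" for i
      unfolding A by (simp add: mat_def if_distrib[where f = of_int] if_distrib[where f = "\<lambda>x. x * _"] cong: if_cong)
    then show "red (A *v v) = (red v :: 'm mod_ring ^ 'n)"
      by (simp add: vec_eq_iff matrix_vector_mult_def)
  qed
next
  assume *: "\<forall>v. red (A *v v) = (red v :: 'm mod_ring ^ 'n)"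
  show "congruent_to_one CARD('m) A"
    unfolding congruent_to_one_def
  proof (intro allI)
    fix i j
    have "(A *v axis j 1) $ i = A $ i $ j" for A :: "int ^ 'n ^ 'n"
      by (simp add: matrix_vector_mult_def axis_def if_distrib cong: if_cong)
    moreover have "[(A *v axis j 1) $ i = (mat 1 *v axis j 1) $ i] (mod int CARD('m))"
      using *[rule_format, of "axis j 1"] unfolding red_eq_iff by simp
    ultimately show "[A $ i $ j = mat 1 $ i $ j] (mod int CARD('m))" by metis
  qed
qed

lemma upair_matrix:
  fixes A :: "'r::comm_ring_1 ^ 'n ^ 'n"
  assumes "invertible A" "upair v w"
  shows "upair (A *v v) (A *v w)"
proof -
  obtain B where B: "B ** A = mat 1" using assms(1) by (auto simp: invertible_def)
  obtain c d where cd: "dotp c v = 1" "dotp c w = 0" "dotp d v = 0" "dotp d w = 1"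
    using assms(2) by (auto simp: upair_def)
  have tr: "dotp (c v* B) (A *v x) = dotp c x" for c x
  proof -
    have "dotp (c v* B) y = dotp c (B *v y)" for y
      by (simp add: dotp_def vector_matrix_mult_def matrix_vector_mult_def sum_distrib_left sum_distrib_right mult.assoc)
        (rule sum.swap)
    then show ?thesis by (simp add: matrix_vector_mul_assoc B)
  qed
  show ?thesis by (rule upairI[of "c v* B" _ _ "d v* B"]) (simp_all add: tr cd)
qed

lemma matrix_vector_smult:
  fixes A :: "'r::comm_ring_1 ^ 'n ^ 'k"
  shows "A *v (c *s x) = c *s (A *v x)"
  by (simp add: vec_eq_iff matrix_vector_mult_def sum_distrib_left mult.left_commute)

text \<open>Cramer's rule gives the matrix taking one basis to the other and, with the roles
  exchanged, its inverse. A vector and its image have the same coordinates in two bases with equal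
  reductions, so the matrix is congruent to one.\<close>

lemma GL2_level_lift:
  fixes v w v' w' :: "int ^ 2"
  assumes "upair v w" "upair v' w'"
    and "red v = (red v' :: 'm::nontriv mod_ring ^ 2)" "red w = (red w' :: 'm mod_ring ^ 2)"
  shows "\<exists>A\<in>GL2_level CARD('m). A *v v = v' \<and> A *v w = w'"
proof -
  have ex: "\<exists>A :: int ^ 2 ^ 2. A *v v = v' \<and> A *v w = w' \<and> (\<forall>x. \<exists>a b. x = a *s v + b *s w \<and> A *v x = a *s v' + b *s w')"
    if uu: "upair v w" "upair v' w'" for v w v' w' :: "int ^ 2"
  proof -
    obtain e where e: "det2 v w * e = 1" using uu unfolding upair_2_iff by (metis dvdE)
    define F where "F x = (e * det2 x w) *s v' + (e * det2 v x) *s w'" for x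
    have "matrix F *v x = F x" for x
      by (rule matrix_of_linear) (simp_all add: F_def algebra_simps vec2_eq_iff)
    moreover have "F v = v'" "F w = w'" using e by (simp_all add: F_def mult.commute)
    moreover have "x = (e * det2 x w) *s v + (e * det2 v x) *s w" for x
    proof -
      have "(e * det2 x w) *s v + (e * det2 v x) *s w = e *s (det2 v w *s x)"
        using arg_cong[OF det2_expand[of v w x], of "(*s) e"] by (simp add: vector_add_ldistrib)
      also have "\<dots> = (det2 v w * e) *s x" by (simp add: mult.commute)
      finally show ?thesis by (simp only: e vector_smult_lid)
    qed
    ultimately show ?thesis
      by (intro exI[of _ "matrix F"] conjI allI) (simp_all, metis F_def)
  qed
  obtain A where A: "A *v v = v'" "A *v w = w'" "\<And>x. \<exists>a b. x = a *s v + b *s w \<and> A *v x = a *s v' + b *s w'"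
    using ex[OF assms(1,2)] by blast
  obtain B where B: "B *v v' = v" "B *v w' = w" "\<And>x. \<exists>a b. x = a *s v' + b *s w' \<and> B *v x = a *s v + b *s w"
    using ex[OF assms(2,1)] by blast
  have lin: "M *v (a *s x + b *s y) = a *s (M *v x) + b *s (M *v y)" for M :: "int ^ 2 ^ 2" and a b x y
    by (simp add: matrix_vector_right_distrib matrix_vector_smult)
  have "A *v (B *v x) = x" for x
    using B(3)[of x] A(1,2) lin by auto
  moreover have "B *v (A *v x) = x" for x
    using A(3)[of x] B(1,2) lin by auto
  ultimately have AB: "A *v (B *v x) = x" "B *v (A *v x) = x" for x
    by blast+
  then have "invertible A"
    unfolding invertible_def by (intro exI[of _ B]) (simp add: matrix_eq AB flip: matrix_vector_mul_assoc)
  moreover have "red (A *v x) = (red x :: 'm mod_ring ^ 2)" for x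
    using A(3)[of x] assms by auto
  ultimately have "A \<in> GL2_level CARD('m)"
    unfolding GL2_level_def congruent_to_one_iff by blast
  then show ?thesis using A by blast
qed

text \<open>Both pairs are completed to symplectic bases, and the map from one basis to the other is
  symplectic. It is congruent to one only if the completions also agree modulo m, so the second
  completion is corrected inside the span of \<open>v'\<close>, \<open>w'\<close>.\<close>

lemma Sp4_level_lift:
  fixes v w v' w' :: "int ^ 4"
  assumes g: "good v w" "good v' w'"
    and "red v = (red v' :: 'm::nontriv mod_ring ^ 4)" "red w = (red w' :: 'm mod_ring ^ 4)"
  shows "\<exists>A\<in>Sp4_level CARD('m). A *v v = v' \<and> A *v w = w'"
proof -
  obtain x y where s: "sympbasis v w x y" using good_sympbasis[OF g(1)] by blast
  obtain x' y' where s': "sympbasis v' w' x' y'" using good_sympbasis[OF g(2)] by blast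
  note r = sympbasis_rels[OF s] and r' = sympbasis_rels[OF s']
  have exp: "z = symp z x *s v + symp z y *s w + symp v z *s x + symp w z *s y" for z
    using sympbasis_expand[OF _ s] inverse_comm_int unfolding inverse_comm_def by blast
  have exp': "z = symp z x' *s v' + symp z y' *s w' + symp v' z *s x' + symp w' z *s y'" for z
    using sympbasis_expand[OF _ s'] inverse_comm_int unfolding inverse_comm_def by blast
  let ?r = "red :: int ^ 4 \<Rightarrow> 'm mod_ring ^ 4"
  have eq: "?r v' = ?r v" "?r w' = ?r w" using assms by auto
  have s1: "(of_int (symp v' x) :: 'm mod_ring) = 1" "(of_int (symp w' x) :: 'm mod_ring) = 0"
    "(of_int (symp v' y) :: 'm mod_ring) = 0" "(of_int (symp w' y) :: 'm mod_ring) = 1"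
    unfolding symp_red[symmetric] eq unfolding symp_red using r by simp_all
  \<comment> \<open>Modulo m these are the expansions of \<open>x\<close> and \<open>y\<close> in
    the primed basis, except that the coefficient of \<open>v'\<close> in \<open>y''\<close> is
    \<open>symp x y'\<close> in place of \<open>symp y x'\<close>. The correction matrix is thus
    symmetric, which keeps \<open>x''\<close> and \<open>y''\<close> orthogonal over the integers,
    and modulo m the two coefficients agree because \<open>x\<close> and \<open>y\<close> are
    orthogonal.\<close>
  define x'' where "x'' = x' + symp x x' *s v' + symp x y' *s w'"
  define y'' where "y'' = y' + symp x y' *s v' + symp y y' *s w'"
  have rx: "?r x'' = ?r x"
    using arg_cong[OF exp'[of x], of ?r] by (simp add: x''_def s1 algebra_simps)
  have "(of_int (symp x y') :: 'm mod_ring) = of_int (symp y x')"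
  proof -
    have "symp x y = symp x x' * symp v' y + symp x y' * symp w' y + symp v' x * symp x' y + symp w' x * symp y' y"
      using arg_cong[OF exp'[of x], of "\<lambda>u. symp u y"] by simp
    then have "(0 :: 'm mod_ring) = of_int (symp x x' * symp v' y + symp x y' * symp w' y + symp v' x * symp x' y + symp w' x * symp y' y)"
      using r by simp
    then have "(0 :: 'm mod_ring) = of_int (symp x y') + of_int (symp x' y)"
      by (simp add: s1)
    then show ?thesis by (metis add_eq_0_iff2 of_int_minus symp_swap)
  qed
  then have ry: "?r y'' = ?r y"
    using arg_cong[OF exp'[of y], of ?r] by (simp add: y''_def s1 algebra_simps)
  have s'': "sympbasis v' w' x'' y''"
    using r' by (simp add: sympbasis_def x''_def y''_def)
  note r'' = sympbasis_rels[OF s'']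
  define F where "F z = symp z x *s v' + symp z y *s w' + symp v z *s x'' + symp w z *s y''" for z
  have F: "matrix F *v z = F z" for z
    by (rule matrix_of_linear) (simp_all add: F_def algebra_simps vec4_eq_iff)
  have "symp (F a) (F b) = symp a b" for a b
  proof -
    have "symp a b = symp b x * symp a v + symp b y * symp a w + symp v b * symp a x + symp w b * symp a y"
      using arg_cong[OF exp[of b], of "symp a"] by simp
    also have "\<dots> = symp (F a) (F b)"
      using r'' symp_swap[of a v] symp_swap[of a w] by (simp add: F_def algebra_simps)
    finally show ?thesis by simp
  qed
  moreover have "?r (F z) = ?r z" for z
    using arg_cong[OF exp[of z], of ?r] by (simp add: F_def rx ry eq)
  ultimately have "matrix F \<in> Sp4_level CARD('m)"
    unfolding Sp4_level_def congruent_to_one_iff by (simp add: F)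
  moreover have "F v = v'" "F w = w'" using r by (simp_all add: F_def)
  ultimately show ?thesis using F by metis
qed

text \<open>Split the space into the hyperbolic planes of coordinates 1, 3 and 2, 4. In each plane
  \<open>v\<close> is a multiple of a primitive vector, \<open>v = g *s p + h *s q\<close>, and a
  Bezout relation between \<open>g\<close> and \<open>h\<close> recombines the two hyperbolic
  bases.\<close>

lemma primitive_sympbasis:
  fixes v :: "int ^ 4"
  assumes "primitive v"
  shows "\<exists>w x y. sympbasis v w x y"
proof -
  have pq: "\<exists>g a b s t. x = g * a \<and> y = g * b \<and> a * s - b * t = 1" for x y :: int
  proof (cases "x = 0 \<and> y = 0")
    case True then show ?thesis by (intro exI[of _ 0] exI[of _ 1]) auto
  next
    case False
    then obtain a b where ab: "x = gcd x y * a" "y = gcd x y * b" "coprime a b"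
      by (metis gcd_coprime_exists gcd_eq_0_iff mult.commute)
    then obtain s t where "s * a + t * b = 1" using bezout_int[of a b] by (auto simp: coprime_iff_gcd_eq_1)
    then have "a * s - b * (- t) = 1" by (simp add: algebra_simps)
    then show ?thesis using ab by blast
  qed
  obtain g a b a' b' where 1: "v $ 1 = g * a" "v $ 3 = g * b" "a * b' - b * a' = 1"
    using pq[of "v $ 1" "v $ 3"] by blast
  obtain h c d c' d' where 2: "v $ 2 = h * c" "v $ 4 = h * d" "c * d' - d * c' = 1"
    using pq[of "v $ 2" "v $ 4"] by blast
  obtain k where k: "(\<Sum>i\<in>UNIV. k i * v $ i) = 1" using assms by (auto simp: primitive_def)
  \<comment> \<open>The covector \<open>k\<close> with value 1 at \<open>v\<close>, restricted to
    the two hyperbolic planes: this is where the Bezout relation between \<open>g\<close> and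
    \<open>h\<close> comes from.\<close>
  define s t where "s = k 1 * a + k 3 * b" and "t = k 2 * c + k 4 * d"
  have st: "s * g + t * h = 1"
    using k by (simp add: sum_4 1 2 s_def t_def algebra_simps)
  define p p' q q' where "p = vec4 a 0 b 0" and "p' = vec4 a' 0 b' 0"
    and "q = vec4 0 c 0 d" and "q' = vec4 0 c' 0 d'"
  have S: "symp p p' = 1" "symp q q' = 1" "symp p q = 0" "symp p q' = 0" "symp p' q = 0" "symp p' q' = 0"
    "symp q p = 0" "symp q p' = 0" "symp q' p' = 0" "symp q' p = 0"
    using 1 2 by (simp_all add: symp_def p_def p'_def q_def q'_def)
  have "v = g *s p + h *s q"
    by (simp add: vec4_eq_iff p_def q_def 1 2)
  moreover have "sympbasis (g *s p + h *s q) ((- t) *s p + s *s q) (s *s p' + t *s q') ((- h) *s p' + g *s q')"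
    using st by (simp add: sympbasis_def S algebra_simps)
  ultimately show ?thesis by blast
qed

text \<open>In the coordinates of \<open>good_iff_coords\<close> only the unimodular row (b, d)
  needs care when lifting; the coefficient of \<open>v\<close> is arbitrary.\<close>

lemma good_lift:
  fixes v :: "int ^ 4" and w :: "'m::nontriv mod_ring ^ 4"
  assumes "primitive v" "good (red v) w"
  shows "\<exists>w'. good v w' \<and> red w' = w"
proof -
  obtain w0 x y where s: "sympbasis v w0 x y" using primitive_sympbasis[OF assms(1)] by blast
  obtain a b d s' t where w: "s' * b + t * d = 1" "w = a *s red v + b *s red w0 + d *s red y"
    using assms(2) good_iff_coords[OF inverse_comm_finite sympbasis_red[OF s]] by blast
  obtain b' d' s'' t' :: int where bd: "of_int b' = b" "of_int d' = d" "s'' * b' + t' * d' = 1"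
    using coprime_lift[OF w(1)] by blast
  obtain a' where a': "a = of_int a'" using of_int_surj by blast
  have "good v (a' *s v + b' *s w0 + d' *s y)"
    using good_iff_coords[OF inverse_comm_int s] bd by blast
  moreover have "red (a' *s v + b' *s w0 + d' *s y) = w"
    by (simp add: w bd a')
  ultimately show ?thesis by blast
qed

text \<open>Preserving the form is all that \<open>Sp4_level\<close> grants here; it carries
  symplectic bases to symplectic bases, and these supply the dual covectors of the image.\<close>

lemma Sp4_good: "A \<in> Sp4_level m \<Longrightarrow> good v w \<Longrightarrow> good (A *v v) (A *v w)"
proof -
  assume A: "A \<in> Sp4_level m" and g: "good v w"
  obtain x y where "sympbasis v w x y" using good_sympbasis[OF g] by blast
  then have "sympbasis (A *v v) (A *v w) (A *v x) (A *v y)"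
    using A by (simp add: sympbasis_def Sp4_level_def)
  then show ?thesis by (rule sympbasis_good)
qed

section \<open>Barycentric coordinates on the cones\<close>

text \<open>The value of the symmetric form Q at the covectors c and d. On a square of v it is the
  product of c(v) and d(v).\<close>

definition qf :: "int ^ 'n \<Rightarrow> int ^ 'n \<Rightarrow> real ^ 'n ^ 'n \<Rightarrow> real" where
  "qf c d Q = (\<Sum>i\<in>UNIV. \<Sum>j\<in>UNIV. real_of_int (c $ i) * real_of_int (d $ j) * Q $ i $ j)"

lemma qf_linear [simp]:
  "qf c d (Q + R) = qf c d Q + qf c d R" "qf c d (t *\<^sub>R Q) = t * qf c d Q" "qf c d 0 = 0"
  by (simp_all add: qf_def sum.distrib sum_distrib_left algebra_simps)

lemma qf_sum: "qf c d (\<Sum>i\<in>A. Q i) = (\<Sum>i\<in>A. qf c d (Q i))"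
  by (induction A rule: infinite_finite_induct) simp_all

lemma qf_outer_sq: "qf c d (outer_sq v) = real_of_int (dotp c v) * real_of_int (dotp d v)"
  by (simp add: qf_def outer_sq_def dotp_def sum_product algebra_simps)

lemma continuous_on_qf [continuous_intros]: "continuous_on A (qf c d)"
  unfolding qf_def by (intro continuous_intros)

lemma outer_sq_minus [simp]: "outer_sq (- v) = outer_sq v"
  by (simp add: outer_sq_def)

text \<open>The perfect form of the cone spanned by \<open>v\<close>, \<open>w\<close> and \<open>v + w\<close>, where \<open>c\<close>, \<open>d\<close> is
  dual to \<open>v\<close>, \<open>w\<close>: it is 1 on the three generators and larger on all other squares.\<close>

definition perf :: "int ^ 'n \<Rightarrow> int ^ 'n \<Rightarrow> real ^ 'n ^ 'n \<Rightarrow> real" where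
  "perf c d Q = qf c c Q - qf c d Q + qf d d Q"

lemma perf_linear [simp]:
  "perf c d (Q + R) = perf c d Q + perf c d R" "perf c d (t *\<^sub>R Q) = t * perf c d Q" "perf c d 0 = 0"
  by (simp_all add: perf_def algebra_simps)

lemma perf_sum: "perf c d (\<Sum>i\<in>A. Q i) = (\<Sum>i\<in>A. perf c d (Q i))"
  by (induction A rule: infinite_finite_induct) simp_all

text \<open>The norm form of the hexagonal lattice; completing the square shows that it is positive
  definite, so it is at least 1 on nonzero integral vectors.\<close>

lemma hex_form_ge_1:
  fixes s t :: int
  assumes "s \<noteq> 0 \<or> t \<noteq> 0"
  shows "s\<^sup>2 - s * t + t\<^sup>2 \<ge> 1"
proof -
  have "4 * (s\<^sup>2 - s * t + t\<^sup>2) = (2 * s - t)\<^sup>2 + 3 * t\<^sup>2"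
    by (simp add: power2_eq_square algebra_simps)
  moreover have "(2 * s - t)\<^sup>2 + 3 * t\<^sup>2 > 0"
    using assms by (cases "t = 0") (auto intro: add_nonneg_pos)
  ultimately have "0 < 4 * (s\<^sup>2 - s * t + t\<^sup>2)" by (simp only:)
  then have "0 < s\<^sup>2 - s * t + t\<^sup>2" by (rule zero_less_mult_pos) simp
  then show ?thesis by (simp only: int_one_le_iff_zero_less)
qed

text \<open>The six minimal vectors of the hexagonal lattice; up to sign they are the three
  generators of a cone.\<close>

lemma hex_form_eq_1:
  fixes s t :: int
  assumes "s\<^sup>2 - s * t + t\<^sup>2 = 1"
  shows "(s, t) \<in> {(1, 0), (-1, 0), (0, 1), (0, -1), (1, 1), (-1, -1)}"
proof -
  have *: "y \<in> {-1, 0, 1}" if "x\<^sup>2 - x * y + y\<^sup>2 = 1" for x y :: int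
  proof -
    have "4 * (x\<^sup>2 - x * y + y\<^sup>2) = (2 * x - y)\<^sup>2 + 3 * y\<^sup>2"
      by (simp add: power2_eq_square algebra_simps)
    moreover define z where "z = (2 * x - y)\<^sup>2"
    ultimately have "4 = z + 3 * y\<^sup>2" using that by simp
    moreover have "0 \<le> z" by (simp add: z_def)
    ultimately have "y\<^sup>2 < 2\<^sup>2" by simp
    then have "\<bar>y\<bar> < 2" by (metis abs_le_square_iff abs_numeral linorder_not_less)
    then show ?thesis by auto
  qed
  have "t \<in> {-1, 0, 1}" using *[OF assms] .
  moreover have "s \<in> {-1, 0, 1}" using *[of t s] assms by (simp add: algebra_simps)
  ultimately show ?thesis using assms by (auto simp: power2_eq_square)
qed

section \<open>Uniqueness of representations by squares\<close>

definition tri :: "int ^ 'n \<Rightarrow> int ^ 'n \<Rightarrow> (int ^ 'n) set set" where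
  "tri v w = {pm v, pm w, pm (v + w)}"

text \<open>The square depends on the vector up to sign only, so for classes \<open>pm v\<close> the
  choice is harmless (\<open>Osq_pm\<close>).\<close>

definition Osq :: "(int ^ 'n) set \<Rightarrow> real ^ 'n ^ 'n" where
  "Osq p = outer_sq (SOME v. v \<in> p)"

lemma pm_eq_iff: "pm v = pm w \<longleftrightarrow> v = w \<or> v = - (w :: 'a::group_add)"
  by (auto simp: pm_def doubleton_eq_iff)

lemma pm_minus [simp]: "pm (- v) = pm (v :: 'a::group_add)"
  by (auto simp: pm_def)

lemma pm_self [simp]: "v \<in> pm v"
  by (simp add: pm_def)

lemma mem_pm_iff: "w \<in> pm v \<longleftrightarrow> pm w = pm (v :: 'a::group_add)"
  by (auto simp: pm_def doubleton_eq_iff)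

lemma Osq_pm [simp]: "Osq (pm v) = outer_sq v"
proof -
  have "(SOME x. x \<in> pm v) \<in> pm v" by (rule someI[of _ v]) simp
  then show ?thesis unfolding Osq_def by (auto simp: pm_def)
qed

lemma finite_tri [simp]: "finite (tri v w)"
  by (simp add: tri_def)

lemma upair_distinct:
  fixes v w :: "int ^ 'n"
  assumes "upair v w"
  shows "pm v \<noteq> pm w" "pm v \<noteq> pm (v + w)" "pm w \<noteq> pm (v + w)"
proof -
  obtain c d where cd: "dotp c v = 1" "dotp c w = 0" "dotp d v = 0" "dotp d w = 1"
    using assms by (auto simp: upair_def)
  have ne: "pm x \<noteq> pm y" if "\<bar>dotp c x\<bar> \<noteq> \<bar>dotp c y\<bar> \<or> \<bar>dotp d x\<bar> \<noteq> \<bar>dotp d y\<bar>" for x y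
    using that unfolding pm_eq_iff by auto
  show "pm v \<noteq> pm w" "pm v \<noteq> pm (v + w)" "pm w \<noteq> pm (v + w)"
    by (rule ne; simp add: cd)+
qed

text \<open>The coefficients form a function on all sign classes, vanishing outside one triangle, so
  that representations of the same form in different cones can be compared as functions.\<close>

definition rep :: "real ^ 'n ^ 'n \<Rightarrow> ((int ^ 'n) set \<Rightarrow> real) \<Rightarrow> bool" where
  "rep x g \<longleftrightarrow> (\<forall>p. 0 \<le> g p) \<and>
     (\<exists>v w. upair v w \<and> {p. g p \<noteq> 0} \<subseteq> tri v w \<and> x = (\<Sum>p\<in>tri v w. g p *\<^sub>R Osq p))"

text \<open>\<open>q\<close> occurs with positive coefficient in a representation of a form whose radical contains
  the annihilator of \<open>v\<close> and \<open>w\<close>, so it lies in their span.\<close>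

lemma rep_support:
  fixes v w q :: "int ^ 'n"
  assumes cd: "dotp c v = 1" "dotp c w = 0" "dotp d v = 0" "dotp d w = 1"
    and x: "x = (\<Sum>p\<in>tri v w. g p *\<^sub>R Osq p)" "x = (\<Sum>p\<in>S. g' p *\<^sub>R Osq p)"
    and S: "finite S" "\<And>p. p \<in> S \<Longrightarrow> 0 \<le> g' p" "\<And>p. p \<in> S \<Longrightarrow> \<exists>u. p = pm u"
    and q: "pm q \<in> S" "g' (pm q) > 0"
  shows "q = dotp c q *s v + dotp d q *s w"
proof -
  have "q $ i = dotp c q * v $ i + dotp d q * w $ i" for i
  proof -
    \<comment> \<open>The i-th coordinate covector minus its part along \<open>c\<close>,
      \<open>d\<close>: it annihilates \<open>v\<close> and \<open>w\<close>, and its vanishing at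
      \<open>q\<close> is the i-th coordinate of the claim. As it is nonnegative on all squares, its
      sum over a representation of \<open>x\<close> vanishes term by term.\<close>
    define xi where "xi = axis i 1 - v $ i *s c - w $ i *s d"
    have ax: "dotp (axis i 1) u = u $ i" for u
      by (simp add: dotp_def axis_def if_distrib[where f = "\<lambda>x. x * _"] cong: if_cong)
    have 0: "dotp xi v = 0" "dotp xi w = 0"
      by (simp_all add: xi_def ax cd)
    have "qf xi xi x = 0"
      unfolding x(1) qf_sum by (intro sum.neutral) (auto simp: tri_def qf_outer_sq 0)
    then have "(\<Sum>p\<in>S. g' p * qf xi xi (Osq p)) = 0"
      unfolding x(2) qf_sum by simp
    moreover have "0 \<le> g' p * qf xi xi (Osq p)" if "p \<in> S" for p
      using S(2,3)[OF that] by (auto simp: qf_outer_sq)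
    ultimately have "g' (pm q) * qf xi xi (Osq (pm q)) = 0"
      using sum_nonneg_eq_0_iff[OF S(1), of "\<lambda>p. g' p * qf xi xi (Osq p)"] q(1) by blast
    then have "dotp xi q = 0" using q by (simp add: qf_outer_sq)
    then show ?thesis by (simp add: xi_def ax mult.commute)
  qed
  then show ?thesis by (simp add: vec_eq_iff)
qed

lemma perf_Osq_tri:
  assumes cd: "dotp c v = 1" "dotp c w = 0" "dotp d v = 0" "dotp d w = 1" and p: "p \<in> tri v w"
  shows "perf c d (Osq p) = 1"
  using p by (auto simp: tri_def perf_def qf_outer_sq cd)

text \<open>Evaluate the perfect form of the cone of \<open>v\<close>, \<open>w\<close> at
  \<open>x\<close>. It is 1 on the generators of that cone, so the value is the sum of
  \<open>g\<close>; it is at least 1 on every square occurring in the other representation, so the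
  value bounds the sum of \<open>g'\<close>. Equality forces the other support into the minimal
  vectors of the form.\<close>

lemma rep_le:
  fixes v w v' w' :: "int ^ 'n"
  assumes cd: "dotp c v = 1" "dotp c w = 0" "dotp d v = 0" "dotp d w = 1" and u': "upair v' w'"
    and x: "x = (\<Sum>p\<in>tri v w. g p *\<^sub>R Osq p)" "x = (\<Sum>p\<in>tri v' w'. g' p *\<^sub>R Osq p)"
    and g': "\<And>p. 0 \<le> g' p"
  shows "sum g' (tri v' w') \<le> sum g (tri v w)"
    and "sum g' (tri v' w') = sum g (tri v w) \<Longrightarrow> p \<in> tri v' w' \<Longrightarrow> g' p \<noteq> 0 \<Longrightarrow> p \<in> tri v w"
proof -
  have ge: "perf c d (Osq p) \<ge> 1 \<and> (perf c d (Osq p) = 1 \<longrightarrow> p \<in> tri v w)"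
    if p: "p \<in> tri v' w'" "g' p \<noteq> 0" for p
  proof -
    obtain q where q: "p = pm q" "q = v' \<or> q = w' \<or> q = v' + w'" using p by (auto simp: tri_def)
    let ?s = "dotp c q" and ?t = "dotp d q"
    have "g' (pm q) > 0" using p g'[of p] q by simp
    then have eq: "q = ?s *s v + ?t *s w"
      using rep_support[OF cd x, of q] p q(1) g' by (auto simp: tri_def)
    have "q \<noteq> 0"
    proof
      assume "q = 0"
      then have "pm (v' + w') = pm w' \<or> pm (v' + w') = pm v' \<or> pm v' = pm w'"
        using q(2) by (auto simp: add_eq_0_iff)
      then show False using upair_distinct[OF u'] by auto
    qed
    then have st: "?s \<noteq> 0 \<or> ?t \<noteq> 0" using eq by auto
    have perf: "perf c d (Osq p) = real_of_int (?s\<^sup>2 - ?s * ?t + ?t\<^sup>2)"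
      by (simp add: q(1) perf_def qf_outer_sq power2_eq_square)
    have "perf c d (Osq p) \<ge> 1" using hex_form_ge_1[OF st] unfolding perf by linarith
    moreover have "p \<in> tri v w" if 1: "perf c d (Osq p) = 1"
    proof -
      have "?s\<^sup>2 - ?s * ?t + ?t\<^sup>2 = 1" using 1 unfolding perf by linarith
      then have "(?s, ?t) \<in> {(1, 0), (-1, 0), (0, 1), (0, -1), (1, 1), (-1, -1)}"
        by (rule hex_form_eq_1)
      then have "q = v \<or> q = - v \<or> q = w \<or> q = - w \<or> q = v + w \<or> q = - (v + w)"
        using eq by (elim insertE emptyE) (auto simp: vec_eq_iff)
      then show ?thesis unfolding q(1) tri_def
        by (metis insertCI pm_minus)
    qed
    ultimately show ?thesis by blast
  qed
  have x1: "perf c d x = sum g (tri v w)"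
    unfolding x(1) perf_sum using perf_Osq_tri[OF cd] by (intro sum.cong) auto
  have x2: "perf c d x = (\<Sum>p\<in>tri v' w'. g' p * perf c d (Osq p))"
    unfolding x(2) perf_sum by (intro sum.cong) auto
  have le: "g' p \<le> g' p * perf c d (Osq p)" if "p \<in> tri v' w'" for p
    using ge[OF that] g'[of p] by (cases "g' p = 0") (auto simp: mult_le_cancel_left1)
  show "sum g' (tri v' w') \<le> sum g (tri v w)"
    unfolding x1[symmetric] x2 by (rule sum_mono) (rule le)
  assume eq: "sum g' (tri v' w') = sum g (tri v w)" and p: "p \<in> tri v' w'" "g' p \<noteq> 0"
  have "(\<Sum>p\<in>tri v' w'. g' p * perf c d (Osq p) - g' p) = 0"
    using eq x1 x2 by (simp add: sum_subtractf)
  then have "g' p * perf c d (Osq p) - g' p = 0"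
    using sum_nonneg_eq_0_iff[of "tri v' w'" "\<lambda>p. g' p * perf c d (Osq p) - g' p"] le p(1) by force
  then have "perf c d (Osq p) = 1" using p(2) by simp
  then show "p \<in> tri v w" using ge[OF p] by blast
qed

text \<open>Exchanging the two cones gives equal totals, so both representations are supported on
  one triangle, where dual forms recover the coefficients.\<close>

lemma rep_unique:
  fixes x :: "real ^ 'n ^ 'n"
  assumes "rep x g" "rep x g'"
  shows "g = g'"
proof -
  obtain v w where u: "upair v w" and g: "\<And>p. 0 \<le> g p" "{p. g p \<noteq> 0} \<subseteq> tri v w"
    and x: "x = (\<Sum>p\<in>tri v w. g p *\<^sub>R Osq p)"
    using assms(1) by (auto simp: rep_def)
  obtain v' w' where u': "upair v' w'" and g': "\<And>p. 0 \<le> g' p" "{p. g' p \<noteq> 0} \<subseteq> tri v' w'"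
    and x': "x = (\<Sum>p\<in>tri v' w'. g' p *\<^sub>R Osq p)"
    using assms(2) by (auto simp: rep_def)
  obtain c d where cd: "dotp c v = 1" "dotp c w = 0" "dotp d v = 0" "dotp d w = 1"
    using u by (auto simp: upair_def)
  obtain c' d' where cd': "dotp c' v' = 1" "dotp c' w' = 0" "dotp d' v' = 0" "dotp d' w' = 1"
    using u' by (auto simp: upair_def)
  have eq: "sum g' (tri v' w') = sum g (tri v w)"
    using rep_le(1)[OF cd u' x x' g'(1)] rep_le(1)[OF cd' u x' x g(1)] by simp
  have sub: "{p. g' p \<noteq> 0} \<subseteq> tri v w"
    using rep_le(2)[OF cd u' x x' g'(1) eq] g'(2) by blast
  have x'': "x = (\<Sum>p\<in>tri v w. g' p *\<^sub>R Osq p)"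
  proof -
    have "x = (\<Sum>p\<in>tri v w \<union> tri v' w'. g' p *\<^sub>R Osq p)"
      unfolding x' using g'(2) by (intro sum.mono_neutral_left) auto
    also have "\<dots> = (\<Sum>p\<in>tri v w. g' p *\<^sub>R Osq p)"
      using sub by (intro sum.mono_neutral_right) auto
    finally show ?thesis .
  qed
  have exp: "(\<Sum>p\<in>tri v w. h p *\<^sub>R Osq p) = h (pm v) *\<^sub>R outer_sq v + h (pm w) *\<^sub>R outer_sq w
      + h (pm (v + w)) *\<^sub>R outer_sq (v + w)" for h
    using upair_distinct[OF u] by (simp add: tri_def add.assoc)
  \<comment> \<open>On a single triangle the mixed form sees only the generator v + w, and the two
    pure forms then give the other coefficients.\<close>
  have q: "qf c c x = h (pm v) + h (pm (v + w))" "qf c d x = h (pm (v + w))" "qf d d x = h (pm w) + h (pm (v + w))"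
    if "x = (\<Sum>p\<in>tri v w. h p *\<^sub>R Osq p)" for h
    unfolding that exp by (simp_all add: qf_outer_sq cd)
  have "g p = g' p" if "p \<in> tri v w" for p
    using that q[OF x] q[OF x''] by (auto simp: tri_def)
  moreover have "g p = g' p" if "p \<notin> tri v w" for p
    using that g(2) sub by (metis (mono_tags, lifting) mem_Collect_eq subsetD)
  ultimately show ?thesis by blast
qed

section \<open>Coordinates on a single cone\<close>

definition comb :: "int ^ 'n \<Rightarrow> int ^ 'n \<Rightarrow> real \<Rightarrow> real \<Rightarrow> real \<Rightarrow> real ^ 'n ^ 'n" where
  "comb v w a b c = a *\<^sub>R outer_sq v + b *\<^sub>R outer_sq w + c *\<^sub>R outer_sq (v + w)"

definition coefs :: "int ^ 'n \<Rightarrow> int ^ 'n \<Rightarrow> real \<Rightarrow> real \<Rightarrow> real \<Rightarrow> (int ^ 'n) set \<Rightarrow> real" where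
  "coefs v w a b c = (\<lambda>p. (if p = pm v then a else 0) + (if p = pm w then b else 0) + (if p = pm (v + w) then c else 0))"

lemma comb_add: "comb v w a b c + comb v w a' b' c' = comb v w (a + a') (b + b') (c + c')"
  by (simp add: comb_def scaleR_add_left)

lemma comb_scale: "t *\<^sub>R comb v w a b c = comb v w (t * a) (t * b) (t * c)"
  by (simp add: comb_def scaleR_add_right)

lemma comb_zero: "comb v w 0 0 0 = 0"
  by (simp add: comb_def)

lemma rep_comb:
  assumes u: "upair v w" and "0 \<le> a" "0 \<le> b" "0 \<le> c"
  shows "rep (comb v w a b c) (coefs v w a b c)"
proof -
  have "{p. coefs v w a b c p \<noteq> 0} \<subseteq> tri v w"
    by (auto simp: coefs_def tri_def split: if_splits)
  moreover have "comb v w a b c = (\<Sum>p\<in>tri v w. coefs v w a b c p *\<^sub>R Osq p)"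
    using upair_distinct[OF u] by (simp add: tri_def comb_def coefs_def add.assoc)
  moreover have "0 \<le> coefs v w a b c p" for p
    using assms by (simp add: coefs_def)
  ultimately show ?thesis
    unfolding rep_def using u by blast
qed

lemma coefs_unique:
  assumes "upair v w" "0 \<le> a" "0 \<le> b" "0 \<le> c" "upair v' w'" "0 \<le> a'" "0 \<le> b'" "0 \<le> c'"
    and "comb v w a b c = comb v' w' a' b' c'"
  shows "coefs v w a b c = coefs v' w' a' b' c'"
  using rep_unique rep_comb assms by metis

lemma cone3_eq: "convex_cone hull {outer_sq v, outer_sq w, outer_sq (v + w)} =
    {comb v w a b c | a b c. 0 \<le> a \<and> 0 \<le> b \<and> 0 \<le> c}" (is "?L = ?R")
proof
  have "convex_cone ?R"
    unfolding convex_cone_iff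
  proof (intro conjI ballI allI impI)
    show "0 \<in> ?R" using comb_zero by force
  next
    fix x y assume "x \<in> ?R" "y \<in> ?R"
    then show "x + y \<in> ?R" by (force simp: comb_add intro: add_nonneg_nonneg)
  next
    fix x and t :: real assume "x \<in> ?R" "0 \<le> t"
    then show "t *\<^sub>R x \<in> ?R" by (force simp: comb_scale)
  qed
  moreover have "{outer_sq v, outer_sq w, outer_sq (v + w)} \<subseteq> ?R"
  proof -
    have "outer_sq v = comb v w 1 0 0" "outer_sq w = comb v w 0 1 0" "outer_sq (v + w) = comb v w 0 0 1"
      by (simp_all add: comb_def)
    then show ?thesis by force
  qed
  ultimately show "?L \<subseteq> ?R" by (rule hull_minimal[rotated])
  have "comb v w a b c \<in> ?L" if "0 \<le> a" "0 \<le> b" "0 \<le> c" for a b c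
    unfolding comb_def using that
    by (intro convex_cone_hull_add convex_cone_hull_mul hull_inc) auto
  then show "?R \<subseteq> ?L" by blast
qed

lemma conj_act_outer_sq: "conj_act A (outer_sq v) = outer_sq (A *v v)"
proof -
  have "(\<Sum>k\<in>UNIV. (\<Sum>l\<in>UNIV. real_of_int (A $ i $ l) * (real_of_int (v $ l) * real_of_int (v $ k))) * real_of_int (A $ j $ k))
    = (\<Sum>l\<in>UNIV. real_of_int (A $ i $ l) * real_of_int (v $ l)) * (\<Sum>k\<in>UNIV. real_of_int (A $ j $ k) * real_of_int (v $ k))" for i j
    by (simp add: sum_distrib_left sum_distrib_right algebra_simps)
  then show ?thesis
    by (simp add: conj_act_def Let_def outer_sq_def vec_eq_iff matrix_matrix_mult_def matrix_vector_mult_def transpose_def)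
qed

lemma conj_act_linear [simp]:
  "conj_act A (Q + R) = conj_act A Q + conj_act A R" "conj_act A (t *\<^sub>R Q) = t *\<^sub>R conj_act A Q" "conj_act A 0 = 0"
  by (simp_all add: conj_act_def Let_def vec_eq_iff matrix_matrix_mult_def sum.distrib sum_distrib_left
      sum_distrib_right algebra_simps)

lemma conj_act_comb: "conj_act A (comb v w a b c) = comb (A *v v) (A *v w) a b c"
  by (simp add: comb_def conj_act_outer_sq matrix_vector_right_distrib)

text \<open>The coefficients are linear functions of the form; this yields both their uniqueness
  within a cone and the continuity of the projection.\<close>

lemma perf_comb:
  assumes "dotp c v = 1" "dotp c w = 0" "dotp d v = 0" "dotp d w = 1"
  shows "qf c c (comb v w x y z) = x + z" "qf c d (comb v w x y z) = z" "qf d d (comb v w x y z) = y + z"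
  by (simp_all add: comb_def qf_outer_sq assms)

lemma comb_eq_0_iff:
  assumes "upair v w" "0 \<le> a" "0 \<le> b" "0 \<le> c"
  shows "comb v w a b c = 0 \<longleftrightarrow> a = 0 \<and> b = 0 \<and> c = 0"
proof
  obtain e d where "dotp e v = 1" "dotp e w = 0" "dotp d v = 0" "dotp d w = 1"
    using assms(1) by (auto simp: upair_def)
  note * = perf_comb[OF this, of a b c]
  assume 0: "comb v w a b c = 0"
  show "a = 0 \<and> b = 0 \<and> c = 0" using * unfolding 0 by simp
qed (simp add: comb_def)

section \<open>Quotients of fans\<close>

text \<open>The common frame of the two instances: \<open>good\<close> pairs span the top cones,
  \<open>\<Gamma>\<close> is the congruence group and \<open>\<rho>\<close> the reduction.
  \<open>lift_neighbour\<close> says that the star of a vertex depends on its reduction only (the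
  pair with \<open>w''\<close> makes \<open>v'\<close> a vertex), \<open>lift_pair\<close> that
  pairs with equal reductions are congruent. The absence of 2-torsion in \<open>\<rho>_2\<close> is
  what m \<ge> 3 supplies.\<close>

locale fan_quotient =
  fixes good :: "int ^ 'n \<Rightarrow> int ^ 'n \<Rightarrow> bool" and \<Gamma> :: "(int ^ 'n ^ 'n) set"
    and \<rho> :: "int ^ 'n \<Rightarrow> 'r::comm_ring_1 ^ 'k"
  assumes good_upair: "good v w \<Longrightarrow> upair v w"
    and good_swap: "good v w \<Longrightarrow> good w v" and good_neg: "good v w \<Longrightarrow> good v (- w)"
    and good_add: "good v w \<Longrightarrow> good v (v + w)"
    and \<rho>_add: "\<rho> (v + w) = \<rho> v + \<rho> w" and \<rho>_minus: "\<rho> (- v) = - \<rho> v"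
    and \<rho>_distinct: "good v w \<Longrightarrow> \<rho> v \<noteq> \<rho> w" and \<rho>_2: "good v w \<Longrightarrow> \<rho> v + \<rho> v \<noteq> 0"
    and \<Gamma>_good: "A \<in> \<Gamma> \<Longrightarrow> good v w \<Longrightarrow> good (A *v v) (A *v w)"
    and \<Gamma>_\<rho>: "A \<in> \<Gamma> \<Longrightarrow> \<rho> (A *v v) = \<rho> v"
    and lift_neighbour: "good v w \<Longrightarrow> good v' w'' \<Longrightarrow> \<rho> v = \<rho> v' \<Longrightarrow> \<exists>w'. good v' w' \<and> \<rho> w' = \<rho> w"
    and lift_pair: "good v w \<Longrightarrow> good v' w' \<Longrightarrow> \<rho> v = \<rho> v' \<Longrightarrow> \<rho> w = \<rho> w' \<Longrightarrow>
      \<exists>A\<in>\<Gamma>. A *v v = v' \<and> A *v w = w'"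
begin

definition cls :: "int ^ 'n \<Rightarrow> ('r ^ 'k) set" where "cls v = pm (\<rho> v)"

definition clstri :: "int ^ 'n \<Rightarrow> int ^ 'n \<Rightarrow> ('r ^ 'k) set set" where
  "clstri v w = {cls v, cls w, cls (v + w)}"

text \<open>Taking all nonempty subsets of triangles closes the complex under faces by construction;
  no simplex is missed, since every vertex and edge of the fan is part of a triangle.\<close>

definition cplx :: "('r ^ 'k) set set set" where
  "cplx = {\<sigma>. \<sigma> \<noteq> {} \<and> (\<exists>v w. good v w \<and> \<sigma> \<subseteq> clstri v w)}"

lemma cls_minus [simp]: "cls (- v) = cls v"
  by (simp add: cls_def \<rho>_minus)

lemma good_neg1: "good v w \<Longrightarrow> good (- v) w"
  using good_swap good_neg by blast

lemma cls_pair: "good v w \<Longrightarrow> cls v \<noteq> cls w"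
  using \<rho>_distinct good_neg by (metis cls_def pm_eq_iff \<rho>_minus)

lemma cls_distinct:
  assumes "good v w"
  shows "cls v \<noteq> cls w" "cls v \<noteq> cls (v + w)" "cls w \<noteq> cls (v + w)"
proof -
  have "good w (v + w)" using good_add[OF good_swap[OF assms]] by (simp add: add.commute)
  then show "cls v \<noteq> cls w" "cls v \<noteq> cls (v + w)" "cls w \<noteq> cls (v + w)"
    using cls_pair good_add assms by blast+
qed

lemma cls_sign: "cls v = cls v' \<Longrightarrow> \<exists>u. (u = v' \<or> u = - v') \<and> \<rho> u = \<rho> v"
  unfolding cls_def pm_eq_iff using \<rho>_minus by metis

text \<open>Barycentric coordinates scaled to total 1. At the apex the total is 0 and division
  yields the zero function, so the result is a point of a simplex only away from the apex.\<close>

definition bar :: "int ^ 'n \<Rightarrow> int ^ 'n \<Rightarrow> real \<Rightarrow> real \<Rightarrow> real \<Rightarrow> ('r ^ 'k) set \<Rightarrow> real" where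
  "bar v w a b c = (\<lambda>q. ((if q = cls v then a else 0) + (if q = cls w then b else 0) +
     (if q = cls (v + w) then c else 0)) / (a + b + c))"

text \<open>Writes the barycentric coordinates in terms of the coefficient function alone. As that
  function is unique, they do not depend on the chosen cone, and \<open>proj\<close> is well
  defined.\<close>

lemma bar_coefs:
  fixes a b c :: real
  assumes "good v w"
  defines "g \<equiv> coefs v w a b c"
  shows "bar v w a b c q = (\<Sum>p | g p \<noteq> 0. if \<rho> ` p = q then g p else 0) / (\<Sum>p | g p \<noteq> 0. g p)"
proof -
  have sub: "{p. g p \<noteq> 0} \<subseteq> tri v w"
    by (auto simp: g_def coefs_def tri_def split: if_splits)
  note d = upair_distinct[OF good_upair[OF assms(1)]]
  have im: "\<rho> ` pm u = cls u" for u
    by (auto simp: pm_def cls_def \<rho>_minus)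
  have g: "g (pm v) = a" "g (pm w) = b" "g (pm (v + w)) = c"
    using d by (auto simp: g_def coefs_def)
  have "(\<Sum>p | g p \<noteq> 0. g p) = (\<Sum>p\<in>tri v w. g p)"
    using sub by (intro sum.mono_neutral_left) auto
  also have "\<dots> = a + b + c" using d g by (simp add: tri_def)
  finally have 1: "(\<Sum>p | g p \<noteq> 0. g p) = a + b + c" .
  have "(\<Sum>p | g p \<noteq> 0. if \<rho> ` p = q then g p else 0) = (\<Sum>p\<in>tri v w. if \<rho> ` p = q then g p else 0)"
    using sub by (intro sum.mono_neutral_left) auto
  also have "\<dots> = (if q = cls v then a else 0) + (if q = cls w then b else 0) + (if q = cls (v + w) then c else 0)"
    using d g by (auto simp: tri_def im)
  finally show ?thesis unfolding bar_def 1 by simp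
qed

lemma bar_unique:
  assumes "good v w" "0 \<le> a" "0 \<le> b" "0 \<le> c" "good v' w'" "0 \<le> a'" "0 \<le> b'" "0 \<le> c'"
    and "comb v w a b c = comb v' w' a' b' c'"
  shows "bar v w a b c = bar v' w' a' b' c'"
proof
  have e: "coefs v w a b c = coefs v' w' a' b' c'"
    by (rule coefs_unique[OF good_upair[OF assms(1)] assms(2-4) good_upair[OF assms(5)] assms(6-9)])
  show "bar v w a b c q = bar v' w' a' b' c' q" for q
    by (simp only: bar_coefs[OF assms(1)] bar_coefs[OF assms(5)] e)
qed

text \<open>The choice ranges over all presentations of \<open>x\<close> and is resolved by
  \<open>proj_comb\<close>; outside the cones the value is arbitrary.\<close>

definition proj :: "real ^ 'n ^ 'n \<Rightarrow> ('r ^ 'k) set \<Rightarrow> real" where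
  "proj x = (SOME y. \<exists>v w a b c. good v w \<and> 0 \<le> a \<and> 0 \<le> b \<and> 0 \<le> c \<and> x = comb v w a b c \<and> y = bar v w a b c)"

lemma proj_comb:
  assumes "good v w" "0 \<le> a" "0 \<le> b" "0 \<le> c"
  shows "proj (comb v w a b c) = bar v w a b c"
proof -
  have "\<exists>y v' w' a' b' c'. good v' w' \<and> 0 \<le> a' \<and> 0 \<le> b' \<and> 0 \<le> c' \<and> comb v w a b c = comb v' w' a' b' c' \<and> y = bar v' w' a' b' c'"
    using assms by blast
  from someI_ex[OF this] obtain v' w' a' b' c' where "good v' w'" "0 \<le> a'" "0 \<le> b'" "0 \<le> c'"
    "comb v w a b c = comb v' w' a' b' c'" "proj (comb v w a b c) = bar v' w' a' b' c'"
    unfolding proj_def by blast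
  then show ?thesis using bar_unique[OF assms, of v' w' a' b' c'] by simp
qed

definition cone_pt :: "real ^ 'n ^ 'n \<Rightarrow> bool" where
  "cone_pt x \<longleftrightarrow> x \<noteq> 0 \<and> (\<exists>v w a b c. good v w \<and> 0 \<le> a \<and> 0 \<le> b \<and> 0 \<le> c \<and> x = comb v w a b c)"

lemma proj_scale:
  assumes "cone_pt x" "t > 0" shows "proj (t *\<^sub>R x) = proj x"
proof -
  obtain v w a b c where *: "good v w" "0 \<le> a" "0 \<le> b" "0 \<le> c" "x = comb v w a b c"
    using assms by (auto simp: cone_pt_def)
  have "bar v w (t * a) (t * b) (t * c) = bar v w a b c"
  proof
    fix q
    have "((if q = cls v then t * a else 0) + (if q = cls w then t * b else 0) + (if q = cls (v + w) then t * c else 0))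
      = t * ((if q = cls v then a else 0) + (if q = cls w then b else 0) + (if q = cls (v + w) then c else 0))"
      by (simp add: algebra_simps)
    then show "bar v w (t * a) (t * b) (t * c) q = bar v w a b c q"
      using assms(2) unfolding bar_def distrib_left[symmetric] by simp
  qed
  then show ?thesis using * assms(2) by (simp add: comb_scale proj_comb)
qed

lemma proj_conj_act:
  assumes "cone_pt x" "A \<in> \<Gamma>" shows "proj (conj_act A x) = proj x"
proof -
  obtain v w a b c where *: "good v w" "0 \<le> a" "0 \<le> b" "0 \<le> c" "x = comb v w a b c"
    using assms by (auto simp: cone_pt_def)
  have "cls (A *v u) = cls u" for u
    using \<Gamma>_\<rho>[OF assms(2)] by (simp add: cls_def)
  then have "bar (A *v v) (A *v w) a b c = bar v w a b c"
    by (simp add: bar_def flip: matrix_vector_right_distrib)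
  then show ?thesis using * \<Gamma>_good[OF assms(2)] by (simp add: conj_act_comb proj_comb)
qed

lemma cone_pt_conj_act:
  assumes "cone_pt x" "A \<in> \<Gamma>" shows "cone_pt (conj_act A x)"
proof -
  obtain v w a b c where *: "good v w" "0 \<le> a" "0 \<le> b" "0 \<le> c" "x = comb v w a b c" "x \<noteq> 0"
    using assms by (auto simp: cone_pt_def)
  then have "comb (A *v v) (A *v w) a b c \<noteq> 0"
    using comb_eq_0_iff good_upair \<Gamma>_good[OF assms(2)] by metis
  then show ?thesis
    unfolding cone_pt_def *(5) conj_act_comb using * \<Gamma>_good[OF assms(2) *(1)] by blast
qed

lemma cone_pt_scale:
  assumes "cone_pt x" "t > 0" shows "cone_pt (t *\<^sub>R x)"
proof -
  obtain v w a b c where *: "good v w" "0 \<le> a" "0 \<le> b" "0 \<le> c" "x = comb v w a b c" "x \<noteq> 0"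
    using assms by (auto simp: cone_pt_def)
  have "t *\<^sub>R x = comb v w (t * a) (t * b) (t * c)" using * by (simp add: comb_scale)
  moreover have "0 \<le> t * a" "0 \<le> t * b" "0 \<le> t * c" using * assms by auto
  ultimately show ?thesis using * assms unfolding cone_pt_def
    by (metis less_irrefl scaleR_eq_0_iff)
qed

lemma cone_pt_comb:
  assumes "good v w" "0 \<le> a" "0 \<le> b" "0 \<le> c"
  shows "cone_pt (comb v w a b c) \<longleftrightarrow> a + b + c > 0"
proof -
  have "a + b + c > 0 \<longleftrightarrow> \<not> (a = 0 \<and> b = 0 \<and> c = 0)" using assms by auto
  then show ?thesis
    unfolding cone_pt_def using comb_eq_0_iff[OF good_upair[OF assms(1)] assms(2-4)] assms by blast
qed

lemma bar_in_closed_simplex: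
  assumes g: "good v w" and pos: "0 \<le> a" "0 \<le> b" "0 \<le> c" "a + b + c > 0"
    and S: "S \<subseteq> clstri v w" "cls v \<notin> S \<Longrightarrow> a = 0" "cls w \<notin> S \<Longrightarrow> b = 0" "cls (v + w) \<notin> S \<Longrightarrow> c = 0"
  shows "bar v w a b c \<in> closed_simplex S"
proof -
  have 0: "bar v w a b c q = 0" if "q \<notin> S" for q
    using that S by (auto simp: bar_def)
  have "sum (bar v w a b c) S = sum (bar v w a b c) (clstri v w)"
    using S(1) 0 by (intro sum.mono_neutral_left) (auto simp: clstri_def)
  also have "\<dots> = 1"
    using cls_distinct[OF g] pos by (simp add: clstri_def bar_def flip: add_divide_distrib)
  finally show ?thesis using pos 0 by (auto simp: closed_simplex_def bar_def)
qed

lemma cplx_finite: "\<sigma> \<in> cplx \<Longrightarrow> finite \<sigma>"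
  by (auto simp: cplx_def clstri_def intro: finite_subset)

lemma clstri_cplx: "good v w \<Longrightarrow> clstri v w \<in> cplx"
  by (auto simp: cplx_def clstri_def)

lemma proj_in: "cone_pt x \<Longrightarrow> proj x \<in> polyhedron_of cplx"
proof -
  assume x: "cone_pt x"
  then obtain v w a b c where *: "good v w" "0 \<le> a" "0 \<le> b" "0 \<le> c" "x = comb v w a b c"
    by (auto simp: cone_pt_def)
  then have "proj x \<in> closed_simplex (clstri v w)"
    using x cone_pt_comb[OF *(1-4)] by (auto simp: proj_comb clstri_def intro!: bar_in_closed_simplex)
  then show ?thesis using clstri_cplx[OF *(1)] by blast
qed

text \<open>The section over a simplex of \<open>clstri v w\<close>: barycentric coordinates are
  used as coefficients in the chosen lift of the cone.\<close>

definition sect :: "int ^ 'n \<Rightarrow> int ^ 'n \<Rightarrow> (('r ^ 'k) set \<Rightarrow> real) \<Rightarrow> real ^ 'n ^ 'n" where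
  "sect v w p = comb v w (p (cls v)) (p (cls w)) (p (cls (v + w)))"

lemma sect:
  assumes g: "good v w" and S: "S \<subseteq> clstri v w" and p: "p \<in> closed_simplex S"
  shows "proj (sect v w p) = p" "cone_pt (sect v w p)"
proof -
  have nn: "0 \<le> p q" for q using p by (simp add: closed_simplex_def)
  have 0: "p q = 0" if "q \<notin> clstri v w" for q using p S that by (auto simp: closed_simplex_def)
  have "sum p S = sum p (clstri v w)"
    using S p by (intro sum.mono_neutral_left) (auto simp: clstri_def closed_simplex_def)
  then have 1: "p (cls v) + p (cls w) + p (cls (v + w)) = 1"
    using p cls_distinct[OF g] by (simp add: closed_simplex_def clstri_def add.assoc)
  have "bar v w (p (cls v)) (p (cls w)) (p (cls (v + w))) = p"
    using cls_distinct[OF g] 0 unfolding bar_def 1 by (auto simp: fun_eq_iff clstri_def)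
  then show "proj (sect v w p) = p"
    unfolding sect_def by (subst proj_comb[OF g nn nn nn])
  show "cone_pt (sect v w p)"
    unfolding sect_def by (subst cone_pt_comb[OF g nn nn nn]) (simp add: 1)
qed

lemma continuous_on_sect: "continuous_on S (sect v w)"
  unfolding sect_def comb_def
  by (intro continuous_intros continuous_on_coordinate)

text \<open>On one cone the coefficients are the linear functions of \<open>perf_comb\<close>, and
  their total is the perfect form, which vanishes only at the apex.\<close>

lemma continuous_on_proj:
  assumes g: "good v w"
  shows "continuous_on (convex_cone hull {outer_sq v, outer_sq w, outer_sq (v + w)} - {0}) (\<lambda>x. proj x q)"
proof -
  obtain c d where cd: "dotp c v = 1" "dotp c w = 0" "dotp d v = 0" "dotp d w = 1"
    using good_upair[OF g] by (auto simp: upair_def)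
  note pc = perf_comb[OF cd]
  let ?C = "convex_cone hull {outer_sq v, outer_sq w, outer_sq (v + w)} - {0}"
  let ?h = "\<lambda>x. ((if q = cls v then qf c c x - qf c d x else 0) + (if q = cls w then qf d d x - qf c d x else 0) +
     (if q = cls (v + w) then qf c d x else 0)) / perf c d x"
  have "\<exists>a b e. x = comb v w a b e \<and> 0 \<le> a \<and> 0 \<le> b \<and> 0 \<le> e \<and> a + b + e > 0" if "x \<in> ?C" for x
    using that comb_eq_0_iff[OF good_upair[OF g]] unfolding cone3_eq
    by (smt (verit) DiffE insertI1 mem_Collect_eq)
  then have x: "proj x q = ?h x" "perf c d x \<noteq> 0" if C: "x \<in> ?C" for x
  proof -
    obtain a b e where e: "x = comb v w a b e" "0 \<le> a" "0 \<le> b" "0 \<le> e" "a + b + e > 0"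
      using \<open>\<And>x. x \<in> ?C \<Longrightarrow> _\<close>[OF C] by blast
    have p: "perf c d x = a + b + e" unfolding e(1) perf_def pc by simp
    then show "perf c d x \<noteq> 0" using e by simp
    show "proj x q = ?h x"
      unfolding p unfolding e(1) proj_comb[OF g e(2-4)] pc bar_def by simp
  qed
  have "continuous_on ?C ?h"
    using x(2) by (cases "q = cls v"; cases "q = cls w"; cases "q = cls (v + w)")
      (simp_all add: perf_def; intro continuous_intros; simp add: perf_def)+
  then show ?thesis by (rule continuous_on_eq) (rule x(1)[symmetric])
qed

text \<open>Vanishing coefficients can be moved to the end by changing the basis within the cone,
  for instance to v + w, v or to v, v + w; the three cases are the relative interiors of rays, edges
  and triangles.\<close>

lemma cone_pt_cases:
  assumes "cone_pt x"
  obtains (ray) v w a where "good v w" "a > 0" "x = comb v w a 0 0"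
  | (edge) v w a b where "good v w" "a > 0" "b > 0" "x = comb v w a b 0"
  | (tri) v w a b c where "good v w" "a > 0" "b > 0" "c > 0" "x = comb v w a b c"
proof -
  obtain v w a b c where *: "good v w" "0 \<le> a" "0 \<le> b" "0 \<le> c" "x = comb v w a b c"
    using assms by (auto simp: cone_pt_def)
  have pos: "a + b + c > 0" using cone_pt_comb[OF *(1-4)] assms * by simp
  have g: "good w v" "good (v + w) v" "good v (v + w)" "good w (v + w)"
    using good_swap good_add *(1) by (blast, blast, blast, metis good_swap good_add add.commute)
  have e: "comb v w 0 b 0 = comb w v b 0 0" "comb v w 0 0 c = comb (v + w) v c 0 0"
    "comb v w a 0 c = comb v (v + w) a c 0" "comb v w 0 b c = comb w (v + w) b c 0"
    by (simp_all add: comb_def)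
  consider "b = 0 \<and> c = 0" | "a = 0 \<and> c = 0" | "a = 0 \<and> b = 0" | "c = 0 \<and> a > 0 \<and> b > 0"
    | "b = 0 \<and> a > 0 \<and> c > 0" | "a = 0 \<and> b > 0 \<and> c > 0" | "a > 0 \<and> b > 0 \<and> c > 0"
    using *(2-4) by argo
  then show ?thesis
  proof cases
    case 1 then show ?thesis using ray[of v w a] * pos by simp
  next
    case 2 then show ?thesis using ray[of w v b] * pos g e by simp
  next
    case 3 then show ?thesis using ray[of "v + w" v c] * pos g e by simp
  next
    case 4 then show ?thesis using edge[of v w a b] * by simp
  next
    case 5 then show ?thesis using edge[of v "v + w" a c] * g e by simp
  next
    case 6 then show ?thesis using edge[of w "v + w" b c] * g e by simp
  next
    case 7 then show ?thesis using tri[of v w a b c] * by simp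
  qed
qed

section \<open>Fibres of the projection to the quotient complex\<close>

lemma bar_at:
  assumes "good v w"
  shows "bar v w a b c (cls v) = a / (a + b + c)" "bar v w a b c (cls w) = b / (a + b + c)"
    "bar v w a b c (cls (v + w)) = c / (a + b + c)"
  by (simp_all add: bar_def cls_distinct[OF assms] cls_distinct[OF assms, symmetric])

lemma bar_supp:
  assumes g: "good v w" and pos: "0 \<le> a" "0 \<le> b" "0 \<le> c" "a + b + c > 0"
  shows "{q. bar v w a b c q \<noteq> 0} = {q. q = cls v \<and> a > 0 \<or> q = cls w \<and> b > 0 \<or> q = cls (v + w) \<and> c > 0}"
proof -
  note d = cls_distinct[OF g] cls_distinct[OF g, symmetric]
  have "bar v w a b c q \<noteq> 0 \<longleftrightarrow> q = cls v \<and> a > 0 \<or> q = cls w \<and> b > 0 \<or> q = cls (v + w) \<and> c > 0" for q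
  proof -
    consider "q = cls v" | "q = cls w" | "q = cls (v + w)" | "q \<noteq> cls v" "q \<noteq> cls w" "q \<noteq> cls (v + w)" by blast
    then show ?thesis
    proof cases
    case 1 then show ?thesis using pos d by (simp add: bar_at[OF g] less_le)
  next
    case 2 then show ?thesis using pos d by (simp add: bar_at[OF g] less_le)
  next
    case 3 then show ?thesis using pos d by (simp add: bar_at[OF g] less_le)
  next
    case 4 then show ?thesis by (simp add: bar_def)
    qed
  qed
  then show ?thesis by blast
qed

text \<open>Choose signs so that \<open>u\<close> = \<plusminus>\<open>v'\<close> and
  \<open>z\<close> = \<plusminus>\<open>w'\<close> have exactly the reductions of \<open>v\<close>
  and \<open>w\<close>; then a congruence carries \<open>v\<close>, \<open>w\<close> to
  \<open>u\<close>, \<open>z\<close>. If the relative sign is wrong, the third class would be that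
  of both u + z and u - z, which forces 2u or 2z to reduce to zero.\<close>

lemma match_pair:
  assumes g: "good v w" "good v' w'" and c: "cls v = cls v'" "cls w = cls w'"
  shows "\<exists>A\<in>\<Gamma>. outer_sq (A *v v) = outer_sq v' \<and> outer_sq (A *v w) = outer_sq w' \<and>
    (cls (v + w) = cls (v' + w') \<longrightarrow> outer_sq (A *v (v + w)) = outer_sq (v' + w'))"
proof -
  obtain u where u: "u = v' \<or> u = - v'" "\<rho> u = \<rho> v" using cls_sign[OF c(1)] by blast
  obtain z where z: "z = w' \<or> z = - w'" "\<rho> z = \<rho> w" using cls_sign[OF c(2)] by blast
  have "good u z" using g(2) u(1) z(1) good_neg good_neg1 by blast
  then obtain A where A: "A \<in> \<Gamma>" "A *v v = u" "A *v w = z"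
    using lift_pair[OF g(1)] u(2) z(2) by metis
  have "outer_sq (u + z) = outer_sq (v' + w')" if cc: "cls (v + w) = cls (v' + w')"
  proof (cases "(u = v' \<and> z = w') \<or> (u = - v' \<and> z = - w')")
    case True
    then show ?thesis by (metis minus_add_distrib outer_sq_minus)
  next
    case False
    then consider "u = v' \<and> z = - w'" | "u = - v' \<and> z = w'" using u(1) z(1) by blast
    then have "cls (v' + w') = cls (u - z)"
    proof cases
      case 1 then show ?thesis by simp
    next
      case 2
      then have "u - z = - (v' + w')" by simp
      then show ?thesis by (simp only: cls_minus)
    qed
    then have "cls (u + z) = cls (u - z)"
      using cc by (simp add: cls_def \<rho>_add u z)
    then have "\<rho> u + \<rho> z = \<rho> u - \<rho> z \<or> \<rho> u + \<rho> z = - (\<rho> u - \<rho> z)"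
      by (simp add: cls_def pm_eq_iff \<rho>_add \<rho>_minus flip: add_uminus_conv_diff)
    then have "\<rho> z + \<rho> z = 0 \<or> \<rho> u + \<rho> u = 0"
      by (simp add: algebra_simps)
    then show ?thesis using \<rho>_2 \<open>good u z\<close> good_swap by blast
  qed
  moreover have "outer_sq u = outer_sq v'" "outer_sq z = outer_sq w'"
    using u(1) z(1) by auto
  ultimately show ?thesis
    using A by (intro bexI[of _ A]) (simp_all add: matrix_vector_right_distrib)
qed

text \<open>Up to sign the three generators sum to zero, a symmetric relation, so any two of them
  may come first. The signs are chosen to make the remaining one, up to sign, the sum of these
  two.\<close>

lemma tri_permute:
  assumes g: "good v w" and pos: "a > 0" "b > 0" "c > 0"
    and q: "q1 \<in> clstri v w" "q2 \<in> clstri v w" "q1 \<noteq> q2"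
  shows "\<exists>v' w' a' b' c'. good v' w' \<and> a' > 0 \<and> b' > 0 \<and> c' > 0 \<and> cls v' = q1 \<and> cls w' = q2 \<and>
    clstri v' w' = clstri v w \<and> comb v w a b c = comb v' w' a' b' c'"
proof -
  have gs: "good w v" "good v (- (v + w))" "good (v + w) (- v)" "good w (- (v + w))" "good (v + w) (- w)"
    using good_swap good_add good_neg g by (metis add.commute)+
  have eqs: "v + - (v + w) = - w" "(v + w) + - v = w" "w + - (v + w) = - v" "(v + w) + - w = v" "w + v = v + w"
    by simp_all
  have comb: "comb v w a b c = comb w v b a c" "comb v w a b c = comb v (- (v + w)) a c b"
    "comb v w a b c = comb (v + w) (- v) c a b" "comb v w a b c = comb w (- (v + w)) b c a"
    "comb v w a b c = comb (v + w) (- w) c b a"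
    unfolding comb_def eqs outer_sq_minus by (simp_all only: ac_simps)
  have tr: "clstri w v = clstri v w" "clstri v (- (v + w)) = clstri v w" "clstri (v + w) (- v) = clstri v w"
    "clstri w (- (v + w)) = clstri v w" "clstri (v + w) (- w) = clstri v w"
    unfolding clstri_def eqs cls_minus by (simp_all only: insert_commute)
  consider "q1 = cls v \<and> q2 = cls w" | "q1 = cls w \<and> q2 = cls v" | "q1 = cls v \<and> q2 = cls (v + w)"
    | "q1 = cls (v + w) \<and> q2 = cls v" | "q1 = cls w \<and> q2 = cls (v + w)" | "q1 = cls (v + w) \<and> q2 = cls w"
    using q by (auto simp: clstri_def)
  then show ?thesis
  proof cases
    case 1 then show ?thesis using g pos by blast
  next
    case 2 then show ?thesis using gs(1) pos comb(1) tr(1) by metis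
  next
    case 3 then show ?thesis using gs(2) pos comb(2) tr(2) cls_minus by metis
  next
    case 4 then show ?thesis using gs(3) pos comb(3) tr(3) cls_minus by metis
  next
    case 5 then show ?thesis using gs(4) pos comb(4) tr(4) cls_minus by metis
  next
    case 6 then show ?thesis using gs(5) pos comb(5) tr(5) cls_minus by metis
  qed
qed

text \<open>Equal barycentric coordinates mean proportional coefficients, the factor
  \<open>t\<close> being the ratio of the totals. The third generators have to match only if their
  coefficients are not both zero.\<close>

lemma proj_eq_match:
  assumes g: "good v w" "good v' w'" and pos: "0 \<le> a" "0 \<le> b" "0 \<le> c" "a + b + c > 0"
      "0 \<le> a'" "0 \<le> b'" "0 \<le> c'" "a' + b' + c' > 0"
    and cl: "cls v = cls v'" "cls w = cls w'" "c = 0 \<and> c' = 0 \<or> cls (v + w) = cls (v' + w')"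
    and eq: "bar v w a b c = bar v' w' a' b' c'"
  shows "\<exists>A\<in>\<Gamma>. \<exists>t>0. conj_act A (comb v w a b c) = t *\<^sub>R comb v' w' a' b' c'"
proof -
  obtain A where A: "A \<in> \<Gamma>" "outer_sq (A *v v) = outer_sq v'" "outer_sq (A *v w) = outer_sq w'"
    "cls (v + w) = cls (v' + w') \<longrightarrow> outer_sq (A *v (v + w)) = outer_sq (v' + w')"
    using match_pair[OF g cl(1,2)] by blast
  define t where "t = (a + b + c) / (a' + b' + c')"
  have t: "t > 0" using pos by (simp add: t_def)
  have "a / (a + b + c) = a' / (a' + b' + c')" "b / (a + b + c) = b' / (a' + b' + c')"
    using bar_at[OF g(1), of a b c] bar_at[OF g(2), of a' b' c'] eq cl by metis+
  moreover have "c / (a + b + c) = c' / (a' + b' + c')"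
    using cl(3) bar_at(3)[OF g(1), of a b c] bar_at(3)[OF g(2), of a' b' c'] eq by (metis div_0)
  ultimately have abc: "a = t * a'" "b = t * b'" "c = t * c'"
    using pos by (auto simp: t_def field_simps)
  have "conj_act A (comb v w a b c) = a *\<^sub>R outer_sq v' + b *\<^sub>R outer_sq w' + c *\<^sub>R outer_sq (v' + w')"
    using A cl(3) by (auto simp: comb_def conj_act_outer_sq)
  also have "\<dots> = t *\<^sub>R comb v' w' a' b' c'"
    by (simp add: comb_scale) (simp add: comb_def abc)
  finally show ?thesis using A(1) t by blast
qed

text \<open>The support of the projection has as many elements as the cell has generators, so two
  points with equal image lie in cells of the same kind, whose generators are then aligned class by
  class.\<close>

lemma proj_fibre:
  assumes "cone_pt x" "cone_pt x'" and eq: "proj x = proj x'"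
  shows "\<exists>A\<in>\<Gamma>. \<exists>t>0. conj_act A x = t *\<^sub>R x'"
proof -
  let ?s = "\<lambda>y. {q. proj y q \<noteq> (0::real)}"
  have s1: "?s (comb v w a 0 0) = {cls v}" if "good v w" "a > 0" for v w a
    using that bar_supp[OF that(1), of a 0 0] proj_comb[OF that(1), of a 0 0] by auto
  have s2: "?s (comb v w a b 0) = {cls v, cls w}" if "good v w" "a > 0" "b > 0" for v w a b
    using that bar_supp[OF that(1), of a b 0] proj_comb[OF that(1), of a b 0] by auto
  have s3: "?s (comb v w a b c) = clstri v w" if "good v w" "a > 0" "b > 0" "c > 0" for v w a b c
    using that bar_supp[OF that(1), of a b c] proj_comb[OF that(1), of a b c] by (auto simp: clstri_def)
  have c1: "card (?s (comb v w a 0 0)) = 1" if "good v w" "a > 0" for v w a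
    unfolding s1[OF that] by simp
  have c2: "card (?s (comb v w a b 0)) = 2" if "good v w" "a > 0" "b > 0" for v w a b
    unfolding s2[OF that] using cls_distinct[OF that(1)] by simp
  have c3: "card (?s (comb v w a b c)) = 3" if "good v w" "a > 0" "b > 0" "c > 0" for v w a b c
    unfolding s3[OF that] clstri_def using cls_distinct[OF that(1)] by simp
  from assms(1) show ?thesis
  proof (cases rule: cone_pt_cases)
    case x: (ray v w a)
    from assms(2) show ?thesis
    proof (cases rule: cone_pt_cases)
      case x': (ray v' w' a')
      have cl: "cls v = cls v'" using s1[of v w a] s1[of v' w' a'] x x' eq by auto
      obtain u where u: "u = v' \<or> u = - v'" "\<rho> u = \<rho> v" using cls_sign[OF cl] by blast
      \<comment> \<open>On a ray the second basis vector is free; it is replaced by a neighbour of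
        \<open>u\<close> with the reduction of \<open>w\<close>, so that pairs can be
        matched.\<close>
      have "good u w'" using u x' good_neg1 by blast
      then obtain z where z: "good u z" "\<rho> z = \<rho> w" using lift_neighbour[OF x(1)] u(2) by metis
      have x'': "x' = comb u z a' 0 0" using x' u(1) by (auto simp: comb_def)
      have b: "bar v w a 0 0 = bar u z a' 0 0"
        using eq x x' x'' z(1) proj_comb[of v w a 0 0] proj_comb[of u z a' 0 0] by simp
      show ?thesis unfolding x(3) x''
        by (rule proj_eq_match[OF x(1) z(1)]) (use x x' b u z in \<open>auto simp: cls_def\<close>)
    next
      case x': (edge v' w' a' b')
      then show ?thesis using c1[OF x(1-2)] c2[OF x'(1-3)] x(3) x'(4) eq by simp
    next
      case x': (tri v' w' a' b' c')
      then show ?thesis using c1[OF x(1-2)] c3[OF x'(1-4)] x(3) x'(5) eq by simp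
    qed
  next
    case x: (edge v w a b)
    from assms(2) show ?thesis
    proof (cases rule: cone_pt_cases)
      case x': (ray v' w' a')
      then show ?thesis using c2[OF x(1-3)] c1[OF x'(1-2)] x(4) x'(3) eq by simp
    next
      case x': (edge v' w' a' b')
      have "{cls v, cls w} = {cls v', cls w'}" using s2[of v w a b] s2[of v' w' a' b'] x x' eq by auto
      then have "cls v = cls v' \<and> cls w = cls w' \<or> cls v = cls w' \<and> cls w = cls v'"
        by (auto simp: doubleton_eq_iff)
      moreover have "x' = comb w' v' b' a' 0" using x' by (simp add: comb_def)
      ultimately obtain v'' w'' a'' b'' where y: "good v'' w''" "a'' > 0" "b'' > 0" "x' = comb v'' w'' a'' b'' 0"
          "cls v = cls v''" "cls w = cls w''"
        using x' good_swap by metis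
      have b: "bar v w a b 0 = bar v'' w'' a'' b'' 0"
        using eq x y proj_comb[of v w a b 0] proj_comb[of v'' w'' a'' b'' 0] by simp
      show ?thesis unfolding x(4) y(4)
        by (rule proj_eq_match[OF x(1) y(1)]) (use x y b in auto)
    next
      case x': (tri v' w' a' b' c')
      then show ?thesis using c2[OF x(1-3)] c3[OF x'(1-4)] x(4) x'(5) eq by simp
    qed
  next
    case x: (tri v w a b c)
    from assms(2) show ?thesis
    proof (cases rule: cone_pt_cases)
      case x': (ray v' w' a')
      then show ?thesis using c3[OF x(1-4)] c1[OF x'(1-2)] x(5) x'(3) eq by simp
    next
      case x': (edge v' w' a' b')
      then show ?thesis using c3[OF x(1-4)] c2[OF x'(1-3)] x(5) x'(4) eq by simp
    next
      case x': (tri v' w' a' b' c')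
      have T: "clstri v w = clstri v' w'" using s3[of v w a b c] s3[of v' w' a' b' c'] x x' eq by auto
      have "cls v \<in> clstri v' w'" "cls w \<in> clstri v' w'" unfolding T[symmetric] by (auto simp: clstri_def)
      then obtain v'' w'' a'' b'' c'' where y: "good v'' w''" "a'' > 0" "b'' > 0" "c'' > 0" "cls v'' = cls v"
          "cls w'' = cls w" "clstri v'' w'' = clstri v' w'" "x' = comb v'' w'' a'' b'' c''"
        using tri_permute[OF x'(1-4), of "cls v" "cls w"] cls_distinct(1)[OF x(1)] x'(5) by metis
      have "clstri v'' w'' = clstri v w" using y T by simp
      then have "cls (v + w) = cls (v'' + w'')"
        using cls_distinct[OF x(1)] y(5,6) unfolding clstri_def by auto
      moreover have "bar v w a b c = bar v'' w'' a'' b'' c''"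
        using eq x y proj_comb[of v w a b c] proj_comb[of v'' w'' a'' b'' c''] by simp
      ultimately show ?thesis unfolding x(5) y(8)
        by (intro proj_eq_match[OF x(1) y(1)]) (use x y in auto)
    qed
  qed
qed

end

section \<open>Cells, their images and their congruence\<close>

definition adm :: "(int ^ 'n) set set \<Rightarrow> int ^ 'n \<Rightarrow> int ^ 'n \<Rightarrow> real \<Rightarrow> real \<Rightarrow> real \<Rightarrow> bool" where
  "adm T v w a b c \<longleftrightarrow> 0 \<le> a \<and> 0 \<le> b \<and> 0 \<le> c \<and>
    (pm v \<notin> T \<longrightarrow> a = 0) \<and> (pm w \<notin> T \<longrightarrow> b = 0) \<and> (pm (v + w) \<notin> T \<longrightarrow> c = 0)"

lemma cell_cone:
  assumes T: "T \<subseteq> tri v w"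
  shows "convex_cone hull (Osq ` T) = {comb v w a b c | a b c. adm T v w a b c}" (is "?L = ?R")
proof
  have "convex_cone ?R"
    unfolding convex_cone_iff
  proof (intro conjI ballI allI impI)
    have "adm T v w 0 0 0" by (simp add: adm_def)
    then show "0 \<in> ?R" using comb_zero[of v w] by force
  next
    fix x y assume "x \<in> ?R" "y \<in> ?R"
    then obtain a b c a' b' c' where *: "x = comb v w a b c" "y = comb v w a' b' c'"
      "adm T v w a b c" "adm T v w a' b' c'" by blast
    then have "adm T v w (a + a') (b + b') (c + c')" by (auto simp: adm_def)
    then show "x + y \<in> ?R" unfolding * comb_add by blast
  next
    fix x and t :: real assume x: "x \<in> ?R" and t: "0 \<le> t"
    then obtain a b c where *: "x = comb v w a b c" "adm T v w a b c" by blast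
    then have "adm T v w (t * a) (t * b) (t * c)" using t by (auto simp: adm_def)
    then show "t *\<^sub>R x \<in> ?R" unfolding * comb_scale by blast
  qed
  moreover have "Osq p \<in> ?R" if p: "p \<in> T" for p
  proof -
    from p T consider "p = pm v" | "p = pm w" | "p = pm (v + w)" by (auto simp: tri_def)
    then show ?thesis
    proof cases
      case 1
      then have "Osq p = comb v w 1 0 0" "adm T v w 1 0 0" using p by (simp_all add: comb_def adm_def)
      then show ?thesis by blast
    next
      case 2
      then have "Osq p = comb v w 0 1 0" "adm T v w 0 1 0" using p by (simp_all add: comb_def adm_def)
      then show ?thesis by blast
    next
      case 3
      then have "Osq p = comb v w 0 0 1" "adm T v w 0 0 1" using p by (simp_all add: comb_def adm_def)
      then show ?thesis by blast
    qed
  qed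
  ultimately show "?L \<subseteq> ?R" by (intro hull_minimal) auto
  have m: "a *\<^sub>R outer_sq q \<in> ?L" if "0 \<le> a" "pm q \<notin> T \<longrightarrow> a = 0" for a q
  proof (cases "pm q \<in> T")
    case True
    then have "outer_sq q \<in> Osq ` T" by (metis Osq_pm imageI)
    then show ?thesis using that by (intro convex_cone_hull_mul hull_inc)
  next
    case False
    then show ?thesis using that convex_cone_hull_contains_0 by simp
  qed
  have "comb v w a b c \<in> ?L" if "adm T v w a b c" for a b c
    unfolding comb_def using that unfolding adm_def by (intro convex_cone_hull_add m) auto
  then show "?R \<subseteq> ?L" by blast
qed

lemma subset_triple:
  assumes "T \<subseteq> {a, b, c}" "T \<noteq> {}"
  shows "T \<in> {{a}, {b}, {c}, {a, b}, {a, c}, {b, c}, {a, b, c}}"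
proof -
  have "T \<in> Pow {a, b, c}" using assms(1) by blast
  then show ?thesis
    using assms(2) by (simp only: Pow_insert Pow_empty image_Un image_insert image_empty) blast
qed

lemma linear_conj_act: "linear (conj_act A)"
  by (rule linearI) simp_all

lemma closed_simplex_inj:
  assumes "closed_simplex \<sigma> = closed_simplex \<tau>" "finite \<sigma>" "finite \<tau>"
  shows "\<sigma> = \<tau>"
proof -
  have "a \<in> \<sigma> \<longleftrightarrow> (\<lambda>q. if q = a then 1 else 0) \<in> closed_simplex \<sigma>" if "finite \<sigma>" for a and \<sigma> :: "'a set"
    using that by (auto simp: closed_simplex_def)
  then show ?thesis using assms by blast
qed

lemma continuous_map_into_coherent:
  assumes "C \<in> \<C>" "continuous_on S g" "g ` S \<subseteq> C"
  shows "continuous_map (top_of_set S) (coherent_topology \<C>) g"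
proof -
  have "continuous_map (top_of_set C) (coherent_topology \<C>) id"
    unfolding continuous_map_def
  proof (intro conjI allI impI)
    show "id \<in> topspace (top_of_set C) \<rightarrow> topspace (coherent_topology \<C>)" using assms(1) by auto
    fix U assume "openin (coherent_topology \<C>) U"
    then have "openin (top_of_set C) (U \<inter> C)" using assms(1) by (auto simp: openin_coherent_topology)
    moreover have "{x \<in> topspace (top_of_set C). id x \<in> U} = U \<inter> C" by auto
    ultimately show "openin (top_of_set C) {x \<in> topspace (top_of_set C). id x \<in> U}" by simp
  qed
  moreover have "continuous_map (top_of_set S) (top_of_set C) g"
    using assms by (simp add: continuous_map_in_subtopology image_subset_iff_funcset)
  ultimately have "continuous_map (top_of_set S) (coherent_topology \<C>) (id \<circ> g)"
    using continuous_map_compose by blast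
  then show ?thesis by simp
qed

context fan_quotient begin

definition cell :: "(int ^ 'n) set set \<Rightarrow> bool" where
  "cell T \<longleftrightarrow> T \<noteq> {} \<and> (\<exists>v w. good v w \<and> T \<subseteq> tri v w)"

definition face :: "(int ^ 'n) set set \<Rightarrow> ('r ^ 'k) set set" where
  "face T = (\<lambda>p. \<rho> ` p) ` T"

lemma image_pm: "\<rho> ` pm u = cls u"
  by (auto simp: pm_def cls_def \<rho>_minus)

lemma face_tri: "face (tri v w) = clstri v w"
  by (simp add: face_def tri_def clstri_def image_pm)

lemma inj_on_tri: "good v w \<Longrightarrow> inj_on (\<lambda>p. \<rho> ` p) (tri v w)"
proof -
  assume g: "good v w"
  note cls_distinct[OF g] cls_distinct[OF g, symmetric]
  then show ?thesis
    unfolding tri_def by (intro inj_onI) (elim insertE emptyE; simp add: image_pm)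
qed

lemma mem_face:
  assumes "good v w" "T \<subseteq> tri v w"
  shows "cls v \<in> face T \<longleftrightarrow> pm v \<in> T" "cls w \<in> face T \<longleftrightarrow> pm w \<in> T" "cls (v + w) \<in> face T \<longleftrightarrow> pm (v + w) \<in> T"
proof -
  have "cls u \<in> face T \<longleftrightarrow> pm u \<in> T" if "pm u \<in> tri v w" for u
    unfolding face_def image_pm[symmetric]
    using inj_on_image_mem_iff[OF inj_on_tri[OF assms(1)] that assms(2)] .
  then show "cls v \<in> face T \<longleftrightarrow> pm v \<in> T" "cls w \<in> face T \<longleftrightarrow> pm w \<in> T" "cls (v + w) \<in> face T \<longleftrightarrow> pm (v + w) \<in> T"
    by (simp_all add: tri_def)
qed

lemma face_cplx: "cell T \<Longrightarrow> face T \<in> cplx"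
proof -
  assume "cell T"
  then obtain v w where g: "good v w" "T \<subseteq> tri v w" "T \<noteq> {}" by (auto simp: cell_def)
  then have "face T \<subseteq> clstri v w" "face T \<noteq> {}"
    unfolding face_tri[symmetric] by (auto simp: face_def)
  then show ?thesis using g(1) by (auto simp: cplx_def)
qed

lemma cplx_face:
  assumes "\<sigma> \<in> cplx" obtains T where "cell T" "face T = \<sigma>"
proof -
  obtain v w where g: "good v w" "\<sigma> \<subseteq> clstri v w" "\<sigma> \<noteq> {}" using assms by (auto simp: cplx_def)
  let ?T = "{p \<in> tri v w. \<rho> ` p \<in> \<sigma>}"
  have "face ?T = \<sigma>" using g(2) unfolding face_tri[symmetric] face_def by auto
  moreover have "cell ?T" using g calculation unfolding cell_def face_def by blast
  ultimately show thesis using that by blast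
qed

lemma proj_cell:
  assumes "cell T"
  shows "proj ` (convex_cone hull (Osq ` T) - {0}) = closed_simplex (face T)"
proof -
  obtain v w where g: "good v w" and T: "T \<subseteq> tri v w" using assms by (auto simp: cell_def)
  have sub: "face T \<subseteq> clstri v w" using T unfolding face_tri[symmetric] by (auto simp: face_def)
  note C = cell_cone[OF T] and mem = mem_face[OF g T]
  show ?thesis
  proof (intro equalityI subsetI)
    fix y assume "y \<in> proj ` (convex_cone hull (Osq ` T) - {0})"
    then obtain a b c where "y = proj (comb v w a b c)" "comb v w a b c \<noteq> 0" "adm T v w a b c"
      unfolding C by blast
    then have *: "y = proj (comb v w a b c)" "comb v w a b c \<noteq> 0" "0 \<le> a" "0 \<le> b" "0 \<le> c"
      "pm v \<notin> T \<longrightarrow> a = 0" "pm w \<notin> T \<longrightarrow> b = 0" "pm (v + w) \<notin> T \<longrightarrow> c = 0"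
      by (simp_all add: adm_def)
    moreover have "a + b + c > 0" using *(2-5) comb_zero[of v w] by (cases "a = 0"; cases "b = 0"; cases "c = 0") auto
    ultimately show "y \<in> closed_simplex (face T)"
      using sub mem by (auto simp: proj_comb[OF g] intro!: bar_in_closed_simplex[OF g])
  next
    fix p assume p: "p \<in> closed_simplex (face T)"
    have "sect v w p \<in> convex_cone hull (Osq ` T)"
    proof -
      have "adm T v w (p (cls v)) (p (cls w)) (p (cls (v + w)))"
        using p mem by (auto simp: adm_def closed_simplex_def)
      then show ?thesis unfolding C sect_def by blast
    qed
    then show "p \<in> proj ` (convex_cone hull (Osq ` T) - {0})"
      using sect[OF g sub p] unfolding cone_pt_def by (metis DiffI image_eqI singletonD)
  qed
qed

text \<open>A relative interior point of the first cell has a congruent multiple in the second. By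
  uniqueness of coefficients the congruence carries the generators of the first cell into those of
  the second, and both have as many as the common face has vertices.\<close>

lemma cell_match:
  assumes T: "cell T" and T': "cell T'" and eq: "face T = face T'"
  shows "\<exists>A\<in>\<Gamma>. conj_act A ` (convex_cone hull (Osq ` T)) = convex_cone hull (Osq ` T')"
proof -
  obtain v w where g: "good v w" and Ts: "T \<subseteq> tri v w" and ne: "T \<noteq> {}" using T by (auto simp: cell_def)
  obtain v' w' where g': "good v' w'" and Ts': "T' \<subseteq> tri v' w'" using T' by (auto simp: cell_def)
  note C = cell_cone[OF Ts] and C' = cell_cone[OF Ts']
  \<comment> \<open>Coefficient 1 on each generator of \<open>T\<close>: the resulting point lies in
    no proper face, so its coefficient function detects all of \<open>T\<close>.\<close>
  define a b c where "a = (if pm v \<in> T then 1 else 0 :: real)" and "b = (if pm w \<in> T then 1 else 0 :: real)"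
    and "c = (if pm (v + w) \<in> T then 1 else 0 :: real)"
  note abc = a_def b_def c_def
  let ?x = "comb v w a b c"
  have nn: "0 \<le> a" "0 \<le> b" "0 \<le> c" by (auto simp: abc)
  have "a + b + c > 0" using ne Ts by (auto simp: abc tri_def)
  then have x: "cone_pt ?x" using cone_pt_comb[OF g nn] by blast
  have "adm T v w a b c" by (simp add: adm_def abc)
  then have "?x \<in> convex_cone hull (Osq ` T)" unfolding C by blast
  then have "proj ?x \<in> closed_simplex (face T')"
    unfolding eq[symmetric] proj_cell[OF T, symmetric] using x by (auto simp: cone_pt_def)
  then obtain x' where x': "x' \<in> convex_cone hull (Osq ` T')" "x' \<noteq> 0" "proj ?x = proj x'"
    unfolding proj_cell[OF T', symmetric] by auto
  then obtain a' b' c' where "x' = comb v' w' a' b' c'" "adm T' v' w' a' b' c'"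
    unfolding C' by blast
  then have e: "x' = comb v' w' a' b' c'" "0 \<le> a'" "0 \<le> b'" "0 \<le> c'"
      "pm v' \<notin> T' \<longrightarrow> a' = 0" "pm w' \<notin> T' \<longrightarrow> b' = 0" "pm (v' + w') \<notin> T' \<longrightarrow> c' = 0"
    by (simp_all add: adm_def)
  have "cone_pt x'" unfolding cone_pt_def using e x'(2) g' by blast
  then obtain A t where A: "A \<in> \<Gamma>" "t > 0" "conj_act A ?x = t *\<^sub>R x'"
    using proj_fibre[OF x _ x'(3)] by blast
  have gA: "good (A *v v) (A *v w)" using \<Gamma>_good A(1) g by blast
  have "coefs (A *v v) (A *v w) a b c = coefs v' w' (t * a') (t * b') (t * c')"
    by (rule coefs_unique[OF good_upair[OF gA] nn good_upair[OF g']])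
      (use A e in \<open>auto simp: conj_act_comb comb_scale\<close>)
  moreover have "coefs v' w' (t * a') (t * b') (t * c') p = 0" if np: "p \<notin> T'" for p
  proof -
    have z: "(if p = pm u then t * k else 0) = 0" if "pm u \<notin> T' \<longrightarrow> k = 0" for u k
      using np that by auto
    show ?thesis unfolding coefs_def z[OF e(5)] z[OF e(6)] z[OF e(7)] by simp
  qed
  ultimately have sub: "p \<in> T'" if "coefs (A *v v) (A *v w) a b c p \<noteq> 0" for p
    using that by metis
  let ?f = "\<lambda>p. (*v) A ` p"
  have Apm: "?f (pm u) = pm (A *v u)" for u
  proof -
    have "A *v (- u) = - (A *v u)" using matrix_vector_smult[of A "-1" u] by simp
    then show ?thesis by (simp add: pm_def)
  qed
  note d = upair_distinct[OF good_upair[OF gA], folded matrix_vector_right_distrib]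
  have im: "?f p \<in> T'" if "p \<in> T" for p
  proof -
    from that Ts consider "p = pm v" | "p = pm w" | "p = pm (v + w)" by (auto simp: tri_def)
    then show ?thesis
    proof cases
      case 1 then show ?thesis using that nn
        by (simp add: Apm) (rule sub, simp add: coefs_def abc)
    next
      case 2 then show ?thesis using that nn
        by (simp add: Apm) (rule sub, simp add: coefs_def abc)
    next
      case 3 then show ?thesis using that nn
        by (simp add: Apm) (rule sub, simp add: coefs_def abc matrix_vector_right_distrib)
    qed
  qed
  have "inj_on ?f (tri v w)"
    using d by (auto simp: tri_def Apm inj_on_def)
  then have "inj_on ?f T" using Ts inj_on_subset by blast
  then have "card (?f ` T) = card T" by (rule card_image)
  also have "\<dots> = card (face T)"
    unfolding face_def using card_image[OF inj_on_subset[OF inj_on_tri[OF g] Ts]] by simp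
  also have "\<dots> = card T'"
    unfolding eq unfolding face_def using card_image[OF inj_on_subset[OF inj_on_tri[OF g'] Ts']] by simp
  finally have "?f ` T = T'"
    using im by (intro card_subset_eq) (auto intro: finite_subset[OF Ts'])
  moreover have "Osq (?f p) = conj_act A (Osq p)" if "p \<in> T" for p
    using that Ts by (auto simp: tri_def Apm conj_act_outer_sq)
  ultimately have "Osq ` T' = conj_act A ` (Osq ` T)"
    by (metis (no_types, lifting) image_cong image_image)
  then show ?thesis
    using A(1) convex_cone_hull_linear_image[OF linear_conj_act] by metis
qed

lemma openin_nonzero: "openin (coherent_topology \<C>) (\<Union>\<C> - {0 :: real ^ 'n ^ 'n})"
  unfolding openin_coherent_topology
proof (intro conjI ballI)
  fix C assume "C \<in> \<C>"
  then have "(\<Union>\<C> - {0}) \<inter> C = C - {0}" by blast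
  then show "openin (top_of_set C) ((\<Union>\<C> - {0}) \<inter> C)"
    by (metis Diff_eq Int_commute openin_open_Int open_Compl closed_singleton)
qed blast

lemma openin_proj_preimage:
  assumes C: "\<And>C. C \<in> \<C> \<Longrightarrow> \<exists>v w. good v w \<and> C \<subseteq> convex_cone hull {outer_sq v, outer_sq w, outer_sq (v + w)}"
    and V: "open V"
  shows "openin (coherent_topology \<C>) {x \<in> \<Union>\<C> - {0}. proj x q \<in> V}"
  unfolding openin_coherent_topology
proof (intro conjI ballI)
  fix C assume CC: "C \<in> \<C>"
  then obtain v w where vw: "good v w" "C \<subseteq> convex_cone hull {outer_sq v, outer_sq w, outer_sq (v + w)}"
    using C by blast
  have "continuous_on (C - {0}) (\<lambda>x. proj x q)"
    by (rule continuous_on_subset[OF continuous_on_proj[OF vw(1)]]) (use vw in auto)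
  then have "openin (top_of_set (C - {0})) ((C - {0}) \<inter> (\<lambda>x. proj x q) -` V)"
    using V continuous_openin_preimage_gen by blast
  moreover have "openin (top_of_set C) (C - {0})"
    by (metis Diff_eq openin_open_Int open_Compl closed_singleton)
  ultimately have "openin (top_of_set C) ((C - {0}) \<inter> (\<lambda>x. proj x q) -` V)"
    using openin_trans by blast
  moreover have "(C - {0}) \<inter> (\<lambda>x. proj x q) -` V = {x \<in> \<Union>\<C> - {0}. proj x q \<in> V} \<inter> C"
    using CC by blast
  ultimately show "openin (top_of_set C) ({x \<in> \<Union>\<C> - {0}. proj x q \<in> V} \<inter> C)" by simp
qed blast

lemma cell_subset_cone3:
  assumes "cell T"
  shows "\<exists>v w. good v w \<and> convex_cone hull (Osq ` T) \<subseteq> convex_cone hull {outer_sq v, outer_sq w, outer_sq (v + w)}"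
proof -
  obtain v w where g: "good v w" and T: "T \<subseteq> tri v w" using assms by (auto simp: cell_def)
  have "Osq ` T \<subseteq> {outer_sq v, outer_sq w, outer_sq (v + w)}" using T by (auto simp: tri_def)
  then show ?thesis using g hull_mono by blast
qed

lemma cell_cone_pt:
  assumes "cell T" "x \<in> convex_cone hull (Osq ` T)" "x \<noteq> 0" shows "cone_pt x"
proof -
  obtain v w where g: "good v w" and T: "T \<subseteq> tri v w" using assms by (auto simp: cell_def)
  show ?thesis using assms(2,3) g unfolding cell_cone[OF T] cone_pt_def adm_def by blast
qed

lemma cell_cases:
  assumes "cell T"
  obtains (ray) v w where "good v w" "T = {pm v}" | (edge) v w where "good v w" "T = {pm v, pm w}"
    | (tri) v w where "good v w" "T = tri v w"
proof -
  obtain v w where g: "good v w" and T: "T \<subseteq> tri v w" "T \<noteq> {}" using assms by (auto simp: cell_def)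
  have gs: "good w v" "good (v + w) v" "good v (v + w)" "good w (v + w)"
    using good_swap good_add g by (blast, blast, blast, metis good_swap good_add add.commute)
  have "T \<in> {{pm v}, {pm w}, {pm (v + w)}, {pm v, pm w}, {pm v, pm (v + w)}, {pm w, pm (v + w)}, tri v w}"
    unfolding tri_def using subset_triple[OF T[unfolded tri_def]] .
  then show ?thesis
    unfolding insert_iff empty_iff
    by - (elim disjE FalseE;
        erule ray[OF g] ray[OF gs(1)] ray[OF gs(2)] edge[OF g] edge[OF gs(3)] edge[OF gs(4)] tri[OF g])
qed

lemma sect_cone3: "p \<in> closed_simplex S \<Longrightarrow> sect v w p \<in> convex_cone hull {outer_sq v, outer_sq w, outer_sq (v + w)}"
  unfolding cone3_eq sect_def closed_simplex_def by blast

text \<open>\<open>C\<close> gives continuity, checked on each cone; \<open>C'\<close> provides the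
  full cones into which the sections over the simplices map.\<close>

lemma quotient_map_proj:
  assumes K: "finite cplx"
    and C: "\<And>C. C \<in> \<C> \<Longrightarrow> \<exists>v w. good v w \<and> C \<subseteq> convex_cone hull {outer_sq v, outer_sq w, outer_sq (v + w)}"
    and C': "\<And>v w. good v w \<Longrightarrow> convex_cone hull {outer_sq v, outer_sq w, outer_sq (v + w)} \<in> \<C>"
  shows "quotient_map (subtopology (coherent_topology \<C>) (\<Union>\<C> - {0})) (realization cplx) proj"
proof -
  let ?X = "coherent_topology \<C>" and ?U = "\<Union>\<C> - {0}"
  have top: "topspace (subtopology ?X ?U) = ?U" by auto
  have pt: "cone_pt x" if "x \<in> ?U" for x
    using that C unfolding cone3_eq cone_pt_def by blast
  have real: "realization cplx = top_of_set (polyhedron_of cplx)"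
    by (rule realization_finite[OF K]) (rule cplx_finite)
  have cont: "continuous_map (subtopology ?X ?U) (realization cplx) proj"
    unfolding real
  proof (rule continuous_map_into_functions)
    show "proj x \<in> polyhedron_of cplx" if "x \<in> topspace (subtopology ?X ?U)" for x
      using that pt proj_in unfolding top by blast
    show "continuous_map (subtopology ?X ?U) euclideanreal (\<lambda>x. proj x q)" for q
      unfolding continuous_map_def top
    proof (intro conjI allI impI)
      fix V assume "openin euclideanreal V"
      then have "open V" by simp
      then have "openin ?X {x \<in> ?U. proj x q \<in> V}" using openin_proj_preimage[of \<C> V q] C by blast
      then show "openin (subtopology ?X ?U) {x \<in> ?U. proj x q \<in> V}"
        by (simp add: openin_open_subtopology[OF openin_nonzero]) blast
    qed auto
  qed
  show ?thesis
    unfolding realization_def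
  proof (rule quotient_map_coherent_sections)
    show "continuous_map (subtopology ?X ?U) (coherent_topology (closed_simplex ` cplx)) proj"
      using cont by (simp add: realization_def)
    fix S assume "S \<in> closed_simplex ` cplx"
    then obtain \<sigma> v w where \<sigma>: "S = closed_simplex \<sigma>" "good v w" "\<sigma> \<subseteq> clstri v w"
      unfolding cplx_def by blast
    have s: "proj (sect v w p) = p \<and> cone_pt (sect v w p)" if "p \<in> S" for p
      using sect[OF \<sigma>(2,3)] that \<sigma>(1) by blast
    have "continuous_map (top_of_set S) ?X (sect v w)"
      by (rule continuous_map_into_coherent[OF C'[OF \<sigma>(2)] continuous_on_sect])
        (use sect_cone3 \<sigma>(1) in blast)
    then have "continuous_map (top_of_set S) (subtopology ?X ?U) (sect v w)"
    proof (rule continuous_map_into_subtopology)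
      have "sect v w p \<in> ?U" if "p \<in> S" for p
        using sect_cone3 C'[OF \<sigma>(2)] s[OF that] that \<sigma>(1) unfolding cone_pt_def by blast
      then show "sect v w \<in> topspace (top_of_set S) \<rightarrow> ?U" by auto
    qed
    then show "\<exists>g. continuous_map (top_of_set S) (subtopology ?X ?U) g \<and> (\<forall>p\<in>S. proj (g p) = p)"
      using s by blast
  qed
qed



end

section \<open>Planes\<close>

lemma fan_scale:
  assumes "x \<in> \<Union>(fan P)" "0 < t" shows "t *\<^sub>R x \<in> \<Union>(fan P)"
proof -
  obtain C where C: "C \<in> fan P" "x \<in> C" using assms by blast
  have "t *\<^sub>R x \<in> C"
    using C assms(2) unfolding fan_def by (auto intro: convex_cone_hull_mul)
  then show ?thesis using C by blast
qed

text \<open>A basis of a free summand of rank two identifies it with pairs of residues. The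
  reduction \<open>rho\<close> takes its values in the plane itself, so that the resulting complex
  is equal to \<open>S_complex\<close> and not merely isomorphic to it.\<close>

locale plane_frame =
  fixes p1 p2 :: "'m::nontriv mod_ring ^ 4"
  assumes frame: "upair p1 p2" and m3: "CARD('m) \<ge> 3"
begin

definition emb :: "'m mod_ring ^ 2 \<Rightarrow> 'm mod_ring ^ 4" where
  "emb u = u $ 1 *s p1 + u $ 2 *s p2"

definition rho :: "int ^ 2 \<Rightarrow> 'm mod_ring ^ 4" where "rho v = emb (red v)"

lemma emb_simps: "emb (u + v) = emb u + emb v" "emb (- u) = - emb u" "emb (a *s u) = a *s emb u"
  "emb (u - v) = emb u - emb v" "emb 0 = 0"
  by (simp_all add: emb_def vec_eq_iff algebra_simps)

lemma emb_inj: "emb u = emb v \<Longrightarrow> u = v"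
proof -
  assume "emb u = emb v"
  then have "emb (u - v) = 0" by (simp add: emb_simps)
  then have "(u - v) $ 1 = 0 \<and> (u - v) $ 2 = 0"
    unfolding emb_def by (rule upair_indep[OF frame])
  then show "u = v" by (simp add: vec2_eq_iff)
qed

lemma frame_dual:
  obtains c d where "\<And>u. dotp c (emb u) = u $ 1" "\<And>u. dotp d (emb u) = u $ 2"
proof -
  obtain c d where cd: "dotp c p1 = 1" "dotp c p2 = 0" "dotp d p1 = 0" "dotp d p2 = 1"
    using frame by (auto simp: upair_def)
  show thesis by (rule that[of c d]) (simp_all add: emb_def cd)
qed

text \<open>Where m \<ge> 3 enters: distinct signs stay distinct modulo m, and 2 is not
  zero.\<close>

lemma small_not_0: "(1 :: 'm mod_ring) \<noteq> - 1" "(2 :: 'm mod_ring) \<noteq> 0"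
proof -
  have "(of_int 2 :: 'm mod_ring) \<noteq> 0"
    unfolding of_int_mod_ring_eq_0_iff using m3 zdvd_imp_le by fastforce
  then show "(2 :: 'm mod_ring) \<noteq> 0" by simp
  then show "(1 :: 'm mod_ring) \<noteq> - 1" by (metis add.inverse_inverse add_eq_0_iff one_add_one)
qed

lemma upair_int_det: "upair v w \<Longrightarrow> det2 v w = 1 \<or> det2 v w = (-1 :: int)" for v w :: "int ^ 2"
  unfolding upair_2_iff by (auto simp: zdvd1_eq)

sublocale fan_quotient upair "GL2_level CARD('m)" rho
proof
  fix v w v' w' w'' :: "int ^ 2" and A
  show "upair v w \<Longrightarrow> upair v w" .
  show "upair v w \<Longrightarrow> upair w v" by (rule upair_sym)
  show "upair v w \<Longrightarrow> upair v (- w)" by (rule upair_minus)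
  show "upair v w \<Longrightarrow> upair v (v + w)" using upair_add[of v w 1] by simp
  show "rho (v + w) = rho v + rho w" "rho (- v) = - rho v" by (simp_all add: rho_def emb_simps)
  \<comment> \<open>The determinant is 1 or -1, so neither it nor its double vanishes modulo m; this
    separates the reductions of a pair and excludes 2-torsion.\<close>
  have ne: "det2 (red v) (red w) \<noteq> (0 :: 'm mod_ring)" "det2 (red v) (red w) + det2 (red v) (red w) \<noteq> (0 :: 'm mod_ring)"
    if "upair v w" for v w :: "int ^ 2"
  proof -
    have "(- 1 :: 'm mod_ring) + - 1 = - 2" by simp
    then have "(- 1 :: 'm mod_ring) + - 1 \<noteq> 0" using small_not_0(2) by (metis neg_equal_0_iff_equal)
    then show "det2 (red v) (red w) \<noteq> (0 :: 'm mod_ring)"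
      "det2 (red v) (red w) + det2 (red v) (red w) \<noteq> (0 :: 'm mod_ring)"
      using upair_int_det[OF that] small_not_0(2) unfolding det2_red by auto
  qed
  show "rho v \<noteq> rho w" if "upair v w"
  proof
    assume "rho v = rho w"
    then have "red v = (red w :: 'm mod_ring ^ 2)" unfolding rho_def by (rule emb_inj)
    then show False using ne(1)[OF that] by simp
  qed
  show "rho v + rho v \<noteq> 0" if "upair v w"
  proof
    assume "rho v + rho v = 0"
    then have "emb (red v + red v) = emb 0" by (simp only: rho_def emb_simps)
    then have "red v + red v = (0 :: 'm mod_ring ^ 2)" by (rule emb_inj)
    then have "det2 (red v + red v) (red w :: 'm mod_ring ^ 2) = 0" by (simp only: det2_simps)
    then show False using ne(2)[OF that] by (simp only: det2_simps)
  qed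
  show "upair (A *v v) (A *v w)" if "A \<in> GL2_level CARD('m)" "upair v w"
    using that upair_matrix by (auto simp: GL2_level_def)
  show "rho (A *v v) = rho v" if "A \<in> GL2_level CARD('m)"
    using that by (simp add: GL2_level_def congruent_to_one_iff rho_def)
  show "\<exists>w'. upair v' w' \<and> rho w' = rho w" if g: "upair v w" "upair v' w''" "rho v = rho v'"
  proof -
    have r: "red v = (red v' :: 'm mod_ring ^ 2)" using g(3) unfolding rho_def by (rule emb_inj)
    \<comment> \<open>The determinant of \<open>v\<close>, \<open>w\<close> depends on reductions
      only modulo m, but the lifted neighbour of \<open>v'\<close> can be given the same integral
      determinant, again a unit.\<close>
    have "det2 (red v') (red w :: 'm mod_ring ^ 2) = of_int (det2 v w)"
      unfolding r[symmetric] by (rule det2_red)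
    then obtain w' where "red w' = (red w :: 'm mod_ring ^ 2)" "det2 v' w' = det2 v w"
      using det2_lift[OF upair_primitive(1)[OF g(2)]] by blast
    then show ?thesis using g(1) unfolding upair_2_iff rho_def by metis
  qed
  show "\<exists>A\<in>GL2_level CARD('m). A *v v = v' \<and> A *v w = w'"
    if "upair v w" "upair v' w'" "rho v = rho v'" "rho w = rho w'"
    using GL2_level_lift[OF that(1,2)] emb_inj that(3,4) unfolding rho_def by blast
qed

text \<open>Translates the cones into cells of sign classes. For a ray, the primitive generator is
  first completed to a basis.\<close>

lemma fan2_cones:
  "C \<in> fan (UNIV :: (int ^ 2) set) \<and> C \<noteq> {0} \<longleftrightarrow> (\<exists>T. cell T \<and> C = convex_cone hull (Osq ` T))"
proof
  assume "C \<in> fan (UNIV :: (int ^ 2) set) \<and> C \<noteq> {0}"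
  then consider v where "primitive v" "C = convex_cone hull {outer_sq v}"
    | v w where "upair v w" "C = convex_cone hull {outer_sq v, outer_sq w}"
    | v w where "upair v w" "C = convex_cone hull {outer_sq v, outer_sq w, outer_sq (v + w)}"
    unfolding fan_def basis_UNIV_2_iff by blast
  then show "\<exists>T. cell T \<and> C = convex_cone hull (Osq ` T)"
  proof cases
    case 1
    obtain w where "upair v w" using primitive_2_det[OF 1(1)] unfolding upair_2_iff by (metis dvd_refl)
    then have "cell {pm v}" unfolding cell_def tri_def by blast
    then show ?thesis using 1(2) by (intro exI[of _ "{pm v}"]) simp
  next
    case 2
    then have "cell {pm v, pm w}" unfolding cell_def tri_def by blast
    then show ?thesis using 2(2) by (intro exI[of _ "{pm v, pm w}"]) simp
  next
    case 3
    then have "cell (tri v w)" unfolding cell_def by (auto simp: tri_def)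
    then show ?thesis using 3(2) by (intro exI[of _ "tri v w"]) (simp add: tri_def)
  qed
next
  assume "\<exists>T. cell T \<and> C = convex_cone hull (Osq ` T)"
  then obtain T where T: "cell T" "C = convex_cone hull (Osq ` T)" by blast
  from T(1) have "C \<in> fan UNIV"
  proof (cases rule: cell_cases)
    case (ray v w)
    then show ?thesis using T(2) upair_primitive(1)[of v w] unfolding fan_def by auto
  next
    case (edge v w)
    then show ?thesis using T(2) unfolding fan_def basis_UNIV_2_iff by auto
  next
    case (tri v w)
    then show ?thesis using T(2) unfolding fan_def basis_UNIV_2_iff by (auto simp: tri_def)
  qed
  \<comment> \<open>Away from the apex a cell projects onto a closed simplex with at least one
    vertex, which is not empty.\<close>
  moreover have "C \<noteq> {0}"
  proof
    assume "C = {0}"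
    then have "closed_simplex (face T) = {}" using proj_cell[OF T(1)] T(2) by simp
    moreover obtain q where "q \<in> face T" using T(1) unfolding cell_def face_def by blast
    then have "(\<lambda>x. if x = q then 1 else 0) \<in> closed_simplex (face T)"
      using cplx_finite[OF face_cplx[OF T(1)]] by (auto simp: closed_simplex_def)
    ultimately show False by blast
  qed
  ultimately show "C \<in> fan UNIV \<and> C \<noteq> {0}" by blast
qed

lemma finite_cplx: "finite cplx"
  by simp

lemma GL2_group:
  "mat 1 \<in> GL2_level CARD('m)"
  "A \<in> GL2_level CARD('m) \<Longrightarrow> B \<in> GL2_level CARD('m) \<Longrightarrow> A ** B \<in> GL2_level CARD('m)"
  "A \<in> GL2_level CARD('m) \<Longrightarrow> \<exists>B\<in>GL2_level CARD('m). B ** A = mat 1"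
proof -
  show "mat 1 \<in> GL2_level CARD('m)"
    by (auto simp: GL2_level_def congruent_to_one_iff invertible_def)
  show "A ** B \<in> GL2_level CARD('m)" if "A \<in> GL2_level CARD('m)" "B \<in> GL2_level CARD('m)"
    using that invertible_mult by (auto simp: GL2_level_def congruent_to_one_iff simp flip: matrix_vector_mul_assoc)
  show "\<exists>B\<in>GL2_level CARD('m). B ** A = mat 1" if A: "A \<in> GL2_level CARD('m)"
  proof -
    obtain B where B: "A ** B = mat 1" "B ** A = mat 1" using A by (auto simp: GL2_level_def invertible_def)
    have "red (B *v v) = (red v :: 'm mod_ring ^ 2)" for v
    proof -
      have "red (A *v (B *v v)) = (red (B *v v) :: 'm mod_ring ^ 2)"
        using A by (simp add: GL2_level_def congruent_to_one_iff)
      then show ?thesis by (simp add: matrix_vector_mul_assoc B)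
    qed
    then have "B \<in> GL2_level CARD('m)" using B by (auto simp: GL2_level_def congruent_to_one_iff invertible_def)
    then show ?thesis using B by blast
  qed
qed

end

lemma conj_act_mult:
  fixes A B :: "int ^ 'n ^ 'n"
  shows "conj_act (A ** B) Q = conj_act A (conj_act B Q)"
proof -
  define R :: "int ^ 'n ^ 'n \<Rightarrow> real ^ 'n ^ 'n" where "R A = (\<chi> i j. real_of_int (A $ i $ j))" for A
  have R: "R (A ** B) = R A ** R B" for A B
    by (simp add: R_def vec_eq_iff matrix_matrix_mult_def)
  show ?thesis
    unfolding conj_act_def Let_def R_def[symmetric] R by (simp add: matrix_transpose_mul matrix_mul_assoc)
qed

lemma conj_act_one:
  fixes Q :: "real ^ 'n ^ 'n"
  shows "conj_act (mat 1) Q = Q"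
proof -
  have "(\<chi> i j. real_of_int (mat 1 $ i $ j)) = (mat 1 :: real ^ 'n ^ 'n)"
    by (simp add: vec_eq_iff mat_def)
  then show ?thesis by (simp add: conj_act_def Let_def transpose_mat)
qed

section \<open>The isomorphism with the link for the congruence subgroup of GL_2\<close>

context plane_frame begin

lemma GL2_rel_iff: "(x, y) \<in> GL2_rel CARD('m) \<longleftrightarrow> (\<exists>A\<in>GL2_level CARD('m). y = conj_act A x)"
  by (auto simp: GL2_rel_def)

lemma GL2_rel_refl: "(x, x) \<in> GL2_rel CARD('m)"
  unfolding GL2_rel_iff using GL2_group(1) conj_act_one by metis

lemma GL2_rel_sym: "(x, y) \<in> GL2_rel CARD('m) \<Longrightarrow> (y, x) \<in> GL2_rel CARD('m)"
  unfolding GL2_rel_iff using GL2_group(3) conj_act_one conj_act_mult by metis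

lemma GL2_rel_trans: "(x, y) \<in> GL2_rel CARD('m) \<Longrightarrow> (y, z) \<in> GL2_rel CARD('m) \<Longrightarrow> (x, z) \<in> GL2_rel CARD('m)"
  unfolding GL2_rel_iff using GL2_group(2) conj_act_mult by metis

lemma GL2_class_eq: "GL2_rel CARD('m) `` {x} = GL2_rel CARD('m) `` {y} \<longleftrightarrow> (x, y) \<in> GL2_rel CARD('m)"
  using GL2_rel_refl GL2_rel_sym GL2_rel_trans by blast

lemma fan_cone3: "upair v w \<Longrightarrow> convex_cone hull {outer_sq v, outer_sq w, outer_sq (v + w)} \<in> fan (UNIV :: (int ^ 2) set)"
  unfolding fan_def basis_UNIV_2_iff by blast

lemma fan_in_cone3: "C \<in> fan (UNIV :: (int ^ 2) set) \<Longrightarrow>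
  \<exists>v w. upair v w \<and> C \<subseteq> convex_cone hull {outer_sq v, outer_sq w, outer_sq (v + w)}"
proof (cases "C = {0}")
  case True
  have "upair (vector [1, 0]) (vector [0, 1] :: int ^ 2)" by (simp add: upair_2_iff det2_def)
  then show ?thesis using True convex_cone_hull_contains_0 by blast
next
  case False
  assume "C \<in> fan (UNIV :: (int ^ 2) set)"
  then show ?thesis using False fan2_cones[of C] cell_subset_cone3 by blast
qed

text \<open>The homeomorphism comes from two quotient maps with equal fibres. For the bijection of
  simplices, the orbit of a cell and its face determine each other: congruent cells have the same
  projection, and cells over one face are congruent by \<open>cell_match\<close>.\<close>

theorem isomorphic_link: "isomorphic_to_PD2_link cplx CARD('m)"
proof -
  let ?m = "CARD('m)" and ?F = "fan (UNIV :: (int ^ 2) set)"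
  let ?r = "GL2_rel ?m" and ?X = "PD2_rt"
  have top: "topspace ?X = \<Union>?F" by (simp add: PD2_rt_def fan_support_def)
  define H where "H x = scaling_rel PD2_scale (PD2_quot ?m) (?r `` {0}) `` {?r `` {x}}" for x
  have q1: "quotient_map (subtopology ?X (topspace ?X - {0})) (realization cplx) proj"
    unfolding top unfolding PD2_rt_def fan_support_def
    by (rule quotient_map_proj[OF finite_cplx fan_in_cone3 fan_cone3])
  have pt: "cone_pt x" if x: "x \<in> topspace ?X - {0}" for x
  proof -
    obtain C where C: "C \<in> ?F" "x \<in> C" "x \<noteq> 0" using x unfolding top by blast
    then have "C \<noteq> {0}" by blast
    then obtain T where "cell T" "C = convex_cone hull (Osq ` T)" using fan2_cones C(1) by blast
    then show ?thesis using cell_cone_pt C by blast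
  qed
  have zero: "(0, x) \<in> ?r \<longleftrightarrow> x \<in> {0}" for x
    using GL2_rel_refl[of 0] by (auto simp: GL2_rel_iff)
  have scl: "PD2_scale t (?r `` {x}) = ?r `` {t *\<^sub>R x}" for t x
    unfolding PD2_scale_def by (auto simp: GL2_rel_iff Image_def image_iff)
  have z: "0 \<in> topspace ?X" unfolding top fan_def by auto
  have op: "openin ?X (topspace ?X - {0})"
    unfolding top unfolding PD2_rt_def fan_support_def by (rule openin_nonzero)
  note ql = quotient_map_cone_link[of ?X ?r "\<lambda>t x. t *\<^sub>R x" PD2_scale 0 "{0}", OF GL2_class_eq _ scl _ _ z zero _ op]
  have q2: "quotient_map (subtopology ?X (topspace ?X - {0})) (PD2_link ?m) H"
    unfolding PD2_link_def PD2_quot_def H_def by (rule ql(1)) (use fan_scale[where P = "UNIV :: (int ^ 2) set"] in \<open>auto simp: top\<close>)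
  have H: "H x = H y \<longleftrightarrow> (\<exists>t>0. (t *\<^sub>R x, y) \<in> ?r)" if "x \<in> topspace ?X - {0}" "y \<in> topspace ?X - {0}" for x y
    unfolding PD2_quot_def H_def by (rule ql(2)) (use fan_scale[where P = "UNIV :: (int ^ 2) set"] that in \<open>auto simp: top\<close>)
  have fib: "proj x = proj y \<longleftrightarrow> H x = H y" if x: "x \<in> topspace ?X - {0}" and y: "y \<in> topspace ?X - {0}" for x y
  proof
    assume "proj x = proj y"
    then obtain A t where A: "A \<in> GL2_level ?m" "t > 0" "conj_act A x = t *\<^sub>R y"
      using proj_fibre pt x y by blast
    then have "y = conj_act A ((1 / t) *\<^sub>R x)" by simp
    moreover have "1 / t > 0" using A by simp
    ultimately show "H x = H y" using H[OF x y] A(1) GL2_rel_iff by blast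
  next
    assume "H x = H y"
    then obtain t A where A: "t > 0" "A \<in> GL2_level ?m" "y = conj_act A (t *\<^sub>R x)"
      using H[OF x y] GL2_rel_iff by blast
    then show "proj x = proj y"
      using proj_conj_act[OF cone_pt_scale[OF pt[OF x] A(1)] A(2)] proj_scale[OF pt[OF x] A(1)] by simp
  qed
  have ts: "topspace (subtopology ?X (topspace ?X - {0})) = topspace ?X - {0}" by auto
  obtain h where h: "homeomorphic_map (realization cplx) (PD2_link ?m) h"
    "\<And>x. x \<in> topspace ?X - {0} \<Longrightarrow> h (proj x) = H x"
    using quotient_maps_same_fibres[OF q1 q2, unfolded ts] fib by blast
  define orb where "orb T = {conj_act A ` (convex_cone hull (Osq ` T)) | A. A \<in> GL2_level ?m}" for T
  have cells: "cone_orbits ?m = orb ` {T. cell T}"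
  proof -
    have "cone_orbits ?m = {{conj_act A ` C | A. A \<in> GL2_level ?m} | C. \<exists>T. cell T \<and> C = convex_cone hull (Osq ` T)}"
      unfolding cone_orbits_def fan2_cones ..
    then show ?thesis unfolding orb_def by auto
  qed
  \<comment> \<open>Any cell above the simplex may be chosen; \<open>orb_eq\<close> shows that its
    orbit does not depend on the choice.\<close>
  define F where "F \<sigma> = orb (SOME T. cell T \<and> face T = \<sigma>)" for \<sigma>
  have someT: "cell (SOME T. cell T \<and> face T = \<sigma>) \<and> face (SOME T. cell T \<and> face T = \<sigma>) = \<sigma>" if "\<sigma> \<in> cplx" for \<sigma>
    by (rule someI_ex) (use cplx_face[OF that] in blast)
  have orb_eq: "orb T = orb T'" if "cell T" "cell T'" "face T = face T'" for T T'
  proof -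
    have sub: "orb T' \<subseteq> orb T" if "cell T" "cell T'" "face T = face T'" for T T'
    proof -
      obtain A where A: "A \<in> GL2_level ?m" "conj_act A ` (convex_cone hull (Osq ` T)) = convex_cone hull (Osq ` T')"
        using cell_match[OF \<open>cell T\<close> \<open>cell T'\<close> \<open>face T = face T'\<close>] by blast
      have "conj_act B ` (convex_cone hull (Osq ` T')) = conj_act (B ** A) ` (convex_cone hull (Osq ` T))" for B
        unfolding A(2)[symmetric] by (auto simp: conj_act_mult image_image)
      then show ?thesis unfolding orb_def using GL2_group(2) A(1) by blast
    qed
    show ?thesis using sub[OF that] sub[OF that(2,1) that(3)[symmetric]] by blast
  qed
  have Uorb: "x \<in> \<Union>(orb T) - {0} \<longleftrightarrow> (\<exists>A\<in>GL2_level ?m. \<exists>y\<in>convex_cone hull (Osq ` T) - {0}. x = conj_act A y)" if "cell T" for T x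
  proof -
    have "conj_act A y \<noteq> 0" if "A \<in> GL2_level ?m" "y \<in> convex_cone hull (Osq ` T) - {0}" for A y
      using cone_pt_conj_act[OF cell_cone_pt[OF \<open>cell T\<close>] that(1)] that(2) unfolding cone_pt_def by blast
    note nz = this
    show ?thesis
    proof
      assume "x \<in> \<Union>(orb T) - {0}"
      then obtain A y where *: "A \<in> GL2_level ?m" "y \<in> convex_cone hull (Osq ` T)" "x = conj_act A y" "x \<noteq> 0"
        unfolding orb_def by blast
      then have "y \<noteq> 0" by auto
      then show "\<exists>A\<in>GL2_level ?m. \<exists>y\<in>convex_cone hull (Osq ` T) - {0}. x = conj_act A y" using * by blast
    next
      assume "\<exists>A\<in>GL2_level ?m. \<exists>y\<in>convex_cone hull (Osq ` T) - {0}. x = conj_act A y"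
      then obtain A y where *: "A \<in> GL2_level ?m" "y \<in> convex_cone hull (Osq ` T) - {0}" "x = conj_act A y"
        by blast
      then have "x \<noteq> 0" using nz[OF *(1,2)] by simp
      moreover have "x \<in> conj_act A ` (convex_cone hull (Osq ` T))" using * by blast
      ultimately show "x \<in> \<Union>(orb T) - {0}" unfolding orb_def using *(1) by blast
    qed
  qed
  have img: "proj ` (\<Union>(orb T) - {0}) = closed_simplex (face T)" if T: "cell T" for T
  proof -
    have p: "proj (conj_act A y) = proj y" if "A \<in> GL2_level ?m" "y \<in> convex_cone hull (Osq ` T) - {0}" for A y
      using proj_conj_act[OF cell_cone_pt[OF T] that(1)] that(2) by blast
    have "proj ` (\<Union>(orb T) - {0}) = proj ` (convex_cone hull (Osq ` T) - {0})"
    proof (intro equalityI subsetI)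
      fix y assume "y \<in> proj ` (\<Union>(orb T) - {0})"
      then obtain x where x: "x \<in> \<Union>(orb T) - {0}" "y = proj x" by blast
      then obtain A z where "A \<in> GL2_level ?m" "z \<in> convex_cone hull (Osq ` T) - {0}" "x = conj_act A z"
        using Uorb[OF T] by blast
      then show "y \<in> proj ` (convex_cone hull (Osq ` T) - {0})" using p x(2) by auto
    next
      fix y assume "y \<in> proj ` (convex_cone hull (Osq ` T) - {0})"
      then obtain x where x: "x \<in> convex_cone hull (Osq ` T) - {0}" "y = proj x" by blast
      then have "x \<in> \<Union>(orb T) - {0}" using Uorb[OF T] GL2_group(1) conj_act_one by metis
      then show "y \<in> proj ` (\<Union>(orb T) - {0})" using x(2) by blast
    qed
    then show ?thesis using proj_cell[OF T] by simp
  qed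
  have in_top: "\<Union>(orb T) - {0} \<subseteq> topspace ?X - {0}" if T: "cell T" for T
  proof
    fix x assume "x \<in> \<Union>(orb T) - {0}"
    then obtain A y where *: "A \<in> GL2_level ?m" "y \<in> convex_cone hull (Osq ` T)" "y \<noteq> 0" "x = conj_act A y" "x \<noteq> 0"
      using Uorb[OF T] by blast
    then have "cone_pt x" using cone_pt_conj_act cell_cone_pt[OF T] by blast
    then obtain v w a b c where "upair v w" "0 \<le> a" "0 \<le> b" "0 \<le> c" "x = comb v w a b c"
      unfolding cone_pt_def by blast
    then have "x \<in> \<Union>?F" using fan_cone3[of v w] unfolding cone3_eq by blast
    then show "x \<in> topspace ?X - {0}" using *(5) top by simp
  qed
  have Fimg: "proj ` (\<Union>(F \<sigma>) - {0}) = closed_simplex \<sigma>" if "\<sigma> \<in> cplx" for \<sigma>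
    unfolding F_def img[OF conjunct1[OF someT[OF that]]] by (simp only: conjunct2[OF someT[OF that]])
  have "bij_betw F cplx (cone_orbits ?m)"
    unfolding bij_betw_def
  proof
    show "inj_on F cplx"
    proof (rule inj_onI)
      fix \<sigma> \<tau> assume st: "\<sigma> \<in> cplx" "\<tau> \<in> cplx" "F \<sigma> = F \<tau>"
      then have "closed_simplex \<sigma> = closed_simplex \<tau>"
        using Fimg[OF st(1)] Fimg[OF st(2)] by simp
      then show "\<sigma> = \<tau>" using closed_simplex_inj cplx_finite st by blast
    qed
    show "F ` cplx = cone_orbits ?m"
      unfolding cells
    proof (intro equalityI subsetI)
      fix O' assume "O' \<in> F ` cplx"
      then obtain \<sigma> where s: "\<sigma> \<in> cplx" "O' = F \<sigma>" by blast
      show "O' \<in> orb ` {T. cell T}"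
        unfolding s(2) F_def by (rule imageI) (simp only: mem_Collect_eq someT[OF s(1)])
    next
      fix O' assume "O' \<in> orb ` {T. cell T}"
      then obtain T where T: "cell T" "O' = orb T" by blast
      have "orb T = F (face T)"
        unfolding F_def by (rule orb_eq[OF T(1)]) (simp_all only: someT[OF face_cplx[OF T(1)]])
      then have "O' = F (face T)" using T(2) by simp
      then show "O' \<in> F ` cplx" using face_cplx T(1) by blast
    qed
  qed
  moreover have "h ` closed_simplex \<sigma> = link_cell ?m (F \<sigma>)" if s: "\<sigma> \<in> cplx" for \<sigma>
  proof -
    define T where "T = (SOME T. cell T \<and> face T = \<sigma>)"
    have T: "cell T" "face T = \<sigma>" unfolding T_def by (simp_all only: someT[OF s])
    have "h ` closed_simplex \<sigma> = (\<lambda>x. h (proj x)) ` (\<Union>(orb T) - {0})"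
      using img[OF T(1)] T(2) by (metis image_image)
    also have "\<dots> = H ` (\<Union>(orb T) - {0})"
      using h(2) in_top[OF T(1)] by (intro image_cong) auto
    finally show ?thesis unfolding link_cell_def F_def T_def H_def .
  qed
  ultimately show ?thesis
    unfolding isomorphic_to_PD2_link_def using h(1) by blast
qed

end

section \<open>The link of the tropical moduli space\<close>

lemma adm_coefs:
  assumes "adm T v w a b c" "p \<notin> T"
  shows "coefs v w a b c p = 0"
proof -
  have z: "(if p = pm u then k else 0) = 0" if "pm u \<notin> T \<longrightarrow> k = 0" for u and k :: real
    using assms(2) that by auto
  have "pm v \<notin> T \<longrightarrow> a = 0" "pm w \<notin> T \<longrightarrow> b = 0" "pm (v + w) \<notin> T \<longrightarrow> c = 0"
    using assms(1) by (auto simp: adm_def)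
  then show ?thesis unfolding coefs_def by (simp only: z)
qed

lemma good_basis_pair:
  fixes P :: "(int ^ 4) set"
  assumes "isotropic_subspace P" "is_basis_pair v w P"
  shows "good v w" "P = span2 v w"
  using isotropic_basis_pair_iff[OF inverse_comm_int, of P v w] assms by auto

lemma primitive_good: "primitive (v :: int ^ 4) \<Longrightarrow> \<exists>w. good v w"
  using primitive_sympbasis sympbasis_good by blast

text \<open>Subspaces of all ranks are brought to one form, the zero cone having empty
  \<open>T\<close>. The second vector of the pair need not lie in \<open>P\<close>: for a line it
  cannot, which is why only the vectors of \<open>T\<close> are asserted to do so.\<close>

lemma fan_isotropic_cell:
  fixes P :: "(int ^ 4) set"
  assumes P: "isotropic_subspace P" and C: "C \<in> fan P"
  shows "\<exists>T v w. good v w \<and> T \<subseteq> tri v w \<and> \<Union>T \<subseteq> P \<and> C = convex_cone hull (Osq ` T)"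
proof -
  have sub: "rvec.subspace P" using P by (auto simp: isotropic_subspace_def free_submodule_def)
  have pmP: "pm v \<subseteq> P" if "v \<in> P" for v
    using that rvec.subspace_neg[OF sub] by (auto simp: pm_def)
  from C consider "C = {0}" | v where "v \<in> P" "primitive v" "C = convex_cone hull {outer_sq v}"
    | v w where "is_basis_pair v w P" "C = convex_cone hull {outer_sq v, outer_sq w}"
    | v w where "is_basis_pair v w P" "C = convex_cone hull {outer_sq v, outer_sq w, outer_sq (v + w)}"
    unfolding fan_def by blast
  then show ?thesis
  proof cases
    case 1
    have "primitive (axis 1 1 :: int ^ 4)"
      by (auto simp: primitive_iff_dotp dotp_def sum_4 axis_def intro!: exI[of _ "axis 1 1"])
    then obtain w where "good (axis 1 (1 :: int) :: int ^ 4) w" using primitive_good by blast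
    then show ?thesis using 1 by (intro exI[of _ "{}"] exI[of _ "axis 1 1"] exI[of _ w]) auto
  next
    case 2
    obtain w where "good v w" using primitive_good[OF 2(2)] by blast
    then show ?thesis using 2 pmP[OF 2(1)]
      by (intro exI[of _ "{pm v}"] exI[of _ v] exI[of _ w]) (auto simp: tri_def)
  next
    case 3
    then have "v \<in> P" "w \<in> P" using is_basis_pair_mem by auto
    then show ?thesis using 3 pmP good_basis_pair(1)[OF P 3(1)]
      by (intro exI[of _ "{pm v, pm w}"] exI[of _ v] exI[of _ w]) (auto simp: tri_def)
  next
    case 4
    then have "v \<in> P" "w \<in> P" using is_basis_pair_mem by auto
    then have "pm v \<subseteq> P" "pm w \<subseteq> P" "pm (v + w) \<subseteq> P" using pmP rvec.subspace_add[OF sub] by auto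
    then show ?thesis using 4 good_basis_pair(1)[OF P 4(1)]
      by (intro exI[of _ "tri v w"] exI[of _ v] exI[of _ w]) (auto simp: tri_def)
  qed
qed

text \<open>Compare the given representation with one by generators from \<open>P\<close>. By
  uniqueness the vectors with positive coefficient are among these generators.\<close>

lemma fan_support_in:
  fixes P :: "(int ^ 4) set"
  assumes P: "isotropic_subspace P" and x: "comb v w a b c \<in> \<Union>(fan P)"
    and g: "good v w" "0 \<le> a" "0 \<le> b" "0 \<le> c"
  shows "a > 0 \<Longrightarrow> v \<in> P" "b > 0 \<Longrightarrow> w \<in> P" "c > 0 \<Longrightarrow> v + w \<in> P"
proof -
  obtain C where C: "C \<in> fan P" "comb v w a b c \<in> C" using x by blast
  obtain T v' w' where T: "good v' w'" "T \<subseteq> tri v' w'" "\<Union>T \<subseteq> P" "C = convex_cone hull (Osq ` T)"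
    using fan_isotropic_cell[OF P C(1)] by blast
  obtain a' b' c' where e: "comb v w a b c = comb v' w' a' b' c'" "adm T v' w' a' b' c'"
    using C(2) unfolding T(4) cell_cone[OF T(2)] by blast
  have u: "upair v w" "upair v' w'" using g(1) T(1) by (auto simp: good_def)
  have "coefs v w a b c = coefs v' w' a' b' c'"
    by (rule coefs_unique[OF u(1) g(2-4) u(2) _ _ _ e(1)]) (use e(2) in \<open>auto simp: adm_def\<close>)
  then have pT: "p \<in> T" if "coefs v w a b c p \<noteq> 0" for p
    using adm_coefs[OF e(2)] that by metis
  have mem: "u \<in> P" if "pm u \<in> T" for u using that T(3) pm_self[of u] by blast
  show "a > 0 \<Longrightarrow> v \<in> P" using g by (intro mem pT) (auto simp: coefs_def add_nonneg_eq_0_iff)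
  show "b > 0 \<Longrightarrow> w \<in> P" using g by (intro mem pT) (auto simp: coefs_def add_nonneg_eq_0_iff)
  show "c > 0 \<Longrightarrow> v + w \<in> P" using g by (intro mem pT) (auto simp: coefs_def add_nonneg_eq_0_iff)
qed

lemma two_neq_0: "CARD('m::nontriv) \<ge> 3 \<Longrightarrow> (2 :: 'm mod_ring) \<noteq> 0"
proof -
  assume m3: "CARD('m) \<ge> 3"
  have "(of_int 2 :: 'm mod_ring) \<noteq> 0"
    unfolding of_int_mod_ring_eq_0_iff using m3 zdvd_imp_le by fastforce
  then show ?thesis by simp
qed

text \<open>The type argument fixes the modulus, which occurs in no vector parameter of the
  locale.\<close>

locale level =
  fixes lev :: "'m::nontriv itself"
  assumes m3: "CARD('m) \<ge> 3"
begin

sublocale fan_quotient good "Sp4_level CARD('m)" "red :: int ^ 4 \<Rightarrow> 'm mod_ring ^ 4"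
proof
  fix v w v' w' w'' :: "int ^ 4" and A
  show "good v w \<Longrightarrow> upair v w" by (simp add: good_def)
  show "good v w \<Longrightarrow> good w v" using upair_sym symp_swap[of w v] by (auto simp: good_def)
  show "good v w \<Longrightarrow> good v (- w)" using upair_minus by (auto simp: good_def)
  show "good v w \<Longrightarrow> good v (v + w)" using upair_add[of v w 1] by (auto simp: good_def)
  show "red (v + w) = (red v + red w :: 'm mod_ring ^ 4)" "red (- v) = (- red v :: 'm mod_ring ^ 4)" by simp_all
  show "(red v :: 'm mod_ring ^ 4) \<noteq> red w" if "good v w"
  proof
    assume "(red v :: 'm mod_ring ^ 4) = red w"
    then have "1 *s red v + (- 1) *s red w = (0 :: 'm mod_ring ^ 4)" by simp
    then have "(1 :: 'm mod_ring) = 0" using upair_indep[OF upair_red] that unfolding good_def by blast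
    then show False by simp
  qed
  show "(red v :: 'm mod_ring ^ 4) + red v \<noteq> 0" if "good v w"
  proof
    assume "(red v :: 'm mod_ring ^ 4) + red v = 0"
    then have "2 *s red v + 0 *s red w = (0 :: 'm mod_ring ^ 4)" by (simp add: vec_eq_iff)
    then have "(2 :: 'm mod_ring) = 0" using upair_indep[OF upair_red] that unfolding good_def by blast
    then show False using two_neq_0[OF m3] by simp
  qed
  show "A \<in> Sp4_level CARD('m) \<Longrightarrow> good v w \<Longrightarrow> good (A *v v) (A *v w)" by (rule Sp4_good)
  show "A \<in> Sp4_level CARD('m) \<Longrightarrow> red (A *v v) = (red v :: 'm mod_ring ^ 4)"
    by (simp add: Sp4_level_def congruent_to_one_iff)
  show "\<exists>w'. good v' w' \<and> (red w' :: 'm mod_ring ^ 4) = red w"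
    if g: "good v w" "good v' w''" "(red v :: 'm mod_ring ^ 4) = red v'"
  proof -
    have "good (red v') (red w :: 'm mod_ring ^ 4)" using good_red[OF g(1)] g(3) by metis
    moreover have "primitive v'" using g(2) upair_primitive by (auto simp: good_def)
    ultimately show ?thesis by (intro good_lift)
  qed
  show "\<exists>A\<in>Sp4_level CARD('m). A *v v = v' \<and> A *v w = w'"
    if "good v w" "good v' w'" "(red v :: 'm mod_ring ^ 4) = red v'" "(red w :: 'm mod_ring ^ 4) = red w'"
    using Sp4_level_lift that by blast
qed

section \<open>The quotient complex of isotropic pairs\<close>

lemma Delta2_edge_good:
  "Delta2_edge a (b :: ('m mod_ring ^ 4) set) \<longleftrightarrow> (\<exists>v w. a = pm v \<and> b = pm w \<and> good v w)"
proof -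
  have "isotropic_plane P \<and> is_basis_pair v w P \<longleftrightarrow> good v w \<and> P = span2 v w" for P and v w :: "'m mod_ring ^ 4"
    using isotropic_basis_pair_iff[OF inverse_comm_finite, of P v w] isotropic_plane_iff[OF inverse_comm_finite, of P]
    unfolding isotropic_plane_def by blast
  then show ?thesis unfolding Delta2_edge_def by blast
qed

lemma Delta2_edge_iff:
  "Delta2_edge a (b :: ('m mod_ring ^ 4) set) \<longleftrightarrow> (\<exists>v w. good v w \<and> a = cls v \<and> b = cls w)"
proof
  assume "Delta2_edge a b"
  then obtain v w :: "'m mod_ring ^ 4" where vw: "a = pm v" "b = pm w" "good v w"
    unfolding Delta2_edge_good by blast
  obtain v' where v': "primitive v'" "red v' = v"
    using primitive_lift[of v] upair_primitive(1)[of v w] vw(3) unfolding good_def by auto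
  then obtain w' where "good v' w'" "red w' = w" using good_lift[of v' w] vw(3) by blast
  then show "\<exists>v w. good v w \<and> a = cls v \<and> b = cls w" using v' vw unfolding cls_def by blast
next
  assume "\<exists>v w. good v w \<and> a = cls v \<and> b = cls w"
  then show "Delta2_edge a b" unfolding Delta2_edge_good cls_def using good_red by blast
qed

text \<open>Edges lift by \<open>good_lift\<close>. For a triangle it suffices to lift one edge with
  suitable signs, since the relation between the three vertices determines the third.\<close>

lemma Delta2_eq_cplx: "(Delta2 :: ('m mod_ring ^ 4) set set set) = cplx"
proof (intro equalityI subsetI)
  fix \<sigma> assume "\<sigma> \<in> (Delta2 :: ('m mod_ring ^ 4) set set set)"
  then have "(\<exists>v. \<sigma> = {pm v} \<and> primitive v) \<or> (\<exists>a b. \<sigma> = {a, b} \<and> Delta2_edge a b) \<or>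
     (\<exists>a b c. \<sigma> = {a, b, c} \<and> Delta2_edge a b \<and> Delta2_edge a c \<and> Delta2_edge b c \<and>
        (\<exists>u\<in>a. \<exists>v\<in>b. \<exists>w\<in>c. u + v + w = 0))"
    unfolding Delta2_def Un_iff mem_Collect_eq disj_assoc .
  then show "\<sigma> \<in> cplx"
  proof (elim disjE exE conjE bexE)
    fix v assume v: "\<sigma> = {pm v}" "primitive v"
    obtain v' where v': "primitive v'" "red v' = v" using primitive_lift[OF v(2)] by auto
    obtain w where "good v' w" using primitive_good[OF v'(1)] by blast
    moreover have "\<sigma> = {cls v'}" using v(1) v'(2) by (simp add: cls_def)
    ultimately show ?thesis unfolding cplx_def clstri_def by blast
  next
    fix a b assume ab: "\<sigma> = {a, b}" "Delta2_edge a b"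
    then obtain v w where "good v w" "a = cls v" "b = cls w" unfolding Delta2_edge_iff by blast
    then show ?thesis unfolding cplx_def clstri_def ab(1) by blast
  next
    fix a b c u v w assume s: "\<sigma> = {a, b, c}" and e: "Delta2_edge a b" "Delta2_edge a c"
      and uvw: "u \<in> a" "v \<in> b" "w \<in> c" "u + v + w = 0"
    obtain x y where xy: "good x y" "a = cls x" "b = cls y" using e(1) Delta2_edge_iff by blast
    \<comment> \<open>The vectors in the relation are reductions of \<open>x\<close>,
      \<open>y\<close> only up to sign. With the signs moved to the integral side the third vertex
      becomes exactly the class of x' + y'.\<close>
    have sgn: "\<exists>x'. (x' = x \<or> x' = - x) \<and> u = red x'" if "u \<in> cls x" for u and x :: "int ^ 4"
      using that unfolding cls_def pm_def by (auto intro: exI[of _ x] exI[of _ "- x"])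
    obtain x' where x': "x' = x \<or> x' = - x" "u = red x'" using sgn uvw(1) xy(2) by blast
    obtain y' where y': "y' = y \<or> y' = - y" "v = red y'" using sgn uvw(2) xy(3) by blast
    have g: "good x' y'" using xy(1) x'(1) y'(1) good_neg good_neg1 by blast
    obtain z where z: "c = pm z" using e(2) unfolding Delta2_edge_good by blast
    have "w = - red (x' + y')" using uvw(4) x'(2) y'(2) by (simp only: add_eq_0_iff red_simps)
    moreover have "c = pm w" using uvw(3) z mem_pm_iff[of w z] by simp
    ultimately have "c = cls (x' + y')" by (simp only: cls_def pm_minus)
    moreover have "a = cls x'" "b = cls y'" using xy x'(1) y'(1) by auto
    ultimately have "\<sigma> = clstri x' y'" using s by (simp add: clstri_def)
    then show ?thesis using clstri_cplx[OF g] by simp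
  qed
next
  fix \<sigma> :: "('m mod_ring ^ 4) set set" assume "\<sigma> \<in> cplx"
  then obtain T where T: "cell T" "face T = \<sigma>" using cplx_face by blast
  from T(1) show "\<sigma> \<in> Delta2"
  proof (cases rule: cell_cases)
    case (ray v w)
    then have "\<sigma> = {pm (red v)}" using T(2) by (simp add: face_def image_pm cls_def)
    moreover have "primitive (red v :: 'm mod_ring ^ 4)"
      using ray(1) primitive_red[OF upair_primitive(1)[of v w]] unfolding good_def by blast
    ultimately show ?thesis unfolding Delta2_def by - (rule UnI1, rule UnI1, blast)
  next
    case (edge v w)
    then have "\<sigma> = {cls v, cls w}" using T(2) by (simp add: face_def image_pm)
    moreover have "Delta2_edge (cls v) (cls w)" using edge Delta2_edge_iff by blast
    ultimately show ?thesis unfolding Delta2_def by - (rule UnI1, rule UnI2, blast)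
  next
    case (tri v w)
    then have s: "\<sigma> = {cls v, cls w, cls (v + w)}" using T(2) by (simp add: face_tri clstri_def)
    have "good v (v + w)" "good w (v + w)"
      using good_add[OF tri(1)] good_add[OF good_swap[OF tri(1)]] by (simp_all add: add.commute)
    then have e: "Delta2_edge (cls v) (cls w)" "Delta2_edge (cls v) (cls (v + w))" "Delta2_edge (cls w) (cls (v + w))"
      using tri(1) Delta2_edge_iff by blast+
    have "red v \<in> cls v" "red w \<in> cls w" "- red (v + w) \<in> cls (v + w)" "red v + red w + - red (v + w) = (0 :: 'm mod_ring ^ 4)"
      by (simp_all add: cls_def pm_def)
    then have "\<exists>u\<in>cls v. \<exists>x\<in>cls w. \<exists>y\<in>cls (v + w). u + x + y = 0" by blast
    then show ?thesis unfolding Delta2_def s using e by - (rule UnI2, blast)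
  qed
qed

section \<open>Identifications and scaling in the colimit\<close>

abbreviation "summands \<equiv> {P :: (int ^ 4) set. isotropic_subspace P}"
abbreviation "scale_pt \<equiv> \<lambda>t (a :: (int ^ 4) set \<times> (real ^ 4 ^ 4)). (fst a, t *\<^sub>R snd a)"

lemma topspace_fan_support: "topspace (fan_support P) = \<Union>(fan P)"
  by (simp add: fan_support_def)

lemma fan_in_cone3:
  assumes "isotropic_subspace P" "C \<in> fan P"
  shows "\<exists>v w. good v w \<and> C \<subseteq> convex_cone hull {outer_sq v, outer_sq w, outer_sq (v + w)}"
proof -
  obtain T v w where T: "good v w" "T \<subseteq> tri v w" "C = convex_cone hull (Osq ` T)"
    using fan_isotropic_cell[OF assms] by blast
  have "Osq ` T \<subseteq> {outer_sq v, outer_sq w, outer_sq (v + w)}" using T(2) by (auto simp: tri_def)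
  then show ?thesis using T hull_mono by blast
qed

lemma fan_cone_pt:
  assumes "isotropic_subspace P" "x \<in> \<Union>(fan P)" "x \<noteq> 0"
  shows "cone_pt x"
proof -
  obtain C where C: "C \<in> fan P" "x \<in> C" using assms by blast
  then obtain v w where "good v w" "x \<in> convex_cone hull {outer_sq v, outer_sq w, outer_sq (v + w)}"
    using fan_in_cone3[OF assms(1)] by blast
  then show ?thesis using assms(3) unfolding cone3_eq cone_pt_def by blast
qed

lemma span2_cone3:
  assumes "good v w"
  shows "convex_cone hull {outer_sq v, outer_sq w, outer_sq (v + w)} \<in> fan (span2 v w)"
proof -
  have "is_basis_pair v w (span2 v w)" using isotropic_basis_pair_iff[OF inverse_comm_int] assms by blast
  then show ?thesis unfolding fan_def by blast
qed

text \<open>An invariant of the generated equivalence: \<open>None\<close> marks the apex, and any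
  other point keeps its projection. It shows that the gluing identifies no points with different
  images.\<close>

lemma A2_glue_inv:
  assumes "A2_glue CARD('m) a b"
  shows "(if snd a = 0 then None else Some (proj (snd a))) = (if snd b = 0 then None else Some (proj (snd b)))"
proof -
  obtain P' P x A where *: "isotropic_subspace P'" "x \<in> topspace (fan_support P')" "A \<in> Sp4_level CARD('m)"
    "a = (P', x)" "b = (P, conj_act A x)"
    using assms unfolding A2_glue_def by blast
  show ?thesis
  proof (cases "x = 0")
    case False
    then have "cone_pt x" using fan_cone_pt * unfolding topspace_fan_support by blast
    then have "conj_act A x \<noteq> 0" "proj (conj_act A x) = proj x"
      using cone_pt_conj_act[OF _ *(3)] proj_conj_act[OF _ *(3)] unfolding cone_pt_def by blast+
    then show ?thesis using False * by simp
  qed (use * in simp)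
qed

lemma A2_rel_inv:
  assumes "(a, b) \<in> A2_rel CARD('m)"
  shows "(if snd a = 0 then None else Some (proj (snd a))) = (if snd b = 0 then None else Some (proj (snd b)))"
proof -
  have "equivclp (A2_glue CARD('m)) a b" using assms by (simp add: A2_rel_def)
  then show ?thesis by (induction rule: equivclp_induct) (use A2_glue_inv in metis)+
qed

lemma A2_glue_scale:
  assumes "A2_glue m a b" "0 < t" shows "A2_glue m (scale_pt t a) (scale_pt t b)"
proof -
  obtain P' P x A where *: "isotropic_subspace P'" "isotropic_subspace P" "x \<in> \<Union>(fan P')" "A \<in> Sp4_level m"
    "(\<lambda>v. A *v v) ` P' \<subseteq> P" "a = (P', x)" "b = (P, conj_act A x)"
    using assms unfolding A2_glue_def topspace_fan_support by blast
  have "t *\<^sub>R x \<in> \<Union>(fan P')" using fan_scale[OF *(3) assms(2)] .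
  moreover have "scale_pt t a = (P', t *\<^sub>R x)" "scale_pt t b = (P, conj_act A (t *\<^sub>R x))" using * by simp_all
  ultimately show ?thesis using * unfolding A2_glue_def topspace_fan_support by blast
qed

lemma A2_rel_scale:
  assumes "(a, b) \<in> A2_rel m" "0 < t" shows "(scale_pt t a, scale_pt t b) \<in> A2_rel m"
proof -
  have "equivclp (A2_glue m) a b" using assms by (simp add: A2_rel_def)
  then have "equivclp (A2_glue m) (scale_pt t a) (scale_pt t b)"
  proof (induction rule: equivclp_induct)
    case base then show ?case by simp
  next
    case (step y z)
    then have "A2_glue m (scale_pt t y) (scale_pt t z) \<or> A2_glue m (scale_pt t z) (scale_pt t y)"
      using A2_glue_scale assms(2) by blast
    then show ?case using equivclp_into_equivclp[OF step.IH] by blast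
  qed
  then show ?thesis by (simp add: A2_rel_def)
qed

lemma A2_rel_glue: "A2_glue m a b \<Longrightarrow> (a, b) \<in> A2_rel m"
  by (simp add: A2_rel_def r_into_equivclp)

lemma A2_rel_refl: "(a, a) \<in> A2_rel m"
  by (simp add: A2_rel_def)

lemma A2_rel_sym: "(a, b) \<in> A2_rel m \<Longrightarrow> (b, a) \<in> A2_rel m"
  by (simp add: A2_rel_def equivclp_sym)

lemma A2_rel_trans: "(a, b) \<in> A2_rel m \<Longrightarrow> (b, c) \<in> A2_rel m \<Longrightarrow> (a, c) \<in> A2_rel m"
  unfolding A2_rel_def mem_Collect_eq case_prod_conv using equivclp_trans by metis

lemma A2_class_eq: "A2_rel m `` {a} = A2_rel m `` {b} \<longleftrightarrow> (a, b) \<in> A2_rel m"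
  using A2_rel_refl A2_rel_sym A2_rel_trans by blast

lemma one_in_Sp4: "mat 1 \<in> Sp4_level CARD('m)"
  by (auto simp: Sp4_level_def congruent_to_one_iff)

text \<open>A congruence that carries \<open>x\<close> to a multiple of \<open>x'\<close> need not
  map \<open>P\<close> into \<open>P'\<close>, so it is not itself a gluing map between them. The
  smallest isotropic subspace \<open>Q\<close> carrying the point maps into both, by the inclusion
  and by the congruence, and joins the two points.\<close>

lemma A2_fibre:
  assumes P: "isotropic_subspace P" "x \<in> \<Union>(fan P)" "x \<noteq> 0"
    and P': "isotropic_subspace P'" "x' \<in> \<Union>(fan P')" "x' \<noteq> 0"
    and eq: "proj x = proj x'"
  shows "\<exists>t>0. ((P, t *\<^sub>R x), (P', x')) \<in> A2_rel CARD('m)"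
proof -
  obtain A t where A: "A \<in> Sp4_level CARD('m)" "t > 0" "conj_act A x = t *\<^sub>R x'"
    using proj_fibre[OF fan_cone_pt[OF P] fan_cone_pt[OF P'] eq] by blast
  define y where "y = (1 / t) *\<^sub>R x"
  have y: "y \<in> \<Union>(fan P)" "conj_act A y = x'" "y \<noteq> 0"
    using fan_scale[OF P(2), of "1 / t"] A P(3) by (simp_all add: y_def)
  have sub: "rvec.subspace P" "rvec.subspace P'"
    using P(1) P'(1) by (auto simp: isotropic_subspace_def free_submodule_def)
  have "\<exists>Q. isotropic_subspace Q \<and> y \<in> \<Union>(fan Q) \<and> Q \<subseteq> P \<and> (\<lambda>v. A *v v) ` Q \<subseteq> P'"
  proof -
    \<comment> \<open>Edges and triangles both involve two independent vectors, so \<open>Q\<close>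
      is the plane they span; only points on rays lead to a line.\<close>
    have two: ?thesis if g: "good v w" "0 \<le> a" "0 \<le> b" "0 \<le> c" "y = comb v w a b c" "a > 0" "b > 0" for v w a b c
    proof -
      have gA: "good (A *v v) (A *v w)" using Sp4_good A(1) g(1) by blast
      have "v \<in> P" "w \<in> P" using fan_support_in[OF P(1) _ g(1-4)] y(1) g(5-7) by auto
      then have "span2 v w \<subseteq> P"
        using sub(1) by (auto simp: span2_def intro!: rvec.subspace_add rvec.subspace_scale)
      moreover have "A *v v \<in> P'" "A *v w \<in> P'"
        using fan_support_in[OF P'(1) _ gA g(2-4)] P'(2) y(2) g(5-7) by (auto simp: conj_act_comb)
      then have "(\<lambda>v. A *v v) ` span2 v w \<subseteq> P'"
        using sub(2) by (auto simp: span2_def matrix_vector_right_distrib matrix_vector_smult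
            intro!: rvec.subspace_add rvec.subspace_scale)
      moreover have "y \<in> \<Union>(fan (span2 v w))"
        using span2_cone3[OF g(1)] g(2-5) unfolding cone3_eq by blast
      ultimately show ?thesis using isotropic_span2[OF inverse_comm_int g(1)] by blast
    qed
    from fan_cone_pt[OF P(1) y(1,3)] show ?thesis
    proof (cases rule: cone_pt_cases)
      case (ray v w a)
      let ?Q = "range (\<lambda>k. k *s v)"
      have gA: "good (A *v v) (A *v w)" using Sp4_good A(1) ray(1) by blast
      have "v \<in> P" using fan_support_in(1)[OF P(1) _ ray(1), of a 0 0] y(1) ray by auto
      then have "?Q \<subseteq> P" using sub(1) by (auto intro: rvec.subspace_scale)
      moreover have "A *v v \<in> P'"
        using fan_support_in(1)[OF P'(1) _ gA, of a 0 0] P'(2) y(2) ray by (auto simp: conj_act_comb)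
      then have "(\<lambda>v. A *v v) ` ?Q \<subseteq> P'"
        using sub(2) by (auto simp: matrix_vector_smult intro: rvec.subspace_scale)
      moreover have "y \<in> \<Union>(fan ?Q)"
      proof -
        have "primitive v" using ray(1) upair_primitive by (auto simp: good_def)
        moreover have "v \<in> ?Q" by (rule range_eqI[of _ _ 1]) simp
        ultimately have "convex_cone hull {outer_sq v} \<in> fan ?Q" unfolding fan_def by blast
        moreover have "a *\<^sub>R outer_sq v \<in> convex_cone hull {outer_sq v}"
          by (intro convex_cone_hull_mul hull_inc) (use ray in auto)
        then have "y \<in> convex_cone hull {outer_sq v}"
          using ray(3) by (simp add: comb_def)
        ultimately show ?thesis by blast
      qed
      ultimately show ?thesis using isotropic_line[OF inverse_comm_int ray(1)] by blast
    next
      case (edge v w a b)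
      then show ?thesis using two[of v w a b 0] by simp
    next
      case (tri v w a b c)
      then show ?thesis using two[of v w a b c] by simp
    qed
  qed
  then obtain Q where Q: "isotropic_subspace Q" "y \<in> \<Union>(fan Q)" "Q \<subseteq> P" "(\<lambda>v. A *v v) ` Q \<subseteq> P'"
    by blast
  have "A2_glue CARD('m) (Q, y) (P, y)"
    unfolding A2_glue_def topspace_fan_support
    using Q P(1) one_in_Sp4
    by (intro exI[of _ Q] exI[of _ P] exI[of _ y] exI[of _ "mat 1"]) (simp add: conj_act_one)
  moreover have "A2_glue CARD('m) (Q, y) (P', x')"
    unfolding A2_glue_def topspace_fan_support using Q P'(1) A(1) y(2) by blast
  ultimately have "((P, y), (P', x')) \<in> A2_rel CARD('m)"
    using A2_rel_glue A2_rel_sym A2_rel_trans by blast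
  then show ?thesis using A(2) unfolding y_def by (intro exI[of _ "1 / t"]) simp
qed

lemma finite_cplx: "finite cplx"
  by simp

theorem LA2_homeomorphic: "LA2_trop CARD('m) homeomorphic_space realization (Delta2 :: ('m mod_ring ^ 4) set set set)"
proof -
  let ?m = "CARD('m)" and ?X = "sum_topology fan_support summands"
  let ?r = "A2_rel ?m" and ?z = "({0 :: int ^ 4}, 0 :: real ^ 4 ^ 4)"
  \<comment> \<open>The zero points of all summands; they form one class, since each is glued to the
    zero subspace.\<close>
  define Z where "Z = {a :: (int ^ 4) set \<times> (real ^ 4 ^ 4). snd a = 0}"
  define f where "f a = proj (snd a)" for a :: "(int ^ 4) set \<times> (real ^ 4 ^ 4)"
  define H where "H a = scaling_rel A2_scale (A2_trop ?m) (?r `` {?z}) `` {?r `` {a}}" for a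
  have top: "topspace ?X = {(P, x). isotropic_subspace P \<and> x \<in> \<Union>(fan P)}"
    by (auto simp: fan_support_def)
  have fan0: "0 \<in> \<Union>(fan P)" for P :: "(int ^ 4) set" unfolding fan_def by auto
  have opZ: "openin ?X (topspace ?X - Z)"
    unfolding openin_sum_topology
  proof (intro conjI ballI)
    fix P assume "P \<in> summands"
    then have "{x. (P, x) \<in> topspace ?X - Z} = \<Union>(fan P) - {0}" by (auto simp: topspace_fan_support Z_def)
    then show "openin (fan_support P) {x. (P, x) \<in> topspace ?X - Z}"
      using openin_nonzero by (simp add: fan_support_def)
  qed auto
  have pt: "cone_pt (snd a)" if a: "a \<in> topspace ?X - Z" for a
  proof -
    obtain P x where "a = (P, x)" by (cases a)
    then show ?thesis using a fan_cone_pt[of P x] by (auto simp: topspace_fan_support Z_def)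
  qed
  have top': "topspace (subtopology ?X (topspace ?X - Z)) = topspace ?X - Z" by auto
  have real: "realization cplx = top_of_set (polyhedron_of cplx)"
    by (rule realization_finite[OF finite_cplx]) (rule cplx_finite)
  have cont: "continuous_map (subtopology ?X (topspace ?X - Z)) (realization cplx) f"
    unfolding real
  proof (rule continuous_map_into_functions)
    show "f a \<in> polyhedron_of cplx" if "a \<in> topspace (subtopology ?X (topspace ?X - Z))" for a
      using that pt proj_in unfolding top' f_def by blast
    show "continuous_map (subtopology ?X (topspace ?X - Z)) euclideanreal (\<lambda>a. f a q)" for q
      unfolding continuous_map_def top'
    proof (intro conjI allI impI)
      fix V assume "openin euclideanreal V"
      then have V: "open V" by simp
      have "openin ?X {a \<in> topspace ?X - Z. f a q \<in> V}"
        unfolding openin_sum_topology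
      proof (intro conjI ballI)
        fix P assume P: "P \<in> summands"
        then have "{x. (P, x) \<in> {a \<in> topspace ?X - Z. f a q \<in> V}} = {x \<in> \<Union>(fan P) - {0}. proj x q \<in> V}"
          by (auto simp: topspace_fan_support Z_def f_def)
        moreover have "openin (fan_support P) {x \<in> \<Union>(fan P) - {0}. proj x q \<in> V}"
          unfolding fan_support_def using openin_proj_preimage[of "fan P" V q] fan_in_cone3 P V by blast
        ultimately show "openin (fan_support P) {x. (P, x) \<in> {a \<in> topspace ?X - Z. f a q \<in> V}}" by simp
      qed auto
      then show "openin (subtopology ?X (topspace ?X - Z)) {a \<in> topspace ?X - Z. f a q \<in> V}"
        using openin_open_subtopology[OF opZ] by blast
    qed auto
  qed
  have q1: "quotient_map (subtopology ?X (topspace ?X - Z)) (realization cplx) f"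
    unfolding realization_def
  proof (rule quotient_map_coherent_sections)
    show "continuous_map (subtopology ?X (topspace ?X - Z)) (coherent_topology (closed_simplex ` cplx)) f"
      using cont by (simp add: realization_def)
    fix S assume "S \<in> closed_simplex ` cplx"
    then obtain \<sigma> v w where \<sigma>: "S = closed_simplex \<sigma>" "good v w" "\<sigma> \<subseteq> clstri v w"
      unfolding cplx_def by blast
    have s: "proj (sect v w p) = p \<and> cone_pt (sect v w p)" if "p \<in> S" for p
      using sect[OF \<sigma>(2,3)] that \<sigma>(1) by blast
    \<comment> \<open>The section over a simplex lands in the summand of the plane spanned by its
      lifted pair, one plane for each simplex.\<close>
    have iso: "isotropic_subspace (span2 v w)" using isotropic_span2[OF inverse_comm_int \<sigma>(2)] .
    have "continuous_map (top_of_set S) (fan_support (span2 v w)) (sect v w)"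
      unfolding fan_support_def
      by (rule continuous_map_into_coherent[OF span2_cone3[OF \<sigma>(2)] continuous_on_sect])
        (use sect_cone3 \<sigma>(1) in blast)
    moreover have "continuous_map (fan_support (span2 v w)) ?X (\<lambda>x. (span2 v w, x))"
      by (rule continuous_map_component_injection) (simp add: iso)
    ultimately have "continuous_map (top_of_set S) ?X ((\<lambda>x. (span2 v w, x)) \<circ> sect v w)"
      by (rule continuous_map_compose)
    then have "continuous_map (top_of_set S) (subtopology ?X (topspace ?X - Z)) ((\<lambda>x. (span2 v w, x)) \<circ> sect v w)"
    proof (rule continuous_map_into_subtopology)
      have "(span2 v w, sect v w p) \<in> topspace ?X - Z" if p: "p \<in> S" for p
      proof -
        have "sect v w p \<in> \<Union>(fan (span2 v w))"
          using sect_cone3[of p \<sigma> v w] span2_cone3[OF \<sigma>(2)] p \<sigma>(1) by blast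
        moreover have "sect v w p \<noteq> 0" using s[OF p] unfolding cone_pt_def by blast
        ultimately show ?thesis using iso by (simp add: topspace_fan_support Z_def)
      qed
      then show "(\<lambda>x. (span2 v w, x)) \<circ> sect v w \<in> topspace (top_of_set S) \<rightarrow> topspace ?X - Z" by auto
    qed
    moreover have "f (((\<lambda>x. (span2 v w, x)) \<circ> sect v w) p) = p" if "p \<in> S" for p
      using s[OF that] by (simp add: f_def)
    ultimately show "\<exists>g. continuous_map (top_of_set S) (subtopology ?X (topspace ?X - Z)) g \<and> (\<forall>p\<in>S. f (g p) = p)"
      by blast
  qed
  have scl: "A2_scale t (?r `` {a}) = ?r `` {scale_pt t a}" if t: "0 < t" for t a
  proof (intro equalityI subsetI)
    fix b assume "b \<in> A2_scale t (?r `` {a})"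
    then obtain c where c: "(a, c) \<in> ?r" "b = scale_pt t c" by (auto simp: A2_scale_def)
    then show "b \<in> ?r `` {scale_pt t a}" using A2_rel_scale[OF c(1) t] by simp
  next
    fix b assume "b \<in> ?r `` {scale_pt t a}"
    then have "(scale_pt (1 / t) (scale_pt t a), scale_pt (1 / t) b) \<in> ?r"
      using A2_rel_scale[of "scale_pt t a" b ?m "1 / t"] t by simp
    then have "(a, scale_pt (1 / t) b) \<in> ?r" using t by simp
    moreover have "b = scale_pt t (scale_pt (1 / t) b)" using t by simp
    moreover have "A2_scale t c = scale_pt t ` c" for c
      by (auto simp: A2_scale_def case_prod_beta')
    ultimately show "b \<in> A2_scale t (?r `` {a})" by blast
  qed
  have zero: "(?z, a) \<in> ?r \<longleftrightarrow> a \<in> Z" if a: "a \<in> topspace ?X" for a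
  proof
    assume "(?z, a) \<in> ?r"
    from A2_rel_inv[OF this] show "a \<in> Z" by (auto simp: Z_def split: if_splits)
  next
    assume "a \<in> Z"
    then obtain P where P: "a = (P, 0)" "isotropic_subspace P" using a by (cases a) (auto simp: topspace_fan_support Z_def)
    then have "0 \<in> P" using rvec.subspace_0 by (auto simp: isotropic_subspace_def free_submodule_def)
    then have "A2_glue ?m ?z a"
      unfolding A2_glue_def topspace_fan_support P(1) using P(2) one_in_Sp4 isotropic_zero fan0
      by (intro exI[of _ "{0}"] exI[of _ P] exI[of _ 0] exI[of _ "mat 1"]) auto
    then show "(?z, a) \<in> ?r" by (rule A2_rel_glue)
  qed
  have z: "?z \<in> topspace ?X" using isotropic_zero fan0 by (auto simp: topspace_fan_support)
  have sc: "scale_pt t a \<in> topspace ?X" if "0 < t" "a \<in> topspace ?X" for t a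
  proof -
    obtain P x where "a = (P, x)" by (cases a)
    then show ?thesis using that fan_scale[of x P t] by (auto simp: topspace_fan_support)
  qed
  note ql = quotient_map_cone_link[of ?X ?r scale_pt A2_scale ?z Z, OF A2_class_eq sc scl _ _ z zero _ opZ]
  have q2: "quotient_map (subtopology ?X (topspace ?X - Z)) (LA2_trop ?m) H"
    unfolding LA2_trop_def A2_trop_def H_def by (rule ql(1)) (auto simp: Z_def)
  have H: "H a = H b \<longleftrightarrow> (\<exists>t>0. (scale_pt t a, b) \<in> ?r)" if "a \<in> topspace ?X - Z" "b \<in> topspace ?X - Z" for a b
    unfolding A2_trop_def H_def by (rule ql(2)) (use that in \<open>auto simp: Z_def\<close>)
  have fib: "f a = f b \<longleftrightarrow> H a = H b" if a: "a \<in> topspace ?X - Z" and b: "b \<in> topspace ?X - Z" for a b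
  proof
    assume eq: "f a = f b"
    obtain P x P' x' where *: "a = (P, x)" "b = (P', x')" by (metis surj_pair)
    then have "\<exists>t>0. ((P, t *\<^sub>R x), (P', x')) \<in> ?r"
      using a b eq unfolding Z_def f_def by (intro A2_fibre) (auto simp: topspace_fan_support)
    then show "H a = H b" using H[OF a b] * by auto
  next
    assume "H a = H b"
    then obtain t where t: "t > 0" "(scale_pt t a, b) \<in> ?r" using H[OF a b] by blast
    have "snd a \<noteq> 0" "snd b \<noteq> 0" using a b by (auto simp: Z_def)
    then have "proj (t *\<^sub>R snd a) = proj (snd b)"
      using A2_rel_inv[OF t(2)] t(1) by simp
    then show "f a = f b" using proj_scale[OF pt[OF a] t(1)] by (simp add: f_def)
  qed
  have "\<exists>h. homeomorphic_map (realization cplx) (LA2_trop ?m) h"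
  proof (rule quotient_maps_same_fibres[OF q1 q2])
    fix a b assume "a \<in> topspace (subtopology ?X (topspace ?X - Z))" "b \<in> topspace (subtopology ?X (topspace ?X - Z))"
    then show "f a = f b \<longleftrightarrow> H a = H b" unfolding top' by (rule fib)
  next
    fix h assume "homeomorphic_map (realization cplx) (LA2_trop ?m) h"
    then show ?thesis by blast
  qed
  then show ?thesis
    unfolding Delta2_eq_cplx homeomorphic_space_sym[of "LA2_trop ?m"]
    by (elim exE) (rule homeomorphic_map_imp_homeomorphic_space)
qed

end

section \<open>Triangulated surfaces\<close>

lemma homeomorphism_homeomorphic_space:
  assumes "homeomorphism S T f g"
  shows "top_of_set S homeomorphic_space top_of_set T"
proof -
  have "homeomorphic_maps (top_of_set S) (top_of_set T) f g"
    using assms unfolding homeomorphism_def homeomorphic_maps_def continuous_map_in_subtopology by auto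
  then show ?thesis unfolding homeomorphic_space_def by blast
qed

section \<open>The regular polygon\<close>

definition circ :: "real \<Rightarrow> real ^ 2" where "circ t = vector [cos t, sin t]"

lemma circ_inner: "circ s \<bullet> circ t = cos (s - t)"
  by (simp add: circ_def inner_vec_def sum_2 cos_diff)

lemma circ_periodic: "circ (t + 2 * pi) = circ t"
  by (simp add: circ_def)

text \<open>The angle e pi / n is further than pi / n from every multiple of 2 pi; beyond pi it is
  reflected to (2n - e) pi / n.\<close>

lemma cos_odd_multiple_less:
  fixes e n :: nat
  assumes "1 < e" "e < 2 * n - 1" "n \<ge> 3"
  shows "cos (real e * pi / real n) < cos (pi / real n)"
proof (cases "e \<le> n")
  case True
  have "pi / n < real e * pi / n" using assms by (simp add: divide_strict_right_mono)
  moreover have "real e * pi / n \<le> pi" using True assms by (simp add: field_simps)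
  ultimately show ?thesis by (intro cos_monotone_0_pi) auto
next
  case False
  have "cos (real e * pi / n) = cos (2 * pi - real e * pi / n)"
    by (simp add: cos_diff)
  also have "2 * pi - real e * pi / n = (2 * real n - real e) * pi / n"
    using assms by (simp add: field_simps)
  also have "cos ((2 * real n - real e) * pi / n) < cos (pi / n)"
  proof (rule cos_monotone_0_pi)
    have "2 * real n - real e > 1" using assms by linarith
    then show "pi / n < (2 * real n - real e) * pi / n" using assms by (simp add: divide_strict_right_mono)
    show "(2 * real n - real e) * pi / n \<le> pi" using False assms by (simp add: field_simps)
  qed simp
  finally show ?thesis .
qed

text \<open>The corners of a regular \<open>n\<close>-gon and, up to a positive factor, the normals of its sides;
  \<open>side n j\<close> is the linear functional that is 1 on the side from corner \<open>j\<close> to the next.\<close>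

definition corner :: "nat \<Rightarrow> nat \<Rightarrow> real ^ 2" where "corner n k = circ (2 * pi * real k / real n)"

definition side :: "nat \<Rightarrow> nat \<Rightarrow> real ^ 2 \<Rightarrow> real" where
  "side n j z = (z \<bullet> circ ((2 * real j + 1) * pi / real n)) / cos (pi / real n)"

lemma side_linear: "side n j (x + y) = side n j x + side n j y" "side n j (a *\<^sub>R x) = a * side n j x"
  "side n j 0 = 0"
  by (simp_all add: side_def inner_add_left add_divide_distrib)

lemma side_sum: "side n j (sum f A) = (\<Sum>i\<in>A. side n j (f i))"
  by (induction A rule: infinite_finite_induct) (simp_all add: side_linear)

lemma cos_pi_n_pos: "n \<ge> 3 \<Longrightarrow> cos (pi / real n) > 0"
proof -
  assume n: "n \<ge> 3"
  have "pi / real n < pi / 2" using n by (simp add: field_simps)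
  moreover have "- (pi / 2) < 0" "0 < pi / real n" using n by auto
  ultimately show ?thesis by (intro cos_gt_zero_pi) auto
qed

text \<open>Corner \<open>i\<close> and the normal of side \<open>j\<close> enclose the angle (2i -
  2j - 1) pi / n, an odd multiple of pi / n. The nearest possible value pi / n is attained exactly
  at the two ends of the side.\<close>

lemma side_corner:
  assumes n: "n \<ge> 3" and i: "i < n" and j: "j < n"
  shows "side n j (corner n i) \<le> 1"
    and "side n j (corner n i) = 1 \<longleftrightarrow> i = j \<or> i = Suc j mod n"
proof -
  have c0: "cos (pi / real n) > 0" by (rule cos_pi_n_pos[OF n])
  have s: "side n j (corner n i) = cos ((2 * real i - 2 * real j - 1) * pi / real n) / cos (pi / real n)"
    by (simp add: side_def corner_def circ_inner) (simp add: algebra_simps diff_divide_distrib add_divide_distrib)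
  have eq1: "side n j (corner n i) = 1" if "i = j \<or> i = Suc j mod n"
  proof -
    have "cos ((2 * real i - 2 * real j - 1) * pi / real n) = cos (pi / real n)"
    proof (cases "i = j")
      case True then show ?thesis by simp
    next
      case False
      then have "i = Suc j \<or> (Suc j = n \<and> i = 0)" using that j by (cases "Suc j = n") auto
      then show ?thesis
      proof
        assume "i = Suc j" then show ?thesis by simp
      next
        assume *: "Suc j = n \<and> i = 0"
        then have "(2 * real i - 2 * real j - 1) * pi / real n = pi / real n - 2 * pi"
          using n by (auto simp: field_simps)
        then show ?thesis by (simp only: cos_diff) simp
      qed
    qed
    then show ?thesis using s c0 by simp
  qed
  have lt: "side n j (corner n i) < 1" if ne: "\<not> (i = j \<or> i = Suc j mod n)"
  proof -
    \<comment> \<open>The witness is the absolute value of 2i - 2j - 1; the values 1 and 2n - 1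
      belong to the two ends of the side, the second one by wrapping around.\<close>
    have "\<exists>e. 1 < e \<and> e < 2 * n - 1 \<and> cos ((2 * real i - 2 * real j - 1) * pi / real n) = cos (real e * pi / real n)"
    proof (cases "i > j")
      case True
      then have "i \<noteq> Suc j" using ne i by auto
      then have "1 < 2 * (i - j) - 1" "2 * (i - j) - 1 < 2 * n - 1" using True i by auto
      moreover have "real (2 * (i - j) - 1) = 2 * real i - 2 * real j - 1" using True by (simp add: of_nat_diff)
      ultimately show ?thesis by metis
    next
      case False
      then have ij: "i < j" using ne by simp
      have "\<not> (i = 0 \<and> Suc j = n)" using ne by auto
      then have "1 < 2 * (j - i) + 1" "2 * (j - i) + 1 < 2 * n - 1" using ij j by auto
      moreover have r: "2 * real i - 2 * real j - 1 = - real (2 * (j - i) + 1)" using ij by (simp add: of_nat_diff)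
      have "(2 * real i - 2 * real j - 1) * pi / real n = - (real (2 * (j - i) + 1) * pi / real n)"
        unfolding r by (simp only: mult_minus_left minus_divide_left)
      then have "cos ((2 * real i - 2 * real j - 1) * pi / real n) = cos (real (2 * (j - i) + 1) * pi / real n)"
        by (simp only: cos_minus)
      ultimately show ?thesis by blast
    qed
    then show ?thesis using s c0 cos_odd_multiple_less[OF _ _ n] by (auto simp: divide_less_eq)
  qed
  show "side n j (corner n i) \<le> 1" using eq1 lt by fastforce
  show "side n j (corner n i) = 1 \<longleftrightarrow> i = j \<or> i = Suc j mod n" using eq1 lt by fastforce
qed

lemma corner_Suc: "n > 0 \<Longrightarrow> k < n \<Longrightarrow> corner n (Suc k mod n) = circ (2 * pi * real k / real n + 2 * pi / real n)"
proof -
  assume n: "n > 0" "k < n"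
  have e: "2 * pi * real k / real n + 2 * pi / real n = 2 * pi * real (Suc k) / real n"
    by (simp add: add_divide_distrib distrib_left)
  show ?thesis
  proof (cases "Suc k = n")
    case True
    then have "2 * pi * real (Suc k) / real n = 0 + 2 * pi" using n by simp
    then show ?thesis unfolding e using True circ_periodic[of 0] by (simp add: corner_def)
  next
    case False
    then show ?thesis unfolding e using n by (simp add: corner_def)
  qed
qed

lemma sin_2pi_n_pos: "n \<ge> 3 \<Longrightarrow> sin (2 * pi / real n) > 0"
  by (intro sin_gt_zero) (auto simp: field_simps)

text \<open>In polar coordinates the sector index is the integral part of the angle divided by h = 2
  pi / n.\<close>

lemma sector:
  fixes z :: "real ^ 2"
  assumes n: "n \<ge> 3"
  shows "\<exists>k<n. \<exists>a\<ge>0. \<exists>b\<ge>0. z = a *\<^sub>R corner n k + b *\<^sub>R corner n (Suc k mod n)"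
proof -
  define r where "r = sqrt ((z$1)\<^sup>2 + (z$2)\<^sup>2)"
  have "\<exists>t. 0 \<le> t \<and> t < 2 * pi \<and> z = r *\<^sub>R circ t"
  proof (cases "r = 0")
    case True
    then have "z $ 1 = 0" "z $ 2 = 0" by (auto simp: r_def add_nonneg_eq_0_iff)
    then show ?thesis using True by (intro exI[of _ 0]) (simp add: vec_eq_iff forall_2)
  next
    case False
    have r2: "r\<^sup>2 = (z$1)\<^sup>2 + (z$2)\<^sup>2" by (simp add: r_def)
    have "(z$1 / r)\<^sup>2 + (z$2 / r)\<^sup>2 = ((z$1)\<^sup>2 + (z$2)\<^sup>2) / r\<^sup>2"
      by (simp add: power_divide add_divide_distrib)
    then have "(z$1 / r)\<^sup>2 + (z$2 / r)\<^sup>2 = 1" using False unfolding r2[symmetric] by simp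
    then obtain t where "0 \<le> t" "t < 2 * pi" "z$1 / r = cos t" "z$2 / r = sin t" by (rule sincos_total_2pi)
    then show ?thesis using False by (intro exI[of _ t]) (auto simp: vec_eq_iff forall_2 circ_def field_simps)
  qed
  then obtain t where t: "0 \<le> t" "t < 2 * pi" "z = r *\<^sub>R circ t" by blast
  have r: "r \<ge> 0" by (simp add: r_def)
  define h where "h = 2 * pi / real n"
  have h: "h > 0" "sin h > 0" "h \<le> pi" using n sin_2pi_n_pos[OF n] by (auto simp: h_def field_simps)
  define k where "k = nat \<lfloor>t / h\<rfloor>"
  have k1: "real k \<le> t / h" "t / h < real k + 1"
  proof -
    have "real k = of_int \<lfloor>t / h\<rfloor>" using t(1) h(1) by (simp add: k_def)
    then show "real k \<le> t / h" "t / h < real k + 1" by linarith+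
  qed
  define s where "s = t - real k * h"
  have s: "0 \<le> s" "s < h" "t = real k * h + s" using k1 h(1) by (auto simp: s_def field_simps)
  have "t / h < real n" using t(2) n by (simp add: h_def field_simps)
  then have kn: "k < n" using k1 by linarith
  have c: "corner n k = circ (real k * h)" "corner n (Suc k mod n) = circ (real k * h + h)"
    using corner_Suc[of n k] kn n by (simp_all add: corner_def h_def mult.commute)
  \<comment> \<open>Decomposition of a unit vector along the two bounding directions; both sine
    coefficients are nonnegative because 0 \<le> s < h \<le> pi.\<close>
  have "sin h *\<^sub>R circ (real k * h + s) = sin (h - s) *\<^sub>R circ (real k * h) + sin s *\<^sub>R circ (real k * h + h)"
    by (simp add: vec_eq_iff forall_2 circ_def cos_add sin_add sin_diff algebra_simps)
  then have "(1 / sin h) *\<^sub>R (sin h *\<^sub>R circ t) = (1 / sin h) *\<^sub>R (sin (h - s) *\<^sub>R corner n k + sin s *\<^sub>R corner n (Suc k mod n))"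
    unfolding c s(3)[symmetric] by (rule arg_cong)
  then have "circ t = (1 / sin h) *\<^sub>R (sin (h - s) *\<^sub>R corner n k + sin s *\<^sub>R corner n (Suc k mod n))"
    using h(2) by simp
  then have "z = (r * (sin (h - s) / sin h)) *\<^sub>R corner n k + (r * (sin s / sin h)) *\<^sub>R corner n (Suc k mod n)"
    using t(3) by (simp add: scaleR_add_right)
  moreover have "sin (h - s) \<ge> 0" "sin s \<ge> 0" using s h by (auto intro!: sin_ge_zero)
  then have "r * (sin (h - s) / sin h) \<ge> 0" "r * (sin s / sin h) \<ge> 0" using r h by auto
  ultimately show ?thesis using kn by blast
qed

text \<open>Eliminating one coefficient at a time leaves the other multiplied by the determinant sin
  h of two consecutive corners.\<close>

lemma corner_indep:
  assumes n: "n \<ge> 3" and k: "k < n"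
    and eq: "a *\<^sub>R corner n k + b *\<^sub>R corner n (Suc k mod n) = a' *\<^sub>R corner n k + b' *\<^sub>R corner n (Suc k mod n)"
  shows "a = a' \<and> b = b'"
proof -
  define h where "h = 2 * pi / real n"
  have h: "sin h > 0" using sin_2pi_n_pos[OF n] by (simp add: h_def)
  define x where "x = real k * h"
  have c: "corner n k = circ x" "corner n (Suc k mod n) = circ (x + h)"
    using corner_Suc[of n k] k n by (simp_all add: corner_def h_def x_def mult.commute)
  have 1: "(a - a') * cos x + (b - b') * cos (x + h) = 0" "(a - a') * sin x + (b - b') * sin (x + h) = 0"
    using eq unfolding c by (simp_all add: vec_eq_iff forall_2 circ_def algebra_simps)
  have sh: "sin h = sin (x + h) * cos x - cos (x + h) * sin x"
    using sin_diff[of "x + h" x] by simp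
  have "(b - b') * sin h = ((a - a') * sin x + (b - b') * sin (x + h)) * cos x - ((a - a') * cos x + (b - b') * cos (x + h)) * sin x"
    unfolding sh by (simp add: algebra_simps)
  then have b: "b = b'" using h unfolding 1 by simp
  have "(a - a') * sin h = ((a - a') * cos x + (b - b') * cos (x + h)) * sin (x + h) - ((a - a') * sin x + (b - b') * sin (x + h)) * cos (x + h)"
    unfolding sh by (simp add: algebra_simps)
  then have "a = a'" using h unfolding 1 by simp
  then show ?thesis using b by blast
qed

text \<open>The star of the vertex \<open>v\<close> is the cone over an \<open>n\<close>-gon with corners \<open>w 0, \<dots>, w (n - 1)\<close>.\<close>

definition cyclic_star :: "'v set set \<Rightarrow> nat \<Rightarrow> 'v \<Rightarrow> (nat \<Rightarrow> 'v) \<Rightarrow> bool" where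
  "cyclic_star K n v w \<longleftrightarrow> inj_on w {..<n} \<and> v \<notin> w ` {..<n} \<and>
     (\<forall>k<n. {v, w k, w (Suc k mod n)} \<in> K) \<and>
     (\<forall>\<sigma>\<in>K. v \<in> \<sigma> \<longrightarrow> (\<exists>k<n. \<sigma> \<subseteq> {v, w k, w (Suc k mod n)}))"

definition delta :: "'v \<Rightarrow> 'v \<Rightarrow> real" where "delta v = (\<lambda>x. if x = v then 1 else 0)"

lemma delta_simplex: "finite \<sigma> \<Longrightarrow> v \<in> \<sigma> \<Longrightarrow> delta v \<in> closed_simplex \<sigma>"
  by (auto simp: closed_simplex_def delta_def)

lemma Suc_mod_ne: "n \<ge> 2 \<Longrightarrow> k < n \<Longrightarrow> Suc k mod n \<noteq> k \<and> Suc k mod n < n"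
  by (cases "Suc k = n") auto

text \<open>\<open>Psi\<close> maps the closed star linearly on each triangle to the regular
  polygon, with \<open>v\<close> at the centre. The polygon is the unit ball of the maximum of the
  functionals \<open>side n j\<close>, and this maximum is 1 - f v at the image of f. Hence
  \<open>Psi\<close> is injective, compactness makes it a homeomorphism, and the part with f v > 0
  goes to the open polygon.\<close>

lemma star_chart:
  assumes K: "finite K" "\<And>\<sigma>. \<sigma> \<in> K \<Longrightarrow> finite \<sigma>" and n: "n \<ge> 3" and st: "cyclic_star K n v w"
  shows "\<exists>V :: (real ^ 2) set. open V \<and>
    subtopology (realization K) {f \<in> polyhedron_of K. f v > 0} homeomorphic_space top_of_set V"
proof -
  have inj: "inj_on w {..<n}" and vw: "\<And>k. k < n \<Longrightarrow> v \<noteq> w k" and tri: "\<And>k. k < n \<Longrightarrow> {v, w k, w (Suc k mod n)} \<in> K"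
    and sub: "\<And>\<sigma>. \<sigma> \<in> K \<Longrightarrow> v \<in> \<sigma> \<Longrightarrow> \<exists>k<n. \<sigma> \<subseteq> {v, w k, w (Suc k mod n)}"
    using st unfolding cyclic_star_def by auto
  define Psi where "Psi f = (\<Sum>k<n. f (w k) *\<^sub>R corner n k)" for f :: "_ \<Rightarrow> real"
  define St where "St = \<Union>(closed_simplex ` {\<sigma>\<in>K. v \<in> \<sigma>})"
  have nx: "Suc k mod n \<noteq> k" "Suc k mod n < n" if "k < n" for k
    using Suc_mod_ne[of n k] that n by auto
  have form: "\<exists>k<n. (\<forall>x. x \<notin> {v, w k, w (Suc k mod n)} \<longrightarrow> f x = 0) \<and> f v + f (w k) + f (w (Suc k mod n)) = 1 \<and> (\<forall>x. 0 \<le> f x)"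
    if f: "f \<in> St" for f
  proof -
    obtain \<sigma> where s: "\<sigma> \<in> K" "v \<in> \<sigma>" "f \<in> closed_simplex \<sigma>" using f by (auto simp: St_def)
    obtain k where k: "k < n" "\<sigma> \<subseteq> {v, w k, w (Suc k mod n)}" using sub s by blast
    have 0: "f x = 0" if "x \<notin> {v, w k, w (Suc k mod n)}" for x using s(3) k(2) that by (auto simp: closed_simplex_def)
    have "sum f \<sigma> = sum f {v, w k, w (Suc k mod n)}"
      using s(3) k(2) by (intro sum.mono_neutral_left) (auto simp: closed_simplex_def)
    moreover have "w k \<noteq> w (Suc k mod n)" using inj_onD[OF inj, of k "Suc k mod n"] nx[OF k(1)] k(1) by auto
    ultimately have "f v + f (w k) + f (w (Suc k mod n)) = 1"
      using s(3) vw[OF k(1)] vw[OF nx(2)[OF k(1)]] by (simp add: closed_simplex_def add.assoc)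
    then show ?thesis using k(1) 0 s(3) by (auto simp: closed_simplex_def)
  qed
  have Psi2: "Psi f = f (w k) *\<^sub>R corner n k + f (w (Suc k mod n)) *\<^sub>R corner n (Suc k mod n)"
    if "k < n" "\<forall>x. x \<notin> {v, w k, w (Suc k mod n)} \<longrightarrow> f x = 0" for f k
  proof -
    have "f (w i) = 0" if i: "i < n" "i \<noteq> k" "i \<noteq> Suc k mod n" for i
      using that \<open>\<forall>x. _\<close> inj_onD[OF inj, of i] vw[OF i(1)] nx(2)[OF \<open>k < n\<close>] \<open>k < n\<close> by fastforce
    then have "Psi f = (\<Sum>i\<in>{k, Suc k mod n}. f (w i) *\<^sub>R corner n i)"
      unfolding Psi_def using nx(2)[OF that(1)] that(1) by (intro sum.mono_neutral_right) auto
    then show ?thesis using nx(1)[OF that(1)] by simp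
  qed
  have side_Psi: "side n j (Psi f) = (\<Sum>i<n. f (w i) * side n j (corner n i))" for j f
    unfolding Psi_def by (simp add: side_sum side_linear)
  have total: "(\<Sum>i<n. f (w i)) = 1 - f v" if f: "f \<in> St" for f
  proof -
    obtain k where k: "k < n" "\<forall>x. x \<notin> {v, w k, w (Suc k mod n)} \<longrightarrow> f x = 0" "f v + f (w k) + f (w (Suc k mod n)) = 1"
      using form[OF f] by blast
    have "f (w i) = 0" if i: "i < n" "i \<noteq> k" "i \<noteq> Suc k mod n" for i
      using k(2) inj_onD[OF inj, of i] vw[OF i(1)] nx(2)[OF k(1)] k(1) i by fastforce
    then have "(\<Sum>i<n. f (w i)) = (\<Sum>i\<in>{k, Suc k mod n}. f (w i))"
      using nx(2)[OF k(1)] k(1) by (intro sum.mono_neutral_right) auto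
    then show ?thesis using nx(1)[OF k(1)] k(3) by simp
  qed
  have side_le: "side n j (Psi f) \<le> 1 - f v" if f: "f \<in> St" and j: "j < n" for f j
  proof -
    have "side n j (Psi f) \<le> (\<Sum>i<n. f (w i))"
      unfolding side_Psi using side_corner(1)[OF n _ j] form[OF f]
      by (intro sum_mono) (auto simp: mult_left_le)
    then show ?thesis using total[OF f] by simp
  qed
  have side_eq: "side n k (Psi f) = f (w k) + f (w (Suc k mod n))"
    if "k < n" "\<forall>x. x \<notin> {v, w k, w (Suc k mod n)} \<longrightarrow> f x = 0" for f k
    unfolding Psi2[OF that] using side_corner(2)[OF n that(1) that(1)] side_corner(2)[OF n nx(2)[OF that(1)] that(1)]
    by (simp add: side_linear)
  have injP: "inj_on Psi St"
  proof (rule inj_onI)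
    fix f g assume f: "f \<in> St" and g: "g \<in> St" and eq: "Psi f = Psi g"
    obtain k where k: "k < n" "\<forall>x. x \<notin> {v, w k, w (Suc k mod n)} \<longrightarrow> f x = 0" "f v + f (w k) + f (w (Suc k mod n)) = 1"
      using form[OF f] by blast
    obtain j where j: "j < n" "\<forall>x. x \<notin> {v, w j, w (Suc j mod n)} \<longrightarrow> g x = 0" "g v + g (w j) + g (w (Suc j mod n)) = 1"
      "\<forall>x. 0 \<le> g x"
      using form[OF g] by blast
    \<comment> \<open>For each of the two points, 1 minus its value at \<open>v\<close> bounds every
      side functional and is attained at the side of its own triangle; comparing at \<open>k\<close>
      and at \<open>j\<close> gives both inequalities.\<close>
    have v: "f v = g v"
      using side_le[OF g k(1)] side_eq[OF k(1,2)] k(3) side_le[OF f j(1)] side_eq[OF j(1,2)] j(3)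
        arg_cong[OF eq, of "side n k"] arg_cong[OF eq, of "side n j"] by linarith
    \<comment> \<open>Side \<open>k\<close> is maximal for \<open>g\<close> as well. The terms are
      nonnegative, so \<open>g\<close> is supported at \<open>v\<close> and the two corners where
      the functional equals 1.\<close>
    have "(\<Sum>i<n. g (w i) * (1 - side n k (corner n i))) = 0"
      using side_Psi[of k g] total[OF g] side_eq[OF k(1,2)] k(3) v eq
      by (simp add: right_diff_distrib sum_subtractf)
    moreover have "0 \<le> g (w i) * (1 - side n k (corner n i))" if "i < n" for i
      using side_corner(1)[OF n that k(1)] j(4) by simp
    ultimately have z: "g (w i) * (1 - side n k (corner n i)) = 0" if "i < n" for i
      using that sum_nonneg_eq_0_iff[of "{..<n}" "\<lambda>i. g (w i) * (1 - side n k (corner n i))"] by blast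
    have g0: "g x = 0" if "x \<notin> {v, w k, w (Suc k mod n)}" for x
    proof (cases "x \<in> w ` {..<n}")
      case True
      then obtain i where i: "i < n" "x = w i" by blast
      then have "side n k (corner n i) \<noteq> 1" using side_corner(2)[OF n i(1) k(1)] that by auto
      then show ?thesis using z[OF i(1)] i(2) by simp
    next
      case False
      then have "x \<noteq> w j" "x \<noteq> w (Suc j mod n)" using j(1) nx(2)[OF j(1)] by blast+
      then show ?thesis using j(2) that by blast
    qed
    have "f (w k) = g (w k) \<and> f (w (Suc k mod n)) = g (w (Suc k mod n))"
      using corner_indep[OF n k(1)] eq Psi2[OF k(1,2)] Psi2[of k g] g0 k(1) by metis
    then have "f x = g x" for x
      using v k(2) g0 by (cases "x \<in> {v, w k, w (Suc k mod n)}") auto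
    then show "f = g" by blast
  qed
  have "compact St" unfolding St_def using K by (intro compact_UN compact_closed_simplex) auto
  moreover have contP: "continuous_on St Psi"
    unfolding Psi_def by (intro continuous_intros continuous_on_coordinate)
  ultimately obtain g where hom: "homeomorphism St (Psi ` St) Psi g"
    using homeomorphism_compact[OF _ _ refl injP] by blast
  define U where "U = {f \<in> polyhedron_of K. f v > 0}"
  define V where "V = {z. \<forall>j<n. side n j z < 1}"
  have US: "U \<subseteq> St"
  proof
    fix f assume "f \<in> U"
    then obtain \<sigma> where "\<sigma> \<in> K" "f \<in> closed_simplex \<sigma>" "f v > 0" by (auto simp: U_def)
    moreover have "v \<in> \<sigma>" using calculation by (auto simp: closed_simplex_def)
    ultimately show "f \<in> St" by (auto simp: St_def)
  qed
  have "Psi ` U = V"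
  proof (intro equalityI subsetI)
    fix z assume "z \<in> Psi ` U"
    then obtain f where f: "f \<in> U" "z = Psi f" by blast
    then have "f v > 0" by (simp add: U_def)
    then show "z \<in> V" unfolding V_def f(2) using side_le US f(1) by fastforce
  next
    fix z assume z: "z \<in> V"
    obtain k a b where k: "k < n" "a \<ge> 0" "b \<ge> 0" "z = a *\<^sub>R corner n k + b *\<^sub>R corner n (Suc k mod n)"
      using sector[OF n] by blast
    have wn: "w k \<noteq> w (Suc k mod n)" using inj_onD[OF inj, of k "Suc k mod n"] nx[OF k(1)] k(1) by auto
    note vn = vw[OF k(1)] vw[OF nx(2)[OF k(1)]]
    have "side n k z = a + b"
      unfolding k(4) using side_corner(2)[OF n k(1) k(1)] side_corner(2)[OF n nx(2)[OF k(1)] k(1)]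
      by (simp add: side_linear)
    then have ab: "a + b < 1" using z k(1) by (auto simp: V_def)
    define f where "f = (\<lambda>x. if x = v then 1 - a - b else if x = w k then a else if x = w (Suc k mod n) then b else 0)"
    have f: "f v = 1 - a - b" "f (w k) = a" "f (w (Suc k mod n)) = b" using vn wn by (auto simp: f_def)
    have f0: "\<forall>x. x \<notin> {v, w k, w (Suc k mod n)} \<longrightarrow> f x = 0" by (auto simp: f_def)
    have "Psi f = z" using Psi2[OF k(1) f0] f k(4) by simp
    moreover have "f \<in> closed_simplex {v, w k, w (Suc k mod n)}"
      using f f0 vn wn ab k(2,3) by (auto simp: closed_simplex_def f_def)
    then have "f \<in> U" using tri[OF k(1)] f ab by (auto simp: U_def)
    ultimately show "z \<in> Psi ` U" by blast
  qed
  then have "homeomorphism U V Psi g"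
    using homeomorphism_of_subsets[OF hom US, of "Psi ` St"] by blast
  moreover have "open V"
  proof -
    have "open {z. side n j z < 1}" for j
      unfolding side_def by (intro open_Collect_less continuous_intros) (use cos_pi_n_pos[OF n] in auto)
    moreover have "V = (\<Inter>j\<in>{..<n}. {z. side n j z < 1})" by (auto simp: V_def)
    ultimately show ?thesis by auto
  qed
  moreover have "subtopology (realization K) U = top_of_set U"
  proof -
    have "realization K = top_of_set (polyhedron_of K)" using realization_finite K by metis
    moreover have "polyhedron_of K \<inter> U = U" by (auto simp: U_def)
    ultimately show ?thesis by (simp only: subtopology_subtopology)
  qed
  ultimately show ?thesis unfolding U_def[symmetric] using homeomorphism_homeomorphic_space by metis
qed

section \<open>Connectedness and recognition of closed surfaces\<close>

lemma connected_component_vertex: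
  assumes "\<sigma> \<in> K" "finite \<sigma>" "v \<in> \<sigma>" "f \<in> closed_simplex \<sigma>"
  shows "connected_component (polyhedron_of K) (delta v) f"
proof -
  define p where "p t = (\<lambda>x. (1 - t) * delta v x + t * f x)" for t :: real
  have "continuous_on {0..1} p"
    unfolding p_def by (intro continuous_on_coordinatewise_then_product continuous_intros)
  then have "connected (p ` {0..1})" by (intro connected_continuous_image) auto
  moreover have "p ` {0..1} \<subseteq> polyhedron_of K"
  proof -
    have "p t \<in> closed_simplex \<sigma>" if "t \<in> {0..1}" for t
      using assms that delta_simplex[OF assms(2,3)]
      by (auto simp: closed_simplex_def p_def sum.distrib simp flip: sum_distrib_left)
    then show ?thesis using assms(1) by blast
  qed
  moreover have "p 0 = delta v" "p 1 = f" by (simp_all add: p_def fun_eq_iff)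
  then have "delta v \<in> p ` {0..1}" "f \<in> p ` {0..1}" by (metis atLeastAtMost_iff imageI order_refl zero_le_one)+
  ultimately show ?thesis by (intro connected_componentI)
qed

lemma realization_connected:
  assumes K: "finite K" "\<And>\<sigma>. \<sigma> \<in> K \<Longrightarrow> finite \<sigma> \<and> \<sigma> \<noteq> {}"
    and con: "\<And>a b. a \<in> \<Union>K \<Longrightarrow> b \<in> \<Union>K \<Longrightarrow> (a, b) \<in> {(a, b). {a, b} \<in> K}\<^sup>*"
  shows "connected_space (realization K)"
proof -
  let ?P = "polyhedron_of K"
  have edge: "connected_component ?P (delta a) (delta b)" if ab: "(a, b) \<in> {(a, b). {a, b} \<in> K}\<^sup>*" and a: "a \<in> \<Union>K" for a b
    using ab
  proof induction
    case base
    obtain \<sigma> where "\<sigma> \<in> K" "a \<in> \<sigma>" using a by blast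
    then show ?case using connected_component_vertex[of \<sigma> K a "delta a"] K(2)[of \<sigma>] delta_simplex[of \<sigma> a] by simp
  next
    case (step b c)
    then have "connected_component ?P (delta b) (delta c)"
      by (intro connected_component_vertex[of "{b, c}"]) (auto intro: delta_simplex)
    then show ?case using step.IH connected_component_trans by blast
  qed
  have "connected_component ?P f g" if fg: "f \<in> ?P" "g \<in> ?P" for f g
  proof -
    obtain \<sigma> \<tau> where s: "\<sigma> \<in> K" "f \<in> closed_simplex \<sigma>" "\<tau> \<in> K" "g \<in> closed_simplex \<tau>" using fg by blast
    obtain a b where ab: "a \<in> \<sigma>" "b \<in> \<tau>" using K(2) s by blast
    have "connected_component ?P (delta a) f" "connected_component ?P (delta b) g"
      using connected_component_vertex[OF s(1) _ ab(1) s(2)] connected_component_vertex[OF s(3) _ ab(2) s(4)]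
        K(2)[OF s(1)] K(2)[OF s(3)] by blast+
    moreover have "connected_component ?P (delta a) (delta b)" using edge con ab s by blast
    ultimately show ?thesis by (meson connected_component_sym connected_component_trans)
  qed
  then have "connected ?P" by (simp add: connected_iff_connected_component)
  then have "connectedin euclidean ?P" by simp
  then have "connected_space (top_of_set ?P)" unfolding connectedin_def by blast
  moreover have "realization K = top_of_set ?P" using realization_finite K by metis
  ultimately show ?thesis by simp
qed

lemma Hausdorff_realization:
  assumes "finite K" "\<And>\<sigma>. \<sigma> \<in> K \<Longrightarrow> finite \<sigma>"
  shows "Hausdorff_space (realization K)"
proof -
  have "Hausdorff_space (euclidean :: ('a \<Rightarrow> real) topology)"
    unfolding euclidean_product_topology[symmetric] by (simp add: Hausdorff_space_product_topology Hausdorff_space_euclidean)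
  moreover have "realization K = top_of_set (polyhedron_of K)"
    by (rule realization_finite) (use assms in auto)
  ultimately show ?thesis by (simp add: Hausdorff_space_subtopology)
qed

lemma closed_surface_realization:
  assumes K: "finite K" "abstract_complex K" "K \<noteq> {}"
    and n: "n \<ge> 3" and st: "\<And>v. v \<in> \<Union>K \<Longrightarrow> \<exists>w. cyclic_star K n v w"
    and con: "\<And>a b. a \<in> \<Union>K \<Longrightarrow> b \<in> \<Union>K \<Longrightarrow> (a, b) \<in> {(a, b). {a, b} \<in> K}\<^sup>*"
  shows "closed_surface (realization K)"
  unfolding closed_surface_def
proof (intro conjI ballI)
  have fin: "finite \<sigma>" "\<sigma> \<noteq> {}" if "\<sigma> \<in> K" for \<sigma> using K(2) that by (auto simp: abstract_complex_def)
  have real: "realization K = top_of_set (polyhedron_of K)" by (rule realization_finite[OF K(1) fin(1)])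
  obtain \<sigma> v where s: "\<sigma> \<in> K" "v \<in> \<sigma>" using K(3) fin(2) by blast
  then show "topspace (realization K) \<noteq> {}" using delta_simplex[OF fin(1)] by fastforce
  show "compact_space (realization K)"
    unfolding real using compact_polyhedron_of[OF K(1) fin(1)] by (simp add: compact_space_subtopology)
  show "connected_space (realization K)" using realization_connected[OF K(1) _ con] fin by blast
  show "Hausdorff_space (realization K)" by (rule Hausdorff_realization[OF K(1) fin(1)])
  fix f assume "f \<in> topspace (realization K)"
  then obtain \<sigma> where f: "\<sigma> \<in> K" "f \<in> closed_simplex \<sigma>" by auto
  have "\<exists>v\<in>\<sigma>. f v > 0"
  proof (rule ccontr)
    assume "\<not> (\<exists>v\<in>\<sigma>. f v > 0)"
    then have "sum f \<sigma> = 0" using f(2) by (intro sum.neutral) (force simp: closed_simplex_def less_le)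
    then show False using f(2) by (simp add: closed_simplex_def)
  qed
  then obtain v where v: "v \<in> \<sigma>" "f v > 0" by blast
  then obtain w where "cyclic_star K n v w" using st f(1) by blast
  then obtain V where V: "open (V :: (real ^ 2) set)"
    "subtopology (realization K) {f \<in> polyhedron_of K. f v > 0} homeomorphic_space top_of_set V"
    using star_chart[OF K(1) fin(1) n] by blast
  have "open {f :: 'a \<Rightarrow> real. f v > 0}"
    by (intro open_Collect_less continuous_on_coordinate continuous_intros)
  then have "openin (realization K) (polyhedron_of K \<inter> {f. f v > 0})"
    unfolding real by (rule openin_open_Int)
  moreover have "polyhedron_of K \<inter> {f. f v > 0} = {f \<in> polyhedron_of K. f v > 0}" by auto
  ultimately have "openin (realization K) {f \<in> polyhedron_of K. f v > 0}" by simp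
  then show "\<exists>U V. openin (realization K) U \<and> f \<in> U \<and> open (V :: (real ^ 2) set) \<and>
    subtopology (realization K) U homeomorphic_space top_of_set V"
    using V f v(2) by blast
qed

text \<open>Relabels the vertices, as \<open>closed_oriented_surface\<close> asks for a
  triangulation on natural numbers; \<open>F\<close> and \<open>G\<close> transport barycentric
  coordinates in both directions.\<close>

lemma realization_image:
  assumes K: "finite K" "\<And>\<sigma>. \<sigma> \<in> K \<Longrightarrow> finite \<sigma>" and inj: "inj_on h (\<Union>K)"
  shows "realization ((`) h ` K) homeomorphic_space realization K"
proof -
  let ?K = "(`) h ` K"
  have K': "finite ?K" "\<And>\<sigma>. \<sigma> \<in> ?K \<Longrightarrow> finite \<sigma>" using K by auto
  define F where "F f = (\<lambda>x. if x \<in> h ` \<Union>K then f (inv_into (\<Union>K) h x) else (0::real))" for f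
  define G where "G g = (\<lambda>v. if v \<in> \<Union>K then g (h v) else (0::real))" for g
  have ih: "inv_into (\<Union>K) h (h v) = v" if "v \<in> \<Union>K" for v
    using inj that by (rule inv_into_f_f)
  have Fh: "F f (h v) = f v" if "v \<in> \<Union>K" for f v
    using that ih[OF that] by (simp add: F_def)
  have F0: "F f x = 0" if "x \<notin> h ` \<Union>K" for f x
    using that by (simp add: F_def)
  have Fc: "F f \<in> closed_simplex (h ` \<sigma>)" if "\<sigma> \<in> K" "f \<in> closed_simplex \<sigma>" for f \<sigma>
  proof -
    have "sum (F f) (h ` \<sigma>) = (\<Sum>v\<in>\<sigma>. F f (h v))"
      using inj that(1) by (intro sum.reindex_cong[of h]) (auto intro: inj_on_subset)
    also have "\<dots> = sum f \<sigma>" using that(1) by (intro sum.cong refl Fh) blast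
    finally have "sum (F f) (h ` \<sigma>) = 1" using that(2) by (simp add: closed_simplex_def)
    moreover have "F f x = 0" if "x \<notin> h ` \<sigma>" for x
    proof (cases "x \<in> h ` \<Union>K")
      case True
      then obtain v where "v \<in> \<Union>K" "x = h v" by blast
      then show ?thesis using Fh[of v f] that \<open>f \<in> closed_simplex \<sigma>\<close> by (auto simp: closed_simplex_def)
    qed (rule F0)
    moreover have "0 \<le> F f x" for x using that(2) by (simp add: F_def closed_simplex_def)
    ultimately show ?thesis by (simp add: closed_simplex_def)
  qed
  have Gc: "G g \<in> closed_simplex \<sigma>" if "\<sigma> \<in> K" "g \<in> closed_simplex (h ` \<sigma>)" for g \<sigma>
  proof -
    have "sum g (h ` \<sigma>) = (\<Sum>v\<in>\<sigma>. g (h v))"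
      using inj that(1) by (intro sum.reindex_cong[of h]) (auto intro: inj_on_subset)
    also have "\<dots> = sum (G g) \<sigma>" using that(1) by (intro sum.cong) (auto simp: G_def)
    moreover have "h v \<notin> h ` \<sigma>" if "v \<in> \<Union>K" "v \<notin> \<sigma>" for v
      using that \<open>\<sigma> \<in> K\<close> inj by (metis Union_iff inj_on_image_mem_iff Union_upper)
    ultimately show ?thesis using that by (auto simp: closed_simplex_def G_def)
  qed
  have FG: "F (G g) = g" if "\<sigma> \<in> K" "g \<in> closed_simplex (h ` \<sigma>)" for g \<sigma>
  proof
    fix x
    show "F (G g) x = g x"
    proof (cases "x \<in> h ` \<Union>K")
      case True
      then obtain v where "v \<in> \<Union>K" "x = h v" by blast
      then show ?thesis using Fh[of v "G g"] by (simp add: G_def)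
    next
      case False
      then have "x \<notin> h ` \<sigma>" using that(1) by blast
      then show ?thesis using F0[OF False] that(2) by (simp add: closed_simplex_def)
    qed
  qed
  have GF: "G (F f) = f" if "\<sigma> \<in> K" "f \<in> closed_simplex \<sigma>" for f \<sigma>
  proof
    fix v
    show "G (F f) v = f v"
    proof (cases "v \<in> \<Union>K")
      case True then show ?thesis using Fh[OF True] by (simp add: G_def)
    next
      case False
      then have "v \<notin> \<sigma>" using that(1) by blast
      then show ?thesis using False that(2) by (simp add: G_def closed_simplex_def)
    qed
  qed
  have real: "realization K = top_of_set (polyhedron_of K)" "realization ?K = top_of_set (polyhedron_of ?K)"
    by (rule realization_finite; use K K' in auto)+
  have cF: "continuous_map (realization K) (realization ?K) F"
    unfolding real
  proof (rule continuous_map_into_functions)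
    show "F x \<in> polyhedron_of ?K" if "x \<in> topspace (top_of_set (polyhedron_of K))" for x
      using that Fc by auto
    show "continuous_map (top_of_set (polyhedron_of K)) euclideanreal (\<lambda>x. F x y)" for y
      unfolding F_def by (cases "y \<in> h ` \<Union>K") (simp_all add: continuous_on_coordinate)
  qed
  have cG: "continuous_map (realization ?K) (realization K) G"
    unfolding real
  proof (rule continuous_map_into_functions)
    show "G x \<in> polyhedron_of K" if "x \<in> topspace (top_of_set (polyhedron_of ?K))" for x
      using that Gc by auto
    show "continuous_map (top_of_set (polyhedron_of ?K)) euclideanreal (\<lambda>x. G x y)" for y
      unfolding G_def by (cases "y \<in> \<Union>K") (simp_all add: continuous_on_coordinate)
  qed
  have "homeomorphic_maps (realization K) (realization ?K) F G"
    unfolding homeomorphic_maps_def using cF cG FG GF by auto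
  then have "realization K homeomorphic_space realization ?K" unfolding homeomorphic_space_def by blast
  then show ?thesis by (rule homeomorphic_space_sym[THEN iffD1])
qed

lemma coherently_orientable_image:
  assumes inj: "inj_on h (\<Union>K)" and K: "\<And>\<sigma>. \<sigma> \<in> K \<Longrightarrow> finite \<sigma>" and or: "coherently_orientable K"
  shows "coherently_orientable ((`) h ` K)"
proof -
  obtain r where r: "(\<forall>T\<in>K. card T = 3 \<longrightarrow> (\<forall>a\<in>T. r T a \<in> T \<and> r T a \<noteq> a \<and> r T (r T (r T a)) = a)) \<and>
      (\<forall>T\<in>K. \<forall>T'\<in>K. card T = 3 \<and> card T' = 3 \<and> T \<noteq> T' \<longrightarrow> (\<forall>a \<in> T \<inter> T'. r T a \<in> T' \<longrightarrow> r T' (r T a) = a))"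
    using or unfolding coherently_orientable_def ..
  then have r1: "\<And>T a. T \<in> K \<Longrightarrow> card T = 3 \<Longrightarrow> a \<in> T \<Longrightarrow> r T a \<in> T \<and> r T a \<noteq> a \<and> r T (r T (r T a)) = a"
    and r2: "\<And>T T' a. T \<in> K \<Longrightarrow> T' \<in> K \<Longrightarrow> card T = 3 \<Longrightarrow> card T' = 3 \<Longrightarrow> T \<noteq> T' \<Longrightarrow> a \<in> T \<inter> T' \<Longrightarrow>
      r T a \<in> T' \<Longrightarrow> r T' (r T a) = a"
    by simp_all
  let ?i = "inv_into (\<Union>K) h"
  have ih: "?i (h x) = x" if "T \<in> K" "x \<in> T" for T x using inj that by (intro inv_into_f_f) auto
  have iT: "?i ` h ` T = T" if "T \<in> K" for T using ih[OF that] by (auto simp: image_image)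
  have cd: "card (h ` T) = card T" if "T \<in> K" for T using inj that by (intro card_image) (auto intro: inj_on_subset)
  have heq: "x = y" if "h x = h y" "T \<in> K" "T' \<in> K" "x \<in> T" "y \<in> T'" for x y T T'
    using that ih by metis
  define s where "s T a = h (r (?i ` T) (?i a))" for T a
  have s: "s (h ` T) (h a) = h (r T a)" if "T \<in> K" "a \<in> T" for T a
    using that by (simp add: s_def iT ih)
  show ?thesis
    unfolding coherently_orientable_def
  proof (intro exI[of _ s] conjI ballI impI)
    fix T' a' assume T': "T' \<in> (`) h ` K" "card T' = 3" "a' \<in> T'"
    then obtain T a where T: "T \<in> K" "T' = h ` T" "a \<in> T" "a' = h a" by blast
    then have c: "card T = 3" using T' cd by simp
    note ra = r1[OF T(1) c]
    show "s T' a' \<in> T'" using ra[OF T(3)] T s by simp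
    show "s T' a' \<noteq> a'" using ra[OF T(3)] T s heq by metis
    show "s T' (s T' (s T' a')) = a'" using ra T s by simp
  next
    fix T1 T2 a' assume A: "T1 \<in> (`) h ` K" "T2 \<in> (`) h ` K" "card T1 = 3 \<and> card T2 = 3 \<and> T1 \<noteq> T2"
      "a' \<in> T1 \<inter> T2" "s T1 a' \<in> T2"
    then obtain T T' where T: "T \<in> K" "T1 = h ` T" "T' \<in> K" "T2 = h ` T'" by blast
    obtain a where a: "a \<in> T" "a' = h a" using A(4) T by blast
    then have a': "a \<in> T'" using A(4) T heq by (metis IntE imageE)
    have c: "card T = 3" "card T' = 3" "T \<noteq> T'" using A(3) T cd by auto
    have "h (r T a) \<in> h ` T'" using A(5) T a s by simp
    then have "r T a \<in> T'" using r1[OF T(1) c(1) a(1)] heq T by (metis imageE)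
    then have "r T' (r T a) = a" using r2[OF T(1,3) c(1,2,3)] a a' by blast
    then show "s T2 (s T1 a') = a'" using T a s \<open>r T a \<in> T'\<close> by simp
  qed
qed

lemma closed_oriented_surface_realization:
  fixes K :: "'v set set"
  assumes K: "finite K" "abstract_complex K" and surf: "closed_surface (realization K)"
    and or: "coherently_orientable K" and ec: "euler_char K = 2 - 2 * int g"
  shows "closed_oriented_surface (realization K) g"
proof -
  have fin: "finite \<sigma>" "\<sigma> \<noteq> {}" if "\<sigma> \<in> K" for \<sigma> using K(2) that by (auto simp: abstract_complex_def)
  have "finite (\<Union>K)" using K(1) fin by blast
  then obtain h :: "'v \<Rightarrow> nat" where h: "inj_on h (\<Union>K)" using finite_imp_inj_to_nat_seg by metis
  let ?K = "(`) h ` K"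
  have injK: "inj_on ((`) h) K"
    using h by (intro inj_onI) (metis Union_upper inj_on_image_eq_iff)
  have cd: "card (h ` T) = card T" if "T \<in> K" for T using h that by (intro card_image) (auto intro: inj_on_subset)
  have "abstract_complex ?K"
    unfolding abstract_complex_def
  proof (intro conjI ballI allI impI)
    fix \<sigma> assume "\<sigma> \<in> ?K" then show "finite \<sigma>" "\<sigma> \<noteq> {}" using fin by auto
  next
    fix \<sigma> \<tau> assume s: "\<sigma> \<in> ?K" "\<tau> \<subseteq> \<sigma> \<and> \<tau> \<noteq> {}"
    then obtain \<sigma>' where s': "\<sigma>' \<in> K" "\<sigma> = h ` \<sigma>'" by blast
    then obtain \<tau>' where t: "\<tau>' \<subseteq> \<sigma>'" "\<tau> = h ` \<tau>'" using s(2) by (metis subset_imageE)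
    then have "\<tau>' \<in> K" using K(2) s'(1) s(2) unfolding abstract_complex_def by blast
    then show "\<tau> \<in> ?K" using t by blast
  qed
  moreover have "euler_char ?K = 2 - 2 * int g"
    unfolding ec[symmetric] euler_char_def using cd by (simp add: sum.reindex[OF injK])
  ultimately show ?thesis
    unfolding closed_oriented_surface_def
    using surf K(1) realization_image[OF K(1) fin(1) h] coherently_orientable_image[OF h fin(1) or] by blast
qed

section \<open>The Euler characteristic from vertex degrees\<close>

lemma sum_card_incidence:
  assumes "finite S" "finite V" "\<And>\<sigma>. \<sigma> \<in> S \<Longrightarrow> \<sigma> \<subseteq> V"
  shows "(\<Sum>v\<in>V. card {\<sigma>\<in>S. v \<in> \<sigma>}) = (\<Sum>\<sigma>\<in>S. card \<sigma>)"
proof -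
  have "(\<Sum>v\<in>V. card {\<sigma>\<in>S. v \<in> \<sigma>}) = (\<Sum>v\<in>V. \<Sum>\<sigma>\<in>S. if v \<in> \<sigma> then 1 else 0)"
    using assms(1) by (simp add: sum.If_cases Int_def)
  also have "\<dots> = (\<Sum>\<sigma>\<in>S. \<Sum>v\<in>V. if v \<in> \<sigma> then 1 else 0)" by (rule sum.swap)
  also have "\<dots> = (\<Sum>\<sigma>\<in>S. card \<sigma>)"
    using assms(2,3) by (intro sum.cong refl) (simp add: sum.If_cases Int_absorb1)
  finally show ?thesis .
qed

text \<open>Each vertex lies on n edges and n triangles, so nV = 2E = 3F by double counting, and 6(V
  - E + F) = (6 - n)V.\<close>

lemma euler_char_cyclic:
  assumes K: "finite K" "abstract_complex K" and n: "n \<ge> 3"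
    and st: "\<And>v. v \<in> \<Union>K \<Longrightarrow> \<exists>w. cyclic_star K n v w"
  shows "6 * euler_char K = (6 - int n) * int (card (\<Union>K))"
proof -
  have fin: "finite \<sigma>" "\<sigma> \<noteq> {}" if "\<sigma> \<in> K" for \<sigma> using K(2) that by (auto simp: abstract_complex_def)
  have face: "\<tau> \<in> K" if "\<sigma> \<in> K" "\<tau> \<subseteq> \<sigma>" "\<tau> \<noteq> {}" for \<sigma> \<tau> using K(2) that unfolding abstract_complex_def by blast
  let ?V = "\<Union>K"
  have fV: "finite ?V" using K(1) fin by blast
  define E F where "E = {\<sigma>\<in>K. card \<sigma> = 2}" and "F = {\<sigma>\<in>K. card \<sigma> = 3}"
  have deg: "card {\<sigma>\<in>E. v \<in> \<sigma>} = n \<and> card {\<sigma>\<in>F. v \<in> \<sigma>} = n \<and> (\<forall>\<sigma>\<in>K. v \<in> \<sigma> \<longrightarrow> card \<sigma> \<le> 3)" if v: "v \<in> ?V" for v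
  proof -
    obtain w where w: "cyclic_star K n v w" using st v by blast
    have inj: "inj_on w {..<n}" and vw: "\<And>k. k < n \<Longrightarrow> v \<noteq> w k" and tri: "\<And>k. k < n \<Longrightarrow> {v, w k, w (Suc k mod n)} \<in> K"
      and sub: "\<And>\<sigma>. \<sigma> \<in> K \<Longrightarrow> v \<in> \<sigma> \<Longrightarrow> \<exists>k<n. \<sigma> \<subseteq> {v, w k, w (Suc k mod n)}"
      using w unfolding cyclic_star_def by auto
    have nx: "Suc k mod n \<noteq> k" "Suc k mod n < n" if "k < n" for k
      using Suc_mod_ne[of n k] that n by auto
    have weq: "w i = w j \<longleftrightarrow> i = j" if "i < n" "j < n" for i j using inj_onD[OF inj] that by auto
    have c3: "card {v, w k, w (Suc k mod n)} = 3" if "k < n" for k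
      using vw[OF that] vw[OF nx(2)[OF that]] nx[OF that] weq[OF that nx(2)[OF that]] by auto
    have "{\<sigma>\<in>E. v \<in> \<sigma>} = (\<lambda>k. {v, w k}) ` {..<n}"
    proof (intro equalityI subsetI)
      fix \<sigma> assume s: "\<sigma> \<in> {\<sigma>\<in>E. v \<in> \<sigma>}"
      then obtain k where k: "k < n" "\<sigma> \<subseteq> {v, w k, w (Suc k mod n)}" using sub by (auto simp: E_def)
      obtain x where x: "\<sigma> = {v, x}" "x \<noteq> v" using s unfolding E_def by (auto simp: card_2_iff)
      then have "x = w k \<or> x = w (Suc k mod n)" using k by auto
      then show "\<sigma> \<in> (\<lambda>k. {v, w k}) ` {..<n}" using x k(1) nx(2)[OF k(1)] by auto
    next
      fix \<sigma> assume "\<sigma> \<in> (\<lambda>k. {v, w k}) ` {..<n}"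
      then obtain k where k: "k < n" "\<sigma> = {v, w k}" by blast
      then have "\<sigma> \<in> K" using face[OF tri[OF k(1)], of \<sigma>] by auto
      then show "\<sigma> \<in> {\<sigma>\<in>E. v \<in> \<sigma>}" using k vw[OF k(1)] by (auto simp: E_def)
    qed
    moreover have "inj_on (\<lambda>k. {v, w k}) {..<n}"
      using weq by (intro inj_onI) (auto simp: doubleton_eq_iff)
    ultimately have 1: "card {\<sigma>\<in>E. v \<in> \<sigma>} = n" by (simp add: card_image)
    have "{\<sigma>\<in>F. v \<in> \<sigma>} = (\<lambda>k. {v, w k, w (Suc k mod n)}) ` {..<n}"
    proof (intro equalityI subsetI)
      fix \<sigma> assume s: "\<sigma> \<in> {\<sigma>\<in>F. v \<in> \<sigma>}"
      then obtain k where k: "k < n" "\<sigma> \<subseteq> {v, w k, w (Suc k mod n)}" using sub by (auto simp: F_def)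
      then have "\<sigma> = {v, w k, w (Suc k mod n)}" using s c3[OF k(1)] unfolding F_def by (intro card_subset_eq) auto
      then show "\<sigma> \<in> (\<lambda>k. {v, w k, w (Suc k mod n)}) ` {..<n}" using k(1) by auto
    next
      fix \<sigma> assume "\<sigma> \<in> (\<lambda>k. {v, w k, w (Suc k mod n)}) ` {..<n}"
      then show "\<sigma> \<in> {\<sigma>\<in>F. v \<in> \<sigma>}" using tri c3 by (auto simp: F_def)
    qed
    moreover have "inj_on (\<lambda>k. {v, w k, w (Suc k mod n)}) {..<n}"
    proof (rule inj_onI)
      fix i j assume ij: "i \<in> {..<n}" "j \<in> {..<n}" "{v, w i, w (Suc i mod n)} = {v, w j, w (Suc j mod n)}"
      then have "{w i, w (Suc i mod n)} = {w j, w (Suc j mod n)}"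
        using vw nx(2) by (metis Diff_insert_absorb insertE lessThan_iff singletonD)
      then have "i = j \<or> (i = Suc j mod n \<and> Suc i mod n = j)"
        using weq ij nx(2) by (auto simp: doubleton_eq_iff)
      then show "i = j"
      proof
        \<comment> \<open>If two indices were successors of each other, a shift by two would fix an
          index modulo n, which is impossible for n \<ge> 3.\<close>
        assume a: "i = Suc j mod n \<and> Suc i mod n = j"
        then have "Suc (Suc j) mod n = j" by (metis mod_Suc_eq)
        then have "(j + 2) mod n = j mod n" using ij by simp
        then have "n dvd 2" by (metis add_diff_cancel_left' mod_eq_dvd_iff_nat le_add1)
        then show ?thesis using n by (auto dest: dvd_imp_le)
      qed
    qed
    ultimately have 2: "card {\<sigma>\<in>F. v \<in> \<sigma>} = n" by (simp add: card_image)
    have "card \<sigma> \<le> 3" if "\<sigma> \<in> K" "v \<in> \<sigma>" for \<sigma>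
      using sub[OF that] c3 by (metis card_mono finite.emptyI finite.insertI)
    then show ?thesis using 1 2 by blast
  qed
  have EV: "n * card ?V = 2 * card E"
  proof -
    have "n * card ?V = (\<Sum>v\<in>?V. card {\<sigma>\<in>E. v \<in> \<sigma>})" using deg by simp
    also have "\<dots> = (\<Sum>\<sigma>\<in>E. card \<sigma>)" using K(1) fV by (intro sum_card_incidence) (auto simp: E_def)
    also have "\<dots> = 2 * card E" by (simp add: E_def)
    finally show ?thesis .
  qed
  have FV: "n * card ?V = 3 * card F"
  proof -
    have "n * card ?V = (\<Sum>v\<in>?V. card {\<sigma>\<in>F. v \<in> \<sigma>})" using deg by simp
    also have "\<dots> = (\<Sum>\<sigma>\<in>F. card \<sigma>)" using K(1) fV by (intro sum_card_incidence) (auto simp: F_def)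
    also have "\<dots> = 3 * card F" by (simp add: F_def)
    finally show ?thesis .
  qed
  define P where "P = {\<sigma>\<in>K. card \<sigma> = 1}"
  have "P = (\<lambda>v. {v}) ` ?V"
  proof (intro equalityI subsetI)
    fix \<sigma> assume "\<sigma> \<in> P" then show "\<sigma> \<in> (\<lambda>v. {v}) ` ?V" by (auto simp: P_def card_1_singleton_iff)
  next
    fix \<sigma> assume "\<sigma> \<in> (\<lambda>v. {v}) ` ?V" then show "\<sigma> \<in> P" using face by (auto simp: P_def)
  qed
  then have PV: "card P = card ?V" by (simp add: card_image)
  have "card \<sigma> = 1 \<or> card \<sigma> = 2 \<or> card \<sigma> = 3" if s: "\<sigma> \<in> K" for \<sigma>
  proof -
    obtain v where v: "v \<in> \<sigma>" using fin(2)[OF s] by blast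
    then have "card \<sigma> \<le> 3" using deg s by blast
    moreover have "card \<sigma> > 0" using fin[OF s] by (simp add: card_gt_0_iff)
    ultimately show ?thesis by linarith
  qed
  then have KU: "K = P \<union> (E \<union> F)" by (auto simp: P_def E_def F_def)
  have "euler_char K = (\<Sum>\<sigma>\<in>P. (-1) ^ (card \<sigma> - 1)) + ((\<Sum>\<sigma>\<in>E. (-1) ^ (card \<sigma> - 1)) + (\<Sum>\<sigma>\<in>F. (-1) ^ (card \<sigma> - 1)))"
    unfolding euler_char_def
    by (subst KU, subst sum.union_disjoint, (use K(1) in \<open>auto simp: P_def E_def F_def\<close>)[3],
        subst sum.union_disjoint) (use K(1) in \<open>auto simp: P_def E_def F_def\<close>)
  also have "\<dots> = int (card P) - int (card E) + int (card F)"
    by (simp add: P_def E_def F_def)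
  finally have "6 * euler_char K = 6 * int (card P) - 3 * int (2 * card E) + 2 * int (3 * card F)" by simp
  then show ?thesis unfolding EV[symmetric] FV[symmetric] PV by (simp add: algebra_simps)
qed

section \<open>Counting primitive vectors\<close>

lemma card_multiples:
  assumes "d dvd m" "d > 0"
  shows "card {x. x < m \<and> d dvd x} = m div (d :: nat)"
proof -
  have "{x. x < m \<and> d dvd x} = (\<lambda>k. d * k) ` {..<m div d}"
    using assms by (auto elim!: dvdE simp: image_iff)
  moreover have "inj_on (\<lambda>k. d * k) {..<m div d}" using assms by (auto simp: inj_on_def)
  ultimately show ?thesis by (simp add: card_image)
qed

text \<open>A sieve: imposing a further prime \<open>q\<close> removes the functions divisible by
  \<open>q\<close> throughout, which are those counted with \<open>d * q\<close> in place of
  \<open>d\<close>. Generality in \<open>d\<close> makes the induction work.\<close>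

lemma card_avoiding:
  fixes m d :: nat and S :: "nat set"
  defines "A \<equiv> \<lambda>S d. {f :: 'n::finite \<Rightarrow> nat. (\<forall>i. f i < m \<and> d dvd f i) \<and> (\<forall>p\<in>S. \<not> (\<forall>i. p dvd f i))}"
  assumes "finite S" "m > 0" "d > 0" "\<And>p. p \<in> S \<Longrightarrow> prime p \<and> coprime p d" "d * \<Prod>S dvd m"
  shows "real (card (A S d)) = (real m / real d) ^ CARD('n) * (\<Prod>p\<in>S. 1 - 1 / real p ^ CARD('n))"
  using assms(2-)
proof (induction S arbitrary: d rule: finite_induct)
  case empty
  have "A {} d = PiE UNIV (\<lambda>_. {x. x < m \<and> d dvd x})"
    by (auto simp: A_def)
  then have "card (A {} d) = (m div d) ^ CARD('n)"
    using empty by (simp add: card_PiE card_multiples)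
  then show ?case using empty by (simp add: real_of_nat_div)
next
  case (insert q S)
  let ?n = "CARD('n)"
  have q: "prime q" "coprime q d" using insert.prems(3) by auto
  have fin: "finite (A S d)"
  proof (rule finite_subset)
    show "A S d \<subseteq> PiE UNIV (\<lambda>_. {..<m})" by (auto simp: A_def)
  qed (simp add: finite_PiE)
  have dq: "d * q dvd x \<longleftrightarrow> d dvd x \<and> q dvd x" for x
    using q(2) divides_mult[of d x q] by (metis coprime_commute dvd_mult_left dvd_mult_right)
  have "A (insert q S) d = A S d - A S (d * q)"
    unfolding A_def dq by blast
  moreover have "A S (d * q) \<subseteq> A S d" unfolding A_def dq by blast
  ultimately have c: "real (card (A (insert q S) d)) = real (card (A S d)) - real (card (A S (d * q)))"
    using fin by (simp add: card_Diff_subset finite_subset card_mono of_nat_diff)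
  have "d * \<Prod>S dvd m" using insert.prems(4) insert.hyps by (simp add: mult.left_commute dvd_mult_right)
  then have 1: "real (card (A S d)) = (real m / real d) ^ ?n * (\<Prod>p\<in>S. 1 - 1 / real p ^ ?n)"
    using insert.prems by (intro insert.IH) auto
  have "prime p \<and> coprime p (d * q)" if "p \<in> S" for p
    using that insert.prems(3) insert.hyps(2) q(1) by (metis coprime_mult_right_iff insertCI primes_coprime)
  moreover have "(d * q) * \<Prod>S dvd m" using insert.prems(4) insert.hyps by (simp add: mult.assoc)
  ultimately have 2: "real (card (A S (d * q))) = (real m / real (d * q)) ^ ?n * (\<Prod>p\<in>S. 1 - 1 / real p ^ ?n)"
    using insert.prems q(1) by (intro insert.IH) (auto simp: prime_gt_0_nat)
  show ?case
    unfolding c 1 2 using insert.hyps by (simp add: power_divide power_mult_distrib algebra_simps)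
qed

lemma prod_prime_factors_dvd: "m > 0 \<Longrightarrow> \<Prod>(prime_factors m) dvd (m :: nat)"
proof -
  assume m: "m > 0"
  have "(\<Prod>p\<in>prime_factors m. p) dvd (\<Prod>p\<in>prime_factors m. p ^ multiplicity p m)"
    by (intro prod_dvd_prod) (simp add: prime_factors_multiplicity)
  also have "\<dots> = m" using prod_prime_factors[of m] m by simp
  finally show ?thesis by simp
qed

text \<open>By \<open>primitive_red_iff\<close> a residue vector is primitive iff no prime factor of
  m divides all entries of its representative in [0, m), which is what the sieve counts.\<close>

lemma card_primitive:
  "real (card {u :: 'm::nontriv mod_ring ^ 'n. primitive u}) =
    real CARD('m) ^ CARD('n) * (\<Prod>p\<in>prime_factors CARD('m). 1 - 1 / real p ^ CARD('n))"
proof -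
  let ?m = "CARD('m)"
  have m0: "?m > 0" by simp
  let ?A = "{f :: 'n \<Rightarrow> nat. (\<forall>i. f i < ?m \<and> 1 dvd f i) \<and> (\<forall>p\<in>prime_factors ?m. \<not> (\<forall>i. p dvd f i))}"
  define U where "U f = (red (\<chi> i. int (f i)) :: 'm mod_ring ^ 'n)" for f
  have prim: "primitive (U f) \<longleftrightarrow> (\<forall>p\<in>prime_factors ?m. \<not> (\<forall>i. p dvd f i))" for f
  proof -
    have "primitive (U f) \<longleftrightarrow> (\<forall>p. prime p \<longrightarrow> p dvd int ?m \<longrightarrow> \<not> (\<forall>i. p dvd int (f i)))"
      unfolding U_def primitive_red_iff by simp
    also have "\<dots> \<longleftrightarrow> (\<forall>p\<in>prime_factors ?m. \<not> (\<forall>i. p dvd f i))"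
    proof (intro iffI ballI allI impI)
      fix p assume "\<forall>p. prime p \<longrightarrow> p dvd int ?m \<longrightarrow> \<not> (\<forall>i. p dvd int (f i))" "p \<in> prime_factors ?m"
      then show "\<not> (\<forall>i. p dvd f i)"
        by (auto dest!: spec[of _ "int p"] simp: in_prime_factors_iff)
    next
      fix p :: int assume *: "\<forall>p\<in>prime_factors ?m. \<not> (\<forall>i. p dvd f i)" "prime p" "p dvd int ?m"
      obtain q where q: "p = int q" using *(2) prime_ge_0_int zero_le_imp_eq_int by metis
      then have "q \<in> prime_factors ?m" using * m0 by (simp add: in_prime_factors_iff)
      then show "\<not> (\<forall>i. p dvd int (f i))" using *(1) q by auto
    qed
    finally show ?thesis .
  qed
  have inj: "inj_on U ?A"
  proof (rule inj_onI)
    fix f g assume f: "f \<in> ?A" and g: "g \<in> ?A" and eq: "U f = U g"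
    have "f i = g i" for i
    proof -
      have "[int (f i) = int (g i)] (mod int ?m)" using eq by (simp add: U_def red_eq_iff)
      then have "int (f i) mod int ?m = int (g i) mod int ?m" by (simp only: cong_def)
      moreover have "f i < ?m" "g i < ?m" using f g by auto
      ultimately show ?thesis by simp
    qed
    then show "f = g" by blast
  qed
  have "U ` ?A = {u. primitive u}"
  proof (intro equalityI subsetI)
    fix u assume "u \<in> U ` ?A" then show "u \<in> {u. primitive u}" using prim by auto
  next
    fix u :: "'m mod_ring ^ 'n" assume u: "u \<in> {u. primitive u}"
    obtain v where v: "red v = u" using red_surj by blast
    define f where "f i = nat (v $ i mod int ?m)" for i
    have fi: "int (f i) = v $ i mod int ?m" for i by (simp add: f_def)
    then have "U f = u" unfolding U_def v[symmetric] red_eq_iff by (simp add: cong_def)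
    moreover have "f i < ?m" for i
      using fi[of i] m0 by (metis of_nat_0_less_iff of_nat_less_iff pos_mod_bound)
    ultimately show "u \<in> U ` ?A" using u prim[of f] by (intro image_eqI[of _ _ f]) auto
  qed
  then have "card {u :: 'm mod_ring ^ 'n. primitive u} = card ?A" using card_image[OF inj] by simp
  moreover have "real (card ?A) = (real ?m / real 1) ^ CARD('n) * (\<Prod>p\<in>prime_factors ?m. 1 - 1 / real p ^ CARD('n))"
    by (rule card_avoiding) (use prod_prime_factors_dvd[OF m0] in auto)
  ultimately show ?thesis by simp
qed

lemma card_pm_classes:
  fixes A :: "'a::{group_add} set"
  assumes "finite A" "\<And>a. a \<in> A \<Longrightarrow> - a \<in> A" "\<And>a. a \<in> A \<Longrightarrow> a \<noteq> - a"
  shows "2 * card (pm ` A) = card A"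
proof -
  have un: "\<Union>(pm ` A) = A" using assms(2) by (auto simp: pm_def)
  have "card (\<Union>(pm ` A)) = sum card (pm ` A)"
    by (intro card_Union_disjoint)
      (auto simp: disjoint_def pm_def)
  also have "\<dots> = (\<Sum>c\<in>pm ` A. 2)"
    using assms(3) by (intro sum.cong) (auto simp: pm_def)
  finally show ?thesis using un by simp
qed

text \<open>J is Jordan's totient, in the application twice the number V of vertices. There 6\<chi>
  = (6 - m)V gives 12\<chi> = (6 - m)J, so divisibility by 24 makes the Euler characteristic even
  and the genus integral.\<close>

lemma jordan_totient_dvd:
  fixes m J :: nat
  assumes m: "m \<ge> 3" and J: "real J = real m ^ 2 * (\<Prod>p\<in>prime_factors m. 1 - 1 / real p ^ 2)"
  shows "24 dvd (6 - int m) * int J"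
proof -
  let ?P = "prime_factors m"
  define t where "t p = p ^ (2 * (multiplicity p m - 1)) * (p ^ 2 - 1)" for p :: nat
  have pp: "prime p" "multiplicity p m \<ge> 1" if "p \<in> ?P" for p
    using that by (auto simp: prime_factors_multiplicity)
  have tr: "real (t p) = (real p ^ multiplicity p m) ^ 2 * (1 - 1 / real p ^ 2)" if p: "p \<in> ?P" for p
  proof -
    have p0: "p > 0" using pp(1)[OF p] prime_gt_0_nat by blast
    obtain k where k: "multiplicity p m = Suc k" using pp(2)[OF p] by (metis One_nat_def Suc_le_D)
    have "(1::nat) \<le> p ^ 2" using p0 by simp
    then have "real (p ^ 2 - 1) = real p ^ 2 - 1" by (simp add: of_nat_diff)
    then have "real (t p) = real p ^ (2 * k) * (real p ^ 2 - 1)" by (simp add: t_def k)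
    also have "\<dots> = (real p ^ Suc k) ^ 2 * (1 - 1 / real p ^ 2)"
      using p0 by (simp add: field_simps power2_eq_square power_mult)
    finally show ?thesis unfolding k .
  qed
  have mp: "(\<Prod>p\<in>?P. p ^ multiplicity p m) = m" using prod_prime_factors[of m] m by simp
  have "real m = (\<Prod>p\<in>?P. real p ^ multiplicity p m)" by (subst mp[symmetric]) simp
  then have "real J = (\<Prod>p\<in>?P. (real p ^ multiplicity p m) ^ 2 * (1 - 1 / real p ^ 2))"
    unfolding J by (simp add: prod.distrib prod_power_distrib)
  also have "\<dots> = real (\<Prod>p\<in>?P. t p)" using tr by simp
  finally have Jt: "J = (\<Prod>p\<in>?P. t p)" by (simp only: of_nat_eq_iff)
  have tJ: "t p dvd J" if "p \<in> ?P" for p unfolding Jt using that by (intro dvd_prodI) auto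
  have d24: ?thesis if "24 dvd J"
  proof -
    have "(24 :: int) dvd int J" using that by presburger
    then show ?thesis by simp
  qed
  \<comment> \<open>The square of a number prime to 6 is 1 modulo 8 and modulo 3.\<close>
  have big: "24 dvd t p" if "p \<in> ?P" "p \<ge> 5" for p
  proof -
    have np: "\<not> 2 dvd p" "\<not> 3 dvd p"
      using pp(1)[OF that(1)] that(2) by (auto simp: prime_nat_iff)
    then have "p mod 8 = 1 \<or> p mod 8 = 3 \<or> p mod 8 = 5 \<or> p mod 8 = 7" "p mod 3 = 1 \<or> p mod 3 = 2"
      by presburger+
    then have "(p mod 8) ^ 2 mod 8 = 1" "(p mod 3) ^ 2 mod 3 = 1" by auto
    then have "p ^ 2 mod 8 = 1" "p ^ 2 mod 3 = 1" by (simp_all only: power_mod)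
    then have "8 dvd p ^ 2 - 1" "3 dvd p ^ 2 - 1" by (metis dvd_minus_mod)+
    moreover have "coprime (8 :: nat) 3" by (simp add: coprime_iff_gcd_eq_1 gcd_non_0_nat)
    ultimately have "8 * 3 dvd p ^ 2 - 1" by (intro divides_mult)
    then show ?thesis by (simp add: t_def)
  qed
  have t2: "t 2 = 3 * 4 ^ (multiplicity 2 m - 1)" by (simp add: t_def power_mult)
  have t3: "t 3 = 8 * 9 ^ (multiplicity 3 m - 1)" by (simp add: t_def power_mult)
  show ?thesis
  proof (cases "\<exists>p\<in>?P. p \<ge> 5")
    case True
    then show ?thesis using big tJ dvd_trans d24 by blast
  next
    case False
    have sub: "?P \<subseteq> {2, 3}"
    proof
      fix p assume p: "p \<in> ?P"
      then have "p < 5" "p \<ge> 2" using False pp(1)[OF p] prime_ge_2_nat by auto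
      moreover have "p \<noteq> 4"
      proof
        assume "p = 4"
        then show False using pp(1)[OF p] primes_dvd_imp_eq[of 2 p] by simp
      qed
      ultimately show "p \<in> {2, 3}" by auto
    qed
    have ne: "?P \<noteq> {}" using m mp by (metis One_nat_def Suc_eq_numeral le_numeral_Suc prod.empty not_less_eq_eq numeral_3_eq_3 le_SucI order_refl)
    \<comment> \<open>The factors of 2 and 3 contribute 3 and 8. If only one of them occurs, higher
      powers supply the rest from m = 8 and m = 9 on; for m = 4 and m = 3 the totients 12 and 8 are
      completed by 6 - m = 2 and 3.\<close>
    consider "?P = {2, 3}" | "?P = {2}" | "?P = {3}" using sub ne by blast
    then show ?thesis
    proof cases
      case 1
      then have "J = t 2 * t 3" using Jt by simp
      then have "J = 24 * (4 ^ (multiplicity 2 m - 1) * 9 ^ (multiplicity 3 m - 1))"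
        by (simp add: t2 t3 mult_ac)
      then show ?thesis by (intro d24) simp
    next
      case 2
      have mm: "m = 2 ^ multiplicity 2 m" and J2: "J = t 2" using mp Jt 2 by simp_all
      have a1: "multiplicity 2 m \<ge> 2"
      proof (rule ccontr)
        assume "\<not> multiplicity 2 m \<ge> 2"
        then have "multiplicity 2 m = 0 \<or> multiplicity 2 m = 1" by auto
        then have "m = 1 \<or> m = 2" using mm by (metis power_0 power_one_right)
        then show False using m by auto
      qed
      show ?thesis
      proof (cases "multiplicity 2 m = 2")
        case True
        then have "m = 4" "J = 12" using mm J2 t2 by simp_all
        then show ?thesis by simp
      next
        case False
        then have "\<exists>k. multiplicity 2 m - 1 = k + 2" using a1 by (intro exI[of _ "multiplicity 2 m - 3"]) simp
        then obtain k where "multiplicity 2 m - 1 = k + 2" by blast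
        then have "J = 24 * (2 * 4 ^ k)" using J2 t2 by (simp add: power_add)
        then show ?thesis by (intro d24) simp
      qed
    next
      case 3
      have mm: "m = 3 ^ multiplicity 3 m" and J3: "J = t 3" using mp Jt 3 by simp_all
      have b1: "multiplicity 3 m \<ge> 1" using pp(2)[of 3] 3 by simp
      show ?thesis
      proof (cases "multiplicity 3 m = 1")
        case True
        then have "m = 3" "J = 8" using mm J3 t3 by simp_all
        then show ?thesis by simp
      next
        case False
        then have "\<exists>k. multiplicity 3 m - 1 = k + 1" using b1 by (intro exI[of _ "multiplicity 3 m - 2"]) simp
        then obtain k where "multiplicity 3 m - 1 = k + 1" by blast
        then have "J = 24 * (3 * 9 ^ k)" using J3 t3 by (simp add: power_add)
        then show ?thesis by (intro d24) simp
      qed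
    qed
  qed
qed

section \<open>The surface of a plane\<close>

lemma wedge_pairing:
  "(\<Sum>i\<in>UNIV. \<Sum>j\<in>UNIV. c $ i * d $ j * wedge v w $ i $ j) = dotp c v * dotp d w - dotp c w * dotp d v"
proof -
  have "c $ i * d $ j * wedge v w $ i $ j = (c $ i * v $ i) * (d $ j * w $ j) - (c $ i * w $ i) * (d $ j * v $ j)" for i j
    by (simp add: wedge_def algebra_simps)
  then show ?thesis by (simp only: dotp_def sum_product sum_subtractf)
qed

text \<open>Pairing with the dual covectors recovers the coefficient, so v \<and> w generates a free
  module even in the presence of zero divisors.\<close>

lemma mscale_wedge_cancel:
  assumes "upair v w" "mscale a (wedge v w) = mscale b (wedge v w)"
  shows "a = b"
proof -
  obtain c d where cd: "dotp c v = 1" "dotp c w = 0" "dotp d v = 0" "dotp d w = 1"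
    using assms(1) by (auto simp: upair_def)
  define F where "F M = (\<Sum>i\<in>UNIV. \<Sum>j\<in>UNIV. c $ i * d $ j * M $ i $ j)" for M
  have F: "F (mscale k (wedge v w)) = k" for k
  proof -
    have "c $ i * d $ j * mscale k (wedge v w) $ i $ j = k * (c $ i * d $ j * wedge v w $ i $ j)" for i j
      by (simp add: mscale_def mult_ac)
    then show ?thesis by (simp only: F_def sum_distrib_left[symmetric] wedge_pairing cd) simp
  qed
  have "a = F (mscale a (wedge v w))" by (simp only: F)
  also have "\<dots> = b" by (simp only: assms(2) F)
  finally show ?thesis .
qed

lemma mscale_pm: "mscale 1 W = W" "mscale (- 1) W = - W"
  by (simp_all add: mscale_def vec_eq_iff)

lemma S_complexI:
  "v \<in> P \<Longrightarrow> primitive v \<Longrightarrow> {pm v} \<in> S_complex P \<Omega>"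
  "S_edge P \<Omega> a b \<Longrightarrow> {a, b} \<in> S_complex P \<Omega>"
  "S_edge P \<Omega> a b \<Longrightarrow> S_edge P \<Omega> a c \<Longrightarrow> S_edge P \<Omega> b c \<Longrightarrow> {a, b, c} \<in> S_complex P \<Omega>"
proof -
  show "v \<in> P \<Longrightarrow> primitive v \<Longrightarrow> {pm v} \<in> S_complex P \<Omega>"
    unfolding S_complex_def by ((rule UnI1)+) blast
  show "S_edge P \<Omega> a b \<Longrightarrow> {a, b} \<in> S_complex P \<Omega>"
    unfolding S_complex_def by (rule UnI1, rule UnI2) blast
  show "S_edge P \<Omega> a b \<Longrightarrow> S_edge P \<Omega> a c \<Longrightarrow> S_edge P \<Omega> b c \<Longrightarrow> {a, b, c} \<in> S_complex P \<Omega>"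
    unfolding S_complex_def by (rule UnI2) blast
qed

lemma Delta2I:
  "primitive v \<Longrightarrow> {pm v} \<in> Delta2"
  "Delta2_edge a b \<Longrightarrow> {a, b} \<in> Delta2"
  "Delta2_edge a b \<Longrightarrow> Delta2_edge a c \<Longrightarrow> Delta2_edge b c \<Longrightarrow> u \<in> a \<Longrightarrow> v \<in> b \<Longrightarrow> w \<in> c \<Longrightarrow>
    u + v + w = 0 \<Longrightarrow> {a, b, c} \<in> Delta2"
proof -
  show "primitive v \<Longrightarrow> {pm v} \<in> Delta2"
    unfolding Delta2_def by ((rule UnI1)+) blast
  show "Delta2_edge a b \<Longrightarrow> {a, b} \<in> Delta2"
    unfolding Delta2_def by (rule UnI1, rule UnI2) blast
  show "Delta2_edge a b \<Longrightarrow> Delta2_edge a c \<Longrightarrow> Delta2_edge b c \<Longrightarrow> u \<in> a \<Longrightarrow> v \<in> b \<Longrightarrow> w \<in> c \<Longrightarrow>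
    u + v + w = 0 \<Longrightarrow> {a, b, c} \<in> Delta2"
    unfolding Delta2_def by (rule UnI2) blast
qed

context fan_quotient begin

lemma abstract_complex_cplx: "abstract_complex cplx"
  unfolding abstract_complex_def
proof (intro conjI ballI allI impI)
  fix \<sigma> assume "\<sigma> \<in> cplx"
  then show "finite \<sigma>" "\<sigma> \<noteq> {}" by (simp add: cplx_finite, simp add: cplx_def)
next
  fix \<sigma> \<tau> assume "\<sigma> \<in> cplx" "\<tau> \<subseteq> \<sigma> \<and> \<tau> \<noteq> {}"
  then show "\<tau> \<in> cplx" unfolding cplx_def mem_Collect_eq by (meson subset_trans)
qed

lemma vertices_cplx: "\<Union>cplx = {cls v | v w. good v w}"
proof (intro equalityI subsetI)
  fix a assume "a \<in> \<Union>cplx"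
  then obtain v w where vw: "good v w" "a \<in> clstri v w" by (auto simp: cplx_def)
  then have "good v w \<and> a = cls v \<or> good w v \<and> a = cls w \<or> good (v + w) v \<and> a = cls (v + w)"
    using good_swap good_add by (auto simp: clstri_def)
  then show "a \<in> {cls v | v w. good v w}" by blast
next
  fix a assume "a \<in> {cls v | v w. good v w}"
  then obtain v w where "good v w" "a = cls v" by blast
  then show "a \<in> \<Union>cplx" using clstri_cplx by (auto simp: clstri_def)
qed

lemma clstri_uminus: "clstri (- v) (- w) = clstri v w"
proof -
  have "- v + - w = - (v + w)" by simp
  then show ?thesis by (simp only: clstri_def cls_minus)
qed

text \<open>Every simplex at a vertex can be read off from one fixed lift \<open>v\<close> of that
  vertex: permute the triangle to start there, adjust the sign, and move the neighbour to
  \<open>v\<close> by lifting.\<close>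

lemma clstri_at:
  assumes g: "good v u" and s: "\<sigma> \<in> cplx" "cls v \<in> \<sigma>"
  shows "\<exists>y. good v y \<and> \<sigma> \<subseteq> clstri v y"
proof -
  obtain x z where xz: "good x z" "\<sigma> \<subseteq> clstri x z" using s(1) by (auto simp: cplx_def)
  have v: "cls v \<in> clstri x z" using s(2) xz(2) by blast
  have "\<exists>q\<in>clstri x z. cls v \<noteq> q" using cls_distinct[OF xz(1)] by (auto simp: clstri_def)
  then obtain q where "q \<in> clstri x z" "cls v \<noteq> q" by blast
  then obtain v' w' where vw': "good v' w'" "cls v' = cls v" "clstri v' w' = clstri x z"
    using tri_permute[OF xz(1), of 1 1 1 "cls v" q] v by auto
  obtain v2 where v2: "v2 = v' \<or> v2 = - v'" "\<rho> v2 = \<rho> v" using cls_sign[of v v'] vw'(2) by auto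
  obtain w2 where w2: "good v2 w2" "clstri v2 w2 = clstri x z"
    using v2(1) vw' good_neg good_neg1 clstri_uminus by metis
  obtain y where y: "good v y" "\<rho> y = \<rho> w2" using lift_neighbour[OF w2(1) g v2(2)] by blast
  have "clstri v y = clstri v2 w2" using y(2) v2(2) by (simp add: clstri_def cls_def \<rho>_add)
  then show ?thesis using y(1) w2(2) xz(2) by auto
qed

lemma cls_neighbour:
  assumes "good v u" "good v' x" "cls v = cls v'"
  shows "\<exists>y. good v y \<and> cls y = cls x"
proof -
  obtain v2 where v2: "v2 = v' \<or> v2 = - v'" "\<rho> v2 = \<rho> v" using cls_sign[OF assms(3)] by auto
  then have "good v2 x" using assms(2) good_neg1 by blast
  then show ?thesis using lift_neighbour[OF _ assms(1) v2(2)] by (metis cls_def)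
qed

end

context plane_frame begin

text \<open>The coordinate of a wedge with respect to the generator is a determinant, so the edges
  of \<open>S_complex\<close> are the pairs of determinant 1 or -1.\<close>

lemma wedge_emb: "wedge (emb u) (emb u') = mscale (det2 u u') (wedge p1 p2)"
  unfolding vec_eq_iff
proof (intro allI)
  fix i j
  have *: "(a * x + b * y) * (c * z + d * w) - (c * x + d * y) * (a * z + b * w) = (a * d - b * c) * (x * w - y * z)"
    for a b c d x y z w :: "'m mod_ring" by (simp add: algebra_simps)
  show "wedge (emb u) (emb u') $ i $ j = mscale (det2 u u') (wedge p1 p2) $ i $ j"
    by (simp add: wedge_def mscale_def emb_def det2_def *)
qed

lemma primitive_emb: "primitive (emb u) \<longleftrightarrow> primitive u"
proof
  assume "primitive (emb u)"
  then obtain c where "dotp c (emb u) = 1" by (auto simp: primitive_iff_dotp)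
  then have "dotp c p1 * u $ 1 + dotp c p2 * u $ 2 = 1" by (simp add: emb_def mult.commute)
  then show "primitive u" unfolding primitive_2_iff by blast
next
  assume "primitive u"
  then obtain s t where st: "s * u $ 1 + t * u $ 2 = 1" unfolding primitive_2_iff by blast
  obtain c d where "\<And>u. dotp c (emb u) = u $ 1" "\<And>u. dotp d (emb u) = u $ 2" using frame_dual by blast
  then have "dotp (s *s c + t *s d) (emb u) = 1" using st by simp
  then show "primitive (emb u)" unfolding primitive_iff_dotp by blast
qed

lemma span2_emb: "span2 p1 p2 = range emb"
proof (intro equalityI subsetI)
  fix x assume "x \<in> span2 p1 p2"
  then obtain a b where "x = a *s p1 + b *s p2" by (auto simp: span2_def)
  then have "x = emb (\<chi> i. if i = 1 then a else b)" by (simp add: emb_def)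
  then show "x \<in> range emb" by blast
next
  fix x assume "x \<in> range emb" then show "x \<in> span2 p1 p2" by (auto simp: span2_def emb_def)
qed

lemma wedge_emb_pm: "wedge (emb u) (emb u') \<in> pm (wedge p1 p2) \<longleftrightarrow> det2 u u' = 1 \<or> det2 u u' = - 1"
proof -
  have "mscale (det2 u u') (wedge p1 p2) \<in> pm (wedge p1 p2) \<longleftrightarrow>
      mscale (det2 u u') (wedge p1 p2) = mscale 1 (wedge p1 p2) \<or>
      mscale (det2 u u') (wedge p1 p2) = mscale (- 1) (wedge p1 p2)"
    by (simp add: pm_def mscale_pm)
  also have "\<dots> \<longleftrightarrow> det2 u u' = 1 \<or> det2 u u' = - 1" using mscale_wedge_cancel[OF frame] by metis
  finally show ?thesis by (simp only: wedge_emb)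
qed

lemma lift_det:
  assumes "primitive u" "det2 u u' = of_int e"
  shows "\<exists>v w. primitive v \<and> red v = u \<and> red w = u' \<and> det2 v w = e"
proof -
  obtain v where v: "primitive v" "red v = u" using primitive_lift[OF assms(1)] by auto
  then show ?thesis using det2_lift[OF v(1), of u' e] assms(2) by blast
qed

lemma upair_detI: "det2 v w = 1 \<or> det2 v w = (- 1 :: int) \<Longrightarrow> upair v w"
  unfolding upair_2_iff by (elim disjE) simp_all

lemma S_edge_iff:
  "S_edge (span2 p1 p2) (pm (wedge p1 p2)) a b \<longleftrightarrow> (\<exists>v w. upair v w \<and> a = cls v \<and> b = cls w)"
proof
  assume "S_edge (span2 p1 p2) (pm (wedge p1 p2)) a b"
  then obtain u u' where u: "primitive (emb u)" "a = pm (emb u)" "b = pm (emb u')"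
      "wedge (emb u) (emb u') \<in> pm (wedge p1 p2)"
    unfolding S_edge_def span2_emb by blast
  then have "det2 u u' = of_int 1 \<or> det2 u u' = of_int (- 1)" by (simp add: wedge_emb_pm)
  then obtain e where e: "e = 1 \<or> e = - 1" "det2 u u' = of_int e" by blast
  then obtain v w where "red v = u" "red w = u'" "det2 v w = e"
    using lift_det u(1) by (metis primitive_emb)
  then show "\<exists>v w. upair v w \<and> a = cls v \<and> b = cls w"
    using u(2,3) e(1) upair_detI by (auto simp: cls_def rho_def)
next
  assume "\<exists>v w. upair v w \<and> a = cls v \<and> b = cls w"
  then obtain v w where vw: "upair v w" "a = cls v" "b = cls w" by blast
  have p: "primitive (rho v)" "primitive (rho w)"
    using upair_primitive[OF vw(1)] by (simp_all add: rho_def primitive_emb primitive_red)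
  have "det2 (red v) (red w) = (1 :: 'm mod_ring) \<or> det2 (red v) (red w) = (- 1 :: 'm mod_ring)"
    using upair_int_det[OF vw(1)] by (auto simp: det2_red)
  then have "wedge (rho v) (rho w) \<in> pm (wedge p1 p2)" by (simp add: rho_def wedge_emb_pm)
  then show "S_edge (span2 p1 p2) (pm (wedge p1 p2)) a b"
    unfolding S_edge_def span2_emb using p vw(2,3) unfolding cls_def rho_def by blast
qed

text \<open>Up to sign, the determinant modulo m depends on the classes only, whichever lifts are
  used.\<close>

lemma det_mult_red: "cls w = cls w' \<Longrightarrow> cls x = cls x' \<Longrightarrow> upair w' x' \<Longrightarrow>
  (of_int (det2 w x) :: 'm mod_ring) = 1 \<or> (of_int (det2 w x) :: 'm mod_ring) = - 1"
proof -
  assume a: "cls w = cls w'" "cls x = cls x'" "upair w' x'"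
  have *: "\<exists>z'. (z' = z \<or> z' = - z) \<and> red z' = (red y :: 'm mod_ring ^ 2)" if "cls y = cls z" for y z
    using cls_sign[OF that] emb_inj unfolding rho_def by blast
  obtain w2 x2 where 2: "w2 = w' \<or> w2 = - w'" "x2 = x' \<or> x2 = - x'"
      "red w2 = (red w :: 'm mod_ring ^ 2)" "red x2 = (red x :: 'm mod_ring ^ 2)"
    using *[OF a(1)] *[OF a(2)] by blast
  have "det2 w2 x2 = 1 \<or> det2 w2 x2 = - 1" using upair_int_det[OF a(3)] 2(1,2) by auto
  moreover have "(of_int (det2 w x) :: 'm mod_ring) = of_int (det2 w2 x2)"
    using 2(3,4) by (simp flip: det2_red)
  ultimately show ?thesis by auto
qed

text \<open>The triangles of \<open>S_complex\<close> are only required to be pairwise joined, so a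
  linear relation has to be found. Lift two vertices to \<open>v\<close>, \<open>w\<close> and the
  third to x = w + k v; the edge between the last two makes k congruent to 1 or -1, so the third
  class is that of v + w or v - w.\<close>

lemma S_complex_eq: "S_complex (span2 p1 p2) (pm (wedge p1 p2)) = cplx"
proof (intro equalityI subsetI)
  let ?P = "span2 p1 p2" and ?\<Omega> = "pm (wedge p1 p2)"
  fix \<sigma> assume "\<sigma> \<in> S_complex ?P ?\<Omega>"
  then have "(\<exists>x. \<sigma> = {pm x} \<and> x \<in> ?P \<and> primitive x) \<or> (\<exists>a b. \<sigma> = {a, b} \<and> S_edge ?P ?\<Omega> a b) \<or>
      (\<exists>a b c. \<sigma> = {a, b, c} \<and> S_edge ?P ?\<Omega> a b \<and> S_edge ?P ?\<Omega> a c \<and> S_edge ?P ?\<Omega> b c)"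
    unfolding S_complex_def by blast
  then show "\<sigma> \<in> cplx"
  proof (elim disjE exE conjE)
    fix x assume x: "\<sigma> = {pm x}" "x \<in> ?P" "primitive x"
    then obtain u where u: "x = emb u" "primitive u" by (auto simp: span2_emb primitive_emb)
    then obtain v where v: "primitive v" "red v = u" using primitive_lift[of u] by auto
    obtain w where "det2 v w = 1" using primitive_2_det[OF v(1)] by blast
    then have "upair v w" by (simp add: upair_detI)
    moreover have "\<sigma> = {cls v}" using x(1) u(1) v(2) by (simp add: cls_def rho_def)
    ultimately show ?thesis by (auto simp: cplx_def clstri_def)
  next
    fix a b assume "\<sigma> = {a, b}" "S_edge ?P ?\<Omega> a b"
    then show ?thesis unfolding S_edge_iff by (auto simp: cplx_def clstri_def)
  next
    fix a b c assume 3: "\<sigma> = {a, b, c}" "S_edge ?P ?\<Omega> a b" "S_edge ?P ?\<Omega> a c" "S_edge ?P ?\<Omega> b c"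
    note 3 = 3(1) 3(2-4)[unfolded S_edge_iff]
    obtain v w where vw: "upair v w" "a = cls v" "b = cls w" using 3(2) by blast
    obtain v' x' where vx': "upair v' x'" "a = cls v'" "c = cls x'" using 3(3) by blast
    obtain x0 where x0: "upair v x0" "cls x0 = c" using cls_neighbour[OF vw(1) vx'(1)] vw vx' by auto
    define e where "e = det2 v w"
    have e: "e = 1 \<or> e = - 1" using upair_int_det[OF vw(1)] by (simp add: e_def)
    \<comment> \<open>The sign of the lift is chosen to give \<open>x\<close> and \<open>w\<close>
      the same determinant with \<open>v\<close>; their difference is then a multiple of
      \<open>v\<close>.\<close>
    obtain x where x: "det2 v x = e" "cls x = c"
    proof (cases "det2 v x0 = e")
      case True then show ?thesis using that x0(2) by blast
    next
      case False
      then have "det2 v (- x0) = e" using upair_int_det[OF x0(1)] e by auto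
      then show ?thesis using that[of "- x0"] x0(2) by simp
    qed
    have "det2 v (x - w) = 0" using x(1) by (simp add: e_def)
    then obtain k where "x - w = k *s v" using det2_zero_multiple upair_primitive(1)[OF vw(1)] by blast
    then have k: "x = w + k *s v" by (simp add: algebra_simps)
    have dk: "det2 w x = - k * e" by (simp add: k e_def det2_swap[of w v])
    obtain w' y where "upair w' y" "b = cls w'" "c = cls y" using 3(4) by blast
    then have "(of_int (det2 w x) :: 'm mod_ring) = 1 \<or> (of_int (det2 w x) :: 'm mod_ring) = - 1"
      using det_mult_red vw(3) x(2) by metis
    moreover have "(of_int k :: 'm mod_ring) = of_int (det2 w x) \<or> (of_int k :: 'm mod_ring) = - of_int (det2 w x)"
      using e unfolding dk by auto
    ultimately have "(of_int k :: 'm mod_ring) = 1 \<or> (of_int k :: 'm mod_ring) = - 1"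
      by (metis minus_minus)
    then have "rho x = rho (v + w) \<or> rho x = rho (w - v)"
      by (auto simp: k rho_def emb_simps add.commute)
    moreover have "cls (w - v) = cls (v + - w)" using cls_minus[of "w - v"] by simp
    ultimately have "cls x = cls (v + w) \<or> cls x = cls (v + - w)" unfolding cls_def by metis
    then have "\<sigma> = clstri v w \<or> \<sigma> = clstri v (- w)"
      using 3(1) vw x(2) by (auto simp: clstri_def)
    then show ?thesis using clstri_cplx vw(1) good_neg by metis
  qed
next
  fix \<sigma> assume "\<sigma> \<in> cplx"
  then obtain v w where vw: "upair v w" "\<sigma> \<subseteq> clstri v w" "\<sigma> \<noteq> {}" by (auto simp: cplx_def)
  let ?S = "S_edge (span2 p1 p2) (pm (wedge p1 p2))"
  have g: "upair v (v + w)" "upair w (v + w)"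
    using good_add[OF vw(1)] good_add[OF good_swap[OF vw(1)]] by (simp_all add: add.commute)
  have E: "?S (cls v) (cls w)" "?S (cls v) (cls (v + w))" "?S (cls w) (cls (v + w))"
    unfolding S_edge_iff using vw(1) g by blast+
  have V: "{cls x} \<in> S_complex (span2 p1 p2) (pm (wedge p1 p2))" if "upair x y" for x y
  proof -
    have "primitive (rho x)"
      using upair_primitive[OF that] by (simp add: rho_def primitive_emb primitive_red)
    moreover have "rho x \<in> span2 p1 p2" by (simp add: span2_emb rho_def)
    ultimately show ?thesis unfolding cls_def by (intro S_complexI)
  qed
  have s: "\<sigma> \<in> {{cls v}, {cls w}, {cls (v + w)}, {cls v, cls w}, {cls v, cls (v + w)}, {cls w, cls (v + w)},
      {cls v, cls w, cls (v + w)}}"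
    by (rule subset_triple[OF vw(2)[unfolded clstri_def] vw(3)])
  show "\<sigma> \<in> S_complex (span2 p1 p2) (pm (wedge p1 p2))"
    by (rule subsetD[OF _ s]) (simp only: insert_subset empty_subsetI simp_thms S_complexI(2)[OF E(1)]
      S_complexI(2)[OF E(2)] S_complexI(2)[OF E(3)] S_complexI(3)[OF E]
      V[OF vw(1)] V[OF good_swap[OF vw(1)]] V[OF good_swap[OF g(1)]])
qed

lemma upair_emb: "upair u u' \<Longrightarrow> upair (emb u) (emb u')"
proof -
  assume u: "upair u u'"
  obtain c d where cd: "\<And>u. dotp c (emb u) = u $ 1" "\<And>u. dotp d (emb u) = u $ 2" using frame_dual by blast
  obtain s t where st: "dotp s u = 1" "dotp s u' = 0" "dotp t u = 0" "dotp t u' = 1"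
    using u by (auto simp: upair_def)
  have "dotp (s $ 1 *s c + s $ 2 *s d) (emb u) = dotp s u" for s u
    unfolding dotp_simps cd by (simp add: dotp_def sum_2)
  then show ?thesis using st unfolding upair_def by metis
qed

lemma cplx_Delta2:
  assumes "symp p1 p2 = 0"
  shows "cplx \<subseteq> Delta2"
proof
  have E: "Delta2_edge (cls v) (cls w)" if vw: "upair v w" for v w
  proof -
    have "symp p2 p1 = 0" using assms symp_swap[of p1 p2] by simp
    then have sy: "symp (rho v) (rho w) = 0" by (simp add: rho_def emb_def assms)
    have "upair (rho v) (rho w)" unfolding rho_def by (rule upair_emb[OF upair_red[OF vw]])
    then show ?thesis using sy unfolding level.Delta2_edge_good[OF level.intro[OF m3]] cls_def good_def by blast
  qed
  fix \<sigma> assume "\<sigma> \<in> cplx"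
  then obtain v w where vw: "upair v w" "\<sigma> \<subseteq> clstri v w" "\<sigma> \<noteq> {}" by (auto simp: cplx_def)
  have g: "upair v (v + w)" "upair w (v + w)"
    using good_add[OF vw(1)] good_add[OF good_swap[OF vw(1)]] by (simp_all add: add.commute)
  have V: "{cls x} \<in> Delta2" if "upair x y" for x y
  proof -
    have "primitive (rho x)"
      using upair_primitive[OF that] by (simp add: rho_def primitive_emb primitive_red)
    then show ?thesis unfolding cls_def by (rule Delta2I)
  qed
  have "rho v \<in> cls v" "rho w \<in> cls w" "- rho (v + w) \<in> cls (v + w)" "rho v + rho w + - rho (v + w) = 0"
    by (auto simp: cls_def pm_def \<rho>_add)
  then have T: "{cls v, cls w, cls (v + w)} \<in> Delta2"
    by (rule Delta2I(3)[OF E[OF vw(1)] E[OF g(1)] E[OF g(2)]])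
  have s: "\<sigma> \<in> {{cls v}, {cls w}, {cls (v + w)}, {cls v, cls w}, {cls v, cls (v + w)}, {cls w, cls (v + w)},
      {cls v, cls w, cls (v + w)}}"
    by (rule subset_triple[OF vw(2)[unfolded clstri_def] vw(3)])
  show "\<sigma> \<in> Delta2"
    by (rule subsetD[OF _ s]) (simp only: insert_subset empty_subsetI simp_thms T Delta2I(2)[OF E[OF vw(1)]]
      Delta2I(2)[OF E[OF g(1)]] Delta2I(2)[OF E[OF g(2)]]
      V[OF vw(1)] V[OF good_swap[OF vw(1)]] V[OF good_swap[OF g(1)]])
qed

end

section \<open>Vertex stars, connectedness and orientation\<close>

lemma card_eq_prime_factors:
  "prime_factors (3 :: nat) = {3}" "prime_factors (4 :: nat) = {2}" "prime_factors (5 :: nat) = {5}"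
proof -
  have "prime_factors (2 ^ 2 :: nat) = {2}" by (simp only: prime_factors_power prime_prime_factors two_is_prime_nat zero_less_numeral)
  then show "prime_factors (4 :: nat) = {2}" by simp
qed (simp_all add: prime_prime_factors)

context plane_frame begin

lemma red_of_cls:
  assumes "cls v = cls v'"
  obtains s :: int where "s = 1 \<or> s = - 1" "red (s *s v') = (red v :: 'm mod_ring ^ 2)"
proof -
  obtain u where u: "u = v' \<or> u = - v'" "rho u = rho v" using cls_sign[OF assms] by blast
  have "red u = (red v :: 'm mod_ring ^ 2)" using emb_inj u(2) by (simp add: rho_def)
  moreover have "- v' = (- 1) *s v'" "v' = 1 *s v'" by (simp_all add: vec_eq_iff)
  ultimately show thesis using u(1) that[of 1] that[of "- 1"] by metis
qed

text \<open>Fixing the first vector and determinant 1 removes the sign ambiguity of the second,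
  since 1 and -1 differ modulo m.\<close>

lemma red_eq_of_cls:
  assumes "red v = (red v' :: 'm mod_ring ^ 2)" "det2 v w = 1" "det2 v' w' = 1" "cls w = cls w'"
  shows "red w = (red w' :: 'm mod_ring ^ 2)"
proof -
  obtain s :: int where s: "s = 1 \<or> s = - 1" "red (s *s w') = (red w :: 'm mod_ring ^ 2)"
    using red_of_cls[OF assms(4)] by blast
  have "of_int (det2 v w) = det2 (red v') (red (s *s w') :: 'm mod_ring ^ 2)"
    by (simp only: assms(1) s(2) det2_red[symmetric])
  also have "\<dots> = of_int (s * det2 v' w')" by (simp only: det2_red det2_simps)
  finally have "(of_int s :: 'm mod_ring) = 1" by (simp add: assms(2,3))
  then have "s = 1" using s(1) small_not_0(1) by auto
  then show ?thesis using s(2) by simp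
qed

lemma vertex_det: "a \<in> \<Union>cplx \<Longrightarrow> \<exists>v u. det2 v u = 1 \<and> a = cls v"
proof -
  assume "a \<in> \<Union>cplx"
  then obtain v u where vu: "upair v u" "a = cls v" unfolding vertices_cplx by blast
  then have "det2 v u = 1 \<or> det2 v (- u) = 1" using upair_int_det[OF vu(1)] by auto
  then show ?thesis using vu(2) by blast
qed

text \<open>The neighbours of \<open>v\<close> are the u + k v with k taken modulo m; none of them
  coincide up to sign.\<close>

lemma cls_shift:
  assumes "det2 v u = 1"
  shows "cls (u + k *s v) = cls (u + l *s v) \<longleftrightarrow> [k = l] (mod int CARD('m))"
proof
  assume "cls (u + k *s v) = cls (u + l *s v)"
  then have "red (u + k *s v) = (red (u + l *s v) :: 'm mod_ring ^ 2)"
    using assms by - (rule red_eq_of_cls[of v v], simp_all)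
  then have "of_int k *s red v = (of_int l *s red v :: 'm mod_ring ^ 2)" by simp
  then have "det2 (of_int k *s red v) (red u) = det2 (of_int l *s red v :: 'm mod_ring ^ 2) (red u)" by (rule arg_cong)
  then have "of_int k * det2 (red v) (red u) = (of_int l * det2 (red v) (red u) :: 'm mod_ring)"
    by (simp only: det2_simps)
  then have "(of_int k :: 'm mod_ring) = of_int l" unfolding det2_red assms by simp
  then show "[k = l] (mod int CARD('m))" by (simp add: of_int_mod_ring_eq_iff)
next
  assume "[k = l] (mod int CARD('m))"
  then have "(of_int k :: 'm mod_ring) = of_int l" by (simp add: of_int_mod_ring_eq_iff)
  then show "cls (u + k *s v) = cls (u + l *s v)" by (simp add: cls_def rho_def)
qed

text \<open>The sum of v and u + k v is u + (k + 1) v, so the triangles at \<open>v\<close> join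
  consecutive neighbours, and every basis starting with \<open>v\<close> is up to sign of this
  form.\<close>

lemma cyclic_star_cplx:
  assumes vu: "det2 v u = 1"
  shows "cyclic_star cplx CARD('m) (cls v) (\<lambda>k. cls (u + int k *s v))"
proof -
  let ?m = "CARD('m)"
  define w where "w k = cls (u + int k *s v)" for k
  have m0: "?m > 0" by simp
  have up: "upair v (u + k *s v)" for k by (rule upair_detI) (simp add: vu)
  have tri: "clstri v (u + k *s v) = {cls v, cls (u + k *s v), cls (u + (k + 1) *s v)}" for k
  proof -
    have "v + (u + k *s v) = u + (k + 1) *s v" by (simp add: vec_eq_iff algebra_simps)
    then show ?thesis by (simp only: clstri_def)
  qed
  \<comment> \<open>\<open>cyclic_star\<close> indexes neighbours by 0, ..., m - 1, whereas the
    shift of a given triangle arises as an arbitrary integer.\<close>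
  have wmod: "w (nat (l mod int ?m)) = cls (u + l *s v)" for l
  proof -
    have "int (nat (l mod int ?m)) = l mod int ?m" by simp
    then show ?thesis unfolding w_def cls_shift[OF vu] by (simp add: cong_def)
  qed
  have wSuc: "w (Suc (nat (l mod int ?m)) mod ?m) = cls (u + (l + 1) *s v)" for l
  proof -
    have "int (Suc (nat (l mod int ?m)) mod ?m) = (l mod int ?m + 1) mod int ?m" by (simp add: zmod_int add.commute)
    then show ?thesis unfolding w_def cls_shift[OF vu] by (simp add: cong_def mod_add_left_eq)
  qed
  have star: "clstri v (u + l *s v) = {cls v, w (nat (l mod int ?m)), w (Suc (nat (l mod int ?m)) mod ?m)}" for l
    unfolding tri wmod wSuc ..
  have "cyclic_star cplx ?m (cls v) w"
    unfolding cyclic_star_def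
  proof (intro conjI allI impI ballI)
    show "inj_on w {..<?m}"
    proof (rule inj_onI)
      fix k l assume "k \<in> {..<?m}" "l \<in> {..<?m}" "w k = w l"
      then have "[int k = int l] (mod int ?m)" "k < ?m" "l < ?m" by (simp_all add: w_def cls_shift[OF vu])
      then show "k = l" by (simp add: cong_int_iff cong_less_modulus_unique_nat)
    qed
    show "cls v \<notin> w ` {..<?m}" using cls_pair[OF up] by (auto simp: w_def)
    show "{cls v, w k, w (Suc k mod ?m)} \<in> cplx" if "k < ?m" for k
      using clstri_cplx[OF up[of "int k"]] star[of "int k"] that by simp
    fix \<sigma> assume "\<sigma> \<in> cplx" "cls v \<in> \<sigma>"
    then obtain y where y: "upair v y" "\<sigma> \<subseteq> clstri v y"
      using clstri_at[OF up[of 0]] by blast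
    have "\<exists>l. clstri v y = clstri v (u + l *s v)"
    proof (cases "det2 v y = 1")
      case True
      then have "det2 v (y - u) = 0" using vu by simp
      then obtain l where "y - u = l *s v" using det2_zero_multiple upair_primitive(1)[OF y(1)] by blast
      then have "y = u + l *s v" by (simp add: algebra_simps)
      then show ?thesis by blast
    next
      case False
      then have "det2 v (y + u) = 0" using upair_int_det[OF y(1)] vu by simp
      then obtain l where l: "y + u = l *s v" using det2_zero_multiple upair_primitive(1)[OF y(1)] by blast
      \<comment> \<open>For determinant -1 the order is reversed: up to sign y has index -l and v +
        y has index -l - 1, so the triangle is the one numbered -l - 1.\<close>
      have 1: "y = - (u + (- l) *s v)" using l by (simp add: vec_eq_iff algebra_simps)
      have 2: "v + y = - (u + (- l - 1) *s v)" using l by (simp add: vec_eq_iff algebra_simps)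
      have 3: "(- l - 1) + 1 = - l" by simp
      have "cls y = cls (u + (- l) *s v)" "cls (v + y) = cls (u + (- l - 1) *s v)"
        by (simp only: 1 cls_minus, simp only: 2 cls_minus)
      then have "clstri v y = clstri v (u + (- l - 1) *s v)"
        unfolding tri 3 by (simp only: clstri_def insert_commute)
      then show ?thesis by blast
    qed
    then obtain l where "clstri v y = clstri v (u + l *s v)" by blast
    then have "\<sigma> \<subseteq> {cls v, w (nat (l mod int ?m)), w (Suc (nat (l mod int ?m)) mod ?m)}"
      using y(2) star by simp
    moreover have "nat (l mod int ?m) < ?m" using m0 by (simp add: nat_less_iff)
    ultimately show "\<exists>k<?m. \<sigma> \<subseteq> {cls v, w k, w (Suc k mod ?m)}" by blast
  qed
  then show ?thesis unfolding w_def .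
qed

lemma cplx_connected:
  assumes "a \<in> \<Union>cplx" "b \<in> \<Union>cplx"
  shows "(a, b) \<in> {(a, b). {a, b} \<in> cplx}\<^sup>*"
proof -
  let ?R = "{(a, b). {a, b} \<in> cplx}"
  define e :: "int ^ 2" where "e = axis 1 1"
  have base: "(cls v, cls e) \<in> ?R\<^sup>*" if "det2 v u = 1" for v u
    using that
  proof (induction "nat \<bar>v $ 2\<bar>" arbitrary: v u rule: less_induct)
    case less
    show ?case
    proof (cases "v $ 2 = 0")
      case True
      then have "v $ 1 * u $ 2 = 1" using less.prems by (simp add: det2_def)
      then have "v $ 1 = 1 \<or> v $ 1 = - 1" by (metis dvd_triv_left zdvd1_eq abs_eq_iff abs_1)
      then have "v = e \<or> v = - e" using True by (auto simp: vec2_eq_iff e_def axis_def)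
      then show ?thesis by auto
    next
      case False
      \<comment> \<open>A neighbour of \<open>v\<close> whose second coordinate is the remainder of
        that of \<open>u\<close> modulo that of \<open>v\<close>, hence smaller in absolute value;
        the descent ends at e or -e.\<close>
      define w where "w = u - (u $ 2 div v $ 2) *s v"
      have w: "det2 v w = 1" using less.prems by (simp add: w_def)
      have "w $ 2 = u $ 2 mod v $ 2" by (simp add: w_def minus_div_mult_eq_mod)
      then have "nat \<bar>w $ 2\<bar> < nat \<bar>v $ 2\<bar>" using False abs_mod_less[of "v $ 2" "u $ 2"] by simp
      moreover have "det2 w (- v) = 1" using w by (simp add: det2_swap[of w v])
      ultimately have "(cls w, cls e) \<in> ?R\<^sup>*" using less.hyps by blast
      moreover have "{cls v, cls w} \<in> cplx"
        using upair_detI[of v w] w by (auto simp: cplx_def clstri_def)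
      ultimately show ?thesis by (auto intro: converse_rtrancl_into_rtrancl)
    qed
  qed
  have "sym ?R" by (auto simp: sym_def insert_commute)
  then have "sym (?R\<^sup>*)" by (rule sym_rtrancl)
  moreover have "(a, cls e) \<in> ?R\<^sup>*" "(b, cls e) \<in> ?R\<^sup>*"
    using assms[THEN vertex_det] base by blast+
  ultimately show ?thesis by (meson rtrancl_trans symD)
qed

text \<open>The edge from a to b is positive in T if it has a lift of determinant 1 whose sum gives
  the third vertex. Changing both signs affects neither the determinant nor the triangle.\<close>

definition orients :: "('m mod_ring ^ 4) set set \<Rightarrow> ('m mod_ring ^ 4) set \<Rightarrow> ('m mod_ring ^ 4) set \<Rightarrow> bool" where
  "orients T a b \<longleftrightarrow> (\<exists>v w. det2 v w = 1 \<and> a = cls v \<and> b = cls w \<and> T = clstri v w)"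

lemma same_start:
  assumes "det2 v w = 1" "det2 v' w' = 1" "cls v = cls v'"
  obtains v2 w2 where "det2 v2 w2 = 1" "cls w2 = cls w'" "clstri v2 w2 = clstri v' w'"
    "red v2 = (red v :: 'm mod_ring ^ 2)" "cls v2 = cls v'"
proof -
  obtain u where u: "u = v' \<or> u = - v'" "rho u = rho v" using cls_sign[OF assms(3)] by blast
  have "red u = (red v :: 'm mod_ring ^ 2)" using emb_inj u(2) by (simp add: rho_def)
  moreover have "det2 (- v') (- w') = 1" using assms(2) by simp
  ultimately show thesis
    using u(1) that[of v' w'] that[of "- v'" "- w'"] assms(2) clstri_uminus cls_minus by metis
qed

text \<open>If both other vertices followed a, then modulo m the second lift would satisfy w2 = v +
  w and v + w2 = w, hence 2v = 0, contradicting m \<ge> 3.\<close>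

lemma orients_unique: "orients T a b \<Longrightarrow> orients T a b' \<Longrightarrow> b = b'"
proof -
  assume "orients T a b" "orients T a b'"
  then obtain v w v' w' where vw: "det2 v w = 1" "a = cls v" "b = cls w" "T = clstri v w"
      and vw': "det2 v' w' = 1" "a = cls v'" "b' = cls w'" "T = clstri v' w'"
    unfolding orients_def by blast
  obtain v2 w2 where 2: "det2 v2 w2 = 1" "cls w2 = b'" "clstri v2 w2 = T" "red v2 = (red v :: 'm mod_ring ^ 2)" "cls v2 = a"
    using same_start[OF vw(1) vw'(1)] vw(2) vw'(2-4) by metis
  note d = cls_distinct[OF upair_detI[OF disjI1[OF vw(1)]]] cls_distinct[OF upair_detI[OF disjI1[OF 2(1)]]]
  show "b = b'"
  proof (rule ccontr)
    assume ne: "b \<noteq> b'"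
    have "cls w2 \<in> clstri v w" "cls (v2 + w2) \<in> clstri v w"
      using 2(3) vw(4) by (auto simp: clstri_def)
    then have c: "cls w2 = cls (v + w)" "cls (v2 + w2) = cls w"
      using ne d 2(2,5) vw(2,3) by (auto simp: clstri_def)
    have "red w2 = (red (v + w) :: 'm mod_ring ^ 2)"
      using red_eq_of_cls[OF 2(4) 2(1) _ c(1)] vw(1) by simp
    moreover have "red (v2 + w2) = (red w :: 'm mod_ring ^ 2)"
      using red_eq_of_cls[OF 2(4) _ vw(1) c(2)] 2(1) by simp
    ultimately have z: "red v + red v = (0 :: 'm mod_ring ^ 2)" using 2(4) by simp
    have "det2 (red v + red v) (red w) = (2 :: 'm mod_ring)" by (simp only: det2_simps det2_red vw(1)) simp
    then have "(2 :: 'm mod_ring) = 0" unfolding z by simp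
    then show False using small_not_0(2) by simp
  qed
qed

text \<open>The pairs (v, w), (w, -(v + w)) and (v + w, -v) all have determinant 1 and the same
  triangle.\<close>

lemma orients_cycle:
  assumes "orients T a b"
  obtains c where "T = {a, b, c}" "c \<noteq> a" "c \<noteq> b" "a \<noteq> b" "orients T b c" "orients T c a"
proof -
  obtain v w where vw: "det2 v w = 1" "a = cls v" "b = cls w" "T = clstri v w"
    using assms unfolding orients_def by blast
  have sw: "det2 w v = - 1" using vw(1) by (simp add: det2_swap[of w v])
  note d = cls_distinct[OF upair_detI[OF disjI1[OF vw(1)]]]
  have "w + - (v + w) = - v" "v + w + - v = w" by simp_all
  then have "clstri w (- (v + w)) = T" "clstri (v + w) (- v) = T"
    unfolding vw(4) clstri_def by (simp_all only: cls_minus insert_commute)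
  moreover have "det2 w (- (v + w)) = 1" "det2 (v + w) (- v) = 1" using sw by simp_all
  moreover have "cls (- (v + w)) = cls (v + w)" "cls (- v) = cls v" by (rule cls_minus)+
  ultimately have "orients T b (cls (v + w))" "orients T (cls (v + w)) a"
    unfolding orients_def vw(2,3) by metis+
  then show thesis using d vw by (intro that[of "cls (v + w)"]) (auto simp: clstri_def)
qed

lemma orients_exists:
  assumes "T \<in> cplx" "card T = 3" "a \<in> T"
  shows "\<exists>b. orients T a b"
proof -
  obtain v w where vw: "upair v w" "T \<subseteq> clstri v w" using assms(1) by (auto simp: cplx_def)
  have "card (clstri v w) = 3" using cls_distinct[OF vw(1)] by (simp add: clstri_def)
  then have T: "T = clstri v w" using vw(2) assms(2) by (metis card.infinite card_subset_eq numeral_eq_iff zero_neq_numeral)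
  have "det2 v w = 1 \<or> det2 w v = 1" using upair_int_det[OF vw(1)] by (auto simp: det2_swap[of w v])
  moreover have "T = clstri w v" unfolding T clstri_def by (simp only: insert_commute add.commute)
  ultimately obtain x y where "orients T x y" using T unfolding orients_def by blast
  then obtain z where "T = {x, y, z}" "orients T y z" "orients T z x" by (rule orients_cycle)
  then show ?thesis using \<open>orients T x y\<close> assms(3) by auto
qed

lemma coherently_orientable_cplx: "coherently_orientable cplx"
proof -
  define r where "r T a = (SOME b. orients T a b)" for T a
  have r: "r T a = b" if "orients T a b" for T a b
    using someI[of "orients T a", OF that] that orients_unique by (metis r_def)
  \<comment> \<open>A common edge positive in both triangles has lifts with equal reductions on both
    sides; these determine the sum and with it the third vertex, so the triangles agree.\<close>
  have coh: "T = T' \<or> orients T' b a" if ab: "orients T a b" and T': "T' \<in> cplx" "card T' = 3" "a \<in> T'" "b \<in> T'" for T T' a b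
  proof -
    obtain b' where ab': "orients T' a b'" using orients_exists[OF T'(1-3)] by blast
    then obtain c where c: "T' = {a, b', c}" "orients T' c a" by (rule orients_cycle)
    obtain c' where "a \<noteq> b" by (rule orients_cycle[OF ab])
    then have "b = c \<or> b = b'" using c(1) T'(4) by blast
    then show ?thesis
    proof
      assume "b = c" then show ?thesis using c(2) by blast
    next
      assume bb: "b = b'"
      obtain v w v' w' where vw: "det2 v w = 1" "a = cls v" "b = cls w" "T = clstri v w"
          and vw': "det2 v' w' = 1" "a = cls v'" "b' = cls w'" "T' = clstri v' w'"
        using ab ab' unfolding orients_def by blast
      obtain v2 w2 where 2: "det2 v2 w2 = 1" "cls w2 = b'" "clstri v2 w2 = T'"
          "red v2 = (red v :: 'm mod_ring ^ 2)" "cls v2 = a"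
        using same_start[OF vw(1) vw'(1)] vw(2) vw'(2-4) by metis
      have "red w2 = (red w :: 'm mod_ring ^ 2)"
        using red_eq_of_cls[OF 2(4) 2(1) vw(1)] 2(2) bb vw(3) by simp
      then have "cls (v2 + w2) = cls (v + w)" using 2(4) by (simp add: cls_def rho_def)
      then have "T' = T" using 2(2,3,5) vw(2-4) bb by (simp add: clstri_def)
      then show ?thesis by blast
    qed
  qed
  show ?thesis
    unfolding coherently_orientable_def
  proof (intro exI[of _ r] conjI ballI impI)
    fix T a assume T: "T \<in> cplx" "card T = 3" "a \<in> T"
    then obtain b where b: "orients T a b" using orients_exists by blast
    obtain c where c: "T = {a, b, c}" "a \<noteq> b" "orients T b c" "orients T c a" by (rule orients_cycle[OF b])
    show "r T a \<in> T" "r T a \<noteq> a" "r T (r T (r T a)) = a"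
      using r[OF b] r[OF c(3)] r[OF c(4)] c(1,2) by auto
  next
    fix T T' a assume T: "T \<in> cplx" "T' \<in> cplx" "card T = 3 \<and> card T' = 3 \<and> T \<noteq> T'" "a \<in> T \<inter> T'" "r T a \<in> T'"
    then obtain b where b: "orients T a b" using orients_exists by blast
    then show "r T' (r T a) = a" using coh[OF b T(2)] r[OF b] T r by auto
  qed
qed

section \<open>Number of vertices and genus\<close>

lemma card_vertices: "2 * card (\<Union>cplx) = card {u :: 'm mod_ring ^ 2. primitive u}"
proof -
  let ?A = "emb ` {u. primitive u}"
  have "\<Union>cplx = pm ` ?A"
  proof (intro equalityI subsetI)
    fix a assume "a \<in> \<Union>cplx"
    then obtain v w where "upair v w" "a = cls v" unfolding vertices_cplx by blast
    then have "primitive (red v :: 'm mod_ring ^ 2)" "a = pm (emb (red v))"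
      using upair_primitive(1) primitive_red by (blast, simp add: cls_def rho_def)
    then show "a \<in> pm ` ?A" by blast
  next
    fix a assume "a \<in> pm ` ?A"
    then obtain u where u: "primitive u" "a = pm (emb u)" by blast
    obtain v where v: "primitive v" "red v = u" using primitive_lift[of u] u(1) by auto
    obtain w where "det2 v w = 1" using primitive_2_det[OF v(1)] by blast
    then have "upair v w" by (simp add: upair_detI)
    then show "a \<in> \<Union>cplx" unfolding vertices_cplx using u(2) v(2) by (auto simp: cls_def rho_def)
  qed
  moreover have "2 * card (pm ` ?A) = card ?A"
  proof (rule card_pm_classes)
    fix x assume "x \<in> ?A"
    then obtain u where u: "primitive u" "x = emb u" by blast
    then have "primitive (- u)" unfolding primitive_2_iff by (metis minus_mult_minus vector_uminus_component)
    then show "- x \<in> ?A" using u(2) emb_simps(2) by (metis image_eqI mem_Collect_eq)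
    show "x \<noteq> - x"
    proof
      assume "x = - x"
      then have "u = - u" using u(2) emb_inj emb_simps(2) by metis
      then have "u + u = 0" by (metis add.right_inverse)
      obtain w where "det2 u w = 1" using primitive_2_det[OF u(1)] by blast
      then have "det2 (u + u) w = 2" by (simp only: det2_simps) simp
      then show False using \<open>u + u = 0\<close> small_not_0(2) by simp
    qed
  qed simp
  moreover have "card ?A = card {u :: 'm mod_ring ^ 2. primitive u}"
    using emb_inj by (intro card_image) (auto simp: inj_on_def)
  ultimately show ?thesis by simp
qed

lemma card_vertices_c1: "real (card (\<Union>cplx)) = c1 CARD('m)"
proof -
  have "2 * real (card (\<Union>cplx)) = real (card {u :: 'm mod_ring ^ 2. primitive u})"
    by (simp flip: card_vertices)
  then show ?thesis unfolding card_primitive by (simp add: c1_def)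
qed

theorem closed_oriented_surface_cplx:
  "\<exists>g. real g = genus_num CARD('m) \<and> closed_oriented_surface (realization cplx) g"
proof -
  let ?m = "CARD('m)" and ?\<chi> = "euler_char cplx" and ?V = "card (\<Union>cplx)"
  have star: "\<exists>w. cyclic_star cplx ?m a w" if "a \<in> \<Union>cplx" for a
    using vertex_det[OF that] cyclic_star_cplx by blast
  have "axis 1 1 = (axis 1 1 :: int ^ 2)" ..
  have "det2 (axis 1 1) (axis 2 1 :: int ^ 2) = 1" by (simp add: det2_def axis_def)
  then have "upair (axis 1 1) (axis 2 1 :: int ^ 2)" by (simp add: upair_detI)
  then have ne: "cplx \<noteq> {}" using clstri_cplx by blast
  have surf: "closed_surface (realization cplx)"
    using closed_surface_realization[OF finite_cplx abstract_complex_cplx ne m3 star cplx_connected] .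
  have chi: "6 * ?\<chi> = (6 - int ?m) * int ?V"
    by (rule euler_char_cyclic[OF finite_cplx abstract_complex_cplx m3 star])
  define J where "J = 2 * ?V"
  have J: "real J = real ?m ^ 2 * (\<Prod>p\<in>prime_factors ?m. 1 - 1 / real p ^ 2)"
    using card_vertices_c1 by (simp add: J_def c1_def)
  have "24 dvd (6 - int ?m) * int J" by (rule jordan_totient_dvd[OF m3 J])
  also have "(6 - int ?m) * int J = 12 * ?\<chi>" using chi by (simp add: J_def)
  finally have "even ?\<chi>" by presburger
  then obtain h where h: "?\<chi> = 2 * h" by (elim evenE)
  \<comment> \<open>This makes 1 - h a natural number. From m = 6 on the formula is nonpositive; for
    m = 3, 4, 5 there are 4, 6, 12 vertices, as for the tetrahedron, octahedron and icosahedron, and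
    the value is 2.\<close>
  have "?\<chi> \<le> 2"
  proof (cases "?m \<ge> 6")
    case True
    then have "6 * ?\<chi> \<le> 0" unfolding chi by (intro mult_nonpos_nonneg) auto
    then show ?thesis by simp
  next
    case False
    then consider "?m = 3" | "?m = 4" | "?m = 5" using m3 by linarith
    then show ?thesis
    proof cases
      case 1
      then have "real J = real 8" using J by (simp add: card_eq_prime_factors)
      then show ?thesis using chi 1 by (simp add: J_def)
    next
      case 2
      then have "real J = real 12" using J by (simp add: card_eq_prime_factors)
      then show ?thesis using chi 2 by (simp add: J_def)
    next
      case 3
      then have "real J = real 24" using J by (simp add: card_eq_prime_factors)
      then show ?thesis using chi 3 by (simp add: J_def)
    qed
  qed
  then have g: "int (nat (1 - h)) = 1 - h" using h by simp
  have "real_of_int (6 * ?\<chi>) = (6 - real ?m) * c1 ?m"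
    unfolding chi card_vertices_c1[symmetric] by simp
  \<comment> \<open>With V = \<open>c1\<close>, these are the edge and triangle counts mV/2 and
    mV/3, so \<open>genus_num\<close> is 1 minus half the Euler characteristic.\<close>
  moreover have "c2 ?m = real ?m / 2 * c1 ?m" "c3 ?m = real ?m / 3 * c1 ?m"
    by (simp_all add: c1_def c2_def c3_def power2_eq_square power3_eq_cube)
  ultimately have "real_of_int h = 1 - genus_num ?m"
    unfolding genus_num_def using h by (simp add: field_simps)
  moreover have "real (nat (1 - h)) = 1 - real_of_int h" using g by (metis of_int_1 of_int_diff of_int_of_nat_eq)
  moreover have "?\<chi> = 2 - 2 * int (nat (1 - h))" using g h by simp
  ultimately show ?thesis
    using closed_oriented_surface_realization[OF finite_cplx abstract_complex_cplx surf coherently_orientable_cplx]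
    by (intro exI[of _ "nat (1 - h)"]) simp
qed

end

section \<open>Planes with a generator\<close>

context plane_frame begin

text \<open>The two ends of an edge have determinant 1 or -1 in the frame, so they form a basis of
  the plane, and their wedge is the generator up to sign, whichever representatives are
  taken.\<close>

lemma S_edge_span:
  assumes "S_edge (span2 p1 p2) (pm (wedge p1 p2)) a b" "x \<in> a" "y \<in> b"
  shows "span2 p1 p2 = span2 x y" "pm (wedge p1 p2) = pm (wedge x y)"
proof -
  obtain u u' where u: "a = pm (emb u)" "b = pm (emb u')" "wedge (emb u) (emb u') \<in> pm (wedge p1 p2)"
    using assms(1) unfolding S_edge_def span2_emb by blast
  obtain z z' where z: "x = emb z" "y = emb z'" "z = u \<or> z = - u" "z' = u' \<or> z' = - u'"
    using assms(2,3) unfolding u(1,2) by (auto simp: pm_def emb_simps(2)[symmetric])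
  have "det2 u u' = 1 \<or> det2 u u' = - 1" using u(3) by (simp add: wedge_emb_pm)
  then have d: "det2 z z' = 1 \<or> det2 z z' = - 1" using z(3,4) by auto
  then have sq: "det2 z z' * det2 z z' = 1" by auto
  show "span2 p1 p2 = span2 x y"
  proof (intro equalityI subsetI)
    fix q assume "q \<in> span2 p1 p2"
    then obtain r where r: "q = emb r" unfolding span2_emb by blast
    have "r = (det2 z z' * det2 r z') *s z + (det2 z z' * det2 z r) *s z'"
      using arg_cong[OF det2_expand[of z z' r], of "\<lambda>v. det2 z z' *s v"] sq
      by (simp add: vector_smult_assoc vector_add_ldistrib)
    then have "q = (det2 z z' * det2 r z') *s x + (det2 z z' * det2 z r) *s y"
      unfolding r z(1,2) using emb_simps(1,3) by metis
    then show "q \<in> span2 x y" by (rule span2I)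
  next
    fix q assume "q \<in> span2 x y"
    then obtain k l where "q = k *s x + l *s y" unfolding span2_def by blast
    then have "q = emb (k *s z + l *s z')" by (simp only: z(1,2) emb_simps)
    then show "q \<in> span2 p1 p2" unfolding span2_emb by blast
  qed
  have "wedge x y \<in> pm (wedge p1 p2)" unfolding z(1,2) wedge_emb_pm by (rule d)
  then show "pm (wedge p1 p2) = pm (wedge x y)" using mem_pm_iff by metis
qed

lemma S_complex_facts:
  defines "S \<equiv> S_complex (span2 p1 p2) (pm (wedge p1 p2))"
  shows "finite S" "abstract_complex S" "isomorphic_to_PD2_link S CARD('m)"
    "\<exists>g. real g = genus_num CARD('m) \<and> closed_oriented_surface (realization S) g"
    "real (card (\<Union>S)) = c1 CARD('m)"
  unfolding S_def S_complex_eq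
  by (rule finite_cplx, rule abstract_complex_cplx, rule isomorphic_link, rule closed_oriented_surface_cplx,
    rule card_vertices_c1)

text \<open>For primitive u and z of determinant 1 with it, the partners of u are the e z + k u with
  e = 1 or -1 and k arbitrary: 2m of them.\<close>

lemma card_unit_pairs:
  "card {(u, u'). det2 u (u' :: 'm mod_ring ^ 2) = 1 \<or> det2 u u' = - 1} =
    card {u :: 'm mod_ring ^ 2. primitive u} * (2 * CARD('m))"
proof -
  let ?B = "\<lambda>u. {u' :: 'm mod_ring ^ 2. det2 u u' = 1 \<or> det2 u u' = - 1}"
  have prim: "primitive u" if "det2 u u' = 1 \<or> det2 u u' = - 1" for u u' :: "'m mod_ring ^ 2"
    using that upair_primitive(1)[of u u'] unfolding upair_2_iff by auto
  have "card (?B u) = 2 * CARD('m)" if u: "primitive u" for u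
  proof -
    obtain z where z: "det2 u z = 1" using primitive_2_det[OF u] by blast
    let ?f = "\<lambda>(e :: 'm mod_ring, k :: 'm mod_ring). e *s z + k *s u"
    have "bij_betw ?f ({1, - 1} \<times> UNIV) (?B u)"
    proof (rule bij_betwI')
      fix p q :: "'m mod_ring \<times> 'm mod_ring"
      show "?f p = ?f q \<longleftrightarrow> p = q"
      proof
        assume eq: "?f p = ?f q"
        have "det2 u (?f p) = fst p" "det2 u (?f q) = fst q" "det2 (?f p) z = snd p" "det2 (?f q) z = snd q"
          by (simp_all add: case_prod_beta z)
        then show "p = q" using eq by (metis prod.collapse)
      qed simp
    next
      fix p :: "'m mod_ring \<times> 'm mod_ring" assume "p \<in> {1, - 1} \<times> UNIV"
      then show "?f p \<in> ?B u" by (auto simp: z)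
    next
      fix u' assume u': "u' \<in> ?B u"
      have "u' = det2 u u' *s z + det2 u' z *s u"
        using det2_expand[of u z u'] by (simp add: z add.commute)
      then have "u' = ?f (det2 u u', det2 u' z)" by simp
      then show "\<exists>p\<in>{1, - 1} \<times> UNIV. u' = ?f p"
        using u' by (intro bexI[of _ "(det2 u u', det2 u' z)"]) auto
    qed
    then have "card (?B u) = card ({1, - 1 :: 'm mod_ring} \<times> (UNIV :: 'm mod_ring set))"
      by (simp add: bij_betw_same_card)
    then show ?thesis using small_not_0(1) by (simp add: card_cartesian_product)
  qed
  then have "card (Sigma {u. primitive u} ?B) = card {u :: 'm mod_ring ^ 2. primitive u} * (2 * CARD('m))"
    by simp
  moreover have "Sigma {u. primitive u} ?B = {(u, u'). det2 u u' = 1 \<or> det2 u u' = - 1}"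
    using prim by auto
  ultimately show ?thesis by simp
qed

text \<open>The good pairs that give a fixed plane and generator are the pairs of determinant 1 or
  -1 in one frame; their number is independent of the plane.\<close>

lemma card_frames:
  assumes "symp p1 p2 = 0"
  shows "card {(v, w). good v w \<and> span2 v w = span2 p1 p2 \<and> pm (wedge v w) = pm (wedge p1 p2)} =
    card {u :: 'm mod_ring ^ 2. primitive u} * (2 * CARD('m))"
proof -
  let ?D = "{(u, u'). det2 u (u' :: 'm mod_ring ^ 2) = 1 \<or> det2 u u' = - 1}"
  have "symp p2 p1 = 0" using assms symp_swap[of p1 p2] by simp
  then have sy: "symp (emb u) (emb u') = 0" for u u' by (simp add: emb_def assms)
  let ?T = "{(v, w). good v w \<and> span2 v w = span2 p1 p2 \<and> pm (wedge v w) = pm (wedge p1 p2)}"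
  have im: "(\<lambda>(u, u'). (emb u, emb u')) ` ?D =
      {(v, w). good v w \<and> span2 v w = span2 p1 p2 \<and> pm (wedge v w) = pm (wedge p1 p2)}"
  proof (intro equalityI subsetI)
    fix q assume "q \<in> (\<lambda>(u, u'). (emb u, emb u')) ` ?D"
    then obtain r where r: "r \<in> ?D" "q = (\<lambda>(u, u'). (emb u, emb u')) r" by (rule imageE)
    obtain u u' where "r = (u, u')" by (cases r)
    with r have u: "q = (emb u, emb u')" "det2 u u' = 1 \<or> det2 u u' = - 1" by simp_all
    have up: "upair u u'" unfolding upair_2_iff using u(2) by auto
    have "S_edge (span2 p1 p2) (pm (wedge p1 p2)) (pm (emb u)) (pm (emb u'))"
      unfolding S_edge_def span2_emb
      using upair_primitive[OF up] u(2) wedge_emb_pm primitive_emb by blast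
    from S_edge_span[OF this pm_self pm_self]
    show "q \<in> {(v, w). good v w \<and> span2 v w = span2 p1 p2 \<and> pm (wedge v w) = pm (wedge p1 p2)}"
      using upair_emb[OF up] sy u(1) by (simp add: good_def)
  next
    fix q assume "q \<in> {(v, w). good v w \<and> span2 v w = span2 p1 p2 \<and> pm (wedge v w) = pm (wedge p1 p2)}"
    then obtain v w where q: "q = (v, w)" "span2 v w = span2 p1 p2" "pm (wedge v w) = pm (wedge p1 p2)" by blast
    have "v \<in> span2 p1 p2" "w \<in> span2 p1 p2" unfolding q(2)[symmetric] by (rule span2_mem)+
    then obtain u u' where u: "v = emb u" "w = emb u'" unfolding span2_emb by blast
    have "wedge v w \<in> pm (wedge p1 p2)" unfolding q(3)[symmetric] by (rule pm_self)
    then have "det2 u u' = 1 \<or> det2 u u' = - 1" unfolding u wedge_emb_pm .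
    then show "q \<in> (\<lambda>(u, u'). (emb u, emb u')) ` ?D"
      unfolding q(1) u by - (rule image_eqI[of _ _ "(u, u')"], simp_all)
  qed
  have inj: "inj_on (\<lambda>(u, u'). (emb u, emb u')) ?D"
    by (auto simp: inj_on_def dest: emb_inj)
  have "card ?T = card ?D" unfolding im[symmetric] by (rule card_image[OF inj])
  then show ?thesis by (simp only: card_unit_pairs)
qed

end

lemma wedge_simps: "wedge (k *s v) w = mscale k (wedge v w)" "wedge w v = - wedge v w" "wedge v (v + w) = wedge v w"
  by (simp_all add: wedge_def mscale_def vec_eq_iff algebra_simps)

lemma wedge_span2: "wedge (a *s v + b *s w) (c *s v + d *s w) = mscale (a * d - b * c) (wedge v w)"
  unfolding vec_eq_iff
proof (intro allI)
  fix i j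
  have "(a * x + b * y) * (c * z + d * t) - (c * x + d * y) * (a * z + b * t) = (a * d - b * c) * (x * t - y * z)"
    for x y z t by (simp add: algebra_simps)
  then show "wedge (a *s v + b *s w) (c *s v + d *s w) $ i $ j = mscale (a * d - b * c) (wedge v w) $ i $ j"
    by (simp add: wedge_def mscale_def)
qed

lemma ext_square_span2: "ext_square (span2 v w) = rmat.span {wedge v w}"
proof (intro equalityI)
  show "ext_square (span2 v w) \<subseteq> rmat.span {wedge v w}"
    unfolding ext_square_def
  proof (rule rmat.span_minimal[OF _ rmat.subspace_span], rule subsetI)
    fix M assume "M \<in> {wedge x y | x y. x \<in> span2 v w \<and> y \<in> span2 v w}"
    then obtain x y where xy: "M = wedge x y" "x \<in> span2 v w" "y \<in> span2 v w" by blast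
    then obtain a b c d where "x = a *s v + b *s w" "y = c *s v + d *s w" unfolding span2_def by blast
    then have "M = mscale (a * d - b * c) (wedge v w)" using xy(1) wedge_span2 by metis
    then show "M \<in> rmat.span {wedge v w}" by (simp add: rmat.span_scale rmat.span_base)
  qed
  show "rmat.span {wedge v w} \<subseteq> ext_square (span2 v w)"
    unfolding ext_square_def by (rule rmat.span_mono) (use span2_mem in blast)
qed

text \<open>A second generator of the exterior square is a unit multiple of v \<and> w, and the unit
  can be absorbed into \<open>v\<close>. So planes with a generator are exactly what good pairs
  produce.\<close>

lemma plane_generator_iff:
  fixes P :: "('m::nontriv mod_ring ^ 4) set"
  shows "isotropic_plane P \<and> \<Omega> \<in> generator_classes P \<longleftrightarrow>
    (\<exists>v w. good v w \<and> P = span2 v w \<and> \<Omega> = pm (wedge v w))"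
proof
  assume "isotropic_plane P \<and> \<Omega> \<in> generator_classes P"
  then obtain v w \<omega> where vw: "good v w" "P = span2 v w" and \<omega>: "\<Omega> = pm \<omega>" "rmat.span {\<omega>} = rmat.span {wedge v w}"
    unfolding isotropic_plane_iff[OF inverse_comm_finite] generator_classes_def
    using ext_square_span2 by blast
  have "\<omega> \<in> rmat.span {wedge v w}" "wedge v w \<in> rmat.span {\<omega>}"
    using \<omega>(2) rmat.span_base[of \<omega> "{\<omega>}"] rmat.span_base[of "wedge v w" "{wedge v w}"] by auto
  then obtain k l where kl: "\<omega> = mscale k (wedge v w)" "wedge v w = mscale l \<omega>"
    unfolding rmat.span_singleton by blast
  have "mscale (l * k) (wedge v w) = mscale 1 (wedge v w)"
    using kl by (metis rmat.scale_scale mscale_pm(1))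
  then have lk: "l * k = 1" using mscale_wedge_cancel vw(1) unfolding good_def by blast
  obtain c d where cd: "dotp c v = 1" "dotp c w = 0" "dotp d v = 0" "dotp d w = 1"
    using vw(1) by (auto simp: good_def upair_def)
  \<comment> \<open>Scaling the covector \<open>c\<close> by the inverse \<open>l\<close> of
    \<open>k\<close> keeps it dual to the scaled vector.\<close>
  have "upair (k *s v) w" by (rule upairI[of "l *s c" _ _ d]) (simp_all add: cd lk mult.commute[of k l])
  then have "good (k *s v) w" using vw(1) by (simp add: good_def)
  moreover have "P = span2 (k *s v) w"
  proof (intro equalityI subsetI)
    fix x assume "x \<in> P"
    then obtain a b where "x = a *s v + b *s w" unfolding vw(2) span2_def by blast
    moreover have "a *s v = (a * l) *s (k *s v)" using lk by (simp add: vector_smult_assoc mult.assoc)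
    ultimately show "x \<in> span2 (k *s v) w" by (intro span2I) simp
  next
    fix x assume "x \<in> span2 (k *s v) w"
    then obtain a b where "x = a *s (k *s v) + b *s w" unfolding span2_def by blast
    then have "x = (a * k) *s v + b *s w" by (simp add: vector_smult_assoc)
    then show "x \<in> P" unfolding vw(2) by (rule span2I)
  qed
  ultimately show "\<exists>v w. good v w \<and> P = span2 v w \<and> \<Omega> = pm (wedge v w)"
    using \<omega>(1) kl(1) wedge_simps(1) by metis
next
  assume "\<exists>v w. good v w \<and> P = span2 v w \<and> \<Omega> = pm (wedge v w)"
  then obtain v w where vw: "good v w" "P = span2 v w" "\<Omega> = pm (wedge v w)" by blast
  then show "isotropic_plane P \<and> \<Omega> \<in> generator_classes P"
    unfolding isotropic_plane_iff[OF inverse_comm_finite] generator_classes_def vw(2,3) ext_square_span2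
    by blast
qed

lemma S_complex_edge:
  assumes "\<sigma> \<in> S_complex P (pm \<omega>)" "a \<in> \<sigma>" "b \<in> \<sigma>" "a \<noteq> b"
  shows "S_edge P (pm \<omega>) a b"
proof -
  have sym: "S_edge P (pm \<omega>) y x" if xy: "S_edge P (pm \<omega>) x y" for x y
  proof -
    obtain v w where vw: "v \<in> P" "primitive v" "w \<in> P" "primitive w" "x = pm v" "y = pm w" "wedge v w \<in> pm \<omega>"
      using xy unfolding S_edge_def by blast
    have "wedge w v \<in> pm \<omega>" using vw(7) wedge_simps(2)[of w v] by (auto simp: pm_def)
    then show ?thesis unfolding S_edge_def using vw by blast
  qed
  show ?thesis
    using assms(1) unfolding S_complex_def
  proof (elim UnE CollectE exE conjE)
    fix v assume "\<sigma> = {pm v}"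
    then show ?thesis using assms(2-4) by simp
  next
    fix x y assume h: "\<sigma> = {x, y}" "S_edge P (pm \<omega>) x y"
    show ?thesis using assms(2-4) h sym[OF h(2)] by auto
  next
    fix x y z assume h: "\<sigma> = {x, y, z}" "S_edge P (pm \<omega>) x y" "S_edge P (pm \<omega>) x z" "S_edge P (pm \<omega>) y z"
    show ?thesis using assms(2-4) h sym[OF h(2)] sym[OF h(3)] sym[OF h(4)] by auto
  qed
qed

context level begin

abbreviation generated :: "(('m mod_ring ^ 4) set \<times> ('m mod_ring ^ 4 ^ 4) set) set" where
  "generated \<equiv> {(P, \<Omega>). isotropic_plane P \<and> \<Omega> \<in> generator_classes P}"

lemma generated_eq: "generated = (\<lambda>(v, w). (span2 v w, pm (wedge v w))) ` {(v, w). good v w}"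
  unfolding plane_generator_iff by auto

lemma good_frame: "good p1 p2 \<Longrightarrow> plane_frame p1 (p2 :: 'm mod_ring ^ 4)"
  using m3 by unfold_locales (simp_all add: good_def)

lemma generated_frame:
  assumes "(P, \<Omega>) \<in> generated"
  obtains p1 p2 where "plane_frame p1 p2" "symp p1 p2 = 0" "P = span2 p1 p2" "\<Omega> = pm (wedge p1 p2)"
proof -
  have "\<exists>v w. good v w \<and> P = span2 v w \<and> \<Omega> = pm (wedge v w)"
    using assms plane_generator_iff by auto
  then obtain v w where vw: "good v w" "P = span2 v w" "\<Omega> = pm (wedge v w)" by blast
  then show thesis using that good_frame good_def by blast
qed

lemma generated_nonempty: "generated \<noteq> {}"
proof -
  have "primitive (axis 1 1 :: int ^ 4)"
    by (auto simp: primitive_iff_dotp dotp_def sum_4 axis_def intro!: exI[of _ "axis 1 1"])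
  then obtain w where "good (axis 1 (1 :: int) :: int ^ 4) w" using primitive_good by blast
  then have "good (red (axis 1 1) :: 'm mod_ring ^ 4) (red w)" by (rule good_red)
  then show ?thesis unfolding generated_eq by blast
qed

text \<open>A triangle v, w, v + w lies in the plane of v, w, and all three of its edges have wedge
  v \<and> w up to sign.\<close>

lemma Delta2_simplex_in_S:
  assumes "\<sigma> \<in> (Delta2 :: ('m mod_ring ^ 4) set set set)"
  shows "\<exists>P \<Omega>. (P, \<Omega>) \<in> generated \<and> \<sigma> \<in> S_complex P \<Omega>"
proof -
  obtain x y where xy: "good x y" "\<sigma> \<subseteq> clstri x y" "\<sigma> \<noteq> {}"
    using assms unfolding Delta2_eq_cplx cplx_def by blast
  define v w where "v = (red x :: 'm mod_ring ^ 4)" and "w = (red y :: 'm mod_ring ^ 4)"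
  have vw: "good v w" unfolding v_def w_def by (rule good_red[OF xy(1)])
  let ?P = "span2 v w" and ?\<Omega> = "pm (wedge v w)"
  have up: "upair v w" using vw by (simp add: good_def)
  have "upair v (v + w)" using upair_add[OF up, of 1] by simp
  then have pr: "primitive v" "primitive w" "primitive (v + w)"
    using upair_primitive[OF up] upair_primitive(2) by blast+
  have mem: "v \<in> ?P" "w \<in> ?P" "v + w \<in> ?P"
    using span2I[of "v + w" 1 v 1 w] by simp_all
  have "wedge v w \<in> ?\<Omega>" "wedge v (v + w) \<in> ?\<Omega>" "wedge w (v + w) \<in> ?\<Omega>"
    using wedge_simps(2)[of w v] wedge_simps(3)[of v w] wedge_simps(3)[of w v] by (auto simp: pm_def add.commute)
  then have "S_edge ?P ?\<Omega> (pm v) (pm w)" "S_edge ?P ?\<Omega> (pm v) (pm (v + w))" "S_edge ?P ?\<Omega> (pm w) (pm (v + w))"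
    unfolding S_edge_def using pr mem by blast+
  then have "{pm v, pm w, pm (v + w)} \<in> S_complex ?P ?\<Omega>" by (rule S_complexI)
  moreover have "\<sigma> \<subseteq> {pm v, pm w, pm (v + w)}"
    using xy(2) by (simp add: clstri_def cls_def v_def w_def)
  ultimately have "\<sigma> \<in> S_complex ?P ?\<Omega>"
    using plane_frame.S_complex_facts(2)[OF good_frame[OF vw]] xy(3) unfolding abstract_complex_def by blast
  moreover have "(?P, ?\<Omega>) \<in> generated" 
    unfolding generated_eq using vw by - (rule image_eqI[of _ _ "(v, w)"], simp_all)
  ultimately show ?thesis by blast
qed

lemma S_complex_unique:
  assumes "(P, \<Omega>) \<in> generated" "\<sigma> \<in> S_complex P \<Omega>" "(P', \<Omega>') \<in> generated" "\<sigma> \<in> S_complex P' \<Omega>'"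
    and ab: "a \<in> \<sigma>" "b \<in> \<sigma>" "a \<noteq> b"
  shows "P = P' \<and> \<Omega> = \<Omega>'"
proof -
  have *: "P = span2 x y \<and> \<Omega> = pm (wedge x y)" if P: "(P, \<Omega>) \<in> generated" "\<sigma> \<in> S_complex P \<Omega>" and xy: "x \<in> a" "y \<in> b" for P \<Omega> x y
  proof -
    obtain p1 p2 where p: "plane_frame p1 p2" "P = span2 p1 p2" "\<Omega> = pm (wedge p1 p2)"
      using generated_frame[OF P(1)] by metis
    have "S_edge (span2 p1 p2) (pm (wedge p1 p2)) a b"
      using S_complex_edge P(2) ab unfolding p(2,3) by blast
    from plane_frame.S_edge_span[OF p(1) this xy] show ?thesis using p(2,3) by simp
  qed
  obtain p1 p2 where p: "plane_frame p1 p2" "P = span2 p1 p2" "\<Omega> = pm (wedge p1 p2)"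
    using generated_frame[OF assms(1)] by metis
  have "S_edge (span2 p1 p2) (pm (wedge p1 p2)) a b"
    using S_complex_edge assms(2) ab unfolding p(2,3) by blast
  then obtain x y where "a = pm x" "b = pm y" unfolding S_edge_def by blast
  then have "x \<in> a" "y \<in> b" by (simp_all add: pm_self)
  then show ?thesis using *[OF assms(1,2)] *[OF assms(3,4)] by metis
qed

text \<open>By \<open>good_iff_coords\<close> a partner of \<open>v\<close> is given by a free
  multiple of \<open>v\<close> and a primitive row of length two.\<close>

lemma card_good_at:
  assumes "primitive (v :: 'm mod_ring ^ 4)"
  shows "card {w. good v w} = CARD('m) * card {u :: 'm mod_ring ^ 2. primitive u}"
proof -
  obtain z where z: "primitive z" "red z = v" using primitive_lift[OF assms] by auto
  obtain w0 x y where "sympbasis z w0 x y" using primitive_sympbasis[OF z(1)] by blast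
  then have "sympbasis v (red w0) (red x) (red y)" using sympbasis_red z(2) by metis
  then obtain w0 x y where s: "sympbasis v w0 x y" by blast
  note rels = sympbasis_rels[OF s]
  let ?f = "\<lambda>(a, u :: 'm mod_ring ^ 2). a *s v + u $ 1 *s w0 + u $ 2 *s y"
  have "bij_betw ?f (UNIV \<times> {u. primitive u}) {w. good v w}"
  proof (rule bij_betwI')
    fix p q :: "'m mod_ring \<times> ('m mod_ring ^ 2)"
    show "?f p = ?f q \<longleftrightarrow> p = q"
    proof
      assume eq: "?f p = ?f q"
      have c: "symp (?f p) x = fst p" "symp (?f p) y = snd p $ 1" "symp w0 (?f p) = snd p $ 2" for p
        by (simp_all add: case_prod_beta rels)
      have "fst p = fst q" "snd p $ 1 = snd q $ 1" "snd p $ 2 = snd q $ 2"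
        using c[of p] c[of q] eq by metis+
      then show "p = q" by (simp add: prod_eq_iff vec2_eq_iff)
    qed simp
  next
    fix p :: "'m mod_ring \<times> ('m mod_ring ^ 2)" assume "p \<in> UNIV \<times> {u. primitive u}"
    then obtain a u where p: "p = (a, u)" "primitive u" by blast
    then have "\<exists>s t. s * u $ 1 + t * u $ 2 = 1" unfolding primitive_2_iff by blast
    then have "good v (a *s v + u $ 1 *s w0 + u $ 2 *s y)"
      unfolding good_iff_coords[OF inverse_comm_finite s] by blast
    then show "?f p \<in> {w. good v w}" by (simp add: p(1))
  next
    fix w assume "w \<in> {w. good v w}"
    then obtain a b d where w: "\<exists>s t. s * b + t * d = 1" "w = a *s v + b *s w0 + d *s y"
      unfolding good_iff_coords[OF inverse_comm_finite s] by blast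
    define u :: "'m mod_ring ^ 2" where "u = (\<chi> i. if i = 1 then b else d)"
    have "u $ 1 = b" "u $ 2 = d" by (simp_all add: u_def)
    then have "w = ?f (a, u)" "(a, u) \<in> UNIV \<times> {u. primitive u}"
      using w by (simp_all add: primitive_2_iff)
    then show "\<exists>p\<in>UNIV \<times> {u. primitive u}. w = ?f p" by blast
  qed
  then have "card {w. good v w} = card ((UNIV :: 'm mod_ring set) \<times> {u :: 'm mod_ring ^ 2. primitive u})"
    by (simp add: bij_betw_same_card)
  then show ?thesis by (simp add: card_cartesian_product)
qed

text \<open>Good pairs are counted twice. With n primitive rows of length two, each primitive vector
  has m n partners, and each plane with generator comes from 2 m n good pairs.\<close>

lemma card_generated_primitive: "card {v :: 'm mod_ring ^ 4. primitive v} = 2 * card generated"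
proof -
  let ?G = "{(v, w). good v (w :: 'm mod_ring ^ 4)}" and ?n = "card {u :: 'm mod_ring ^ 2. primitive u}"
  let ?f = "\<lambda>(v, w :: 'm mod_ring ^ 4). (span2 v w, pm (wedge v w))"
  have "?G = Sigma {v. primitive v} (\<lambda>v. {w. good v w})"
    using upair_primitive(1) by (auto simp: good_def)
  then have "card ?G = card {v :: 'm mod_ring ^ 4. primitive v} * (CARD('m) * ?n)"
    by (simp add: card_good_at)
  moreover have sum: "card ?G = (\<Sum>q\<in>generated. card {p \<in> ?G. ?f p = q})"
    using sum.image_gen[of ?G "\<lambda>_. 1 :: nat" ?f] unfolding generated_eq by simp
  have fib: "card {p \<in> ?G. ?f p = q} = ?n * (2 * CARD('m))" if q: "q \<in> generated" for q
  proof -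
    obtain P \<Omega> where PO: "q = (P, \<Omega>)" by (cases q)
    obtain p1 p2 where p: "plane_frame p1 p2" "symp p1 p2 = 0" "P = span2 p1 p2" "\<Omega> = pm (wedge p1 p2)"
      by (rule generated_frame[OF q[unfolded PO]])
    have "{p \<in> ?G. ?f p = q} = {(v, w). good v w \<and> span2 v w = span2 p1 p2 \<and> pm (wedge v w) = pm (wedge p1 p2)}"
      unfolding PO p(3,4) by auto
    then show ?thesis using plane_frame.card_frames[OF p(1,2)] by simp
  qed
  have "card ?G = (\<Sum>q\<in>generated. ?n * (2 * CARD('m)))"
    unfolding sum by (rule sum.cong[OF refl fib])
  then have "card ?G = card generated * (?n * (2 * CARD('m)))" by (simp only: sum_constant of_nat_id)
  ultimately have "card {v :: 'm mod_ring ^ 4. primitive v} * (CARD('m) * ?n) = card generated * (?n * (2 * CARD('m)))"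
    by (simp only:)
  then have eq: "card {v :: 'm mod_ring ^ 4. primitive v} * (CARD('m) * ?n) = (2 * card generated) * (CARD('m) * ?n)"
    by (simp only: mult_ac)
  have "primitive (axis 1 1 :: 'm mod_ring ^ 2)"
    unfolding primitive_2_iff by (intro exI[of _ 1] exI[of _ 0]) (simp add: axis_def)
  then have "?n > 0" by (auto simp: card_gt_0_iff)
  then have ne: "CARD('m) * ?n \<noteq> 0"
    using zero_less_card_finite[where 'a = 'm] by (metis mult_eq_0_iff less_irrefl)
  show ?thesis
    using iffD1[OF mult_cancel_right eq] ne by - (elim disjE; (assumption | erule (1) notE))
qed

lemma card_generated: "real (card generated) = pi_num CARD('m)"
proof -
  have "2 * real (card generated) = real (card {v :: 'm mod_ring ^ 4. primitive v})"
    by (simp only: card_generated_primitive)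
  then show ?thesis unfolding card_primitive by (simp add: pi_num_def)
qed

text \<open>Both are half the number of primitive vectors of length four, which is why the number of
  surfaces equals the number of points after gluing.\<close>

lemma card_Delta2_vertices: "card (\<Union>(Delta2 :: ('m mod_ring ^ 4) set set set)) = card generated"
proof -
  let ?A = "{v :: 'm mod_ring ^ 4. primitive v}"
  have "\<Union>(Delta2 :: ('m mod_ring ^ 4) set set set) = pm ` ?A"
  proof (intro equalityI subsetI)
    fix a assume "a \<in> \<Union>(Delta2 :: ('m mod_ring ^ 4) set set set)"
    then obtain v w where vw: "good v w" "a = cls v" unfolding Delta2_eq_cplx vertices_cplx by blast
    then have "primitive (red v :: 'm mod_ring ^ 4)" "a = pm (red v)"
      using primitive_red upair_primitive(1) unfolding good_def cls_def by blast+
    then show "a \<in> pm ` ?A" by blast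
  next
    fix a assume "a \<in> pm ` ?A"
    then obtain v where v: "primitive v" "a = pm v" by blast
    then have "{a} \<in> Delta2" using Delta2I(1) by blast
    then show "a \<in> \<Union>Delta2" by blast
  qed
  moreover have "2 * card (pm ` ?A) = card ?A"
  proof (rule card_pm_classes)
    fix v assume v: "v \<in> ?A"
    then obtain c where c: "dotp c v = 1" by (auto simp: primitive_iff_dotp)
    then have "dotp (- c) (- v) = 1" by simp
    then show "- v \<in> ?A" unfolding primitive_iff_dotp by blast
    show "v \<noteq> - v"
    proof
      assume "v = - v"
      then have "dotp c v = dotp c (- v)" by (rule arg_cong)
      then have "(1 :: 'm mod_ring) = - 1" using c by simp
      then have "(1 :: 'm mod_ring) + 1 = 0" by (metis add.right_inverse)
      then show False using two_neq_0[OF m3] by simp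
    qed
  qed simp
  ultimately show ?thesis using card_generated_primitive by simp
qed

lemma S_complex_level:
  assumes "(P, \<Omega>) \<in> generated"
  shows "abstract_complex (S_complex P \<Omega>)" "S_complex P \<Omega> \<subseteq> Delta2"
    "isomorphic_to_PD2_link (S_complex P \<Omega>) CARD('m)"
    "\<exists>g. real g = genus_num CARD('m) \<and> closed_oriented_surface (realization (S_complex P \<Omega>)) g"
    "real (card (\<Union>(S_complex P \<Omega>))) = c1 CARD('m)"
proof -
  obtain p1 p2 where p: "plane_frame p1 p2" "symp p1 p2 = 0" "P = span2 p1 p2" "\<Omega> = pm (wedge p1 p2)"
    by (rule generated_frame[OF assms])
  note f = plane_frame.S_complex_facts[OF p(1)]
  show "abstract_complex (S_complex P \<Omega>)" "isomorphic_to_PD2_link (S_complex P \<Omega>) CARD('m)"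
    "\<exists>g. real g = genus_num CARD('m) \<and> closed_oriented_surface (realization (S_complex P \<Omega>)) g"
    "real (card (\<Union>(S_complex P \<Omega>))) = c1 CARD('m)"
    unfolding p(3,4) by (rule f(2), rule f(3), rule f(4), rule f(5))
  show "S_complex P \<Omega> \<subseteq> Delta2"
    unfolding p(3,4) plane_frame.S_complex_eq[OF p(1)] by (rule plane_frame.cplx_Delta2[OF p(1,2)])
qed

end

section \<open>Gluing\<close>

lemma delta_inj [simp]: "delta v = delta w \<longleftrightarrow> v = w"
proof
  assume "delta v = delta w"
  then have "delta v v = delta w v" by simp
  then show "v = w" by (simp add: delta_def split: if_splits)
qed simp

text \<open>The support is the smallest simplex containing the point. It belongs to every subcomplex
  whose realization contains the point.\<close>

lemma closed_simplex_supp: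
  assumes "abstract_complex K" "\<tau> \<in> K" "p \<in> closed_simplex \<tau>"
  shows "{v. p v \<noteq> 0} \<in> K"
proof -
  have "{v. p v \<noteq> 0} \<subseteq> \<tau>" using assms(3) by (auto simp: closed_simplex_def)
  moreover have "{v. p v \<noteq> 0} \<noteq> {}"
  proof
    assume "{v. p v \<noteq> 0} = {}"
    then have "sum p \<tau> = 0" by simp
    then show False using assms(3) by (simp add: closed_simplex_def)
  qed
  ultimately show ?thesis using assms(1,2) unfolding abstract_complex_def by blast
qed

lemma closed_simplex_delta:
  assumes "p \<in> closed_simplex \<tau>" "finite \<tau>" "{v. p v \<noteq> 0} = {x}"
  shows "p = delta x"
proof -
  have "x \<in> \<tau>" using assms(1,3) by (auto simp: closed_simplex_def)
  have z: "p v = 0" if "v \<noteq> x" for v using assms(3) that by blast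
  have "sum p \<tau> = sum p {x}" using assms(2) \<open>x \<in> \<tau>\<close> z by (intro sum.mono_neutral_right) auto
  then have "p x = 1" using assms(1) by (simp add: closed_simplex_def)
  then show ?thesis using z by (auto simp: delta_def)
qed

lemma continuous_map_inclusion: "A \<subseteq> B \<Longrightarrow> continuous_map (top_of_set A) (top_of_set B) id"
  by (auto simp: continuous_map_in_subtopology continuous_map_from_subtopology)

text \<open>\<open>uniq\<close> says that different subcomplexes share no simplex with two vertices,
  so their realizations can meet only in vertices.\<close>

locale subcomplex_cover =
  fixes K :: "'v set set" and L :: "'i \<Rightarrow> 'v set set" and I :: "'i set"
  assumes fin: "finite K" and cplx: "abstract_complex K"
    and sub: "\<And>i. i \<in> I \<Longrightarrow> L i \<subseteq> K" and subcplx: "\<And>i. i \<in> I \<Longrightarrow> abstract_complex (L i)"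
    and cover: "\<And>\<sigma>. \<sigma> \<in> K \<Longrightarrow> \<exists>i\<in>I. \<sigma> \<in> L i"
    and uniq: "\<And>i j \<sigma> a b. i \<in> I \<Longrightarrow> j \<in> I \<Longrightarrow> \<sigma> \<in> L i \<Longrightarrow> \<sigma> \<in> L j \<Longrightarrow> a \<in> \<sigma> \<Longrightarrow> b \<in> \<sigma> \<Longrightarrow> a \<noteq> b \<Longrightarrow> i = j"
begin

definition marked :: "'i \<Rightarrow> ('v \<Rightarrow> real) set" where "marked i = delta ` \<Union>(L i)"

definition same_point :: "(('i \<times> ('v \<Rightarrow> real)) \<times> ('i \<times> ('v \<Rightarrow> real))) set" where
  "same_point = {((i, p), (j, q)). i \<in> I \<and> j \<in> I \<and> p \<in> marked i \<and> q \<in> marked j \<and> p = q}"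

lemma fin_simplex: "\<sigma> \<in> K \<Longrightarrow> finite \<sigma>"
  using cplx by (auto simp: abstract_complex_def)

lemma real_K: "realization K = top_of_set (polyhedron_of K)"
  by (rule realization_finite[OF fin]) (rule fin_simplex)

lemma real_L: "i \<in> I \<Longrightarrow> realization (L i) = top_of_set (polyhedron_of (L i))"
  by (rule realization_finite) (use sub fin fin_simplex finite_subset in blast)+

lemma finite_vertices: "finite (\<Union>K)"
  using fin fin_simplex by blast

lemma vertex_sub: "i \<in> I \<Longrightarrow> \<Union>(L i) \<subseteq> \<Union>K"
  using sub by blast

lemma finite_marked: "i \<in> I \<Longrightarrow> finite (marked i)"
  unfolding marked_def using finite_subset[OF vertex_sub finite_vertices] by simp

lemma card_marked: "card (marked i) = card (\<Union>(L i))"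
  unfolding marked_def by (rule card_image) (simp add: inj_on_def)

lemma marked_topspace: "i \<in> I \<Longrightarrow> marked i \<subseteq> topspace (realization (L i))"
proof -
  assume i: "i \<in> I"
  have "delta v \<in> closed_simplex \<sigma>" if "v \<in> \<sigma>" "\<sigma> \<in> L i" for v \<sigma>
    using delta_simplex[OF _ that(1)] fin_simplex sub[OF i] that(2) by blast
  then show ?thesis unfolding marked_def topspace_realization by blast
qed

lemma equiv_same_point: "equiv (Sigma I marked) same_point"
  by (rule equivI) (auto simp: same_point_def refl_on_def sym_def trans_def)

lemma card_classes: "card (Sigma I marked // same_point) = card (\<Union>K)"
proof -
  define c where "c v = {(i, delta v) | i. i \<in> I \<and> v \<in> \<Union>(L i)}" for v
  have ne: "\<exists>i. (i, delta v) \<in> c v" if "v \<in> \<Union>K" for v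
    using that cover unfolding c_def by blast
  have "inj_on c (\<Union>K)"
  proof (rule inj_onI)
    fix v w assume vw: "v \<in> \<Union>K" "w \<in> \<Union>K" "c v = c w"
    obtain i where "(i, delta v) \<in> c w" using ne[OF vw(1)] vw(3) by auto
    then show "v = w" by (simp add: c_def)
  qed
  have cl: "same_point `` {(i, delta v)} = c v" if "i \<in> I" "v \<in> \<Union>(L i)" for i v
    using that unfolding same_point_def c_def marked_def by auto
  have "c ` \<Union>K = Sigma I marked // same_point"
  proof (intro equalityI subsetI)
    fix x assume "x \<in> c ` \<Union>K"
    then obtain v where v: "v \<in> \<Union>K" "x = c v" by blast
    then obtain i where i: "i \<in> I" "v \<in> \<Union>(L i)" using cover by blast
    then have "(i, delta v) \<in> Sigma I marked" by (simp add: marked_def)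
    then show "x \<in> Sigma I marked // same_point" using cl[OF i] v(2) by (metis quotientI)
  next
    fix x assume "x \<in> Sigma I marked // same_point"
    then obtain i p where ip: "i \<in> I" "p \<in> marked i" "x = same_point `` {(i, p)}" by (auto elim: quotientE)
    then obtain v where v: "v \<in> \<Union>(L i)" "p = delta v" unfolding marked_def by blast
    then show "x \<in> c ` \<Union>K" using cl[OF ip(1) v(1)] ip vertex_sub by blast
  qed
  then show ?thesis using card_image[OF \<open>inj_on c (\<Union>K)\<close>] by simp
qed

text \<open>A point lying in two subcomplexes has its support in both. A support with two vertices
  forces equal indices; otherwise the point is a vertex, hence marked on both sides.\<close>

lemma snd_eq_iff:
  assumes x: "x \<in> topspace (sum_topology (\<lambda>i. realization (L i)) I)"
    and y: "y \<in> topspace (sum_topology (\<lambda>i. realization (L i)) I)"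
  shows "snd x = snd y \<longleftrightarrow> (Id \<union> same_point) `` {x} = (Id \<union> same_point) `` {y}"
proof
  assume eq: "(Id \<union> same_point) `` {x} = (Id \<union> same_point) `` {y}"
  have "y \<in> (Id \<union> same_point) `` {x}" unfolding eq by simp
  then have "x = y \<or> (x, y) \<in> same_point" by simp
  then show "snd x = snd y" by (auto simp: same_point_def)
next
  assume eq: "snd x = snd y"
  define i p j where "i = fst x" and "p = snd x" and "j = fst y"
  have xy: "x = (i, p)" "y = (j, p)" unfolding i_def p_def j_def using eq by (simp_all add: prod_eq_iff)
  obtain \<sigma> where s: "i \<in> I" "\<sigma> \<in> L i" "p \<in> closed_simplex \<sigma>" using x xy(1) by auto
  obtain \<tau> where t: "j \<in> I" "\<tau> \<in> L j" "p \<in> closed_simplex \<tau>" using y xy(2) by auto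
  have S: "{v. p v \<noteq> 0} \<in> L i" "{v. p v \<noteq> 0} \<in> L j"
    using closed_simplex_supp[OF subcplx] s t by blast+
  show "(Id \<union> same_point) `` {x} = (Id \<union> same_point) `` {y}"
  proof (cases "\<exists>a b. p a \<noteq> 0 \<and> p b \<noteq> 0 \<and> a \<noteq> b")
    case True
    then have "i = j" using uniq[OF s(1) t(1) S] by blast
    then show ?thesis using xy by simp
  next
    case False
    moreover have "{v. p v \<noteq> 0} \<noteq> {}" using S(1) subcplx[OF s(1)] unfolding abstract_complex_def by blast
    ultimately obtain a where a: "{v. p v \<noteq> 0} = {a}" by blast
    have "p = delta a" using closed_simplex_delta[OF s(3) _ a] fin_simplex sub s by blast
    moreover have "a \<in> \<Union>(L i)" "a \<in> \<Union>(L j)" using S unfolding a by blast+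
    ultimately have E: "(x, y) \<in> same_point" using s(1) t(1) by (simp add: xy same_point_def marked_def)
    have "(x, x) \<in> same_point" "(y, y) \<in> same_point" using E by (auto simp: same_point_def)
    then have "(Id \<union> same_point) `` {x} = same_point `` {x}" "(Id \<union> same_point) `` {y} = same_point `` {y}" by blast+
    then show ?thesis using equiv_class_eq[OF equiv_same_point E] by simp
  qed
qed

text \<open>Forgetting the index maps the disjoint union onto the realization. The sections over
  closed simplices are inclusions into some subcomplex, and the fibres are those of the gluing
  relation.\<close>

theorem realization_homeomorphic_glue:
  "realization K homeomorphic_space glue_points I (\<lambda>i. realization (L i)) same_point"
proof -
  let ?X = "sum_topology (\<lambda>i. realization (L i)) I"
  have poly: "polyhedron_of (L i) \<subseteq> polyhedron_of K" if "i \<in> I" for i using sub[OF that] by blast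
  have cont: "continuous_map ?X (realization K) snd"
    unfolding continuous_map_def
  proof (intro conjI allI impI)
    show "snd \<in> topspace ?X \<rightarrow> topspace (realization K)"
    proof (rule funcsetI)
      fix x assume "x \<in> topspace ?X"
      then obtain i p where "x = (i, p)" "i \<in> I" "p \<in> polyhedron_of (L i)" by auto
      then show "snd x \<in> topspace (realization K)" using poly[of i] by (simp only: topspace_realization snd_conv) blast
    qed
    fix U assume U: "openin (realization K) U"
    show "openin ?X {x \<in> topspace ?X. snd x \<in> U}"
      unfolding openin_sum_topology
    proof (intro conjI ballI)
      fix i assume i: "i \<in> I"
      have "continuous_map (realization (L i)) (realization K) id"
        unfolding real_K real_L[OF i] by (rule continuous_map_inclusion[OF poly[OF i]])
      then have "openin (realization (L i)) {p \<in> topspace (realization (L i)). id p \<in> U}"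
        using U by (rule openin_continuous_map_preimage)
      moreover have "{p. (i, p) \<in> {x \<in> topspace ?X. snd x \<in> U}} = {p \<in> topspace (realization (L i)). id p \<in> U}"
        using i by auto
      ultimately show "openin (realization (L i)) {p. (i, p) \<in> {x \<in> topspace ?X. snd x \<in> U}}" by simp
    qed auto
  qed
  have q1: "quotient_map ?X (realization K) snd"
    unfolding realization_def[of K]
  proof (rule quotient_map_coherent_sections)
    show "continuous_map ?X (coherent_topology (closed_simplex ` K)) snd"
      using cont by (simp only: realization_def[of K])
    fix C assume "C \<in> closed_simplex ` K"
    then obtain \<sigma> i where s: "C = closed_simplex \<sigma>" "i \<in> I" "\<sigma> \<in> L i" using cover by blast
    then have "C \<subseteq> polyhedron_of (L i)" by blast
    then have "continuous_map (top_of_set C) (realization (L i)) id"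
      unfolding real_L[OF s(2)] by (rule continuous_map_inclusion)
    moreover have "continuous_map (realization (L i)) ?X (\<lambda>p. (i, p))"
      by (rule continuous_map_component_injection[OF s(2)])
    ultimately have "continuous_map (top_of_set C) ?X ((\<lambda>p. (i, p)) \<circ> id)" by (rule continuous_map_compose)
    then show "\<exists>g. continuous_map (top_of_set C) ?X g \<and> (\<forall>p\<in>C. snd (g p) = p)"
      by (intro exI[of _ "(\<lambda>p. (i, p)) \<circ> id"]) simp
  qed
  obtain h where "homeomorphic_map (realization K) (quotient_space ?X (Id \<union> same_point)) h"
    by (rule quotient_maps_same_fibres[OF q1 quotient_map_quotient_space snd_eq_iff])
  then show ?thesis unfolding glue_points_def by (rule homeomorphic_map_imp_homeomorphic_space)
qed

end

theorem corollary5p8: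
  fixes m :: nat
  assumes "m \<ge> 3" and "CARD('m::nontriv) = m"
  shows "\<exists>g c N :: nat.
    real g = genus_num m \<and> real c = c1 m \<and> real N = pi_num m \<and>
    (\<forall>P :: ('m mod_ring ^ 4) set. \<forall>\<Omega>. isotropic_plane P \<and> \<Omega> \<in> generator_classes P \<longrightarrow>
       abstract_complex (S_complex P \<Omega>) \<and> S_complex P \<Omega> \<subseteq> Delta2 \<and>
       isomorphic_to_PD2_link (S_complex P \<Omega>) m \<and>
       closed_oriented_surface (realization (S_complex P \<Omega>)) g) \<and>
    (\<forall>\<sigma> \<in> (Delta2 :: ('m mod_ring ^ 4) set set set). card \<sigma> = 2 \<or> card \<sigma> = 3 \<longrightarrow>
       (\<exists>!(P, \<Omega>). isotropic_plane P \<and> \<Omega> \<in> generator_classes P \<and> \<sigma> \<in> S_complex P \<Omega>)) \<and>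
    (\<exists>(Y :: nat \<Rightarrow> (('m mod_ring ^ 4) set \<Rightarrow> real) topology) M E.
       (\<forall>i<N. closed_oriented_surface (Y i) g \<and>
          M i \<subseteq> topspace (Y i) \<and> finite (M i) \<and> card (M i) = c) \<and>
       equiv (Sigma {..<N} M) E \<and>
       card (Sigma {..<N} M // E) = N \<and>
       realization (Delta2 :: ('m mod_ring ^ 4) set set set)
         homeomorphic_space glue_points {..<N} Y E \<and>
       LA2_trop m homeomorphic_space glue_points {..<N} Y E)"
proof -
  have m3: "CARD('m) \<ge> 3" using assms by simp
  interpret level "TYPE('m)" by (rule level.intro[OF m3])
  let ?D = "Delta2 :: ('m mod_ring ^ 4) set set set"
  define S where "S q = S_complex (fst q) (snd q)"
    for q :: "('m mod_ring ^ 4) set \<times> ('m mod_ring ^ 4 ^ 4) set"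
  define N where "N = card generated"
  obtain q0 where "q0 \<in> generated" using generated_nonempty unfolding ex_in_conv[symmetric] by (rule exE)
  moreover obtain P0 \<Omega>0 where "q0 = (P0, \<Omega>0)" by (cases q0)
  ultimately have q0: "(P0, \<Omega>0) \<in> generated" by (simp only:)
  \<comment> \<open>The genus is taken from one surface; it serves for all, since its real value
    depends on m only. The same holds for the number of marked points.\<close>
  obtain g where g: "real g = genus_num m" using S_complex_level(4)[OF q0] assms(2) by auto
  define c where "c = card (\<Union>(S_complex P0 \<Omega>0))"
  have c: "real c = c1 m" using S_complex_level(5)[OF q0] assms(2) by (simp add: c_def)
  have N: "real N = pi_num m" using card_generated assms(2) by (simp add: N_def)
  have surf: "closed_oriented_surface (realization (S_complex P \<Omega>)) g" if q: "(P, \<Omega>) \<in> generated" for P \<Omega>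
  proof -
    obtain g' where g': "real g' = genus_num m" "closed_oriented_surface (realization (S_complex P \<Omega>)) g'"
      using S_complex_level(4)[OF q] assms(2) by auto
    then have "g' = g" using g by simp
    then show ?thesis using g'(2) by simp
  qed
  have 1: "\<forall>P :: ('m mod_ring ^ 4) set. \<forall>\<Omega>. isotropic_plane P \<and> \<Omega> \<in> generator_classes P \<longrightarrow>
      abstract_complex (S_complex P \<Omega>) \<and> S_complex P \<Omega> \<subseteq> Delta2 \<and>
      isomorphic_to_PD2_link (S_complex P \<Omega>) m \<and> closed_oriented_surface (realization (S_complex P \<Omega>)) g"
  proof (intro allI impI)
    fix P :: "('m mod_ring ^ 4) set" and \<Omega> assume "isotropic_plane P \<and> \<Omega> \<in> generator_classes P"
    then have "(P, \<Omega>) \<in> generated" by simp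
    then show "abstract_complex (S_complex P \<Omega>) \<and> S_complex P \<Omega> \<subseteq> Delta2 \<and>
        isomorphic_to_PD2_link (S_complex P \<Omega>) m \<and> closed_oriented_surface (realization (S_complex P \<Omega>)) g"
      using S_complex_level(1-3)[of P \<Omega>] surf[of P \<Omega>] assms(2) by simp
  qed
  have 2: "\<forall>\<sigma>\<in>?D. card \<sigma> = 2 \<or> card \<sigma> = 3 \<longrightarrow>
      (\<exists>!(P, \<Omega>). isotropic_plane P \<and> \<Omega> \<in> generator_classes P \<and> \<sigma> \<in> S_complex P \<Omega>)"
  proof (intro ballI impI)
    fix \<sigma> assume s: "\<sigma> \<in> ?D" "card \<sigma> = 2 \<or> card \<sigma> = 3"
    have "\<not> card \<sigma> \<le> Suc 0" using s(2) by auto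
    then obtain a b where ab: "a \<in> \<sigma>" "b \<in> \<sigma>" "a \<noteq> b"
      using card_le_Suc0_iff_eq[of \<sigma>] by auto
    obtain P \<Omega> where PO: "(P, \<Omega>) \<in> generated" "\<sigma> \<in> S_complex P \<Omega>"
      using Delta2_simplex_in_S[OF s(1)] by blast
    show "\<exists>!(P, \<Omega>). isotropic_plane P \<and> \<Omega> \<in> generator_classes P \<and> \<sigma> \<in> S_complex P \<Omega>"
    proof (rule ex1I[of _ "(P, \<Omega>)"])
      show "case (P, \<Omega>) of (P, \<Omega>) \<Rightarrow> isotropic_plane P \<and> \<Omega> \<in> generator_classes P \<and> \<sigma> \<in> S_complex P \<Omega>"
        using PO by simp
      fix q assume q: "case q of (P, \<Omega>) \<Rightarrow> isotropic_plane P \<and> \<Omega> \<in> generator_classes P \<and> \<sigma> \<in> S_complex P \<Omega>"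
      obtain P' \<Omega>' where q': "q = (P', \<Omega>')" by (cases q)
      have "(P', \<Omega>') \<in> generated" "\<sigma> \<in> S_complex P' \<Omega>'" using q unfolding q' by simp_all
      then show "q = (P, \<Omega>)" using S_complex_unique[OF PO _ _ ab] q' by simp
    qed
  qed
  \<comment> \<open>A numbering of the pairs of a plane and a generator, because the surfaces to be
    glued are indexed by natural numbers below N.\<close>
  obtain e where e: "bij_betw e {..<N} generated"
    using ex_bij_betw_nat_finite[OF finite[of generated]] unfolding N_def atLeast0LessThan by (rule exE)
  have eg: "(fst (e i), snd (e i)) \<in> generated" if "i \<in> {..<N}" for i
    unfolding prod.collapse using bij_betwE[OF e] that by (rule bspec)
  interpret C: subcomplex_cover ?D "\<lambda>i. S (e i)" "{..<N}"
  proof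
    show "finite ?D" by simp
    show "abstract_complex ?D" unfolding Delta2_eq_cplx by (rule abstract_complex_cplx)
    show "S (e i) \<subseteq> ?D" "abstract_complex (S (e i))" if "i \<in> {..<N}" for i
      using S_complex_level(1,2)[OF eg[OF that]] by (simp_all only: S_def)
    show "\<exists>i\<in>{..<N}. \<sigma> \<in> S (e i)" if s: "\<sigma> \<in> ?D" for \<sigma>
    proof -
      obtain P \<Omega> where PO: "(P, \<Omega>) \<in> generated" "\<sigma> \<in> S_complex P \<Omega>"
        using Delta2_simplex_in_S[OF s] by blast
      have "(P, \<Omega>) \<in> e ` {..<N}" unfolding bij_betw_imp_surj_on[OF e] by (rule PO(1))
      then obtain i where "(P, \<Omega>) = e i" "i \<in> {..<N}" by (rule imageE)
      then have "i \<in> {..<N}" "e i = (P, \<Omega>)" by simp_all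
      then show ?thesis using PO(2) by (intro bexI[of _ i]) (simp_all add: S_def)
    qed
    show "i = j" if ij: "i \<in> {..<N}" "j \<in> {..<N}" "\<sigma> \<in> S (e i)" "\<sigma> \<in> S (e j)" "a \<in> \<sigma>" "b \<in> \<sigma>" "a \<noteq> b"
      for i j \<sigma> a b
    proof -
      have "e i = e j"
        using S_complex_unique[OF eg[OF ij(1)] ij(3)[unfolded S_def] eg[OF ij(2)] ij(4)[unfolded S_def] ij(5-7)]
        by (simp add: prod_eq_iff)
      then show "i = j" using bij_betw_imp_inj_on[OF e] ij(1,2) by (simp add: inj_on_eq_iff)
    qed
  qed
  let ?Y = "\<lambda>i. realization (S (e i))"
  have Y: "closed_oriented_surface (?Y i) g \<and> C.marked i \<subseteq> topspace (?Y i) \<and>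
      finite (C.marked i) \<and> card (C.marked i) = c" if "i < N" for i
  proof (intro conjI)
    have i: "i \<in> {..<N}" using that by simp
    show "closed_oriented_surface (?Y i) g" unfolding S_def by (rule surf[OF eg[OF i]])
    show "C.marked i \<subseteq> topspace (?Y i)" "finite (C.marked i)"
      by (rule C.marked_topspace[OF i], rule C.finite_marked[OF i])
    have "real (card (\<Union>(S (e i)))) = real c"
      unfolding S_def c using S_complex_level(5)[OF eg[OF i]] assms(2) by simp
    then show "card (C.marked i) = c" unfolding C.card_marked by (simp only: of_nat_eq_iff)
  qed
  have glue: "realization ?D homeomorphic_space glue_points {..<N} ?Y C.same_point"
    by (rule C.realization_homeomorphic_glue)
  have LA: "LA2_trop m homeomorphic_space glue_points {..<N} ?Y C.same_point"
    using homeomorphic_space_trans[OF LA2_homeomorphic glue] assms(2) by simp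
  have classes: "card (Sigma {..<N} C.marked // C.same_point) = N"
    by (rule trans[OF C.card_classes]) (simp only: card_Delta2_vertices N_def)
  have 3: "\<exists>(Y :: nat \<Rightarrow> (('m mod_ring ^ 4) set \<Rightarrow> real) topology) M E.
      (\<forall>i<N. closed_oriented_surface (Y i) g \<and> M i \<subseteq> topspace (Y i) \<and> finite (M i) \<and> card (M i) = c) \<and>
      equiv (Sigma {..<N} M) E \<and> card (Sigma {..<N} M // E) = N \<and>
      realization ?D homeomorphic_space glue_points {..<N} Y E \<and> LA2_trop m homeomorphic_space glue_points {..<N} Y E"
    by (rule exI[of _ ?Y], rule exI[of _ C.marked], rule exI[of _ C.same_point],
        intro conjI C.equiv_same_point classes glue LA) (intro allI impI, rule Y)
  show ?thesis
    by (rule exI[of _ g], rule exI[of _ c], rule exI[of _ N])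
      (rule conjI[OF g conjI[OF c conjI[OF N conjI[OF 1 conjI[OF 2 3]]]]])
qed

end
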